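(* Let $k$ be a commutative ring, $\mathbf{a}$ an essentially small $k$-linear category and $\mathcal{T}$ a $k$-linear Grothendieck topology on $\mathbf{a}$. The following are equivalent. (a) $\mathcal{T}$ is subcanonical. (b) $\mathcal{T}=\mathrm{top}(\mathcal{S})$ for some pretopology $\mathcal{S}$ comprising only right exact sequences. (c) If $\mathcal{T}=\mathrm{top}(\mathcal{S})$ for some pretopology $\mathcal{S}$, then $\mathcal{S}$ consists of right exact sequences (i.e. every pretopology $\mathcal{S}$ with $\mathrm{top}(\mathcal{S})=\mathcal{T}$ consists of right exact sequences). (d) $\mathrm{pre}(\mathcal{T})$ consists of right exact sequences. (e) $\mathtt{Z}:\mathbf{a}\to\mathsf{Sh}(\mathbf{a},\mathcal{T})$ is fully faithful.
   Context: $\mathsf{PSh}\,\mathbf{a}$ is the category of $k$-linear functors $\mathbf{a}^{op}\to\mathsf{Mod}_k$, with Yoneda embedding $\mathtt{Y}$. A sieve on $A$ is a $k$-linear subfunctor $R\subset\mathbf{a}(-,A)$; for $f:B\to A$, $f^{-1}R$ is the sieve on $B$ of all $g$ with $f\circ g\in R$. A ($k$-linear Grothendieck) topology assigns to each $A$ a set $\mathcal{T}(A)$ of sieves on $A$ with: (T1) $\mathbf{a}(-,A)\in\mathcal{T}(A)$; (T2) $R\in\mathcal{T}(A)$ and $f:B\to A$ imply $f^{-1}R\in\mathcal{T}(B)$; (T3) if $S$ is a sieve on $A$ and $R\in\mathcal{T}(A)$ with $f^{-1}S\in\mathcal{T}(B)$ for all $B$ and $f\in R(B)$, then $S\in\mathcal{T}(A)$.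 $\mathsf{Sh}(\mathbf{a},\mathcal{T})\subset\mathsf{PSh}\,\mathbf{a}$ is the full subcategory of $\mathcal{T}$-sheaves: those $F$ with $F(A)\to\mathrm{Nat}(R,F)$ an isomorphism for all $A$, $R\in\mathcal{T}(A)$; the inclusion has an exact left adjoint $\mathtt{S}$, and $\mathtt{Z}=\mathtt{S}\circ\mathtt{Y}$. $\mathcal{T}$ is subcanonical if every representable presheaf $\mathbf{a}(-,A)$ is a $\mathcal{T}$-sheaf. Formal morphisms: for set-indexed families of objects of $\mathbf{a}$, a formal morphism $f:\amalg_\alpha A_\alpha\to\amalg_\beta B_\beta$ is an element of $\prod_\alpha\bigoplus_\beta\mathbf{a}(A_\alpha,B_\beta)$ (equivalently a morphism $\bigoplus_\alpha\mathtt{Y}(A_\alpha)\to\bigoplus_\beta\mathtt{Y}(B_\beta)$), composed accordingly. For $v=(v_\alpha):\amalg_\alpha V_\alpha\to A$, $R_v$ is the sieve on $A$ generated by all $v_\alpha$. A (formal) sequence is a pair of formal morphisms $\amalg_\gamma Z_\gamma\xrightarrow{p}\amalg_\beta Y_\beta\xrightarrow{q}X$ with $X\in\mathbf{a}$, $q\circ p=0$. It is right exact if $0\to\mathbf{a}(X,A)\to\prod_\beta\mathbf{a}(Y_\beta,A)\to\prod_\gamma\mathbf{a}(Z_\gamma,A)$ is exact for every $A\in\mathbf{a}$. For a class $\mathcal{S}$ of sequences, $\mathcal{C}o(\mathcal{S})=\mathcal{C}o^1(\mathcal{S})$ is the class of right-hand morphisms $q$; $\mathcal{C}o^0(\mathcal{S})$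 is the class of identity morphisms in $\mathbf{a}$; for $i>1$, $\mathcal{C}o^i(\mathcal{S})$ consists of all $(v_\alpha\circ w(\alpha)_\delta):\amalg_\alpha\amalg_{\delta\in D(\alpha)}W_\delta(\alpha)\to X$ with $v:\amalg_\alpha V_\alpha\to X$ in $\mathcal{C}o^{i-1}(\mathcal{S})$ and, for each $\alpha$, $w(\alpha):\amalg_{\delta\in D(\alpha)}W_\delta(\alpha)\to V_\alpha$ in $\mathcal{C}o(\mathcal{S})$. Set $\widetilde{\mathcal{C}o}(\mathcal{S})=\bigcup_{i\in\mathbb{N}}\mathcal{C}o^i(\mathcal{S})$; a subscript $X$ means target $X$. A pretopology is a class $\mathcal{S}$ of sequences such that: (PTa) for each $q:\amalg_\beta Y_\beta\to X$ in $\mathcal{C}o(\mathcal{S})$ and $f:A\to X$ in $\mathbf{a}$ there exist $q':\amalg_\delta C_\delta\to A$ in $\widetilde{\mathcal{C}o}_A(\mathcal{S})$ and a formal morphism $f':\amalg_\delta C_\delta\to\amalg_\beta Y_\beta$ with $q\circ f'=f\circ q'$; (PTb) for each sequence $(p,q)$ in $\mathcal{S}$ and $f:A\to\amalg_\beta Y_\beta$ with $A\in\mathbf{a}$, $q\circ f=0$, there exist $q':\amalg_\alpha B_\alpha\to A$ in $\widetilde{\mathcal{C}o}_A(\mathcal{S})$ and $f':\amalg_\alpha B_\alpha\to\amalg_\gamma Z_\gamma$ with $p\circ f'=f\circ q'$. $\mathrm{top}(\mathcal{S})$ is the Grothendieck topology of all sieves $R\subset\mathbf{a}(-,X)$ containing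 $R_r$ for some $r\in\widetilde{\mathcal{C}o}_X(\mathcal{S})$. $\mathrm{pre}(\mathcal{T})$ is the class of all sequences for which $\bigoplus_\gamma\mathtt{Z}(Z_\gamma)\to\bigoplus_\beta\mathtt{Z}(Y_\beta)\to\mathtt{Z}(X)\to0$ is exact in $\mathsf{Sh}(\mathbf{a},\mathcal{T})$. *)

theory Defs
  imports "HOL-Algebra.Module"
begin

section \<open>Linear categories\<close>

text \<open>
  A category enriched in modules over \<open>K\<close>. Hom-modules for different pairs of objects need not be
  disjoint, so composition takes the objects as arguments: for \<open>f\<close> in \<open>Hm C X Y\<close> and \<open>g\<close> in
  \<open>Hm C Y Z\<close>, the composite \<open>g\<close> after \<open>f\<close> is \<open>Cmp C X Y Z g f\<close>.
  The multiplicative fields of the record type of modules carry no information.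
\<close>

record ('o, 'm, 'k) lincat =
  Ob :: "'o set"
  Hm :: "'o \<Rightarrow> 'o \<Rightarrow> ('k, 'm) module"
  Cmp :: "'o \<Rightarrow> 'o \<Rightarrow> 'o \<Rightarrow> 'm \<Rightarrow> 'm \<Rightarrow> 'm"
  Idt :: "'o \<Rightarrow> 'm"

abbreviation hom_set :: "('o, 'm, 'k) lincat \<Rightarrow> 'o \<Rightarrow> 'o \<Rightarrow> 'm set" where
  "hom_set C X Y \<equiv> carrier (Hm C X Y)"

definition linear_category :: "'k ring \<Rightarrow> ('o, 'm, 'k) lincat \<Rightarrow> bool" where
  "linear_category K C \<longleftrightarrow>
     cring K \<and>
     (\<forall>X\<in>Ob C. \<forall>Y\<in>Ob C. module K (Hm C X Y)) \<and>
     (\<forall>X\<in>Ob C. Idt C X \<in> hom_set C X X) \<and>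
     (\<forall>X\<in>Ob C. \<forall>Y\<in>Ob C. \<forall>Z\<in>Ob C. \<forall>f\<in>hom_set C X Y. \<forall>g\<in>hom_set C Y Z.
        Cmp C X Y Z g f \<in> hom_set C X Z) \<and>
     (\<forall>X\<in>Ob C. \<forall>Y\<in>Ob C. \<forall>f\<in>hom_set C X Y.
        Cmp C X X Y f (Idt C X) = f \<and> Cmp C X Y Y (Idt C Y) f = f) \<and>
     (\<forall>W\<in>Ob C. \<forall>X\<in>Ob C. \<forall>Y\<in>Ob C. \<forall>Z\<in>Ob C.
        \<forall>f\<in>hom_set C W X. \<forall>g\<in>hom_set C X Y. \<forall>h\<in>hom_set C Y Z.
        Cmp C W X Z (Cmp C X Y Z h g) f = Cmp C W Y Z h (Cmp C W X Y g f)) \<and>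
     (\<forall>X\<in>Ob C. \<forall>Y\<in>Ob C. \<forall>Z\<in>Ob C.
        \<forall>f\<in>hom_set C X Y. \<forall>f'\<in>hom_set C X Y. \<forall>g\<in>hom_set C Y Z. \<forall>g'\<in>hom_set C Y Z.
        Cmp C X Y Z (g \<oplus>\<^bsub>Hm C Y Z\<^esub> g') f = Cmp C X Y Z g f \<oplus>\<^bsub>Hm C X Z\<^esub> Cmp C X Y Z g' f \<and>
        Cmp C X Y Z g (f \<oplus>\<^bsub>Hm C X Y\<^esub> f') = Cmp C X Y Z g f \<oplus>\<^bsub>Hm C X Z\<^esub> Cmp C X Y Z g f') \<and>
     (\<forall>X\<in>Ob C. \<forall>Y\<in>Ob C. \<forall>Z\<in>Ob C. \<forall>f\<in>hom_set C X Y. \<forall>g\<in>hom_set C Y Z. \<forall>r\<in>carrier K.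
        Cmp C X Y Z (r \<odot>\<^bsub>Hm C Y Z\<^esub> g) f = r \<odot>\<^bsub>Hm C X Z\<^esub> Cmp C X Y Z g f \<and>
        Cmp C X Y Z g (r \<odot>\<^bsub>Hm C X Y\<^esub> f) = r \<odot>\<^bsub>Hm C X Z\<^esub> Cmp C X Y Z g f)"

definition opcat :: "('o, 'm, 'k) lincat \<Rightarrow> ('o, 'm, 'k) lincat" where
  "opcat C = \<lparr>Ob = Ob C, Hm = (\<lambda>X Y. Hm C Y X),
     Cmp = (\<lambda>X Y Z g f. Cmp C Z Y X f g), Idt = Idt C\<rparr>"

definition full_subcat :: "('o, 'm, 'k) lincat \<Rightarrow> ('o \<Rightarrow> bool) \<Rightarrow> ('o, 'm, 'k) lincat" where
  "full_subcat C P = C\<lparr>Ob := {X \<in> Ob C. P X}\<rparr>"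

definition isomorphic :: "('o, 'm, 'k) lincat \<Rightarrow> 'o \<Rightarrow> 'o \<Rightarrow> bool" where
  "isomorphic C X Y \<longleftrightarrow> (\<exists>f\<in>hom_set C X Y. \<exists>g\<in>hom_set C Y X.
     Cmp C X Y X g f = Idt C X \<and> Cmp C Y X Y f g = Idt C Y)"

text \<open>
  Size conventions. A set is small if it is equipotent to a subset of the type \<open>'i\<close>; the
  type \<open>'v\<close> provides the elements of all modules. The condition below says that \<open>'v\<close> is closed
  under families indexed by small sets, so that the modules with elements in \<open>'v\<close> are closed
  up to isomorphism under products and direct sums over small sets.
  It holds for instance for \<open>'v = 'i set\<close> whenever \<open>'i\<close> is infinite.
\<close>

definition size_condition :: "'i itself \<Rightarrow> 'v itself \<Rightarrow> bool" where
  "size_condition (_ :: 'i itself) (_ :: 'v itself) \<longleftrightarrow>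
     infinite (UNIV :: 'i set) \<and>
     (\<exists>e :: 'i \<Rightarrow> 'v. inj e) \<and>
     (\<exists>e :: ('i \<Rightarrow> 'v) \<Rightarrow> 'v. inj e)"

definition essentially_small :: "'i itself \<Rightarrow> ('o, 'm, 'k) lincat \<Rightarrow> bool" where
  "essentially_small (_ :: 'i itself) C \<longleftrightarrow>
     (\<exists>O0 \<subseteq> Ob C. (\<forall>X\<in>Ob C. \<exists>Y\<in>O0. isomorphic C X Y) \<and> (\<exists>e :: 'o \<Rightarrow> 'i. inj_on e O0)) \<and>
     (\<forall>X\<in>Ob C. \<forall>Y\<in>Ob C. \<exists>e :: 'm \<Rightarrow> 'i. inj_on e (hom_set C X Y))"

section \<open>The category of modules, linear functors and natural transformations\<close>

definition lin_maps :: "'k ring \<Rightarrow> ('k, 'v) module \<Rightarrow> ('k, 'v) module \<Rightarrow> ('v \<Rightarrow> 'v) set" where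
  "lin_maps K M N = {f \<in> carrier M \<rightarrow>\<^sub>E carrier N.
     (\<forall>x\<in>carrier M. \<forall>y\<in>carrier M. f (x \<oplus>\<^bsub>M\<^esub> y) = f x \<oplus>\<^bsub>N\<^esub> f y) \<and>
     (\<forall>r\<in>carrier K. \<forall>x\<in>carrier M. f (r \<odot>\<^bsub>M\<^esub> x) = r \<odot>\<^bsub>N\<^esub> f x)}"

definition Mod :: "'k ring \<Rightarrow> (('k, 'v) module, 'v \<Rightarrow> 'v, 'k) lincat" where
  "Mod K = \<lparr>
     Ob = {M. module K M},
     Hm = (\<lambda>M N. \<lparr>carrier = lin_maps K M N,
             mult = undefined, one = undefined,
             zero = (\<lambda>x\<in>carrier M. \<zero>\<^bsub>N\<^esub>),
             add = (\<lambda>f g. \<lambda>x\<in>carrier M. f x \<oplus>\<^bsub>N\<^esub> g x),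
             smult = (\<lambda>r f. \<lambda>x\<in>carrier M. r \<odot>\<^bsub>N\<^esub> f x)\<rparr>),
     Cmp = (\<lambda>M N P g f. compose (carrier M) g f),
     Idt = (\<lambda>M. \<lambda>x\<in>carrier M. x)\<rparr>"

record ('o, 'm, 'p, 'n) linfun =
  FOb :: "'o \<Rightarrow> 'p"
  FAr :: "'o \<Rightarrow> 'o \<Rightarrow> 'm \<Rightarrow> 'n"

definition linear_functor ::
  "'k ring \<Rightarrow> ('o, 'm, 'k) lincat \<Rightarrow> ('p, 'n, 'k) lincat \<Rightarrow> ('o, 'm, 'p, 'n) linfun \<Rightarrow> bool" where
  "linear_functor K C D F \<longleftrightarrow>
     (\<forall>X\<in>Ob C. FOb F X \<in> Ob D) \<and>
     (\<forall>X\<in>Ob C. \<forall>Y\<in>Ob C. \<forall>f\<in>hom_set C X Y. FAr F X Y f \<in> hom_set D (FOb F X) (FOb F Y)) \<and>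
     (\<forall>X\<in>Ob C. FAr F X X (Idt C X) = Idt D (FOb F X)) \<and>
     (\<forall>X\<in>Ob C. \<forall>Y\<in>Ob C. \<forall>Z\<in>Ob C. \<forall>f\<in>hom_set C X Y. \<forall>g\<in>hom_set C Y Z.
        FAr F X Z (Cmp C X Y Z g f) =
        Cmp D (FOb F X) (FOb F Y) (FOb F Z) (FAr F Y Z g) (FAr F X Y f)) \<and>
     (\<forall>X\<in>Ob C. \<forall>Y\<in>Ob C. \<forall>f\<in>hom_set C X Y. \<forall>g\<in>hom_set C X Y.
        FAr F X Y (f \<oplus>\<^bsub>Hm C X Y\<^esub> g) = FAr F X Y f \<oplus>\<^bsub>Hm D (FOb F X) (FOb F Y)\<^esub> FAr F X Y g) \<and>
     (\<forall>X\<in>Ob C. \<forall>Y\<in>Ob C. \<forall>f\<in>hom_set C X Y. \<forall>r\<in>carrier K.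
        FAr F X Y (r \<odot>\<^bsub>Hm C X Y\<^esub> f) = r \<odot>\<^bsub>Hm D (FOb F X) (FOb F Y)\<^esub> FAr F X Y f)"

definition id_linfun :: "('o, 'm, 'o, 'm) linfun" where
  "id_linfun = \<lparr>FOb = (\<lambda>X. X), FAr = (\<lambda>X Y f. f)\<rparr>"

definition comp_linfun ::
  "('p, 'n, 'q, 'l) linfun \<Rightarrow> ('o, 'm, 'p, 'n) linfun \<Rightarrow> ('o, 'm, 'q, 'l) linfun" where
  "comp_linfun G F = \<lparr>FOb = (\<lambda>X. FOb G (FOb F X)),
     FAr = (\<lambda>X Y f. FAr G (FOb F X) (FOb F Y) (FAr F X Y f))\<rparr>"

definition fully_faithful ::
  "('o, 'm, 'k) lincat \<Rightarrow> ('p, 'n, 'k) lincat \<Rightarrow> ('o, 'm, 'p, 'n) linfun \<Rightarrow> bool" where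
  "fully_faithful C D F \<longleftrightarrow> (\<forall>X\<in>Ob C. \<forall>Y\<in>Ob C.
     bij_betw (FAr F X Y) (hom_set C X Y) (hom_set D (FOb F X) (FOb F Y)))"

definition nat_trans ::
  "('o, 'm, 'k) lincat \<Rightarrow> ('p, 'n, 'k) lincat \<Rightarrow>
   ('o, 'm, 'p, 'n) linfun \<Rightarrow> ('o, 'm, 'p, 'n) linfun \<Rightarrow> ('o \<Rightarrow> 'n) set" where
  "nat_trans C D F G = {\<eta> \<in> (\<Pi>\<^sub>E X\<in>Ob C. hom_set D (FOb F X) (FOb G X)).
     \<forall>X\<in>Ob C. \<forall>Y\<in>Ob C. \<forall>f\<in>hom_set C X Y.
       Cmp D (FOb F X) (FOb F Y) (FOb G Y) (\<eta> Y) (FAr F X Y f) =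
       Cmp D (FOb F X) (FOb G X) (FOb G Y) (FAr G X Y f) (\<eta> X)}"

definition fun_cat ::
  "'k ring \<Rightarrow> ('o, 'm, 'k) lincat \<Rightarrow> ('p, 'n, 'k) lincat \<Rightarrow>
   (('o, 'm, 'p, 'n) linfun, 'o \<Rightarrow> 'n, 'k) lincat" where
  "fun_cat K C D = \<lparr>
     Ob = {F. linear_functor K C D F},
     Hm = (\<lambda>F G. \<lparr>carrier = nat_trans C D F G,
             mult = undefined, one = undefined,
             zero = (\<lambda>X\<in>Ob C. \<zero>\<^bsub>Hm D (FOb F X) (FOb G X)\<^esub>),
             add = (\<lambda>\<eta> \<theta>. \<lambda>X\<in>Ob C. \<eta> X \<oplus>\<^bsub>Hm D (FOb F X) (FOb G X)\<^esub> \<theta> X),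
             smult = (\<lambda>r \<eta>. \<lambda>X\<in>Ob C. r \<odot>\<^bsub>Hm D (FOb F X) (FOb G X)\<^esub> \<eta> X)\<rparr>),
     Cmp = (\<lambda>F G H \<theta> \<eta>. \<lambda>X\<in>Ob C. Cmp D (FOb F X) (FOb G X) (FOb H X) (\<theta> X) (\<eta> X)),
     Idt = (\<lambda>F. \<lambda>X\<in>Ob C. Idt D (FOb F X))\<rparr>"

text \<open>\<open>L\<close> is left adjoint to \<open>R\<close> with unit \<open>\<eta>\<close>.\<close>

definition left_adjoint ::
  "'k ring \<Rightarrow> ('o, 'm, 'k) lincat \<Rightarrow> ('p, 'n, 'k) lincat \<Rightarrow>
   ('o, 'm, 'p, 'n) linfun \<Rightarrow> ('p, 'n, 'o, 'm) linfun \<Rightarrow> ('o \<Rightarrow> 'm) \<Rightarrow> bool" where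
  "left_adjoint K C D L R \<eta> \<longleftrightarrow>
     linear_functor K C D L \<and> linear_functor K D C R \<and>
     \<eta> \<in> nat_trans C C id_linfun (comp_linfun R L) \<and>
     (\<forall>X\<in>Ob C. \<forall>Y\<in>Ob D.
        bij_betw (\<lambda>g. Cmp C X (FOb R (FOb L X)) (FOb R Y) (FAr R (FOb L X) Y g) (\<eta> X))
          (hom_set D (FOb L X) Y) (hom_set C X (FOb R Y)))"

section \<open>Kernels, images, exactness and coproducts\<close>

definition is_kernel ::
  "('o, 'm, 'k) lincat \<Rightarrow> 'o \<Rightarrow> 'o \<Rightarrow> 'm \<Rightarrow> 'o \<Rightarrow> 'm \<Rightarrow> bool" where
  "is_kernel C X Y f N m \<longleftrightarrow>
     N \<in> Ob C \<and> m \<in> hom_set C N X \<and> Cmp C N X Y f m = \<zero>\<^bsub>Hm C N Y\<^esub> \<and>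
     (\<forall>W\<in>Ob C. \<forall>h\<in>hom_set C W X. Cmp C W X Y f h = \<zero>\<^bsub>Hm C W Y\<^esub> \<longrightarrow>
        (\<exists>!u. u \<in> hom_set C W N \<and> Cmp C W N X m u = h))"

definition is_cokernel ::
  "('o, 'm, 'k) lincat \<Rightarrow> 'o \<Rightarrow> 'o \<Rightarrow> 'm \<Rightarrow> 'o \<Rightarrow> 'm \<Rightarrow> bool" where
  "is_cokernel C X Y f Q c \<longleftrightarrow> is_kernel (opcat C) Y X f Q c"

definition is_image ::
  "('o, 'm, 'k) lincat \<Rightarrow> 'o \<Rightarrow> 'o \<Rightarrow> 'm \<Rightarrow> 'o \<Rightarrow> 'm \<Rightarrow> bool" where
  "is_image C X Y f I m \<longleftrightarrow> (\<exists>Q c. is_cokernel C X Y f Q c \<and> is_kernel C Y Q c I m)"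

text \<open>Exactness at \<open>Y\<close> of \<open>f\<close> from \<open>X\<close> to \<open>Y\<close> and \<open>g\<close> from \<open>Y\<close> to \<open>Z\<close>: the image of \<open>f\<close> is
  the kernel of \<open>g\<close>.\<close>

definition exact_at ::
  "('o, 'm, 'k) lincat \<Rightarrow> 'o \<Rightarrow> 'o \<Rightarrow> 'o \<Rightarrow> 'm \<Rightarrow> 'm \<Rightarrow> bool" where
  "exact_at C X Y Z f g \<longleftrightarrow>
     X \<in> Ob C \<and> Y \<in> Ob C \<and> Z \<in> Ob C \<and> f \<in> hom_set C X Y \<and> g \<in> hom_set C Y Z \<and>
     (\<exists>I m. is_image C X Y f I m \<and> is_kernel C Y Z g I m)"

definition is_zero_object :: "('o, 'm, 'k) lincat \<Rightarrow> 'o \<Rightarrow> bool" where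
  "is_zero_object C N \<longleftrightarrow> N \<in> Ob C \<and> Idt C N = \<zero>\<^bsub>Hm C N N\<^esub>"

text \<open>Exactness of \<open>X \<rightarrow> Y \<rightarrow> Z \<rightarrow> 0\<close>.\<close>

definition exact_to_zero ::
  "('o, 'm, 'k) lincat \<Rightarrow> 'o \<Rightarrow> 'o \<Rightarrow> 'o \<Rightarrow> 'm \<Rightarrow> 'm \<Rightarrow> bool" where
  "exact_to_zero C X Y Z f g \<longleftrightarrow>
     exact_at C X Y Z f g \<and>
     (\<exists>N. is_zero_object C N \<and> exact_at C Y Z N g \<zero>\<^bsub>Hm C Z N\<^esub>)"

definition is_coproduct ::
  "('o, 'm, 'k) lincat \<Rightarrow> 'i set \<Rightarrow> ('i \<Rightarrow> 'o) \<Rightarrow> 'o \<Rightarrow> ('i \<Rightarrow> 'm) \<Rightarrow> bool" where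
  "is_coproduct C I X P j \<longleftrightarrow>
     P \<in> Ob C \<and> (\<forall>i\<in>I. X i \<in> Ob C \<and> j i \<in> hom_set C (X i) P) \<and>
     (\<forall>W\<in>Ob C. \<forall>h. (\<forall>i\<in>I. h i \<in> hom_set C (X i) W) \<longrightarrow>
        (\<exists>!u. u \<in> hom_set C P W \<and> (\<forall>i\<in>I. Cmp C (X i) P W u (j i) = h i)))"

section \<open>Presheaves, topologies and sheaves\<close>

text \<open>From here on \<open>a\<close> is the linear site. Its morphisms have type \<open>'v\<close>, so that its Hom-modules are
  objects of \<open>Mod K\<close>.\<close>

type_synonym ('o, 'v, 'k) presheaf = "('o, 'v, ('k, 'v) module, 'v \<Rightarrow> 'v) linfun"

definition PSh ::
  "'k ring \<Rightarrow> ('o, 'v, 'k) lincat \<Rightarrow> (('o, 'v, 'k) presheaf, 'o \<Rightarrow> 'v \<Rightarrow> 'v, 'k) lincat" where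
  "PSh K a = fun_cat K (opcat a) (Mod K)"

definition yoneda ::
  "('o, 'v, 'k) lincat \<Rightarrow> ('o, 'v, ('o, 'v, 'k) presheaf, 'o \<Rightarrow> 'v \<Rightarrow> 'v) linfun" where
  "yoneda a = \<lparr>
     FOb = (\<lambda>A. \<lparr>FOb = (\<lambda>B. Hm a B A),
              FAr = (\<lambda>B C g. \<lambda>f\<in>hom_set a B A. Cmp a C B A f g)\<rparr>),
     FAr = (\<lambda>A A' h. \<lambda>B\<in>Ob a. \<lambda>f\<in>hom_set a B A. Cmp a B A A' h f)\<rparr>"

text \<open>Subfunctors are normalised to be empty outside \<open>Ob a\<close>, so that equal sieves are equal as
  functions.\<close>

definition sieve :: "'k ring \<Rightarrow> ('o, 'v, 'k) lincat \<Rightarrow> 'o \<Rightarrow> ('o \<Rightarrow> 'v set) \<Rightarrow> bool" where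
  "sieve K a A R \<longleftrightarrow>
     (\<forall>B. B \<notin> Ob a \<longrightarrow> R B = {}) \<and>
     (\<forall>B\<in>Ob a. submodule (R B) K (Hm a B A)) \<and>
     (\<forall>B\<in>Ob a. \<forall>C\<in>Ob a. \<forall>f\<in>R B. \<forall>g\<in>hom_set a C B. Cmp a C B A f g \<in> R C)"

definition max_sieve :: "('o, 'v, 'k) lincat \<Rightarrow> 'o \<Rightarrow> 'o \<Rightarrow> 'v set" where
  "max_sieve a A = (\<lambda>B. if B \<in> Ob a then hom_set a B A else {})"

definition pull_sieve ::
  "('o, 'v, 'k) lincat \<Rightarrow> 'o \<Rightarrow> 'o \<Rightarrow> 'v \<Rightarrow> ('o \<Rightarrow> 'v set) \<Rightarrow> 'o \<Rightarrow> 'v set" where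
  "pull_sieve a B A f R = (\<lambda>C. if C \<in> Ob a then {g \<in> hom_set a C B. Cmp a C B A f g \<in> R C} else {})"

definition topology ::
  "'k ring \<Rightarrow> ('o, 'v, 'k) lincat \<Rightarrow> ('o \<Rightarrow> ('o \<Rightarrow> 'v set) set) \<Rightarrow> bool" where
  "topology K a T \<longleftrightarrow>
     (\<forall>A. A \<notin> Ob a \<longrightarrow> T A = {}) \<and>
     (\<forall>A\<in>Ob a. \<forall>R\<in>T A. sieve K a A R) \<and>
     (\<forall>A\<in>Ob a. max_sieve a A \<in> T A) \<and>
     (\<forall>A\<in>Ob a. \<forall>B\<in>Ob a. \<forall>R\<in>T A. \<forall>f\<in>hom_set a B A. pull_sieve a B A f R \<in> T B) \<and>
     (\<forall>A\<in>Ob a. \<forall>S R. sieve K a A S \<longrightarrow> R \<in> T A \<longrightarrow>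
        (\<forall>B\<in>Ob a. \<forall>f\<in>R B. pull_sieve a B A f S \<in> T B) \<longrightarrow> S \<in> T A)"

definition sieve_presheaf ::
  "('o, 'v, 'k) lincat \<Rightarrow> 'o \<Rightarrow> ('o \<Rightarrow> 'v set) \<Rightarrow> ('o, 'v, 'k) presheaf" where
  "sieve_presheaf a A R = \<lparr>
     FOb = (\<lambda>B. (Hm a B A)\<lparr>carrier := R B\<rparr>),
     FAr = (\<lambda>B C g. \<lambda>f\<in>R B. Cmp a C B A f g)\<rparr>"

text \<open>The map \<open>F(A) \<rightarrow> Nat(R, F)\<close> sends \<open>x\<close> to the transformation \<open>f \<mapsto> F(f)(x)\<close>.\<close>

definition is_sheaf ::
  "'k ring \<Rightarrow> ('o, 'v, 'k) lincat \<Rightarrow> ('o \<Rightarrow> ('o \<Rightarrow> 'v set) set) \<Rightarrow> ('o, 'v, 'k) presheaf \<Rightarrow> bool" where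
  "is_sheaf K a T F \<longleftrightarrow> F \<in> Ob (PSh K a) \<and>
     (\<forall>A\<in>Ob a. \<forall>R\<in>T A.
        bij_betw (\<lambda>x. \<lambda>B\<in>Ob a. \<lambda>f\<in>R B. FAr F A B f x)
          (carrier (FOb F A)) (hom_set (PSh K a) (sieve_presheaf a A R) F))"

definition Sh ::
  "'k ring \<Rightarrow> ('o, 'v, 'k) lincat \<Rightarrow> ('o \<Rightarrow> ('o \<Rightarrow> 'v set) set) \<Rightarrow>
   (('o, 'v, 'k) presheaf, 'o \<Rightarrow> 'v \<Rightarrow> 'v, 'k) lincat" where
  "Sh K a T = full_subcat (PSh K a) (is_sheaf K a T)"

definition subcanonical ::
  "'k ring \<Rightarrow> ('o, 'v, 'k) lincat \<Rightarrow> ('o \<Rightarrow> ('o \<Rightarrow> 'v set) set) \<Rightarrow> bool" where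
  "subcanonical K a T \<longleftrightarrow> (\<forall>A\<in>Ob a. is_sheaf K a T (FOb (yoneda a) A))"

text \<open>The sheafification functor is a left adjoint of the inclusion of sheaves into presheaves; it is
  determined up to natural isomorphism.\<close>

definition sheafification ::
  "'k ring \<Rightarrow> ('o, 'v, 'k) lincat \<Rightarrow> ('o \<Rightarrow> ('o \<Rightarrow> 'v set) set) \<Rightarrow>
   (('o, 'v, 'k) presheaf, 'o \<Rightarrow> 'v \<Rightarrow> 'v, ('o, 'v, 'k) presheaf, 'o \<Rightarrow> 'v \<Rightarrow> 'v) linfun" where
  "sheafification K a T = (SOME L. \<exists>\<eta>. left_adjoint K (PSh K a) (Sh K a T) L id_linfun \<eta>)"

definition Zfun ::
  "'k ring \<Rightarrow> ('o, 'v, 'k) lincat \<Rightarrow> ('o \<Rightarrow> ('o \<Rightarrow> 'v set) set) \<Rightarrow>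
   ('o, 'v, ('o, 'v, 'k) presheaf, 'o \<Rightarrow> 'v \<Rightarrow> 'v) linfun" where
  "Zfun K a T = comp_linfun (sheafification K a T) (yoneda a)"

section \<open>Formal morphisms\<close>

text \<open>A family of objects consists of its index set and its members. A single object is regarded as
  a family indexed by the one-element type, so that formal morphisms to and from single objects
  need no separate treatment.\<close>

type_synonym ('i, 'o) fam = "'i set \<times> ('i \<Rightarrow> 'o)"

definition is_fam :: "('o, 'v, 'k) lincat \<Rightarrow> ('i, 'o) fam \<Rightarrow> bool" where
  "is_fam a V \<longleftrightarrow> snd V \<in> fst V \<rightarrow>\<^sub>E Ob a"

definition sng :: "'o \<Rightarrow> (unit, 'o) fam" where
  "sng X = (UNIV, \<lambda>_. X)"

text \<open>\<open>FHom a V W\<close> is the product over \<open>\<alpha>\<close> of the direct sums over \<open>\<beta>\<close> of the modules of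
  morphisms from the \<open>\<alpha>\<close>-th member of \<open>V\<close> to the \<open>\<beta>\<close>-th member of \<open>W\<close>.\<close>

definition FHom ::
  "('o, 'v, 'k) lincat \<Rightarrow> ('i, 'o) fam \<Rightarrow> ('j, 'o) fam \<Rightarrow> ('i \<Rightarrow> 'j \<Rightarrow> 'v) set" where
  "FHom a V W = (\<Pi>\<^sub>E \<alpha>\<in>fst V. {f \<in> \<Pi>\<^sub>E \<beta>\<in>fst W. hom_set a (snd V \<alpha>) (snd W \<beta>).
     finite {\<beta>\<in>fst W. f \<beta> \<noteq> \<zero>\<^bsub>Hm a (snd V \<alpha>) (snd W \<beta>)\<^esub>}})"

definition fzero ::
  "('o, 'v, 'k) lincat \<Rightarrow> ('i, 'o) fam \<Rightarrow> ('j, 'o) fam \<Rightarrow> 'i \<Rightarrow> 'j \<Rightarrow> 'v" where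
  "fzero a V W = (\<lambda>\<alpha>\<in>fst V. \<lambda>\<beta>\<in>fst W. \<zero>\<^bsub>Hm a (snd V \<alpha>) (snd W \<beta>)\<^esub>)"

text \<open>Matrix multiplication; the sum runs over the finite support of the row \<open>f \<alpha>\<close>.\<close>

definition fcomp ::
  "('o, 'v, 'k) lincat \<Rightarrow> ('i, 'o) fam \<Rightarrow> ('j, 'o) fam \<Rightarrow> ('l, 'o) fam \<Rightarrow>
   ('j \<Rightarrow> 'l \<Rightarrow> 'v) \<Rightarrow> ('i \<Rightarrow> 'j \<Rightarrow> 'v) \<Rightarrow> 'i \<Rightarrow> 'l \<Rightarrow> 'v" where
  "fcomp a U V W g f = (\<lambda>\<alpha>\<in>fst U. \<lambda>\<gamma>\<in>fst W.
     \<Oplus>\<^bsub>Hm a (snd U \<alpha>) (snd W \<gamma>)\<^esub>\<beta>\<in>{\<beta>\<in>fst V. f \<alpha> \<beta> \<noteq> \<zero>\<^bsub>Hm a (snd U \<alpha>) (snd V \<beta>)\<^esub>}.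
       Cmp a (snd U \<alpha>) (snd V \<beta>) (snd W \<gamma>) (g \<beta> \<gamma>) (f \<alpha> \<beta>))"

text \<open>A formal morphism to a single object, bundled with its source and target.\<close>

type_synonym ('i, 'o, 'v) cover = "('i, 'o) fam \<times> 'o \<times> ('i \<Rightarrow> unit \<Rightarrow> 'v)"

definition gen_sieve ::
  "'k ring \<Rightarrow> ('o, 'v, 'k) lincat \<Rightarrow> ('i, 'o, 'v) cover \<Rightarrow> 'o \<Rightarrow> 'v set" where
  "gen_sieve K a = (\<lambda>(V, A, v) B.
     \<Inter>{R B |R. sieve K a A R \<and> (\<forall>\<alpha>\<in>fst V. v \<alpha> () \<in> R (snd V \<alpha>))})"

text \<open>The tuple \<open>(Z, Y, X, p, q)\<close> stands for \<open>p\<close> from \<open>Z\<close> to \<open>Y\<close> followed by \<open>q\<close> from \<open>Y\<close> to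
  \<open>X\<close>.\<close>

type_synonym ('i, 'o, 'v) fseq =
  "('i, 'o) fam \<times> ('i, 'o) fam \<times> 'o \<times> ('i \<Rightarrow> 'i \<Rightarrow> 'v) \<times> ('i \<Rightarrow> unit \<Rightarrow> 'v)"

definition formal_sequence :: "('o, 'v, 'k) lincat \<Rightarrow> ('i, 'o, 'v) fseq \<Rightarrow> bool" where
  "formal_sequence a = (\<lambda>(Z, Y, X, p, q).
     is_fam a Z \<and> is_fam a Y \<and> X \<in> Ob a \<and> p \<in> FHom a Z Y \<and> q \<in> FHom a Y (sng X) \<and>
     fcomp a Z Y (sng X) q p = fzero a Z (sng X))"

text \<open>\<open>FHom a Y (sng A)\<close> is the product of the modules of morphisms from the members of \<open>Y\<close> to
  \<open>A\<close>; the two conjuncts are exactness at \<open>a(X, A)\<close> and at this product.\<close>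

definition right_exact :: "('o, 'v, 'k) lincat \<Rightarrow> ('i, 'o, 'v) fseq \<Rightarrow> bool" where
  "right_exact a = (\<lambda>(Z, Y, X, p, q). \<forall>A\<in>Ob a.
     inj_on (\<lambda>h. fcomp a Y (sng X) (sng A) h q) (FHom a (sng X) (sng A)) \<and>
     (\<lambda>h. fcomp a Y (sng X) (sng A) h q) ` FHom a (sng X) (sng A) =
       {h \<in> FHom a Y (sng A). fcomp a Z Y (sng A) h p = fzero a Z (sng A)})"

section \<open>Pretopologies\<close>

text \<open>The index set of an iterated family is a disjoint union of index sets; it is represented
  inside the type \<open>'i\<close> by means of an arbitrary bijection \<open>e\<close>.\<close>

fun Co :: "('o, 'v, 'k) lincat \<Rightarrow> ('i, 'o, 'v) fseq set \<Rightarrow> nat \<Rightarrow> ('i, 'o, 'v) cover set" where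
  "Co a S 0 = {(V, A, v). A \<in> Ob a \<and>
     (\<exists>i. V = ({i}, \<lambda>\<alpha>\<in>{i}. A) \<and> v = (\<lambda>\<alpha>\<in>{i}. \<lambda>_. Idt a A))}"
| "Co a S (Suc 0) = {(Y, X, q). \<exists>Z p. (Z, Y, X, p, q) \<in> S}"
| "Co a S (Suc (Suc n)) = {(U, X, r). is_fam a U \<and> r \<in> FHom a U (sng X) \<and>
     (\<exists>V v W w e. (V, X, v) \<in> Co a S (Suc n) \<and>
        (\<forall>\<alpha>\<in>fst V. (W \<alpha>, snd V \<alpha>, w \<alpha>) \<in> Co a S (Suc 0)) \<and>
        bij_betw e (fst U) (SIGMA \<alpha>:fst V. fst (W \<alpha>)) \<and>
        (\<forall>\<epsilon>\<in>fst U. \<forall>\<alpha> \<delta>. e \<epsilon> = (\<alpha>, \<delta>) \<longrightarrow>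
           snd U \<epsilon> = snd (W \<alpha>) \<delta> \<and>
           r \<epsilon> () = Cmp a (snd (W \<alpha>) \<delta>) (snd V \<alpha>) X (v \<alpha> ()) (w \<alpha> \<delta> ())))}"

definition Co_iter :: "('o, 'v, 'k) lincat \<Rightarrow> ('i, 'o, 'v) fseq set \<Rightarrow> ('i, 'o, 'v) cover set" where
  "Co_iter a S = (\<Union>n. Co a S n)"

definition pretopology :: "('o, 'v, 'k) lincat \<Rightarrow> ('i, 'o, 'v) fseq set \<Rightarrow> bool" where
  "pretopology a S \<longleftrightarrow>
     (\<forall>s\<in>S. formal_sequence a s) \<and>
     (\<forall>(Y, X, q)\<in>Co a S 1. \<forall>A\<in>Ob a. \<forall>f\<in>FHom a (sng A) (sng X).
        \<exists>C q'. (C, A, q') \<in> Co_iter a S \<and>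
          (\<exists>f'\<in>FHom a C Y. fcomp a C Y (sng X) q f' = fcomp a C (sng A) (sng X) f q')) \<and>
     (\<forall>(Z, Y, X, p, q)\<in>S. \<forall>A\<in>Ob a. \<forall>f\<in>FHom a (sng A) Y.
        fcomp a (sng A) Y (sng X) q f = fzero a (sng A) (sng X) \<longrightarrow>
        (\<exists>B q'. (B, A, q') \<in> Co_iter a S \<and>
          (\<exists>f'\<in>FHom a B Z. fcomp a B Z Y p f' = fcomp a B (sng A) Y f q')))"

definition top_of ::
  "'k ring \<Rightarrow> ('o, 'v, 'k) lincat \<Rightarrow> ('i, 'o, 'v) fseq set \<Rightarrow> 'o \<Rightarrow> ('o \<Rightarrow> 'v set) set" where
  "top_of K a S X = {R. X \<in> Ob a \<and> sieve K a X R \<and>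
     (\<exists>V r. (V, X, r) \<in> Co_iter a S \<and> (\<forall>B\<in>Ob a. gen_sieve K a (V, X, r) B \<subseteq> R B))}"

text \<open>\<open>(P, j)\<close> and \<open>(Q, j')\<close> are the coproducts in sheaves of the \<open>Z(Z\<^sub>\<gamma>)\<close> and of the \<open>Z(Y\<^sub>\<beta>)\<close>, and
  \<open>u\<close>, \<open>w\<close> are the morphisms induced by \<open>p\<close>, \<open>q\<close>.\<close>

definition pre_of ::
  "'k ring \<Rightarrow> ('o, 'v, 'k) lincat \<Rightarrow> ('o \<Rightarrow> ('o \<Rightarrow> 'v set) set) \<Rightarrow> ('i, 'o, 'v) fseq set" where
  "pre_of K a T = {(Z, Y, X, p, q). formal_sequence a (Z, Y, X, p, q) \<and>
     (let D = Sh K a T; F = Zfun K a T; zZ = (\<lambda>\<gamma>. FOb F (snd Z \<gamma>)); zY = (\<lambda>\<beta>. FOb F (snd Y \<beta>)) in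
      \<exists>P j Q j' u w.
        is_coproduct D (fst Z) zZ P j \<and>
        is_coproduct D (fst Y) zY Q j' \<and>
        u \<in> hom_set D P Q \<and>
        (\<forall>\<gamma>\<in>fst Z. Cmp D (zZ \<gamma>) P Q u (j \<gamma>) =
           (\<Oplus>\<^bsub>Hm D (zZ \<gamma>) Q\<^esub>\<beta>\<in>{\<beta>\<in>fst Y. p \<gamma> \<beta> \<noteq> \<zero>\<^bsub>Hm a (snd Z \<gamma>) (snd Y \<beta>)\<^esub>}.
              Cmp D (zZ \<gamma>) (zY \<beta>) Q (j' \<beta>) (FAr F (snd Z \<gamma>) (snd Y \<beta>) (p \<gamma> \<beta>)))) \<and>
        w \<in> hom_set D Q (FOb F X) \<and>
        (\<forall>\<beta>\<in>fst Y. Cmp D (zY \<beta>) Q (FOb F X) w (j' \<beta>) = FAr F (snd Y \<beta>) X (q \<beta> ())) \<and>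
        exact_to_zero D P Q (FOb F X) u w)}"

end

theory Submission
  imports Defs
begin

text \<open>
  The condition that a sequence becomes exact after sheafification has an elementary form: its
  right-hand morphism generates a covering sieve, and every row killed by it lifts locally along the
  left-hand morphism. Covering sieves are generated by such sequences, because sources can be taken in
  a small skeleton and the relations between the generators form a small set; so they constitute a
  pretopology that induces the given topology. If representables are sheaves, a family on the
  generators that kills the relations factors locally, hence globally, over the target, so these
  sequences are right exact. Conversely, gluing along iterated covers reduces, by extending a matching
  family to every morphism along which it is locally represented, to gluing along the covers of single
  right exact sequences. For full faithfulness, the adjunction and the Yoneda lemma identify the action
  of \<open>Z\<close> on morphisms into \<open>Y\<close> with the unit of sheafification at the presheaf represented by \<open>Y\<close>,
  which is bijective precisely when this presheaf is a sheaf.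

  Sheafification, quotients and infinite direct sums of sheaves all come from one construction, the
  sheaf associated with the quotient of a presheaf by a closed subpresheaf.
\<close>

section \<open>Linear categories and presheaves, elementwise\<close>

text \<open>The objects of \<open>PSh K a\<close> have elements in the fixed type \<open>'v\<close>,
  whereas sections of an associated sheaf are graphs and elements of an infinite direct sum are
  rows, both in larger types. So presheaves are handled elementwise with an arbitrary element type;
  each sheaf is built where it arises and is then transported into \<open>'v\<close> along
  injections, which exist because a section is determined by its values on a small set of morphisms.
  The functor \<open>sheafification\<close> is an arbitrary choice of left adjoint, so nothing can
  be read off from a construction: that its unit has torsion kernel and is locally surjective is
  deduced from the universal property, by mapping into sheaves built by hand. Since the topology is
  linear, sieves are closed under sums as well as composition; whenever a local property is tested
  on generators, or on a cover of a cover, the morphisms that have it must first be shown to form a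
  sieve. This accounts for the recurring sieve verifications.\<close>

locale lin_cat =
  fixes K :: "'k ring" and a :: "('o, 'v, 'k) lincat"
  assumes cat: "linear_category K a"
begin

abbreviation "yo \<equiv> FOb (yoneda a)"

abbreviation hm :: "'o \<Rightarrow> 'o \<Rightarrow> 'v set" where "hm B A \<equiv> carrier (Hm a B A)"

lemma cr: "cring K" by (rule linear_category_def[THEN iffD1, OF cat, THEN conjunct1])

sublocale K: cring K by (rule cr)

lemma Hmod: "X \<in> Ob a \<Longrightarrow> Y \<in> Ob a \<Longrightarrow> module K (Hm a X Y)"
  by (rule linear_category_def[THEN iffD1, OF cat, THEN conjunct2, THEN conjunct1, rule_format])

lemma Hgrp: "X \<in> Ob a \<Longrightarrow> Y \<in> Ob a \<Longrightarrow> abelian_group (Hm a X Y)"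
  by (rule module.axioms(2)[OF Hmod])

lemma Idt_in [simp]: "X \<in> Ob a \<Longrightarrow> Idt a X \<in> hm X X"
  by (rule linear_category_def[THEN iffD1, OF cat, THEN conjunct2, THEN conjunct2, THEN conjunct1, rule_format])

lemma Cmp_in [simp]:
  "X \<in> Ob a \<Longrightarrow> Y \<in> Ob a \<Longrightarrow> Z \<in> Ob a \<Longrightarrow> f \<in> hm X Y \<Longrightarrow> g \<in> hm Y Z \<Longrightarrow> Cmp a X Y Z g f \<in> hm X Z"
  by (rule linear_category_def[THEN iffD1, OF cat, THEN conjunct2, THEN conjunct2, THEN conjunct2, THEN conjunct1, rule_format])

lemma Cmp_Idt [simp]:
  assumes "X \<in> Ob a" "Y \<in> Ob a" "f \<in> hm X Y"
  shows "Cmp a X X Y f (Idt a X) = f" "Cmp a X Y Y (Idt a Y) f = f"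
  using linear_category_def[THEN iffD1, OF cat, THEN conjunct2, THEN conjunct2, THEN conjunct2, THEN conjunct2, THEN conjunct1, rule_format] assms by auto

lemma Cmp_assoc:
  "W \<in> Ob a \<Longrightarrow> X \<in> Ob a \<Longrightarrow> Y \<in> Ob a \<Longrightarrow> Z \<in> Ob a \<Longrightarrow> f \<in> hm W X \<Longrightarrow> g \<in> hm X Y \<Longrightarrow> h \<in> hm Y Z \<Longrightarrow>
   Cmp a W X Z (Cmp a X Y Z h g) f = Cmp a W Y Z h (Cmp a W X Y g f)"
  by (rule linear_category_def[THEN iffD1, OF cat, THEN conjunct2, THEN conjunct2, THEN conjunct2, THEN conjunct2, THEN conjunct2, THEN conjunct1, rule_format])

lemma Cmp_add_left:
  assumes "X \<in> Ob a" "Y \<in> Ob a" "Z \<in> Ob a" "f \<in> hm X Y" "g \<in> hm Y Z" "g' \<in> hm Y Z"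
  shows "Cmp a X Y Z (g \<oplus>\<^bsub>Hm a Y Z\<^esub> g') f = Cmp a X Y Z g f \<oplus>\<^bsub>Hm a X Z\<^esub> Cmp a X Y Z g' f"
  using linear_category_def[THEN iffD1, OF cat, THEN conjunct2, THEN conjunct2, THEN conjunct2, THEN conjunct2, THEN conjunct2, THEN conjunct2, THEN conjunct1, rule_format] assms by auto

lemma Cmp_add_right:
  assumes "X \<in> Ob a" "Y \<in> Ob a" "Z \<in> Ob a" "f \<in> hm X Y" "f' \<in> hm X Y" "g \<in> hm Y Z"
  shows "Cmp a X Y Z g (f \<oplus>\<^bsub>Hm a X Y\<^esub> f') = Cmp a X Y Z g f \<oplus>\<^bsub>Hm a X Z\<^esub> Cmp a X Y Z g f'"
  using linear_category_def[THEN iffD1, OF cat, THEN conjunct2, THEN conjunct2, THEN conjunct2, THEN conjunct2, THEN conjunct2, THEN conjunct2, THEN conjunct1, rule_format] assms by auto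

lemma Cmp_smult:
  assumes "X \<in> Ob a" "Y \<in> Ob a" "Z \<in> Ob a" "f \<in> hm X Y" "g \<in> hm Y Z" "r \<in> carrier K"
  shows "Cmp a X Y Z (r \<odot>\<^bsub>Hm a Y Z\<^esub> g) f = r \<odot>\<^bsub>Hm a X Z\<^esub> Cmp a X Y Z g f"
    and "Cmp a X Y Z g (r \<odot>\<^bsub>Hm a X Y\<^esub> f) = r \<odot>\<^bsub>Hm a X Z\<^esub> Cmp a X Y Z g f"
  using linear_category_def[THEN iffD1, OF cat, THEN conjunct2, THEN conjunct2, THEN conjunct2, THEN conjunct2, THEN conjunct2, THEN conjunct2, THEN conjunct2, rule_format] assms by auto

lemma Hadd_in [simp]:
  "X \<in> Ob a \<Longrightarrow> Y \<in> Ob a \<Longrightarrow> f \<in> hm X Y \<Longrightarrow> g \<in> hm X Y \<Longrightarrow> f \<oplus>\<^bsub>Hm a X Y\<^esub> g \<in> hm X Y"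
  by (rule abelian_monoid.a_closed[OF abelian_group.axioms(1)[OF Hgrp]])

lemma Hzero_in [simp]: "X \<in> Ob a \<Longrightarrow> Y \<in> Ob a \<Longrightarrow> \<zero>\<^bsub>Hm a X Y\<^esub> \<in> hm X Y"
  by (rule abelian_monoid.zero_closed[OF abelian_group.axioms(1)[OF Hgrp]])

lemma Hsmult_in [simp]:
  "X \<in> Ob a \<Longrightarrow> Y \<in> Ob a \<Longrightarrow> r \<in> carrier K \<Longrightarrow> f \<in> hm X Y \<Longrightarrow> r \<odot>\<^bsub>Hm a X Y\<^esub> f \<in> hm X Y"
  by (rule module.smult_closed[OF Hmod])

text \<open>The presheaves of this predicate may have elements in any type, in contrast to the objects of
  \<open>PSh K a\<close>; the values of \<open>FAr F A B f\<close> outside the carrier are irrelevant.\<close>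

definition psh :: "('o, 'v, ('k, 'w) module, 'w \<Rightarrow> 'w) linfun \<Rightarrow> bool" where
  "psh F \<longleftrightarrow>
    (\<forall>A\<in>Ob a. module K (FOb F A)) \<and>
    (\<forall>A\<in>Ob a. \<forall>B\<in>Ob a. \<forall>f\<in>hm B A. \<forall>x\<in>carrier (FOb F A). FAr F A B f x \<in> carrier (FOb F B)) \<and>
    (\<forall>A\<in>Ob a. \<forall>B\<in>Ob a. \<forall>f\<in>hm B A. \<forall>x\<in>carrier (FOb F A). \<forall>y\<in>carrier (FOb F A).
       FAr F A B f (x \<oplus>\<^bsub>FOb F A\<^esub> y) = FAr F A B f x \<oplus>\<^bsub>FOb F B\<^esub> FAr F A B f y) \<and>
    (\<forall>A\<in>Ob a. \<forall>x\<in>carrier (FOb F A). FAr F A A (Idt a A) x = x) \<and>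
    (\<forall>A\<in>Ob a. \<forall>B\<in>Ob a. \<forall>C\<in>Ob a. \<forall>f\<in>hm B A. \<forall>g\<in>hm C B. \<forall>x\<in>carrier (FOb F A).
       FAr F A C (Cmp a C B A f g) x = FAr F B C g (FAr F A B f x)) \<and>
    (\<forall>A\<in>Ob a. \<forall>B\<in>Ob a. \<forall>f\<in>hm B A. \<forall>g\<in>hm B A. \<forall>x\<in>carrier (FOb F A).
       FAr F A B (f \<oplus>\<^bsub>Hm a B A\<^esub> g) x = FAr F A B f x \<oplus>\<^bsub>FOb F B\<^esub> FAr F A B g x) \<and>
    (\<forall>A\<in>Ob a. \<forall>B\<in>Ob a. \<forall>f\<in>hm B A. \<forall>r\<in>carrier K. \<forall>x\<in>carrier (FOb F A).
       FAr F A B (r \<odot>\<^bsub>Hm a B A\<^esub> f) x = r \<odot>\<^bsub>FOb F B\<^esub> FAr F A B f x)"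

lemma psh_mod: "psh F \<Longrightarrow> A \<in> Ob a \<Longrightarrow> module K (FOb F A)"
  by (rule psh_def[THEN iffD1, THEN conjunct1, rule_format])

lemma psh_grp: "psh F \<Longrightarrow> A \<in> Ob a \<Longrightarrow> abelian_group (FOb F A)"
  by (rule module.axioms(2)[OF psh_mod])

lemma psh_mon: "psh F \<Longrightarrow> A \<in> Ob a \<Longrightarrow> abelian_monoid (FOb F A)"
  by (rule abelian_group.axioms(1)[OF psh_grp])

lemma act_in [simp]:
  "psh F \<Longrightarrow> A \<in> Ob a \<Longrightarrow> B \<in> Ob a \<Longrightarrow> f \<in> hm B A \<Longrightarrow> x \<in> carrier (FOb F A) \<Longrightarrow>
   FAr F A B f x \<in> carrier (FOb F B)"
  by (rule psh_def[THEN iffD1, THEN conjunct2, THEN conjunct1, rule_format])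

lemma act_add:
  "psh F \<Longrightarrow> A \<in> Ob a \<Longrightarrow> B \<in> Ob a \<Longrightarrow> f \<in> hm B A \<Longrightarrow> x \<in> carrier (FOb F A) \<Longrightarrow> y \<in> carrier (FOb F A) \<Longrightarrow>
   FAr F A B f (x \<oplus>\<^bsub>FOb F A\<^esub> y) = FAr F A B f x \<oplus>\<^bsub>FOb F B\<^esub> FAr F A B f y"
  by (rule psh_def[THEN iffD1, THEN conjunct2, THEN conjunct2, THEN conjunct1, rule_format])

lemma act_Idt [simp]: "psh F \<Longrightarrow> A \<in> Ob a \<Longrightarrow> x \<in> carrier (FOb F A) \<Longrightarrow> FAr F A A (Idt a A) x = x"
  by (rule psh_def[THEN iffD1, THEN conjunct2, THEN conjunct2, THEN conjunct2, THEN conjunct1, rule_format])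

lemma act_Cmp:
  "psh F \<Longrightarrow> A \<in> Ob a \<Longrightarrow> B \<in> Ob a \<Longrightarrow> C \<in> Ob a \<Longrightarrow> f \<in> hm B A \<Longrightarrow> g \<in> hm C B \<Longrightarrow> x \<in> carrier (FOb F A) \<Longrightarrow>
   FAr F A C (Cmp a C B A f g) x = FAr F B C g (FAr F A B f x)"
  by (rule psh_def[THEN iffD1, THEN conjunct2, THEN conjunct2, THEN conjunct2, THEN conjunct2, THEN conjunct1, rule_format])

lemma act_add_left:
  "psh F \<Longrightarrow> A \<in> Ob a \<Longrightarrow> B \<in> Ob a \<Longrightarrow> f \<in> hm B A \<Longrightarrow> g \<in> hm B A \<Longrightarrow> x \<in> carrier (FOb F A) \<Longrightarrow>
   FAr F A B (f \<oplus>\<^bsub>Hm a B A\<^esub> g) x = FAr F A B f x \<oplus>\<^bsub>FOb F B\<^esub> FAr F A B g x"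
  by (rule psh_def[THEN iffD1, THEN conjunct2, THEN conjunct2, THEN conjunct2, THEN conjunct2, THEN conjunct2, THEN conjunct1, rule_format])

lemma act_smult_left:
  "psh F \<Longrightarrow> A \<in> Ob a \<Longrightarrow> B \<in> Ob a \<Longrightarrow> f \<in> hm B A \<Longrightarrow> r \<in> carrier K \<Longrightarrow> x \<in> carrier (FOb F A) \<Longrightarrow>
   FAr F A B (r \<odot>\<^bsub>Hm a B A\<^esub> f) x = r \<odot>\<^bsub>FOb F B\<^esub> FAr F A B f x"
  by (rule psh_def[THEN iffD1, THEN conjunct2, THEN conjunct2, THEN conjunct2, THEN conjunct2, THEN conjunct2, THEN conjunct2, rule_format])

lemma psh_add_in [simp]:
  "psh F \<Longrightarrow> A \<in> Ob a \<Longrightarrow> x \<in> carrier (FOb F A) \<Longrightarrow> y \<in> carrier (FOb F A) \<Longrightarrow>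
   x \<oplus>\<^bsub>FOb F A\<^esub> y \<in> carrier (FOb F A)"
  by (rule abelian_monoid.a_closed[OF psh_mon])

lemma psh_zero_in [simp]: "psh F \<Longrightarrow> A \<in> Ob a \<Longrightarrow> \<zero>\<^bsub>FOb F A\<^esub> \<in> carrier (FOb F A)"
  by (rule abelian_monoid.zero_closed[OF psh_mon])

lemma psh_neg_in [simp]:
  "psh F \<Longrightarrow> A \<in> Ob a \<Longrightarrow> x \<in> carrier (FOb F A) \<Longrightarrow> \<ominus>\<^bsub>FOb F A\<^esub> x \<in> carrier (FOb F A)"
  by (rule abelian_group.a_inv_closed[OF psh_grp])

lemma psh_minus_in [simp]:
  "psh F \<Longrightarrow> A \<in> Ob a \<Longrightarrow> x \<in> carrier (FOb F A) \<Longrightarrow> y \<in> carrier (FOb F A) \<Longrightarrow>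
   x \<ominus>\<^bsub>FOb F A\<^esub> y \<in> carrier (FOb F A)"
  by (rule abelian_group.minus_closed[OF psh_grp])

lemma psh_smult_in [simp]:
  "psh F \<Longrightarrow> A \<in> Ob a \<Longrightarrow> r \<in> carrier K \<Longrightarrow> x \<in> carrier (FOb F A) \<Longrightarrow> r \<odot>\<^bsub>FOb F A\<^esub> x \<in> carrier (FOb F A)"
  by (rule module.smult_closed[OF psh_mod])

lemma psh_zero_add [simp]:
  assumes "psh F" "A \<in> Ob a" "x \<in> carrier (FOb F A)"
  shows "x \<oplus>\<^bsub>FOb F A\<^esub> \<zero>\<^bsub>FOb F A\<^esub> = x" "\<zero>\<^bsub>FOb F A\<^esub> \<oplus>\<^bsub>FOb F A\<^esub> x = x"
  by (rule abelian_monoid.r_zero[OF psh_mon[OF assms(1,2)] assms(3)])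
    (rule abelian_monoid.l_zero[OF psh_mon[OF assms(1,2)] assms(3)])

text \<open>A composite with \<open>r\<close> times the identity is multiplication by \<open>r\<close>, so functoriality and
  naturality imply linearity.\<close>

lemma act_scalar:
  assumes "psh F" "A \<in> Ob a" "r \<in> carrier K" "x \<in> carrier (FOb F A)"
  shows "FAr F A A (r \<odot>\<^bsub>Hm a A A\<^esub> Idt a A) x = r \<odot>\<^bsub>FOb F A\<^esub> x"
  using assms by (simp add: act_smult_left)

lemma act_smult:
  assumes F: "psh F" and A: "A \<in> Ob a" "B \<in> Ob a" "f \<in> hm B A" "r \<in> carrier K" "x \<in> carrier (FOb F A)"
  shows "FAr F A B f (r \<odot>\<^bsub>FOb F A\<^esub> x) = r \<odot>\<^bsub>FOb F B\<^esub> FAr F A B f x"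
proof -
  have "FAr F A B f (r \<odot>\<^bsub>FOb F A\<^esub> x) = FAr F A B (Cmp a B A A (r \<odot>\<^bsub>Hm a A A\<^esub> Idt a A) f) x"
    using assms by (simp add: act_Cmp act_scalar)
  also have "\<dots> = r \<odot>\<^bsub>FOb F B\<^esub> FAr F A B f x"
    using assms by (simp add: Cmp_smult act_smult_left)
  finally show ?thesis .
qed

text \<open>Source and target may have different element types, as the map from a presheaf to the
  sheaf of graphs over it demands. Compatibility with scalars is derived in
  \<open>lin_nat_smult\<close>.\<close>

definition lin_nat :: "('o, 'v, ('k, 'w) module, 'w \<Rightarrow> 'w) linfun \<Rightarrow>
    ('o, 'v, ('k, 'u) module, 'u \<Rightarrow> 'u) linfun \<Rightarrow> ('o \<Rightarrow> 'w \<Rightarrow> 'u) \<Rightarrow> bool" where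
  "lin_nat F G \<phi> \<longleftrightarrow>
    (\<forall>A\<in>Ob a. \<forall>x\<in>carrier (FOb F A). \<phi> A x \<in> carrier (FOb G A)) \<and>
    (\<forall>A\<in>Ob a. \<forall>x\<in>carrier (FOb F A). \<forall>y\<in>carrier (FOb F A).
       \<phi> A (x \<oplus>\<^bsub>FOb F A\<^esub> y) = \<phi> A x \<oplus>\<^bsub>FOb G A\<^esub> \<phi> A y) \<and>
    (\<forall>A\<in>Ob a. \<forall>B\<in>Ob a. \<forall>f\<in>hm B A. \<forall>x\<in>carrier (FOb F A). \<phi> B (FAr F A B f x) = FAr G A B f (\<phi> A x))"

lemma lin_nat_in: "lin_nat F G \<phi> \<Longrightarrow> A \<in> Ob a \<Longrightarrow> x \<in> carrier (FOb F A) \<Longrightarrow> \<phi> A x \<in> carrier (FOb G A)"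
  by (rule lin_nat_def[THEN iffD1, THEN conjunct1, rule_format])

lemma lin_nat_add: "lin_nat F G \<phi> \<Longrightarrow> A \<in> Ob a \<Longrightarrow> x \<in> carrier (FOb F A) \<Longrightarrow> y \<in> carrier (FOb F A) \<Longrightarrow>
    \<phi> A (x \<oplus>\<^bsub>FOb F A\<^esub> y) = \<phi> A x \<oplus>\<^bsub>FOb G A\<^esub> \<phi> A y"
  by (rule lin_nat_def[THEN iffD1, THEN conjunct2, THEN conjunct1, rule_format])

lemma lin_nat_act: "lin_nat F G \<phi> \<Longrightarrow> A \<in> Ob a \<Longrightarrow> B \<in> Ob a \<Longrightarrow> f \<in> hm B A \<Longrightarrow> x \<in> carrier (FOb F A) \<Longrightarrow>
    \<phi> B (FAr F A B f x) = FAr G A B f (\<phi> A x)"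
  by (rule lin_nat_def[THEN iffD1, THEN conjunct2, THEN conjunct2, rule_format])

lemma lin_nat_comp: "lin_nat F G \<phi> \<Longrightarrow> lin_nat G H \<psi> \<Longrightarrow> lin_nat F H (\<lambda>A x. \<psi> A (\<phi> A x))"
  unfolding lin_nat_def by simp

lemma lin_nat_smult:
  assumes "psh F" "psh G" "lin_nat F G \<phi>" "A \<in> Ob a" "r \<in> carrier K" "x \<in> carrier (FOb F A)"
  shows "\<phi> A (r \<odot>\<^bsub>FOb F A\<^esub> x) = r \<odot>\<^bsub>FOb G A\<^esub> \<phi> A x"
  using lin_nat_act[OF assms(3,4,4), of "r \<odot>\<^bsub>Hm a A A\<^esub> Idt a A" x] assms
  by (simp add: act_scalar lin_nat_in)

end

section \<open>Additive maps and finite sums\<close>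

lemma additive_zero_neg:
  assumes M: "abelian_group M" and N: "abelian_group N"
    and "\<And>x. x \<in> carrier M \<Longrightarrow> h x \<in> carrier N"
    and "\<And>x y. x \<in> carrier M \<Longrightarrow> y \<in> carrier M \<Longrightarrow> h (x \<oplus>\<^bsub>M\<^esub> y) = h x \<oplus>\<^bsub>N\<^esub> h y"
  shows "h \<zero>\<^bsub>M\<^esub> = \<zero>\<^bsub>N\<^esub>"
    and "x \<in> carrier M \<Longrightarrow> h (\<ominus>\<^bsub>M\<^esub> x) = \<ominus>\<^bsub>N\<^esub> h x"
    and "x \<in> carrier M \<Longrightarrow> y \<in> carrier M \<Longrightarrow> h (x \<ominus>\<^bsub>M\<^esub> y) = h x \<ominus>\<^bsub>N\<^esub> h y"
proof -
  interpret M: abelian_group M by fact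
  interpret N: abelian_group N by fact
  have h: "h \<in> hom (add_monoid M) (add_monoid N)"
    using assms(3,4) by (simp add: hom_def)
  interpret h: group_hom "add_monoid M" "add_monoid N" h
    by (unfold_locales) (rule h)
  show 0: "h \<zero>\<^bsub>M\<^esub> = \<zero>\<^bsub>N\<^esub>" using h.hom_one by simp
  show neg: "x \<in> carrier M \<Longrightarrow> h (\<ominus>\<^bsub>M\<^esub> x) = \<ominus>\<^bsub>N\<^esub> h x" for x
    using h.hom_inv by (simp add: a_inv_def)
  show "x \<in> carrier M \<Longrightarrow> y \<in> carrier M \<Longrightarrow> h (x \<ominus>\<^bsub>M\<^esub> y) = h x \<ominus>\<^bsub>N\<^esub> h y"
    unfolding a_minus_def using neg assms(4) M.a_inv_closed by simp
qed

lemma additive_finsum: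
  assumes M: "abelian_monoid M" and N: "abelian_monoid N"
    and "\<And>x. x \<in> carrier M \<Longrightarrow> h x \<in> carrier N"
    and "\<And>x y. x \<in> carrier M \<Longrightarrow> y \<in> carrier M \<Longrightarrow> h (x \<oplus>\<^bsub>M\<^esub> y) = h x \<oplus>\<^bsub>N\<^esub> h y"
    and "h \<zero>\<^bsub>M\<^esub> = \<zero>\<^bsub>N\<^esub>" "\<And>i. i \<in> I \<Longrightarrow> t i \<in> carrier M" "finite I"
  shows "h (\<Oplus>\<^bsub>M\<^esub>i\<in>I. t i) = (\<Oplus>\<^bsub>N\<^esub>i\<in>I. h (t i))"
  using assms(7,6)
proof (induction I rule: finite_induct)
  case empty
  then show ?case using assms by (simp add: abelian_monoid.finsum_empty)
next
  case (insert i I)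
  interpret M: abelian_monoid M by fact
  interpret N: abelian_monoid N by fact
  have "h (\<Oplus>\<^bsub>M\<^esub>i\<in>insert i I. t i) = h (t i \<oplus>\<^bsub>M\<^esub> (\<Oplus>\<^bsub>M\<^esub>i\<in>I. t i))"
    using insert by (subst M.finsum_insert) auto
  also have "\<dots> = h (t i) \<oplus>\<^bsub>N\<^esub> h (\<Oplus>\<^bsub>M\<^esub>i\<in>I. t i)"
    using insert by (intro assms(4)) (auto intro: M.finsum_closed)
  also have "\<dots> = (\<Oplus>\<^bsub>N\<^esub>i\<in>insert i I. h (t i))"
    using insert assms(3) by (subst N.finsum_insert) auto
  finally show ?case .
qed

context lin_cat
begin

lemma lin_nat_zero_neg:
  assumes "psh F" "psh G" "lin_nat F G \<phi>" "A \<in> Ob a"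
  shows "\<phi> A \<zero>\<^bsub>FOb F A\<^esub> = \<zero>\<^bsub>FOb G A\<^esub>"
    and "x \<in> carrier (FOb F A) \<Longrightarrow> \<phi> A (\<ominus>\<^bsub>FOb F A\<^esub> x) = \<ominus>\<^bsub>FOb G A\<^esub> \<phi> A x"
    and "x \<in> carrier (FOb F A) \<Longrightarrow> y \<in> carrier (FOb F A) \<Longrightarrow>
         \<phi> A (x \<ominus>\<^bsub>FOb F A\<^esub> y) = \<phi> A x \<ominus>\<^bsub>FOb G A\<^esub> \<phi> A y"
  using additive_zero_neg[OF psh_grp[OF assms(1,4)] psh_grp[OF assms(2,4)], of "\<phi> A"]
    lin_nat_in[OF assms(3,4)] lin_nat_add[OF assms(3,4)] by blast+

lemma act_zero_neg:
  assumes "psh F" "A \<in> Ob a" "B \<in> Ob a" "f \<in> hm B A"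
  shows "FAr F A B f \<zero>\<^bsub>FOb F A\<^esub> = \<zero>\<^bsub>FOb F B\<^esub>"
    and "x \<in> carrier (FOb F A) \<Longrightarrow> FAr F A B f (\<ominus>\<^bsub>FOb F A\<^esub> x) = \<ominus>\<^bsub>FOb F B\<^esub> FAr F A B f x"
    and "x \<in> carrier (FOb F A) \<Longrightarrow> y \<in> carrier (FOb F A) \<Longrightarrow>
         FAr F A B f (x \<ominus>\<^bsub>FOb F A\<^esub> y) = FAr F A B f x \<ominus>\<^bsub>FOb F B\<^esub> FAr F A B f y"
  using additive_zero_neg[OF psh_grp[OF assms(1,2)] psh_grp[OF assms(1,3)], of "FAr F A B f"]
    act_in[OF assms] act_add[OF assms] by blast+

lemma act_zero_neg_left:
  assumes "psh F" "A \<in> Ob a" "B \<in> Ob a" "x \<in> carrier (FOb F A)"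
  shows "FAr F A B \<zero>\<^bsub>Hm a B A\<^esub> x = \<zero>\<^bsub>FOb F B\<^esub>"
    and "f \<in> hm B A \<Longrightarrow> FAr F A B (\<ominus>\<^bsub>Hm a B A\<^esub> f) x = \<ominus>\<^bsub>FOb F B\<^esub> FAr F A B f x"
    and "f \<in> hm B A \<Longrightarrow> g \<in> hm B A \<Longrightarrow> FAr F A B (f \<ominus>\<^bsub>Hm a B A\<^esub> g) x = FAr F A B f x \<ominus>\<^bsub>FOb F B\<^esub> FAr F A B g x"
  using additive_zero_neg[OF Hgrp[OF assms(3,2)] psh_grp[OF assms(1,3)], of "\<lambda>f. FAr F A B f x"]
    act_in[OF assms(1-3) _ assms(4)] act_add_left[OF assms(1-3) _ _ assms(4)] by blast+

lemma psh_minus_eq_zero: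
  assumes "psh F" "A \<in> Ob a" "x \<in> carrier (FOb F A)" "y \<in> carrier (FOb F A)"
  shows "x \<ominus>\<^bsub>FOb F A\<^esub> y = \<zero>\<^bsub>FOb F A\<^esub> \<longleftrightarrow> x = y"
proof -
  interpret M: abelian_group "FOb F A" by (rule psh_grp[OF assms(1,2)])
  show ?thesis
    unfolding a_minus_def using M.add.right_cancel[of "\<ominus>\<^bsub>FOb F A\<^esub> y" x y] M.r_neg[of y] assms by auto
qed

section \<open>Representable presheaves and sieves\<close>

lemma yoneda_simps [simp]:
  "FOb (yo A) B = Hm a B A"
  "f \<in> hm B A \<Longrightarrow> FAr (yo A) B C g f = Cmp a C B A f g"
  by (simp_all add: yoneda_def)

lemma psh_yoneda [simp]: "A \<in> Ob a \<Longrightarrow> psh (yo A)"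
  unfolding psh_def by (simp add: Hmod Cmp_assoc Cmp_add_left Cmp_add_right Cmp_smult)

lemma sieve_presheaf_simps [simp]:
  "FOb (sieve_presheaf a A R) B = (Hm a B A)\<lparr>carrier := R B\<rparr>"
  "f \<in> R B \<Longrightarrow> FAr (sieve_presheaf a A R) B C g f = Cmp a C B A f g"
  by (simp_all add: sieve_presheaf_def)

lemma sieve_out: "sieve K a A R \<Longrightarrow> B \<notin> Ob a \<Longrightarrow> R B = {}"
  unfolding sieve_def by blast

lemma sieve_Ob: "sieve K a A R \<Longrightarrow> f \<in> R B \<Longrightarrow> B \<in> Ob a"
  using sieve_out by blast

lemma sieve_sub:
  assumes "sieve K a A R" "A \<in> Ob a" "B \<in> Ob a"
  shows "submodule (R B) K (Hm a B A)" using assms unfolding sieve_def by blast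

lemma sieve_hm: "sieve K a A R \<Longrightarrow> A \<in> Ob a \<Longrightarrow> f \<in> R B \<Longrightarrow> f \<in> hm B A"
  using sieve_sub sieve_Ob module.submoduleE(1) Hmod by (meson subsetD)

lemma sieve_add:
  "sieve K a A R \<Longrightarrow> A \<in> Ob a \<Longrightarrow> f \<in> R B \<Longrightarrow> g \<in> R B \<Longrightarrow> f \<oplus>\<^bsub>Hm a B A\<^esub> g \<in> R B"
  using sieve_sub sieve_Ob module.submoduleE(5) Hmod by meson

lemma sieve_zero: "sieve K a A R \<Longrightarrow> A \<in> Ob a \<Longrightarrow> B \<in> Ob a \<Longrightarrow> \<zero>\<^bsub>Hm a B A\<^esub> \<in> R B"
  using sieve_sub subgroup.one_closed submodule.axioms(1) by fastforce

lemma sieve_Cmp: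
  "sieve K a A R \<Longrightarrow> f \<in> R B \<Longrightarrow> C \<in> Ob a \<Longrightarrow> g \<in> hm C B \<Longrightarrow> Cmp a C B A f g \<in> R C"
  using sieve_Ob unfolding sieve_def by blast

lemma psh_sieve:
  assumes R: "sieve K a A R" and A: "A \<in> Ob a"
  shows "psh (sieve_presheaf a A R)"
  unfolding psh_def
  using sieve_hm[OF R A] sieve_Cmp[OF R] sieve_add[OF R A] A
    submodule.submodule_is_module[OF sieve_sub[OF R A] Hmod]
    submodule.smult_closed[OF sieve_sub[OF R A]]
  by (simp add: Cmp_assoc Cmp_add_left Cmp_add_right Cmp_smult)

definition sieve_of :: "'o \<Rightarrow> ('o \<Rightarrow> 'v \<Rightarrow> bool) \<Rightarrow> 'o \<Rightarrow> 'v set" where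
  "sieve_of A P = (\<lambda>B. if B \<in> Ob a then {f \<in> hm B A. P B f} else {})"

lemma mem_sieve_of [simp]: "f \<in> sieve_of A P B \<longleftrightarrow> B \<in> Ob a \<and> f \<in> hm B A \<and> P B f"
  by (simp add: sieve_of_def)

text \<open>Composition with r times the identity is scalar multiplication by r, and r = -1 gives
  negation, so additive closure and closure under composition yield a submodule.\<close>

lemma sieveI:
  assumes A: "A \<in> Ob a" and out: "\<And>B. B \<notin> Ob a \<Longrightarrow> R B = {}"
    and hm: "\<And>B f. B \<in> Ob a \<Longrightarrow> f \<in> R B \<Longrightarrow> f \<in> hm B A"
    and zero: "\<And>B. B \<in> Ob a \<Longrightarrow> \<zero>\<^bsub>Hm a B A\<^esub> \<in> R B"
    and add: "\<And>B f g. B \<in> Ob a \<Longrightarrow> f \<in> R B \<Longrightarrow> g \<in> R B \<Longrightarrow> f \<oplus>\<^bsub>Hm a B A\<^esub> g \<in> R B"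
    and Cmp: "\<And>B C f g. B \<in> Ob a \<Longrightarrow> C \<in> Ob a \<Longrightarrow> f \<in> R B \<Longrightarrow> g \<in> hm C B \<Longrightarrow> Cmp a C B A f g \<in> R C"
  shows "sieve K a A R"
  unfolding sieve_def
proof (intro conjI ballI allI impI)
  fix B assume B: "B \<in> Ob a"
  interpret M: module K "Hm a B A" by (rule Hmod[OF B A])
  have smult: "r \<odot>\<^bsub>Hm a B A\<^esub> f \<in> R B" if "r \<in> carrier K" "f \<in> R B" for r f
    using Cmp[OF B B that(2), of "r \<odot>\<^bsub>Hm a B B\<^esub> Idt a B"] that hm[OF B] A B by (simp add: Cmp_smult)
  show "submodule (R B) K (Hm a B A)"
  proof (rule M.submoduleI)
    show "\<ominus>\<^bsub>Hm a B A\<^esub> f \<in> R B" if "f \<in> R B" for f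
      using smult[of "\<ominus>\<^bsub>K\<^esub> \<one>\<^bsub>K\<^esub>" f] that hm[OF B] by (simp add: M.smult_l_minus)
  qed (use B hm zero add smult in auto)
qed (use out Cmp in auto)

lemma sieve_of_sieveI:
  assumes A: "A \<in> Ob a"
    and "\<And>B. B \<in> Ob a \<Longrightarrow> P B \<zero>\<^bsub>Hm a B A\<^esub>"
    and "\<And>B f g. B \<in> Ob a \<Longrightarrow> f \<in> hm B A \<Longrightarrow> g \<in> hm B A \<Longrightarrow> P B f \<Longrightarrow> P B g \<Longrightarrow> P B (f \<oplus>\<^bsub>Hm a B A\<^esub> g)"
    and "\<And>B C f g. B \<in> Ob a \<Longrightarrow> C \<in> Ob a \<Longrightarrow> f \<in> hm B A \<Longrightarrow> P B f \<Longrightarrow> g \<in> hm C B \<Longrightarrow> P C (Cmp a C B A f g)"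
  shows "sieve K a A (sieve_of A P)"
  by (rule sieveI[OF A]) (use assms in \<open>auto simp: sieve_of_def\<close>)

lemma pull_sieve_sieve_of: "pull_sieve a B A f R = sieve_of B (\<lambda>C g. Cmp a C B A f g \<in> R C)"
  by (auto simp: pull_sieve_def sieve_of_def)

lemma sieve_pull:
  assumes R: "sieve K a A R" and A: "A \<in> Ob a" "B \<in> Ob a" "f \<in> hm B A"
  shows "sieve K a B (pull_sieve a B A f R)"
  unfolding pull_sieve_sieve_of
proof (rule sieve_of_sieveI[OF A(2)])
  show "Cmp a C B A f \<zero>\<^bsub>Hm a C B\<^esub> \<in> R C" if "C \<in> Ob a" for C
  proof -
    have "Cmp a C B A f \<zero>\<^bsub>Hm a C B\<^esub> = \<zero>\<^bsub>Hm a C A\<^esub>"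
      using act_zero_neg_left(1)[OF psh_yoneda[OF A(1)] A(2) that, of f] A by simp
    then show ?thesis using sieve_zero[OF R A(1) that] by simp
  qed
next
  fix C g h assume "C \<in> Ob a" "g \<in> hm C B" "h \<in> hm C B" "Cmp a C B A f g \<in> R C" "Cmp a C B A f h \<in> R C"
  then show "Cmp a C B A f (g \<oplus>\<^bsub>Hm a C B\<^esub> h) \<in> R C"
    using sieve_add[OF R A(1)] A by (simp add: Cmp_add_right)
next
  fix C D g h assume C: "C \<in> Ob a" "D \<in> Ob a" "g \<in> hm C B" "Cmp a C B A f g \<in> R C" "h \<in> hm D C"
  then show "Cmp a D B A f (Cmp a D C B g h) \<in> R D"
    using sieve_Cmp[OF R C(4,2,5)] A by (simp add: Cmp_assoc)
qed

end

section \<open>Local truth\<close>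

locale site = lin_cat K a for K :: "'k ring" and a :: "('o, 'v, 'k) lincat" +
  fixes T :: "'o \<Rightarrow> ('o \<Rightarrow> 'v set) set"
  assumes top: "topology K a T"
begin

lemma T_Ob: "R \<in> T A \<Longrightarrow> A \<in> Ob a"
  using top unfolding topology_def by blast

lemma T_sieve: "R \<in> T A \<Longrightarrow> sieve K a A R"
  using top T_Ob unfolding topology_def by blast

lemma T_max: "A \<in> Ob a \<Longrightarrow> max_sieve a A \<in> T A"
  using top unfolding topology_def by blast

lemma T_pull: "R \<in> T A \<Longrightarrow> B \<in> Ob a \<Longrightarrow> f \<in> hm B A \<Longrightarrow> pull_sieve a B A f R \<in> T B"
  using top T_Ob unfolding topology_def by blast

lemma T_local:
  assumes "sieve K a A S" "R \<in> T A" "\<And>B f. B \<in> Ob a \<Longrightarrow> f \<in> R B \<Longrightarrow> pull_sieve a B A f S \<in> T B"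
  shows "S \<in> T A"
  using top assms T_Ob[OF assms(2)] unfolding topology_def by blast

lemma T_hm: "R \<in> T A \<Longrightarrow> f \<in> R B \<Longrightarrow> f \<in> hm B A"
  using T_sieve T_Ob sieve_hm by blast

text \<open>Along a member of R, which is also a member of S, the pullback of S is the maximal
  sieve, so (T3) applies.\<close>

lemma T_mono:
  assumes S: "sieve K a A S" and R: "R \<in> T A" and sub: "\<And>B f. B \<in> Ob a \<Longrightarrow> f \<in> R B \<Longrightarrow> f \<in> S B"
  shows "S \<in> T A"
proof (rule T_local[OF S R])
  fix B f assume B: "B \<in> Ob a" "f \<in> R B"
  then have "f \<in> S B" using sub by blast
  then have "pull_sieve a B A f S = max_sieve a B"
    using sieve_Cmp[OF S] B by (auto simp: pull_sieve_def max_sieve_def fun_eq_iff)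
  then show "pull_sieve a B A f S \<in> T B" using T_max B by simp
qed

text \<open>A quantifier over covering sieves. The predicate is arbitrary, so the morphisms that
  satisfy it may fail to form a sieve; results for which this matters assume it explicitly.\<close>

definition locally :: "'o \<Rightarrow> ('o \<Rightarrow> 'v \<Rightarrow> bool) \<Rightarrow> bool" where
  "locally A P \<longleftrightarrow> (\<exists>R\<in>T A. \<forall>B\<in>Ob a. \<forall>f\<in>R B. P B f)"

lemma locallyI: "R \<in> T A \<Longrightarrow> (\<And>B f. B \<in> Ob a \<Longrightarrow> f \<in> R B \<Longrightarrow> P B f) \<Longrightarrow> locally A P"
  unfolding locally_def by blast

lemma locally_all: "A \<in> Ob a \<Longrightarrow> (\<And>B f. B \<in> Ob a \<Longrightarrow> f \<in> hm B A \<Longrightarrow> P B f) \<Longrightarrow> locally A P"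
  unfolding locally_def by (rule bexI[OF _ T_max]) (auto simp: max_sieve_def)

lemma locally_mono:
  "locally A P \<Longrightarrow> (\<And>B f. B \<in> Ob a \<Longrightarrow> f \<in> hm B A \<Longrightarrow> P B f \<Longrightarrow> Q B f) \<Longrightarrow> locally A Q"
  unfolding locally_def by (meson T_hm)

lemma locally_pull:
  assumes "locally A P" "B \<in> Ob a" "f \<in> hm B A"
  shows "locally B (\<lambda>C g. P C (Cmp a C B A f g))"
proof -
  obtain R where R: "R \<in> T A" "\<And>B f. B \<in> Ob a \<Longrightarrow> f \<in> R B \<Longrightarrow> P B f"
    using assms(1) unfolding locally_def by blast
  show ?thesis
    by (rule locallyI[OF T_pull[OF R(1) assms(2,3)]]) (use R(2) in \<open>auto simp: pull_sieve_def\<close>)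
qed

lemma locally_sieve_of:
  assumes "sieve K a A (sieve_of A P)" shows "locally A P \<longleftrightarrow> sieve_of A P \<in> T A"
proof
  assume "locally A P"
  then obtain R where R: "R \<in> T A" "\<And>B f. B \<in> Ob a \<Longrightarrow> f \<in> R B \<Longrightarrow> P B f"
    unfolding locally_def by blast
  show "sieve_of A P \<in> T A" by (rule T_mono[OF assms R(1)]) (use R T_hm[OF R(1)] in auto)
next
  assume "sieve_of A P \<in> T A"
  then show "locally A P" by (rule locallyI) auto
qed

text \<open>Along a member of R the intersection pulls back to the pullback of S alone, which is
  covering by (T2); (T3) concludes.\<close>

lemma T_Int:
  assumes R: "R \<in> T A" and S: "S \<in> T A"
  shows "sieve_of A (\<lambda>B f. f \<in> R B \<and> f \<in> S B) \<in> T A"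
proof -
  note A = T_Ob[OF R] and R' = T_sieve[OF R] and S' = T_sieve[OF S]
  have sv: "sieve K a A (sieve_of A (\<lambda>B f. f \<in> R B \<and> f \<in> S B))"
    by (rule sieve_of_sieveI) (use A R' S' sieve_zero sieve_add sieve_Cmp in auto)
  show ?thesis
  proof (rule T_local[OF sv R])
    fix B f assume B: "B \<in> Ob a" "f \<in> R B"
    then have f: "f \<in> hm B A" using R T_hm by blast
    have "pull_sieve a B A f (sieve_of A (\<lambda>B f. f \<in> R B \<and> f \<in> S B)) = pull_sieve a B A f S"
      using B f A sieve_Cmp[OF R'] by (auto simp: pull_sieve_def fun_eq_iff)
    then show "pull_sieve a B A f (sieve_of A (\<lambda>B f. f \<in> R B \<and> f \<in> S B)) \<in> T B"
      using T_pull[OF S] B f by simp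
  qed
qed

lemma locally_conj:
  assumes "locally A P" "locally A Q" shows "locally A (\<lambda>B f. P B f \<and> Q B f)"
proof -
  obtain R S where RS: "R \<in> T A" "S \<in> T A" "\<And>B f. B \<in> Ob a \<Longrightarrow> f \<in> R B \<Longrightarrow> P B f"
    "\<And>B f. B \<in> Ob a \<Longrightarrow> f \<in> S B \<Longrightarrow> Q B f"
    using assms unfolding locally_def by blast
  show ?thesis by (rule locallyI[OF T_Int[OF RS(1,2)]]) (use RS in auto)
qed

text \<open>The covers of the individual sources assemble to a covering sieve on A only after sums
  and composites have been added. The property has to survive this, which is the sieve assumption;
  the rest is (T3).\<close>

lemma locally_trans:
  assumes P: "sieve K a A (sieve_of A P)"
    and loc: "locally A (\<lambda>B f. locally B (\<lambda>C g. P C (Cmp a C B A f g)))"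
  shows "locally A P"
proof -
  obtain R where R: "R \<in> T A"
    "\<And>B f. B \<in> Ob a \<Longrightarrow> f \<in> R B \<Longrightarrow> locally B (\<lambda>C g. P C (Cmp a C B A f g))"
    using loc unfolding locally_def[of A] by blast
  have "sieve_of A P \<in> T A"
  proof (rule T_local[OF P R(1)])
    fix B f assume B: "B \<in> Ob a" "f \<in> R B"
    then have f: "f \<in> hm B A" using R T_hm by blast
    from R(2)[OF B] obtain S where S: "S \<in> T B" "\<And>C g. C \<in> Ob a \<Longrightarrow> g \<in> S C \<Longrightarrow> P C (Cmp a C B A f g)"
      unfolding locally_def by blast
    show "pull_sieve a B A f (sieve_of A P) \<in> T B"
      by (rule T_mono[OF sieve_pull[OF P _ _ f] S(1)])
        (use S B f R T_Ob T_hm[OF S(1)] in \<open>auto simp: pull_sieve_def\<close>)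
  qed
  then show ?thesis using locally_sieve_of[OF P] by simp
qed

end

section \<open>The sheaf associated with a quotient presheaf\<close>

context site
begin

definition sheaf_elt :: "('o, 'v, ('k, 'w) module, 'w \<Rightarrow> 'w) linfun \<Rightarrow> bool" where
  "sheaf_elt F \<longleftrightarrow> (\<forall>A\<in>Ob a. \<forall>R\<in>T A. \<forall>\<sigma>. lin_nat (sieve_presheaf a A R) F \<sigma> \<longrightarrow>
     (\<exists>!x. x \<in> carrier (FOb F A) \<and> (\<forall>B\<in>Ob a. \<forall>f\<in>R B. FAr F A B f x = \<sigma> B f)))"

text \<open>The fourth clause is closedness for the topology: it says that the quotient of F by N is
  separated, and it is what makes N the exact kernel of the map into the associated sheaf. Negatives
  and scalar multiples come from restriction along multiples of identities.\<close>

definition closed_sub :: "('o, 'v, ('k, 'w) module, 'w \<Rightarrow> 'w) linfun \<Rightarrow> ('o \<Rightarrow> 'w set) \<Rightarrow> bool" where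
  "closed_sub F N \<longleftrightarrow>
    (\<forall>A\<in>Ob a. N A \<subseteq> carrier (FOb F A)) \<and>
    (\<forall>A\<in>Ob a. \<forall>x\<in>N A. \<forall>y\<in>N A. x \<oplus>\<^bsub>FOb F A\<^esub> y \<in> N A) \<and>
    (\<forall>A\<in>Ob a. \<forall>B\<in>Ob a. \<forall>f\<in>hm B A. \<forall>x\<in>N A. FAr F A B f x \<in> N B) \<and>
    (\<forall>A\<in>Ob a. \<forall>x\<in>carrier (FOb F A). locally A (\<lambda>B f. FAr F A B f x \<in> N B) \<longrightarrow> x \<in> N A) \<and>
    (\<forall>A\<in>Ob a. \<zero>\<^bsub>FOb F A\<^esub> \<in> N A)"

definition locsurj :: "('o, 'v, ('k, 'w) module, 'w \<Rightarrow> 'w) linfun \<Rightarrow>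
    ('o, 'v, ('k, 'u) module, 'u \<Rightarrow> 'u) linfun \<Rightarrow> ('o \<Rightarrow> 'w \<Rightarrow> 'u) \<Rightarrow> bool" where
  "locsurj F G \<phi> \<longleftrightarrow> (\<forall>A\<in>Ob a. \<forall>y\<in>carrier (FOb G A).
     locally A (\<lambda>B f. \<exists>x\<in>carrier (FOb F B). \<phi> B x = FAr G A B f y))"

end

locale quot = site K a T for K :: "'k ring" and a :: "('o, 'v, 'k) lincat" and T +
  fixes F :: "('o, 'v, ('k, 'w) module, 'w \<Rightarrow> 'w) linfun" and N :: "'o \<Rightarrow> 'w set"
  assumes F: "psh F" and N: "closed_sub F N"
begin

abbreviation M :: "'o \<Rightarrow> 'w set" where "M A \<equiv> carrier (FOb F A)"

lemma N_in: "A \<in> Ob a \<Longrightarrow> x \<in> N A \<Longrightarrow> x \<in> M A"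
  using N unfolding closed_sub_def by blast

lemma N_add: "A \<in> Ob a \<Longrightarrow> x \<in> N A \<Longrightarrow> y \<in> N A \<Longrightarrow> x \<oplus>\<^bsub>FOb F A\<^esub> y \<in> N A"
  using N unfolding closed_sub_def by blast

lemma N_act: "A \<in> Ob a \<Longrightarrow> B \<in> Ob a \<Longrightarrow> f \<in> hm B A \<Longrightarrow> x \<in> N A \<Longrightarrow> FAr F A B f x \<in> N B"
  using N unfolding closed_sub_def by blast

lemma N_local: "A \<in> Ob a \<Longrightarrow> x \<in> M A \<Longrightarrow> locally A (\<lambda>B f. FAr F A B f x \<in> N B) \<Longrightarrow> x \<in> N A"
  using N unfolding closed_sub_def by blast

lemma N_zero: "A \<in> Ob a \<Longrightarrow> \<zero>\<^bsub>FOb F A\<^esub> \<in> N A"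
  using N unfolding closed_sub_def by blast

lemma N_smult:
  assumes "A \<in> Ob a" "r \<in> carrier K" "x \<in> N A"
  shows "r \<odot>\<^bsub>FOb F A\<^esub> x \<in> N A"
  using N_act[OF assms(1,1) _ assms(3), of "r \<odot>\<^bsub>Hm a A A\<^esub> Idt a A"] assms F N_in by (simp add: act_scalar)

lemma N_neg:
  assumes "A \<in> Ob a" "x \<in> N A"
  shows "\<ominus>\<^bsub>FOb F A\<^esub> x \<in> N A"
proof -
  interpret M: module K "FOb F A" by (rule psh_mod[OF F assms(1)])
  show ?thesis using N_smult[of A "\<ominus>\<^bsub>K\<^esub> \<one>\<^bsub>K\<^esub>" x] assms N_in by (simp add: M.smult_l_minus)
qed

text \<open>Equality in the quotient presheaf F/N. This quotient is never formed; every statement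
  about it is phrased with representatives.\<close>

definition eqv :: "'o \<Rightarrow> 'w \<Rightarrow> 'w \<Rightarrow> bool" where
  "eqv A x y \<longleftrightarrow> x \<in> M A \<and> y \<in> M A \<and> x \<ominus>\<^bsub>FOb F A\<^esub> y \<in> N A"

lemma eqv_in: "eqv A x y \<Longrightarrow> x \<in> M A" "eqv A x y \<Longrightarrow> y \<in> M A"
  unfolding eqv_def by auto

lemma eqv_refl: "A \<in> Ob a \<Longrightarrow> x \<in> M A \<Longrightarrow> eqv A x x"
  using N_zero F by (simp add: eqv_def psh_minus_eq_zero[OF F, THEN iffD2])

lemma eqv_sym:
  assumes A: "A \<in> Ob a" and "eqv A x y" shows "eqv A y x"
proof -
  interpret M: abelian_group "FOb F A" by (rule psh_grp[OF F A])
  have "\<ominus>\<^bsub>FOb F A\<^esub> (x \<ominus>\<^bsub>FOb F A\<^esub> y) = y \<ominus>\<^bsub>FOb F A\<^esub> x"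
    using assms by (simp add: eqv_def a_minus_def M.minus_add M.a_comm)
  then show ?thesis using assms N_neg[OF A, of "x \<ominus>\<^bsub>FOb F A\<^esub> y"] by (simp add: eqv_def)
qed

lemma eqv_add:
  assumes A: "A \<in> Ob a" and "eqv A x y" "eqv A x' y'"
  shows "eqv A (x \<oplus>\<^bsub>FOb F A\<^esub> x') (y \<oplus>\<^bsub>FOb F A\<^esub> y')"
proof -
  interpret M: abelian_group "FOb F A" by (rule psh_grp[OF F A])
  have "(x \<oplus>\<^bsub>FOb F A\<^esub> x') \<ominus>\<^bsub>FOb F A\<^esub> (y \<oplus>\<^bsub>FOb F A\<^esub> y') = (x \<ominus>\<^bsub>FOb F A\<^esub> y) \<oplus>\<^bsub>FOb F A\<^esub> (x' \<ominus>\<^bsub>FOb F A\<^esub> y')"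
    using assms by (simp add: eqv_def a_minus_def M.minus_add M.a_ac)
  then show ?thesis using assms N_add[OF A] by (simp add: eqv_def)
qed

lemma eqv_trans:
  assumes A: "A \<in> Ob a" and "eqv A x y" "eqv A y z" shows "eqv A x z"
proof -
  interpret M: abelian_group "FOb F A" by (rule psh_grp[OF F A])
  have "(x \<ominus>\<^bsub>FOb F A\<^esub> y) \<oplus>\<^bsub>FOb F A\<^esub> (y \<ominus>\<^bsub>FOb F A\<^esub> z) = x \<ominus>\<^bsub>FOb F A\<^esub> z"
    using assms by (simp add: eqv_def a_minus_def M.a_assoc M.r_neg1)
  then show ?thesis using assms N_add[OF A, of "x \<ominus>\<^bsub>FOb F A\<^esub> y" "y \<ominus>\<^bsub>FOb F A\<^esub> z"] by (simp add: eqv_def)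
qed

lemma eqv_act:
  assumes "A \<in> Ob a" "B \<in> Ob a" "f \<in> hm B A" "eqv A x y"
  shows "eqv B (FAr F A B f x) (FAr F A B f y)"
  using assms F N_act[OF assms(1-3), of "x \<ominus>\<^bsub>FOb F A\<^esub> y"] by (simp add: eqv_def act_zero_neg(3))

lemma eqv_smult:
  assumes "A \<in> Ob a" "r \<in> carrier K" "eqv A x y"
  shows "eqv A (r \<odot>\<^bsub>FOb F A\<^esub> x) (r \<odot>\<^bsub>FOb F A\<^esub> y)"
  using eqv_act[OF assms(1,1) _ assms(3), of "r \<odot>\<^bsub>Hm a A A\<^esub> Idt a A"] assms F
  by (simp add: act_scalar eqv_in[OF assms(3)])

text \<open>Separatedness of F/N, the only place where closedness of N is used.\<close>

lemma eqv_local: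
  assumes "A \<in> Ob a" "x \<in> M A" "y \<in> M A" "locally A (\<lambda>B f. eqv B (FAr F A B f x) (FAr F A B f y))"
  shows "eqv A x y"
proof -
  have "locally A (\<lambda>B f. FAr F A B f (x \<ominus>\<^bsub>FOb F A\<^esub> y) \<in> N B)"
    by (rule locally_mono[OF assms(4)]) (use assms(1-3) F in \<open>auto simp: eqv_def act_zero_neg(3)\<close>)
  then show ?thesis using assms F by (simp add: eqv_def N_local)
qed

text \<open>A section of the associated sheaf over \<open>A\<close> is encoded by its graph: the set of all pairs
  \<open>(f, x)\<close> such that its restriction along \<open>f\<close> is the class of \<open>x\<close>.
  Working with the largest graph replaces the colimit over covering sieves.\<close>

definition psec :: "'o \<Rightarrow> ('o \<Rightarrow> ('v \<times> 'w) set) \<Rightarrow> bool" where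
  "psec A \<Gamma> \<longleftrightarrow> A \<in> Ob a \<and>
     (\<forall>B f x. (f, x) \<in> \<Gamma> B \<longrightarrow> B \<in> Ob a \<and> f \<in> hm B A \<and> x \<in> M B) \<and>
     (\<forall>B f x g y. (f, x) \<in> \<Gamma> B \<longrightarrow> (g, y) \<in> \<Gamma> B \<longrightarrow> (f \<oplus>\<^bsub>Hm a B A\<^esub> g, x \<oplus>\<^bsub>FOb F B\<^esub> y) \<in> \<Gamma> B) \<and>
     (\<forall>B C f x g. (f, x) \<in> \<Gamma> B \<longrightarrow> C \<in> Ob a \<longrightarrow> g \<in> hm C B \<longrightarrow> (Cmp a C B A f g, FAr F B C g x) \<in> \<Gamma> C) \<and>
     (\<forall>B f x y. (f, x) \<in> \<Gamma> B \<longrightarrow> (f, y) \<in> \<Gamma> B \<longrightarrow> eqv B x y) \<and>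
     locally A (\<lambda>B f. \<exists>x. (f, x) \<in> \<Gamma> B)"

definition close :: "'o \<Rightarrow> ('o \<Rightarrow> ('v \<times> 'w) set) \<Rightarrow> 'o \<Rightarrow> ('v \<times> 'w) set" where
  "close A \<Gamma> B = {(f, x). B \<in> Ob a \<and> f \<in> hm B A \<and> x \<in> M B \<and>
     locally B (\<lambda>C g. \<exists>y. (Cmp a C B A f g, y) \<in> \<Gamma> C \<and> eqv C (FAr F B C g x) y)}"

definition sec :: "'o \<Rightarrow> ('o \<Rightarrow> ('v \<times> 'w) set) \<Rightarrow> bool" where
  "sec A \<Gamma> \<longleftrightarrow> psec A \<Gamma> \<and> (\<forall>B. close A \<Gamma> B \<subseteq> \<Gamma> B)"

lemma psecI:
  assumes "A \<in> Ob a" "\<And>B f x. (f, x) \<in> \<Gamma> B \<Longrightarrow> B \<in> Ob a \<and> f \<in> hm B A \<and> x \<in> M B"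
    and "\<And>B f x g y. (f, x) \<in> \<Gamma> B \<Longrightarrow> (g, y) \<in> \<Gamma> B \<Longrightarrow> (f \<oplus>\<^bsub>Hm a B A\<^esub> g, x \<oplus>\<^bsub>FOb F B\<^esub> y) \<in> \<Gamma> B"
    and "\<And>B C f x g. (f, x) \<in> \<Gamma> B \<Longrightarrow> C \<in> Ob a \<Longrightarrow> g \<in> hm C B \<Longrightarrow> (Cmp a C B A f g, FAr F B C g x) \<in> \<Gamma> C"
    and "\<And>B f x y. (f, x) \<in> \<Gamma> B \<Longrightarrow> (f, y) \<in> \<Gamma> B \<Longrightarrow> eqv B x y"
    and "locally A (\<lambda>B f. \<exists>x. (f, x) \<in> \<Gamma> B)"
  shows "psec A \<Gamma>"
  unfolding psec_def using assms by blast

lemma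
  assumes "psec A \<Gamma>"
  shows psec_Ob: "A \<in> Ob a"
    and psec_in: "(f, x) \<in> \<Gamma> B \<Longrightarrow> B \<in> Ob a \<and> f \<in> hm B A \<and> x \<in> M B"
    and psec_add: "(f, x) \<in> \<Gamma> B \<Longrightarrow> (g, y) \<in> \<Gamma> B \<Longrightarrow> (f \<oplus>\<^bsub>Hm a B A\<^esub> g, x \<oplus>\<^bsub>FOb F B\<^esub> y) \<in> \<Gamma> B"
    and psec_act: "(f, x) \<in> \<Gamma> B \<Longrightarrow> C \<in> Ob a \<Longrightarrow> g \<in> hm C B \<Longrightarrow> (Cmp a C B A f g, FAr F B C g x) \<in> \<Gamma> C"
    and psec_eqv: "(f, x) \<in> \<Gamma> B \<Longrightarrow> (f, y) \<in> \<Gamma> B \<Longrightarrow> eqv B x y"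
    and psec_dom: "locally A (\<lambda>B f. \<exists>x. (f, x) \<in> \<Gamma> B)"
  using assms unfolding psec_def by blast+

lemma psec_smult:
  assumes "psec A \<Gamma>" "(f, x) \<in> \<Gamma> B" "r \<in> carrier K"
  shows "(r \<odot>\<^bsub>Hm a B A\<^esub> f, r \<odot>\<^bsub>FOb F B\<^esub> x) \<in> \<Gamma> B"
proof -
  note B = psec_in[OF assms(1,2)] and A = psec_Ob[OF assms(1)]
  then have "(Cmp a B B A f (r \<odot>\<^bsub>Hm a B B\<^esub> Idt a B), FAr F B B (r \<odot>\<^bsub>Hm a B B\<^esub> Idt a B) x) \<in> \<Gamma> B"
    using assms by (intro psec_act) auto
  then show ?thesis using B A assms F by (simp add: Cmp_smult act_scalar)
qed

text \<open>A covering sieve contains the zero morphism, so the graph has some value there;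
  restricting that pair once more along the zero endomorphism of B makes the value zero.\<close>

lemma psec_zero:
  assumes \<Gamma>: "psec A \<Gamma>" and B: "B \<in> Ob a"
  shows "(\<zero>\<^bsub>Hm a B A\<^esub>, \<zero>\<^bsub>FOb F B\<^esub>) \<in> \<Gamma> B"
proof -
  note A = psec_Ob[OF \<Gamma>]
  obtain R where R: "R \<in> T A" "\<And>B f. B \<in> Ob a \<Longrightarrow> f \<in> R B \<Longrightarrow> \<exists>x. (f, x) \<in> \<Gamma> B"
    using psec_dom[OF \<Gamma>] unfolding locally_def by blast
  obtain x where x: "(\<zero>\<^bsub>Hm a B A\<^esub>, x) \<in> \<Gamma> B"
    using R(2)[OF B sieve_zero[OF T_sieve[OF R(1)] A B]] by blast
  have "(Cmp a B B A \<zero>\<^bsub>Hm a B A\<^esub> \<zero>\<^bsub>Hm a B B\<^esub>, FAr F B B \<zero>\<^bsub>Hm a B B\<^esub> x) \<in> \<Gamma> B"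
    by (rule psec_act[OF \<Gamma> x B]) (use B in simp)
  then show ?thesis
    using act_zero_neg_left(1)[OF F B B, of x] act_zero_neg_left(1)[OF psh_yoneda[OF A] B B, of "\<zero>\<^bsub>Hm a B A\<^esub>"]
      psec_in[OF \<Gamma> x] A B by simp
qed

lemma mem_close: "(f, x) \<in> close A \<Gamma> B \<longleftrightarrow> B \<in> Ob a \<and> f \<in> hm B A \<and> x \<in> M B \<and>
     locally B (\<lambda>C g. \<exists>y. (Cmp a C B A f g, y) \<in> \<Gamma> C \<and> eqv C (FAr F B C g x) y)"
  by (simp add: close_def)

lemma close_sub:
  assumes \<Gamma>: "psec A \<Gamma>" and f: "(f, x) \<in> \<Gamma> B"
  shows "(f, x) \<in> close A \<Gamma> B"
  using psec_in[OF assms] psec_act[OF assms] eqv_refl F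
  by (fastforce simp: mem_close intro!: locally_all)

lemma sec_psec: "sec A \<Gamma> \<Longrightarrow> psec A \<Gamma>"
  unfolding sec_def by blast

lemmas sec_Ob = psec_Ob[OF sec_psec] and sec_in = psec_in[OF sec_psec] and sec_add = psec_add[OF sec_psec]
  and sec_act = psec_act[OF sec_psec] and sec_eqv = psec_eqv[OF sec_psec] and sec_dom = psec_dom[OF sec_psec]

lemma sec_closed:
  assumes "sec A \<Gamma>" "B \<in> Ob a" "f \<in> hm B A" "x \<in> M B"
    "locally B (\<lambda>C g. \<exists>y. (Cmp a C B A f g, y) \<in> \<Gamma> C \<and> eqv C (FAr F B C g x) y)"
  shows "(f, x) \<in> \<Gamma> B"
  using assms mem_close unfolding sec_def by blast

text \<open>Over the cover where both graphs share a value, any pair of \<Gamma> is equivalent to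
  the shared one because \<Gamma> is single-valued modulo N. Since \<Delta> is closed, it absorbs
  the pair; the situation is symmetric.\<close>

lemma sec_eqI:
  assumes \<Gamma>: "sec A \<Gamma>" and \<Delta>: "sec A \<Delta>" and loc: "locally A (\<lambda>B f. \<exists>x. (f, x) \<in> \<Gamma> B \<and> (f, x) \<in> \<Delta> B)"
  shows "\<Gamma> = \<Delta>"
proof -
  have sub: "(f, x) \<in> \<Delta> B" if \<Gamma>: "sec A \<Gamma>" and \<Delta>: "sec A \<Delta>"
    and loc: "locally A (\<lambda>B f. \<exists>x. (f, x) \<in> \<Gamma> B \<and> (f, x) \<in> \<Delta> B)" and f: "(f, x) \<in> \<Gamma> B" for \<Gamma> \<Delta> B f x
  proof (rule sec_closed[OF \<Delta>])
    note B = sec_in[OF \<Gamma> f]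
    then show "B \<in> Ob a" "f \<in> hm B A" "x \<in> M B" by auto
    show "locally B (\<lambda>C g. \<exists>y. (Cmp a C B A f g, y) \<in> \<Delta> C \<and> eqv C (FAr F B C g x) y)"
      using sec_eqv[OF \<Gamma>] sec_act[OF \<Gamma> f]
      by (intro locally_mono[OF locally_pull[OF loc, of B f]]) (use B in blast)+
  qed
  have loc': "locally A (\<lambda>B f. \<exists>x. (f, x) \<in> \<Delta> B \<and> (f, x) \<in> \<Gamma> B)"
    by (rule locally_mono[OF loc]) blast
  show ?thesis
    using sub[OF \<Gamma> \<Delta> loc] sub[OF \<Delta> \<Gamma> loc'] by (fastforce simp: fun_eq_iff)
qed

lemma sec_close:
  assumes \<Gamma>: "psec A \<Gamma>"
  shows "sec A (close A \<Gamma>)"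
proof -
  note A = psec_Ob[OF \<Gamma>]
  have "psec A (close A \<Gamma>)"
  proof (rule psecI[OF A])
    fix B f x g y assume f: "(f, x) \<in> close A \<Gamma> B" and g: "(g, y) \<in> close A \<Gamma> B"
    then have B: "B \<in> Ob a" "f \<in> hm B A" "x \<in> M B" "g \<in> hm B A" "y \<in> M B" by (auto simp: mem_close)
    have loc: "locally B (\<lambda>C h. (\<exists>x'. (Cmp a C B A f h, x') \<in> \<Gamma> C \<and> eqv C (FAr F B C h x) x') \<and>
        (\<exists>y'. (Cmp a C B A g h, y') \<in> \<Gamma> C \<and> eqv C (FAr F B C h y) y'))"
      using f g by (intro locally_conj) (auto simp: mem_close)
    have "locally B (\<lambda>C h. \<exists>z. (Cmp a C B A (f \<oplus>\<^bsub>Hm a B A\<^esub> g) h, z) \<in> \<Gamma> C \<and>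
        eqv C (FAr F B C h (x \<oplus>\<^bsub>FOb F B\<^esub> y)) z)"
    proof (rule locally_mono[OF loc])
      fix C h assume C: "C \<in> Ob a" "h \<in> hm C B"
        and "(\<exists>x'. (Cmp a C B A f h, x') \<in> \<Gamma> C \<and> eqv C (FAr F B C h x) x') \<and>
          (\<exists>y'. (Cmp a C B A g h, y') \<in> \<Gamma> C \<and> eqv C (FAr F B C h y) y')"
      then obtain x' y' where "(Cmp a C B A f h, x') \<in> \<Gamma> C" "eqv C (FAr F B C h x) x'"
        "(Cmp a C B A g h, y') \<in> \<Gamma> C" "eqv C (FAr F B C h y) y'" by blast
      then show "\<exists>z. (Cmp a C B A (f \<oplus>\<^bsub>Hm a B A\<^esub> g) h, z) \<in> \<Gamma> C \<and>
          eqv C (FAr F B C h (x \<oplus>\<^bsub>FOb F B\<^esub> y)) z"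
        using psec_add[OF \<Gamma>] eqv_add A B C F
        by (intro exI[of _ "x' \<oplus>\<^bsub>FOb F C\<^esub> y'"]) (simp add: Cmp_add_left act_add)
    qed
    then show "(f \<oplus>\<^bsub>Hm a B A\<^esub> g, x \<oplus>\<^bsub>FOb F B\<^esub> y) \<in> close A \<Gamma> B"
      using A B F by (simp add: mem_close)
  next
    fix B C f x g assume f: "(f, x) \<in> close A \<Gamma> B" and C: "C \<in> Ob a" "g \<in> hm C B"
    then have B: "B \<in> Ob a" "f \<in> hm B A" "x \<in> M B"
      and loc: "locally B (\<lambda>C g. \<exists>y. (Cmp a C B A f g, y) \<in> \<Gamma> C \<and> eqv C (FAr F B C g x) y)"
      by (auto simp: mem_close)
    have "locally C (\<lambda>D h. \<exists>y. (Cmp a D C A (Cmp a C B A f g) h, y) \<in> \<Gamma> D \<and> eqv D (FAr F C D h (FAr F B C g x)) y)"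
      by (rule locally_mono[OF locally_pull[OF loc C]]) (use A B C F in \<open>simp add: Cmp_assoc act_Cmp\<close>)
    then show "(Cmp a C B A f g, FAr F B C g x) \<in> close A \<Gamma> C"
      using A B C F by (simp add: mem_close)
  next
    fix B f x y assume f: "(f, x) \<in> close A \<Gamma> B" "(f, y) \<in> close A \<Gamma> B"
    then have B: "B \<in> Ob a" "f \<in> hm B A" "x \<in> M B" "y \<in> M B"
      and loc: "locally B (\<lambda>C g. (\<exists>y. (Cmp a C B A f g, y) \<in> \<Gamma> C \<and> eqv C (FAr F B C g x) y) \<and>
         (\<exists>z. (Cmp a C B A f g, z) \<in> \<Gamma> C \<and> eqv C (FAr F B C g y) z))"
      by (auto simp: mem_close intro!: locally_conj)
    show "eqv B x y"
    proof (rule eqv_local[OF B(1,3,4) locally_mono[OF loc]])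
      fix C g assume C: "C \<in> Ob a" "g \<in> hm C B" and
        "(\<exists>y. (Cmp a C B A f g, y) \<in> \<Gamma> C \<and> eqv C (FAr F B C g x) y) \<and>
         (\<exists>z. (Cmp a C B A f g, z) \<in> \<Gamma> C \<and> eqv C (FAr F B C g y) z)"
      then obtain x' y' where 1: "(Cmp a C B A f g, x') \<in> \<Gamma> C" "eqv C (FAr F B C g x) x'"
         "(Cmp a C B A f g, y') \<in> \<Gamma> C" "eqv C (FAr F B C g y) y'" by blast
      show "eqv C (FAr F B C g x) (FAr F B C g y)"
        using eqv_trans[OF C(1) 1(2) eqv_trans[OF C(1) psec_eqv[OF \<Gamma> 1(1,3)] eqv_sym[OF C(1) 1(4)]]] .
    qed
  next
    show "locally A (\<lambda>B f. \<exists>x. (f, x) \<in> close A \<Gamma> B)"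
      by (rule locally_mono[OF psec_dom[OF \<Gamma>]]) (use close_sub[OF \<Gamma>] in blast)
  qed (auto simp: mem_close)
  \<comment> \<open>Closing twice adds nothing: the two layers of covers merge by transitivity of
    local truth, for which the morphisms along which the pair lies in \<Gamma> modulo N must form a
    sieve.\<close>
  moreover have "(f, x) \<in> close A \<Gamma> B" if f: "(f, x) \<in> close A (close A \<Gamma>) B" for f x B
  proof -
    have B: "B \<in> Ob a" "f \<in> hm B A" "x \<in> M B"
      and loc: "locally B (\<lambda>C g. \<exists>y. (Cmp a C B A f g, y) \<in> close A \<Gamma> C \<and> eqv C (FAr F B C g x) y)"
      using f mem_close by auto
    let ?P = "\<lambda>C g. \<exists>y. (Cmp a C B A f g, y) \<in> \<Gamma> C \<and> eqv C (FAr F B C g x) y"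
    have sv: "sieve K a B (sieve_of B ?P)"
    proof (rule sieve_of_sieveI[OF B(1)])
      fix C assume C: "C \<in> Ob a"
      show "?P C \<zero>\<^bsub>Hm a C B\<^esub>"
        using psec_zero[OF \<Gamma> C] act_zero_neg_left(1)[OF F B(1) C B(3)] A B F C eqv_refl[OF C, of "\<zero>\<^bsub>FOb F C\<^esub>"]
          act_zero_neg_left(1)[OF psh_yoneda[OF A] B(1) C, of f] act_zero_neg(1)[OF psh_yoneda[OF A] B(1) C]
          act_zero_neg_left(1)[OF psh_yoneda[OF A] B(1) C, of f]
        by (intro exI[of _ "\<zero>\<^bsub>FOb F C\<^esub>"]) simp
    next
      fix C g h assume C: "C \<in> Ob a" "g \<in> hm C B" "h \<in> hm C B" and "?P C g" "?P C h"
      then obtain y z where "(Cmp a C B A f g, y) \<in> \<Gamma> C" "eqv C (FAr F B C g x) y"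
        "(Cmp a C B A f h, z) \<in> \<Gamma> C" "eqv C (FAr F B C h x) z" by blast
      then show "?P C (g \<oplus>\<^bsub>Hm a C B\<^esub> h)"
        using psec_add[OF \<Gamma>] eqv_add A B C F
        by (intro exI[of _ "y \<oplus>\<^bsub>FOb F C\<^esub> z"]) (simp add: Cmp_add_right act_add_left)
    next
      fix C D g h assume C: "C \<in> Ob a" "D \<in> Ob a" "g \<in> hm C B" "?P C g" "h \<in> hm D C"
      then obtain y where "(Cmp a C B A f g, y) \<in> \<Gamma> C" "eqv C (FAr F B C g x) y" by blast
      then show "?P D (Cmp a D C B g h)"
        using psec_act[OF \<Gamma>, of "Cmp a C B A f g" y C D h] eqv_act[of C D h "FAr F B C g x" y] A B C F
        by (intro exI[of _ "FAr F C D h y"]) (simp add: Cmp_assoc act_Cmp)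
    qed
    have "locally B ?P"
    proof (rule locally_trans[OF sv locally_mono[OF loc]])
      fix C g assume C: "C \<in> Ob a" "g \<in> hm C B"
        and "\<exists>y. (Cmp a C B A f g, y) \<in> close A \<Gamma> C \<and> eqv C (FAr F B C g x) y"
      then obtain y where y: "locally C (\<lambda>D h. \<exists>z. (Cmp a D C A (Cmp a C B A f g) h, z) \<in> \<Gamma> D \<and> eqv D (FAr F C D h y) z)"
        "eqv C (FAr F B C g x) y" by (auto simp: mem_close)
      show "locally C (\<lambda>D h. ?P D (Cmp a D C B g h))"
      proof (rule locally_mono[OF y(1)])
        fix D h assume D: "D \<in> Ob a" "h \<in> hm D C"
          and "\<exists>z. (Cmp a D C A (Cmp a C B A f g) h, z) \<in> \<Gamma> D \<and> eqv D (FAr F C D h y) z"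
        then obtain z where z: "(Cmp a D C A (Cmp a C B A f g) h, z) \<in> \<Gamma> D" "eqv D (FAr F C D h y) z" by blast
        show "?P D (Cmp a D C B g h)"
          using z eqv_trans[OF D(1) eqv_act[OF C(1) D y(2)] z(2)] A B C D F
          by (intro exI[of _ z]) (simp add: Cmp_assoc act_Cmp)
      qed
    qed
    then show ?thesis using B by (simp add: mem_close)
  qed
  ultimately show ?thesis unfolding sec_def by auto
qed

section \<open>Operations on sections\<close>

definition sec_add_op :: "'o \<Rightarrow> ('o \<Rightarrow> ('v \<times> 'w) set) \<Rightarrow> ('o \<Rightarrow> ('v \<times> 'w) set) \<Rightarrow> 'o \<Rightarrow> ('v \<times> 'w) set" where
  "sec_add_op A \<Gamma> \<Delta> = close A (\<lambda>B. {(f, x \<oplus>\<^bsub>FOb F B\<^esub> y) |f x y. (f, x) \<in> \<Gamma> B \<and> (f, y) \<in> \<Delta> B})"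

definition sec_smult_op :: "'o \<Rightarrow> 'k \<Rightarrow> ('o \<Rightarrow> ('v \<times> 'w) set) \<Rightarrow> 'o \<Rightarrow> ('v \<times> 'w) set" where
  "sec_smult_op A r \<Gamma> = close A (\<lambda>B. {(f, r \<odot>\<^bsub>FOb F B\<^esub> x) |f x. (f, x) \<in> \<Gamma> B})"

definition sec_of :: "'o \<Rightarrow> 'w \<Rightarrow> 'o \<Rightarrow> ('v \<times> 'w) set" where
  "sec_of A x = close A (\<lambda>B. {(f, FAr F A B f x) |f. B \<in> Ob a \<and> f \<in> hm B A})"

text \<open>No closing is applied here: in contrast to sums and scalar multiples, the reindexed
  graph is closed as it stands, by associativity of composition.\<close>

definition sec_act_op :: "'o \<Rightarrow> 'o \<Rightarrow> 'v \<Rightarrow> ('o \<Rightarrow> ('v \<times> 'w) set) \<Rightarrow> 'o \<Rightarrow> ('v \<times> 'w) set" where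
  "sec_act_op A B f \<Gamma> = (\<lambda>C. {(g, x). g \<in> hm C B \<and> (Cmp a C B A f g, x) \<in> \<Gamma> C})"

lemma sec_add_op:
  assumes \<Gamma>: "sec A \<Gamma>" and \<Delta>: "sec A \<Delta>"
  shows "sec A (sec_add_op A \<Gamma> \<Delta>)"
    and "(f, x) \<in> \<Gamma> B \<Longrightarrow> (f, y) \<in> \<Delta> B \<Longrightarrow> (f, x \<oplus>\<^bsub>FOb F B\<^esub> y) \<in> sec_add_op A \<Gamma> \<Delta> B"
proof -
  note A = sec_Ob[OF \<Gamma>]
  have p: "psec A (\<lambda>B. {(f, x \<oplus>\<^bsub>FOb F B\<^esub> y) |f x y. (f, x) \<in> \<Gamma> B \<and> (f, y) \<in> \<Delta> B})" (is "psec A ?D")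
  proof (rule psecI[OF A])
    fix B f x assume "(f, x) \<in> ?D B"
    then show "B \<in> Ob a \<and> f \<in> hm B A \<and> x \<in> M B"
      using sec_in[OF \<Gamma>, of f _ B] sec_in[OF \<Delta>, of f _ B] F by auto
  next
    fix B f x g y assume "(f, x) \<in> ?D B" "(g, y) \<in> ?D B"
    then obtain x1 x2 y1 y2 where xy: "(f, x1) \<in> \<Gamma> B" "(f, x2) \<in> \<Delta> B" "(g, y1) \<in> \<Gamma> B" "(g, y2) \<in> \<Delta> B"
      "x = x1 \<oplus>\<^bsub>FOb F B\<^esub> x2" "y = y1 \<oplus>\<^bsub>FOb F B\<^esub> y2" by auto
    note ins = sec_in[OF \<Gamma> xy(1)] sec_in[OF \<Gamma> xy(3)] sec_in[OF \<Delta> xy(2)] sec_in[OF \<Delta> xy(4)]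
    then interpret B: abelian_group "FOb F B" using psh_grp[OF F] by blast
    have "x \<oplus>\<^bsub>FOb F B\<^esub> y = (x1 \<oplus>\<^bsub>FOb F B\<^esub> y1) \<oplus>\<^bsub>FOb F B\<^esub> (x2 \<oplus>\<^bsub>FOb F B\<^esub> y2)"
      using ins xy(5,6) by (simp add: B.a_ac)
    then show "(f \<oplus>\<^bsub>Hm a B A\<^esub> g, x \<oplus>\<^bsub>FOb F B\<^esub> y) \<in> ?D B"
      using sec_add[OF \<Gamma> xy(1,3)] sec_add[OF \<Delta> xy(2,4)] by blast
  next
    fix B C f x g assume "(f, x) \<in> ?D B" and C: "C \<in> Ob a" "g \<in> hm C B"
    then obtain x1 x2 where x: "(f, x1) \<in> \<Gamma> B" "(f, x2) \<in> \<Delta> B" "x = x1 \<oplus>\<^bsub>FOb F B\<^esub> x2" by auto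
    note ins = sec_in[OF \<Gamma> x(1)] sec_in[OF \<Delta> x(2)]
    have "FAr F B C g x = FAr F B C g x1 \<oplus>\<^bsub>FOb F C\<^esub> FAr F B C g x2"
      using ins C x F by (simp add: act_add)
    then show "(Cmp a C B A f g, FAr F B C g x) \<in> ?D C"
      using sec_act[OF \<Gamma> x(1) C] sec_act[OF \<Delta> x(2) C] by blast
  next
    fix B f x y assume "(f, x) \<in> ?D B" "(f, y) \<in> ?D B"
    then show "eqv B x y" using sec_eqv[OF \<Gamma>] sec_eqv[OF \<Delta>] sec_in[OF \<Gamma>] eqv_add by blast
  next
    show "locally A (\<lambda>B f. \<exists>x. (f, x) \<in> ?D B)"
      by (rule locally_mono[OF locally_conj[OF sec_dom[OF \<Gamma>] sec_dom[OF \<Delta>]]]) auto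
  qed
  show "sec A (sec_add_op A \<Gamma> \<Delta>)" unfolding sec_add_op_def by (rule sec_close[OF p])
  show "(f, x) \<in> \<Gamma> B \<Longrightarrow> (f, y) \<in> \<Delta> B \<Longrightarrow> (f, x \<oplus>\<^bsub>FOb F B\<^esub> y) \<in> sec_add_op A \<Gamma> \<Delta> B"
    unfolding sec_add_op_def by (rule close_sub[OF p]) auto
qed

lemma sec_smult_op:
  assumes \<Gamma>: "sec A \<Gamma>" and r: "r \<in> carrier K"
  shows "sec A (sec_smult_op A r \<Gamma>)"
    and "(f, x) \<in> \<Gamma> B \<Longrightarrow> (f, r \<odot>\<^bsub>FOb F B\<^esub> x) \<in> sec_smult_op A r \<Gamma> B"
proof -
  note A = sec_Ob[OF \<Gamma>]
  have p: "psec A (\<lambda>B. {(f, r \<odot>\<^bsub>FOb F B\<^esub> x) |f x. (f, x) \<in> \<Gamma> B})" (is "psec A ?D")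
  proof (rule psecI[OF A])
    fix B f x assume "(f, x) \<in> ?D B"
    then show "B \<in> Ob a \<and> f \<in> hm B A \<and> x \<in> M B"
      using sec_in[OF \<Gamma>, of f _ B] F r by auto
  next
    fix B f x g y assume "(f, x) \<in> ?D B" "(g, y) \<in> ?D B"
    then obtain x1 y1 where xy: "(f, x1) \<in> \<Gamma> B" "(g, y1) \<in> \<Gamma> B"
      "x = r \<odot>\<^bsub>FOb F B\<^esub> x1" "y = r \<odot>\<^bsub>FOb F B\<^esub> y1" by auto
    note ins = sec_in[OF \<Gamma> xy(1)] sec_in[OF \<Gamma> xy(2)]
    then interpret B: module K "FOb F B" using psh_mod[OF F] by blast
    have "x \<oplus>\<^bsub>FOb F B\<^esub> y = r \<odot>\<^bsub>FOb F B\<^esub> (x1 \<oplus>\<^bsub>FOb F B\<^esub> y1)"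
      using ins xy(3,4) r by (simp add: B.smult_r_distr)
    then show "(f \<oplus>\<^bsub>Hm a B A\<^esub> g, x \<oplus>\<^bsub>FOb F B\<^esub> y) \<in> ?D B"
      using sec_add[OF \<Gamma> xy(1,2)] by blast
  next
    fix B C f x g assume "(f, x) \<in> ?D B" and C: "C \<in> Ob a" "g \<in> hm C B"
    then obtain x1 where x: "(f, x1) \<in> \<Gamma> B" "x = r \<odot>\<^bsub>FOb F B\<^esub> x1" by auto
    have "FAr F B C g x = r \<odot>\<^bsub>FOb F C\<^esub> FAr F B C g x1"
      using sec_in[OF \<Gamma> x(1)] C x F r by (simp add: act_smult)
    then show "(Cmp a C B A f g, FAr F B C g x) \<in> ?D C"
      using sec_act[OF \<Gamma> x(1) C] by blast
  next
    fix B f x y assume "(f, x) \<in> ?D B" "(f, y) \<in> ?D B"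
    then show "eqv B x y" using sec_eqv[OF \<Gamma>] sec_in[OF \<Gamma>] eqv_smult r by blast
  next
    show "locally A (\<lambda>B f. \<exists>x. (f, x) \<in> ?D B)"
      by (rule locally_mono[OF sec_dom[OF \<Gamma>]]) auto
  qed
  show "sec A (sec_smult_op A r \<Gamma>)" unfolding sec_smult_op_def by (rule sec_close[OF p])
  show "(f, x) \<in> \<Gamma> B \<Longrightarrow> (f, r \<odot>\<^bsub>FOb F B\<^esub> x) \<in> sec_smult_op A r \<Gamma> B"
    unfolding sec_smult_op_def by (rule close_sub[OF p]) auto
qed

lemma sec_of:
  assumes A: "A \<in> Ob a" and x: "x \<in> M A"
  shows "sec A (sec_of A x)"
    and "B \<in> Ob a \<Longrightarrow> f \<in> hm B A \<Longrightarrow> (f, FAr F A B f x) \<in> sec_of A x B"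
proof -
  have p: "psec A (\<lambda>B. {(f, FAr F A B f x) |f. B \<in> Ob a \<and> f \<in> hm B A})" (is "psec A ?D")
    by (rule psecI[OF A])
      (use A x F in \<open>auto simp: act_add_left[symmetric] act_Cmp[symmetric] intro: eqv_refl locally_all\<close>)
  show "sec A (sec_of A x)" unfolding sec_of_def by (rule sec_close[OF p])
  show "B \<in> Ob a \<Longrightarrow> f \<in> hm B A \<Longrightarrow> (f, FAr F A B f x) \<in> sec_of A x B"
    unfolding sec_of_def by (rule close_sub[OF p]) auto
qed

lemma mem_sec_act_op [simp]:
  "(g, x) \<in> sec_act_op A B f \<Gamma> C \<longleftrightarrow> g \<in> hm C B \<and> (Cmp a C B A f g, x) \<in> \<Gamma> C"
  by (simp add: sec_act_op_def)

lemma sec_act_op: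
  assumes \<Gamma>: "sec A \<Gamma>" and B: "B \<in> Ob a" "f \<in> hm B A"
  shows "sec B (sec_act_op A B f \<Gamma>)"
proof -
  note A = sec_Ob[OF \<Gamma>]
  have "psec B (sec_act_op A B f \<Gamma>)"
  proof (rule psecI[OF B(1)])
    fix C g x assume "(g, x) \<in> sec_act_op A B f \<Gamma> C"
    then show "C \<in> Ob a \<and> g \<in> hm C B \<and> x \<in> M C" using sec_in[OF \<Gamma>] by auto
  next
    fix C g x h y assume "(g, x) \<in> sec_act_op A B f \<Gamma> C" "(h, y) \<in> sec_act_op A B f \<Gamma> C"
    then show "(g \<oplus>\<^bsub>Hm a C B\<^esub> h, x \<oplus>\<^bsub>FOb F C\<^esub> y) \<in> sec_act_op A B f \<Gamma> C"
      using sec_in[OF \<Gamma>] sec_add[OF \<Gamma>] A B by (auto simp: Cmp_add_right)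
  next
    fix C D g x h assume "(g, x) \<in> sec_act_op A B f \<Gamma> C" "D \<in> Ob a" "h \<in> hm D C"
    then show "(Cmp a D C B g h, FAr F C D h x) \<in> sec_act_op A B f \<Gamma> D"
      using sec_in[OF \<Gamma>] sec_act[OF \<Gamma>] A B by (auto simp: Cmp_assoc[symmetric])
  next
    show "locally B (\<lambda>C g. \<exists>x. (g, x) \<in> sec_act_op A B f \<Gamma> C)"
      by (rule locally_mono[OF locally_pull[OF sec_dom[OF \<Gamma>] B]]) auto
  qed (use sec_eqv[OF \<Gamma>] in auto)
  moreover have "(g, x) \<in> sec_act_op A B f \<Gamma> C" if c: "(g, x) \<in> close B (sec_act_op A B f \<Gamma>) C" for g x C
  proof -
    have C: "C \<in> Ob a" "g \<in> hm C B" "x \<in> M C" using c mem_close by auto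
    have "(Cmp a C B A f g, x) \<in> \<Gamma> C"
    proof (rule sec_closed[OF \<Gamma>])
      show "locally C (\<lambda>D h. \<exists>y. (Cmp a D C A (Cmp a C B A f g) h, y) \<in> \<Gamma> D \<and> eqv D (FAr F C D h x) y)"
        using c A B C unfolding mem_close by (auto simp: Cmp_assoc elim!: locally_mono)
    qed (use A B C in auto)
    then show ?thesis using C by simp
  qed
  ultimately show ?thesis unfolding sec_def by auto
qed

text \<open>A pair over the identity restricts along every morphism into A, so the two graphs agree
  on the maximal sieve.\<close>

lemma sec_of_eqI:
  assumes \<Gamma>: "sec A \<Gamma>" and x: "(Idt a A, x) \<in> \<Gamma> A"
  shows "\<Gamma> = sec_of A x"
proof -
  have A: "A \<in> Ob a" "x \<in> M A" using sec_in[OF \<Gamma> x] by auto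
  show ?thesis
  proof (rule sec_eqI[OF \<Gamma> sec_of(1)[OF A]], rule locally_all[OF A(1)])
    fix B f assume B: "B \<in> Ob a" "f \<in> hm B A"
    show "\<exists>y. (f, y) \<in> \<Gamma> B \<and> (f, y) \<in> sec_of A x B"
      using sec_act[OF \<Gamma> x B] sec_of(2)[OF A B] A B by auto
  qed
qed

lemma sec_of_Idt: "A \<in> Ob a \<Longrightarrow> x \<in> M A \<Longrightarrow> (Idt a A, x) \<in> sec_of A x A"
  using sec_of(2)[of A x A "Idt a A"] F by simp

text \<open>The values x and y lie over the same identity morphism, and graphs remain single-valued
  modulo N after closing. Hence the kernel of \<open>sec_of\<close> is exactly N.\<close>

lemma sec_of_eq_iff:
  assumes A: "A \<in> Ob a" and xy: "x \<in> M A" "y \<in> M A"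
  shows "sec_of A x = sec_of A y \<longleftrightarrow> eqv A x y"
proof
  assume "sec_of A x = sec_of A y"
  then show "eqv A x y" using sec_of_Idt[OF A xy(1)] sec_of_Idt[OF A xy(2)] sec_eqv[OF sec_of(1)[OF A xy(2)]] by simp
next
  assume e: "eqv A x y"
  have "(Idt a A, y) \<in> sec_of A x A"
  proof (rule sec_closed[OF sec_of(1)[OF A xy(1)] A _ xy(2)], simp add: A, rule locally_all[OF A])
    fix B f assume B: "B \<in> Ob a" "f \<in> hm B A"
    show "\<exists>z. (Cmp a B A A (Idt a A) f, z) \<in> sec_of A x B \<and> eqv B (FAr F A B f y) z"
      using sec_of(2)[OF A xy(1) B] eqv_act[OF A B eqv_sym[OF A e]] A B by auto
  qed
  then show "sec_of A x = sec_of A y" using sec_of_eqI[OF sec_of(1)[OF A xy(1)]] by simp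
qed

section \<open>The sheaf of sections\<close>

definition quot_sheaf :: "('o, 'v, ('k, 'o \<Rightarrow> ('v \<times> 'w) set) module, ('o \<Rightarrow> ('v \<times> 'w) set) \<Rightarrow> ('o \<Rightarrow> ('v \<times> 'w) set)) linfun" where
  "quot_sheaf = \<lparr>FOb = (\<lambda>A. \<lparr>carrier = {\<Gamma>. sec A \<Gamma>}, mult = undefined, one = undefined,
      zero = sec_of A \<zero>\<^bsub>FOb F A\<^esub>, add = sec_add_op A, smult = sec_smult_op A\<rparr>),
    FAr = sec_act_op\<rparr>"

lemma quot_sheaf_simps [simp]:
  "carrier (FOb quot_sheaf A) = {\<Gamma>. sec A \<Gamma>}" "\<zero>\<^bsub>FOb quot_sheaf A\<^esub> = sec_of A \<zero>\<^bsub>FOb F A\<^esub>"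
  "\<Gamma> \<oplus>\<^bsub>FOb quot_sheaf A\<^esub> \<Delta> = sec_add_op A \<Gamma> \<Delta>" "r \<odot>\<^bsub>FOb quot_sheaf A\<^esub> \<Gamma> = sec_smult_op A r \<Gamma>"
  "FAr quot_sheaf = sec_act_op"
  by (simp_all add: quot_sheaf_def)

text \<open>Reduces an identity between composite sections to an identity of elements of F over the
  morphisms where the input is defined. \<open>sec_eqI2\<close> does the same for two inputs. In
  this way the module laws are inherited from F.\<close>

lemma sec_eqI1:
  assumes S: "sec A S" and \<Delta>: "sec A \<Delta>" and \<Gamma>: "sec A \<Gamma>"
    and "\<And>B f x. B \<in> Ob a \<Longrightarrow> f \<in> hm B A \<Longrightarrow> x \<in> M B \<Longrightarrow> (f, x) \<in> \<Gamma> B \<Longrightarrow> \<exists>y. (f, y) \<in> S B \<and> (f, y) \<in> \<Delta> B"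
  shows "S = \<Delta>"
  by (rule sec_eqI[OF S \<Delta> locally_mono[OF sec_dom[OF \<Gamma>]]]) (use assms sec_in[OF \<Gamma>] in blast)

lemma sec_eqI2:
  assumes S: "sec A S" and \<Delta>: "sec A \<Delta>" and \<Gamma>: "sec A \<Gamma>" "sec A \<Gamma>'"
    and *: "\<And>B f x x'. B \<in> Ob a \<Longrightarrow> f \<in> hm B A \<Longrightarrow> x \<in> M B \<Longrightarrow> x' \<in> M B \<Longrightarrow> (f, x) \<in> \<Gamma> B \<Longrightarrow> (f, x') \<in> \<Gamma>' B \<Longrightarrow>
      \<exists>y. (f, y) \<in> S B \<and> (f, y) \<in> \<Delta> B"
  shows "S = \<Delta>"
  by (rule sec_eqI[OF S \<Delta> locally_mono[OF locally_conj[OF sec_dom[OF \<Gamma>(1)] sec_dom[OF \<Gamma>(2)]]]])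
    (use * sec_in[OF \<Gamma>(1)] sec_in[OF \<Gamma>(2)] in blast)

lemma quot_sheaf_abelian_group:
  assumes A: "A \<in> Ob a" shows "abelian_group (FOb quot_sheaf A)"
proof (rule abelian_groupI; simp)
  note z = psh_zero_in[OF F A]
  show "sec A (sec_of A \<zero>\<^bsub>FOb F A\<^esub>)" by (rule sec_of(1)[OF A z])
  fix \<Gamma> assume \<Gamma>: "sec A \<Gamma>"
  show "sec_add_op A (sec_of A \<zero>\<^bsub>FOb F A\<^esub>) \<Gamma> = \<Gamma>"
  proof (rule sec_eqI1[OF sec_add_op(1)[OF sec_of(1)[OF A z] \<Gamma>] \<Gamma> \<Gamma>])
    fix B f x assume B: "B \<in> Ob a" "f \<in> hm B A" "x \<in> M B" "(f, x) \<in> \<Gamma> B"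
    show "\<exists>y. (f, y) \<in> sec_add_op A (sec_of A \<zero>\<^bsub>FOb F A\<^esub>) \<Gamma> B \<and> (f, y) \<in> \<Gamma> B"
      using sec_add_op(2)[OF sec_of(1)[OF A z] \<Gamma> sec_of(2)[OF A z B(1,2)] B(4)] B F
      by (auto simp: act_zero_neg(1)[OF F A B(1,2)])
  qed
  \<comment> \<open>The inverse of a section is its multiple by minus one.\<close>
  have m1: "\<ominus>\<^bsub>K\<^esub> \<one>\<^bsub>K\<^esub> \<in> carrier K" by simp
  show "\<exists>\<Delta>. sec A \<Delta> \<and> sec_add_op A \<Delta> \<Gamma> = sec_of A \<zero>\<^bsub>FOb F A\<^esub>"
  proof (intro exI conjI)
    let ?D = "sec_smult_op A (\<ominus>\<^bsub>K\<^esub> \<one>\<^bsub>K\<^esub>) \<Gamma>"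
    show D: "sec A ?D" by (rule sec_smult_op(1)[OF \<Gamma> m1])
    show "sec_add_op A ?D \<Gamma> = sec_of A \<zero>\<^bsub>FOb F A\<^esub>"
    proof (rule sec_eqI1[OF sec_add_op(1)[OF D \<Gamma>] sec_of(1)[OF A z] \<Gamma>])
      fix B f x assume B: "B \<in> Ob a" "f \<in> hm B A" "x \<in> M B" "(f, x) \<in> \<Gamma> B"
      interpret B: module K "FOb F B" by (rule psh_mod[OF F B(1)])
      have "(\<ominus>\<^bsub>K\<^esub> \<one>\<^bsub>K\<^esub> \<odot>\<^bsub>FOb F B\<^esub> x) \<oplus>\<^bsub>FOb F B\<^esub> x = \<zero>\<^bsub>FOb F B\<^esub>"
        using B by (simp add: B.smult_l_minus B.l_neg)
      then show "\<exists>y. (f, y) \<in> sec_add_op A ?D \<Gamma> B \<and> (f, y) \<in> sec_of A \<zero>\<^bsub>FOb F A\<^esub> B"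
        using sec_add_op(2)[OF D \<Gamma> sec_smult_op(2)[OF \<Gamma> m1 B(4)] B(4)] sec_of(2)[OF A z B(1,2)]
        by (auto simp: act_zero_neg(1)[OF F A B(1,2)])
    qed
  qed
  fix \<Delta> assume \<Delta>: "sec A \<Delta>"
  show "sec A (sec_add_op A \<Gamma> \<Delta>)" by (rule sec_add_op(1)[OF \<Gamma> \<Delta>])
  show "sec_add_op A \<Gamma> \<Delta> = sec_add_op A \<Delta> \<Gamma>"
  proof (rule sec_eqI2[OF sec_add_op(1)[OF \<Gamma> \<Delta>] sec_add_op(1)[OF \<Delta> \<Gamma>] \<Gamma> \<Delta>])
    fix B f x y assume B: "B \<in> Ob a" "f \<in> hm B A" "x \<in> M B" "y \<in> M B" "(f, x) \<in> \<Gamma> B" "(f, y) \<in> \<Delta> B"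
    interpret B: module K "FOb F B" by (rule psh_mod[OF F B(1)])
    show "\<exists>y. (f, y) \<in> sec_add_op A \<Gamma> \<Delta> B \<and> (f, y) \<in> sec_add_op A \<Delta> \<Gamma> B"
      using sec_add_op(2)[OF \<Gamma> \<Delta> B(5,6)] sec_add_op(2)[OF \<Delta> \<Gamma> B(6,5)] B.a_comm[OF B(3,4)] by auto
  qed
  fix \<Theta> assume \<Theta>: "sec A \<Theta>"
  note 1 = sec_add_op(1)[OF \<Gamma> \<Delta>] and 2 = sec_add_op(1)[OF \<Delta> \<Theta>]
  show "sec_add_op A (sec_add_op A \<Gamma> \<Delta>) \<Theta> = sec_add_op A \<Gamma> (sec_add_op A \<Delta> \<Theta>)"
  proof (rule sec_eqI[OF sec_add_op(1)[OF 1 \<Theta>] sec_add_op(1)[OF \<Gamma> 2]],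
      rule locally_mono[OF locally_conj[OF locally_conj[OF sec_dom[OF \<Gamma>] sec_dom[OF \<Delta>]] sec_dom[OF \<Theta>]]])
    fix B f assume B: "B \<in> Ob a" "f \<in> hm B A"
      and "((\<exists>x. (f, x) \<in> \<Gamma> B) \<and> (\<exists>x. (f, x) \<in> \<Delta> B)) \<and> (\<exists>x. (f, x) \<in> \<Theta> B)"
    then obtain x y z where x: "(f, x) \<in> \<Gamma> B" "(f, y) \<in> \<Delta> B" "(f, z) \<in> \<Theta> B" by blast
    interpret B: module K "FOb F B" by (rule psh_mod[OF F B(1)])
    show "\<exists>x. (f, x) \<in> sec_add_op A (sec_add_op A \<Gamma> \<Delta>) \<Theta> B \<and> (f, x) \<in> sec_add_op A \<Gamma> (sec_add_op A \<Delta> \<Theta>) B"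
      using sec_add_op(2)[OF 1 \<Theta> sec_add_op(2)[OF \<Gamma> \<Delta> x(1,2)] x(3)]
        sec_add_op(2)[OF \<Gamma> 2 x(1) sec_add_op(2)[OF \<Delta> \<Theta> x(2,3)]]
        B.a_assoc sec_in[OF \<Gamma> x(1)] sec_in[OF \<Delta> x(2)] sec_in[OF \<Theta> x(3)] by auto
  qed
qed

lemma quot_sheaf_module:
  assumes A: "A \<in> Ob a" shows "module K (FOb quot_sheaf A)"
proof (rule moduleI[OF cr quot_sheaf_abelian_group[OF A]]; simp)
  fix r \<Gamma> assume r: "r \<in> carrier K" and \<Gamma>: "sec A \<Gamma>"
  note rG = sec_smult_op[OF \<Gamma> r]
  show "sec A (sec_smult_op A r \<Gamma>)" by (rule rG(1))
  {
    fix s assume s: "s \<in> carrier K"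
    note sG = sec_smult_op[OF \<Gamma> s]
    have rs: "r \<oplus>\<^bsub>K\<^esub> s \<in> carrier K" "r \<otimes>\<^bsub>K\<^esub> s \<in> carrier K" using r s by auto
    show "sec_smult_op A (r \<oplus>\<^bsub>K\<^esub> s) \<Gamma> = sec_add_op A (sec_smult_op A r \<Gamma>) (sec_smult_op A s \<Gamma>)"
    proof (rule sec_eqI1[OF sec_smult_op(1)[OF \<Gamma> rs(1)] sec_add_op(1)[OF rG(1) sG(1)] \<Gamma>])
      fix B f x assume B: "B \<in> Ob a" "f \<in> hm B A" "x \<in> M B" "(f, x) \<in> \<Gamma> B"
      interpret B: module K "FOb F B" by (rule psh_mod[OF F B(1)])
      show "\<exists>y. (f, y) \<in> sec_smult_op A (r \<oplus>\<^bsub>K\<^esub> s) \<Gamma> B \<and>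
          (f, y) \<in> sec_add_op A (sec_smult_op A r \<Gamma>) (sec_smult_op A s \<Gamma>) B"
        using sec_smult_op(2)[OF \<Gamma> rs(1) B(4)] sec_add_op(2)[OF rG(1) sG(1) rG(2)[OF B(4)] sG(2)[OF B(4)]]
          B.smult_l_distr[OF r s B(3)] by auto
    qed
    show "sec_smult_op A (r \<otimes>\<^bsub>K\<^esub> s) \<Gamma> = sec_smult_op A r (sec_smult_op A s \<Gamma>)"
    proof (rule sec_eqI1[OF sec_smult_op(1)[OF \<Gamma> rs(2)] sec_smult_op(1)[OF sG(1) r] \<Gamma>])
      fix B f x assume B: "B \<in> Ob a" "f \<in> hm B A" "x \<in> M B" "(f, x) \<in> \<Gamma> B"
      interpret B: module K "FOb F B" by (rule psh_mod[OF F B(1)])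
      show "\<exists>y. (f, y) \<in> sec_smult_op A (r \<otimes>\<^bsub>K\<^esub> s) \<Gamma> B \<and>
          (f, y) \<in> sec_smult_op A r (sec_smult_op A s \<Gamma>) B"
        using sec_smult_op(2)[OF \<Gamma> rs(2) B(4)] sec_smult_op(2)[OF sG(1) r sG(2)[OF B(4)]]
          B.smult_assoc1[OF r s B(3)] by auto
    qed
  }
  fix \<Delta> assume \<Delta>: "sec A \<Delta>"
  note rD = sec_smult_op[OF \<Delta> r] and GD = sec_add_op[OF \<Gamma> \<Delta>]
  show "sec_smult_op A r (sec_add_op A \<Gamma> \<Delta>) = sec_add_op A (sec_smult_op A r \<Gamma>) (sec_smult_op A r \<Delta>)"
  proof (rule sec_eqI2[OF sec_smult_op(1)[OF GD(1) r] sec_add_op(1)[OF rG(1) rD(1)] \<Gamma> \<Delta>])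
    fix B f x y assume B: "B \<in> Ob a" "f \<in> hm B A" "x \<in> M B" "y \<in> M B" "(f, x) \<in> \<Gamma> B" "(f, y) \<in> \<Delta> B"
    interpret B: module K "FOb F B" by (rule psh_mod[OF F B(1)])
    show "\<exists>z. (f, z) \<in> sec_smult_op A r (sec_add_op A \<Gamma> \<Delta>) B \<and>
        (f, z) \<in> sec_add_op A (sec_smult_op A r \<Gamma>) (sec_smult_op A r \<Delta>) B"
      using sec_smult_op(2)[OF GD(1) r GD(2)[OF B(5,6)]]
        sec_add_op(2)[OF rG(1) rD(1) rG(2)[OF B(5)] rD(2)[OF B(6)]] B.smult_r_distr[OF r B(3,4)] by auto
  qed
next
  fix \<Gamma> assume \<Gamma>: "sec A \<Gamma>"
  have 1: "\<one>\<^bsub>K\<^esub> \<in> carrier K" by simp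
  show "sec_smult_op A \<one>\<^bsub>K\<^esub> \<Gamma> = \<Gamma>"
  proof (rule sec_eqI1[OF sec_smult_op(1)[OF \<Gamma> 1] \<Gamma> \<Gamma>])
    fix B f x assume B: "B \<in> Ob a" "f \<in> hm B A" "x \<in> M B" "(f, x) \<in> \<Gamma> B"
    interpret B: module K "FOb F B" by (rule psh_mod[OF F B(1)])
    show "\<exists>y. (f, y) \<in> sec_smult_op A \<one>\<^bsub>K\<^esub> \<Gamma> B \<and> (f, y) \<in> \<Gamma> B"
      using sec_smult_op(2)[OF \<Gamma> 1 B(4)] B by auto
  qed
qed

lemma psh_quot_sheaf: "psh quot_sheaf"
  unfolding psh_def
proof (intro conjI ballI; simp?)
  show "module K (FOb quot_sheaf A)" if "A \<in> Ob a" for A using quot_sheaf_module[OF that] .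
next
  fix A \<Gamma> assume A: "A \<in> Ob a" and \<Gamma>: "sec A \<Gamma>"
  show "sec_act_op A A (Idt a A) \<Gamma> = \<Gamma>"
    by (rule sec_eqI1[OF sec_act_op[OF \<Gamma> A] \<Gamma> \<Gamma>]) (use A in auto)
next
  fix A B f \<Gamma> assume A: "A \<in> Ob a" and B: "B \<in> Ob a" "f \<in> hm B A" and \<Gamma>: "sec A \<Gamma>"
  note fG = sec_act_op[OF \<Gamma> B]
  show "sec B (sec_act_op A B f \<Gamma>)" by (rule fG)
  {
    fix \<Delta> assume \<Delta>: "sec A \<Delta>"
    note fD = sec_act_op[OF \<Delta> B] and GD = sec_add_op[OF \<Gamma> \<Delta>]
    show "sec_act_op A B f (sec_add_op A \<Gamma> \<Delta>) = sec_add_op B (sec_act_op A B f \<Gamma>) (sec_act_op A B f \<Delta>)"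
    proof (rule sec_eqI2[OF sec_act_op[OF GD(1) B] sec_add_op(1)[OF fG fD] fG fD])
      fix C g x y assume C: "C \<in> Ob a" "g \<in> hm C B" "x \<in> M C" "y \<in> M C"
        "(g, x) \<in> sec_act_op A B f \<Gamma> C" "(g, y) \<in> sec_act_op A B f \<Delta> C"
      then show "\<exists>z. (g, z) \<in> sec_act_op A B f (sec_add_op A \<Gamma> \<Delta>) C \<and>
          (g, z) \<in> sec_add_op B (sec_act_op A B f \<Gamma>) (sec_act_op A B f \<Delta>) C"
        using GD(2)[of "Cmp a C B A f g" x C y] sec_add_op(2)[OF fG fD C(5,6)] by auto
    qed
  }
  {
    fix C g assume C: "C \<in> Ob a" "g \<in> hm C B"
    have fg: "Cmp a C B A f g \<in> hm C A" using A B C by simp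
    show "sec_act_op A C (Cmp a C B A f g) \<Gamma> = sec_act_op B C g (sec_act_op A B f \<Gamma>)"
      by (rule sec_eqI1[OF sec_act_op[OF \<Gamma> C(1) fg] sec_act_op[OF fG C] sec_act_op[OF \<Gamma> C(1) fg]])
        (use A B C in \<open>auto simp: Cmp_assoc\<close>)
  }
  {
    fix g assume g: "g \<in> hm B A"
    have fg: "f \<oplus>\<^bsub>Hm a B A\<^esub> g \<in> hm B A" using A B g by simp
    note gG = sec_act_op[OF \<Gamma> B(1) g]
    show "sec_act_op A B (f \<oplus>\<^bsub>Hm a B A\<^esub> g) \<Gamma> = sec_add_op B (sec_act_op A B f \<Gamma>) (sec_act_op A B g \<Gamma>)"
    proof (rule sec_eqI2[OF sec_act_op[OF \<Gamma> B(1) fg] sec_add_op(1)[OF fG gG] fG gG])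
      fix C h x y assume C: "C \<in> Ob a" "h \<in> hm C B" "x \<in> M C" "y \<in> M C"
        "(h, x) \<in> sec_act_op A B f \<Gamma> C" "(h, y) \<in> sec_act_op A B g \<Gamma> C"
      then show "\<exists>z. (h, z) \<in> sec_act_op A B (f \<oplus>\<^bsub>Hm a B A\<^esub> g) \<Gamma> C \<and>
          (h, z) \<in> sec_add_op B (sec_act_op A B f \<Gamma>) (sec_act_op A B g \<Gamma>) C"
        using sec_add[OF \<Gamma>, of "Cmp a C B A f h" x C "Cmp a C B A g h" y] A B g sec_add_op(2)[OF fG gG C(5,6)]
        by (auto simp: Cmp_add_left)
    qed
  }
  fix r assume r: "r \<in> carrier K"
  have rf: "r \<odot>\<^bsub>Hm a B A\<^esub> f \<in> hm B A" using A B r by simp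
  show "sec_act_op A B (r \<odot>\<^bsub>Hm a B A\<^esub> f) \<Gamma> = sec_smult_op B r (sec_act_op A B f \<Gamma>)"
  proof (rule sec_eqI1[OF sec_act_op[OF \<Gamma> B(1) rf] sec_smult_op(1)[OF fG r] fG])
    fix C h x assume C: "C \<in> Ob a" "h \<in> hm C B" "x \<in> M C" "(h, x) \<in> sec_act_op A B f \<Gamma> C"
    then show "\<exists>z. (h, z) \<in> sec_act_op A B (r \<odot>\<^bsub>Hm a B A\<^esub> f) \<Gamma> C \<and>
        (h, z) \<in> sec_smult_op B r (sec_act_op A B f \<Gamma>) C"
      using psec_smult[OF sec_psec[OF \<Gamma>], of "Cmp a C B A f h" x C r] A B r sec_smult_op(2)[OF fG r C(4)]
      by (auto simp: Cmp_smult)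
  qed
qed

lemma lin_nat_sec_of: "lin_nat F quot_sheaf sec_of"
  unfolding lin_nat_def
proof (intro conjI ballI; simp)
  fix A x assume A: "A \<in> Ob a" and x: "x \<in> M A"
  show s: "sec A (sec_of A x)" by (rule sec_of(1)[OF A x])
  { fix y assume y: "y \<in> M A"
    show "sec_of A (x \<oplus>\<^bsub>FOb F A\<^esub> y) = sec_add_op A (sec_of A x) (sec_of A y)"
      by (rule sec_of_eqI[symmetric, OF sec_add_op(1)[OF s sec_of(1)[OF A y]]])
        (rule sec_add_op(2)[OF s sec_of(1)[OF A y] sec_of_Idt[OF A x] sec_of_Idt[OF A y]]) }
  fix B f assume B: "B \<in> Ob a" "f \<in> hm B A"
  show "sec_of B (FAr F A B f x) = sec_act_op A B f (sec_of A x)"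
    by (rule sec_of_eqI[symmetric, OF sec_act_op[OF s B]]) (use A B x sec_of(2)[OF A x B] in simp)
qed

lemma sec_act_op_eq_sec_of:
  assumes "sec A \<Gamma>" "(f, x) \<in> \<Gamma> B" shows "sec_act_op A B f \<Gamma> = sec_of B x"
  using sec_in[OF assms] sec_Ob[OF assms(1)] assms sec_act_op[OF assms(1)]
  by (intro sec_of_eqI) auto

lemma locsurj_sec_of: "locsurj F quot_sheaf sec_of"
  unfolding locsurj_def
proof (intro ballI)
  fix A \<Gamma> assume "A \<in> Ob a" "\<Gamma> \<in> carrier (FOb quot_sheaf A)"
  then have \<Gamma>: "sec A \<Gamma>" by simp
  show "locally A (\<lambda>B f. \<exists>x\<in>M B. sec_of B x = FAr quot_sheaf A B f \<Gamma>)"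
    by (rule locally_mono[OF sec_dom[OF \<Gamma>]]) (use sec_act_op_eq_sec_of[OF \<Gamma>] sec_in[OF \<Gamma>] in fastforce)
qed

lemma quot_sheaf_separated:
  assumes \<Gamma>: "sec A \<Gamma>" and \<Delta>: "sec A \<Delta>"
    and loc: "locally A (\<lambda>B f. sec_act_op A B f \<Gamma> = sec_act_op A B f \<Delta>)"
  shows "\<Gamma> = \<Delta>"
proof (rule sec_eqI[OF \<Gamma> \<Delta> locally_mono[OF locally_conj[OF loc sec_dom[OF \<Gamma>]]]])
  fix B f assume B: "B \<in> Ob a" "f \<in> hm B A"
    and "sec_act_op A B f \<Gamma> = sec_act_op A B f \<Delta> \<and> (\<exists>x. (f, x) \<in> \<Gamma> B)"
  then obtain x where x: "sec_act_op A B f \<Gamma> = sec_act_op A B f \<Delta>" "(f, x) \<in> \<Gamma> B" by blast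
  have "(Idt a B, x) \<in> sec_act_op A B f \<Gamma> B" using x(2) B sec_Ob[OF \<Gamma>] by simp
  then have "(Idt a B, x) \<in> sec_act_op A B f \<Delta> B" unfolding x(1) .
  then have "(f, x) \<in> \<Delta> B" using B sec_Ob[OF \<Gamma>] by simp
  then show "\<exists>x. (f, x) \<in> \<Gamma> B \<and> (f, x) \<in> \<Delta> B" using x by blast
qed

lemma sheaf_elt_quot_sheaf: "sheaf_elt quot_sheaf"
  unfolding sheaf_elt_def
proof (intro ballI allI impI)
  fix A R \<sigma> assume A: "A \<in> Ob a" and R: "R \<in> T A" and \<sigma>: "lin_nat (sieve_presheaf a A R) quot_sheaf \<sigma>"
  note Rs = T_sieve[OF R] and Rh = T_hm[OF R]
  have s1: "sec B (\<sigma> B f)" if "B \<in> Ob a" "f \<in> R B" for B f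
    using lin_nat_in[OF \<sigma>, of B f] that by simp
  have s2: "\<sigma> B (f \<oplus>\<^bsub>Hm a B A\<^esub> g) = sec_add_op B (\<sigma> B f) (\<sigma> B g)" if "B \<in> Ob a" "f \<in> R B" "g \<in> R B" for B f g
    using lin_nat_add[OF \<sigma>, of B f g] that by simp
  have s3: "\<sigma> C (Cmp a C B A f g) = sec_act_op B C g (\<sigma> B f)"
    if "B \<in> Ob a" "C \<in> Ob a" "f \<in> R B" "g \<in> hm C B" for B C f g
    using lin_nat_act[OF \<sigma>, of B C g f] that by simp
  \<comment> \<open>The candidate for the glued section: over f in R it takes the value x when the
    section \<open>\<sigma> B f\<close> is the image of the element x. It is defined only where
    \<open>\<sigma> B f\<close> comes from an element of F, but each of these sections does so
    locally, hence by transitivity the graph is defined on a cover of A.\<close>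
  define \<Gamma>0 where "\<Gamma>0 = (\<lambda>B. {(f, x). f \<in> R B \<and> x \<in> M B \<and> (Idt a B, x) \<in> \<sigma> B f B})"
  have dom: "(Cmp a C B A f g, x) \<in> \<Gamma>0 C"
    if "B \<in> Ob a" "C \<in> Ob a" "f \<in> R B" "g \<in> hm C B" "(g, x) \<in> \<sigma> B f C" for B C f g x
    using that sec_in[OF s1[OF that(1,3)] that(5)] sieve_Cmp[OF Rs that(3,2,4)]
    by (auto simp: \<Gamma>0_def s3)
  have Rsv: "sieve_of A (\<lambda>B f. f \<in> R B) = R"
    using Rh sieve_Ob[OF Rs] by (auto simp: fun_eq_iff sieve_of_def)
  have sv: "sieve K a A (sieve_of A (\<lambda>B f. \<exists>x. (f, x) \<in> \<Gamma>0 B))"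
  proof (rule sieve_of_sieveI[OF A])
    fix B assume B: "B \<in> Ob a"
    have 0: "\<zero>\<^bsub>Hm a B A\<^esub> \<in> R B" using sieve_zero[OF Rs A B] .
    have "(\<zero>\<^bsub>Hm a B B\<^esub>, \<zero>\<^bsub>FOb F B\<^esub>) \<in> \<sigma> B \<zero>\<^bsub>Hm a B A\<^esub> B"
      using psec_zero[OF sec_psec[OF s1[OF B 0]] B] .
    moreover have "Cmp a B B A \<zero>\<^bsub>Hm a B A\<^esub> \<zero>\<^bsub>Hm a B B\<^esub> = \<zero>\<^bsub>Hm a B A\<^esub>"
      using act_zero_neg_left(1)[OF psh_yoneda[OF A] B B, of "\<zero>\<^bsub>Hm a B A\<^esub>"] A B by simp
    ultimately show "\<exists>x. (\<zero>\<^bsub>Hm a B A\<^esub>, x) \<in> \<Gamma>0 B" using dom[OF B B 0, of "\<zero>\<^bsub>Hm a B B\<^esub>"] B by fastforce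
  next
    fix B f g assume B: "B \<in> Ob a" and "\<exists>x. (f, x) \<in> \<Gamma>0 B" "\<exists>x. (g, x) \<in> \<Gamma>0 B"
    then obtain x y where *: "(f, x) \<in> \<Gamma>0 B" "(g, y) \<in> \<Gamma>0 B" by blast
    then have f: "f \<in> R B" and g: "g \<in> R B" by (auto simp: \<Gamma>0_def)
    show "\<exists>x. (f \<oplus>\<^bsub>Hm a B A\<^esub> g, x) \<in> \<Gamma>0 B"
      using * sec_add_op(2)[OF s1[OF B f] s1[OF B g]] sieve_add[OF Rs A f g] B F
      by (auto simp: \<Gamma>0_def s2 intro!: exI[of _ "x \<oplus>\<^bsub>FOb F B\<^esub> y"])
  next
    fix B C f g assume B: "B \<in> Ob a" "C \<in> Ob a" "\<exists>x. (f, x) \<in> \<Gamma>0 B" "g \<in> hm C B"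
    then obtain x where x: "f \<in> R B" "x \<in> M B" "(Idt a B, x) \<in> \<sigma> B f B" by (auto simp: \<Gamma>0_def)
    show "\<exists>x. (Cmp a C B A f g, x) \<in> \<Gamma>0 C"
      using sec_act[OF s1[OF B(1) x(1)] x(3) B(2,4)] dom[OF B(1,2) x(1) B(4)] B by auto
  qed
  have loc: "locally A (\<lambda>B f. \<exists>x. (f, x) \<in> \<Gamma>0 B)"
  proof (rule locally_trans[OF sv], rule locallyI[OF R])
    fix B f assume B: "B \<in> Ob a" "f \<in> R B"
    show "locally B (\<lambda>C g. \<exists>x. (Cmp a C B A f g, x) \<in> \<Gamma>0 C)"
      by (rule locally_mono[OF sec_dom[OF s1[OF B]]]) (use dom[OF B(1) _ B(2)] in blast)
  qed
  have p: "psec A \<Gamma>0"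
  proof (rule psecI[OF A _ _ _ _ loc])
    fix B f x assume "(f, x) \<in> \<Gamma>0 B"
    then show "B \<in> Ob a \<and> f \<in> hm B A \<and> x \<in> M B" using sieve_Ob[OF Rs] Rh by (auto simp: \<Gamma>0_def)
  next
    fix B f x g y assume "(f, x) \<in> \<Gamma>0 B" "(g, y) \<in> \<Gamma>0 B"
    then have *: "f \<in> R B" "g \<in> R B" "x \<in> M B" "y \<in> M B" "(Idt a B, x) \<in> \<sigma> B f B" "(Idt a B, y) \<in> \<sigma> B g B"
      by (auto simp: \<Gamma>0_def)
    then have B: "B \<in> Ob a" using sieve_Ob[OF Rs] by blast
    show "(f \<oplus>\<^bsub>Hm a B A\<^esub> g, x \<oplus>\<^bsub>FOb F B\<^esub> y) \<in> \<Gamma>0 B"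
      using * sec_add_op(2)[OF s1[OF B *(1)] s1[OF B *(2)] *(5,6)] sieve_add[OF Rs A] B F
      by (auto simp: \<Gamma>0_def s2)
  next
    fix B C f x g assume "(f, x) \<in> \<Gamma>0 B" and C: "C \<in> Ob a" "g \<in> hm C B"
    then have *: "f \<in> R B" "x \<in> M B" "(Idt a B, x) \<in> \<sigma> B f B" by (auto simp: \<Gamma>0_def)
    then have B: "B \<in> Ob a" using sieve_Ob[OF Rs] by blast
    show "(Cmp a C B A f g, FAr F B C g x) \<in> \<Gamma>0 C"
      using * sec_act[OF s1[OF B *(1)] *(3) C] sieve_Cmp[OF Rs *(1) C] B C F
      by (auto simp: \<Gamma>0_def s3)
  next
    fix B f x y assume "(f, x) \<in> \<Gamma>0 B" "(f, y) \<in> \<Gamma>0 B"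
    then show "eqv B x y" using sec_eqv[OF s1] sieve_Ob[OF Rs] by (auto simp: \<Gamma>0_def)
  qed
  let ?G = "close A \<Gamma>0"
  have G: "sec A ?G" by (rule sec_close[OF p])
  have eq: "sec_act_op A B f ?G = \<sigma> B f" if B: "B \<in> Ob a" "f \<in> R B" for B f
  proof (rule sec_eqI1[OF sec_act_op[OF G B(1) Rh[OF B(2)]] s1[OF B] s1[OF B]])
    fix C g x assume C: "C \<in> Ob a" "g \<in> hm C B" "x \<in> M C" "(g, x) \<in> \<sigma> B f C"
    then show "\<exists>y. (g, y) \<in> sec_act_op A B f ?G C \<and> (g, y) \<in> \<sigma> B f C"
      using close_sub[OF p dom[OF B(1) C(1) B(2) C(2,4)]] by auto
  qed
  show "\<exists>!\<Gamma>. \<Gamma> \<in> carrier (FOb quot_sheaf A) \<and> (\<forall>B\<in>Ob a. \<forall>f\<in>R B. FAr quot_sheaf A B f \<Gamma> = \<sigma> B f)"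
  proof (rule ex1I[of _ ?G])
    show "?G \<in> carrier (FOb quot_sheaf A) \<and> (\<forall>B\<in>Ob a. \<forall>f\<in>R B. FAr quot_sheaf A B f ?G = \<sigma> B f)"
      using G eq by simp
    fix \<Delta> assume D: "\<Delta> \<in> carrier (FOb quot_sheaf A) \<and> (\<forall>B\<in>Ob a. \<forall>f\<in>R B. FAr quot_sheaf A B f \<Delta> = \<sigma> B f)"
    show "\<Delta> = ?G"
      by (rule quot_sheaf_separated[OF _ G locallyI[OF R]]) (use D eq in auto)
  qed
qed

end

section \<open>Gluing and factorisation\<close>

context site
begin

lemma lin_nat_restr:
  assumes "psh F" "sieve K a A R" "A \<in> Ob a" "x \<in> carrier (FOb F A)"
  shows "lin_nat (sieve_presheaf a A R) F (\<lambda>B f. FAr F A B f x)"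
  unfolding lin_nat_def using assms sieve_hm[OF assms(2,3)]
  by (simp add: act_add_left act_Cmp)

lemma sheaf_elt_sep:
  assumes F: "psh F" "sheaf_elt F" and xy: "x \<in> carrier (FOb F A)" "y \<in> carrier (FOb F A)"
    and loc: "locally A (\<lambda>B f. FAr F A B f x = FAr F A B f y)"
  shows "x = y"
proof -
  obtain R where R: "R \<in> T A" "\<forall>B\<in>Ob a. \<forall>f\<in>R B. FAr F A B f x = FAr F A B f y"
    using loc unfolding locally_def by blast
  have "\<exists>!z. z \<in> carrier (FOb F A) \<and> (\<forall>B\<in>Ob a. \<forall>f\<in>R B. FAr F A B f z = FAr F A B f y)"
    using F(2)[unfolded sheaf_elt_def, rule_format, OF T_Ob[OF R(1)] R(1)]
      lin_nat_restr[OF F(1) T_sieve[OF R(1)] T_Ob[OF R(1)] xy(2)] by blast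
  then show ?thesis using R(2) xy by blast
qed

text \<open>Descent for elements that are characterised rather than computed: uniqueness turns the
  compatibility of Q with sums and restrictions into additivity and naturality of a choice function,
  which is then a matching family.\<close>

lemma glue:
  assumes F: "psh F" "sheaf_elt F" and R: "R \<in> T A"
    and ex: "\<And>B f. B \<in> Ob a \<Longrightarrow> f \<in> R B \<Longrightarrow> \<exists>y\<in>carrier (FOb F B). Q B f y"
    and uniq: "\<And>B f y y'. B \<in> Ob a \<Longrightarrow> f \<in> R B \<Longrightarrow> y \<in> carrier (FOb F B) \<Longrightarrow> y' \<in> carrier (FOb F B) \<Longrightarrow>
      Q B f y \<Longrightarrow> Q B f y' \<Longrightarrow> y = y'"
    and add: "\<And>B f g y z. B \<in> Ob a \<Longrightarrow> f \<in> R B \<Longrightarrow> g \<in> R B \<Longrightarrow> y \<in> carrier (FOb F B) \<Longrightarrow> z \<in> carrier (FOb F B) \<Longrightarrow>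
      Q B f y \<Longrightarrow> Q B g z \<Longrightarrow> Q B (f \<oplus>\<^bsub>Hm a B A\<^esub> g) (y \<oplus>\<^bsub>FOb F B\<^esub> z)"
    and act: "\<And>B C f g y. B \<in> Ob a \<Longrightarrow> C \<in> Ob a \<Longrightarrow> f \<in> R B \<Longrightarrow> g \<in> hm C B \<Longrightarrow> y \<in> carrier (FOb F B) \<Longrightarrow>
      Q B f y \<Longrightarrow> Q C (Cmp a C B A f g) (FAr F B C g y)"
  obtains x where "x \<in> carrier (FOb F A)" "\<And>B f. B \<in> Ob a \<Longrightarrow> f \<in> R B \<Longrightarrow> Q B f (FAr F A B f x)"
proof -
  note A = T_Ob[OF R] and Rs = T_sieve[OF R]
  define \<sigma> where "\<sigma> = (\<lambda>B f. SOME y. y \<in> carrier (FOb F B) \<and> Q B f y)"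
  have \<sigma>: "\<sigma> B f \<in> carrier (FOb F B)" "Q B f (\<sigma> B f)" if "B \<in> Ob a" "f \<in> R B" for B f
    using someI_ex[of "\<lambda>y. y \<in> carrier (FOb F B) \<and> Q B f y"] ex[OF that] unfolding \<sigma>_def by blast+
  have \<sigma>_eq: "\<sigma> B f = y" if "B \<in> Ob a" "f \<in> R B" "y \<in> carrier (FOb F B)" "Q B f y" for B f y
    using uniq[OF that(1,2) \<sigma>(1)[OF that(1,2)] that(3) \<sigma>(2)[OF that(1,2)] that(4)] .
  have "lin_nat (sieve_presheaf a A R) F \<sigma>"
    unfolding lin_nat_def
  proof (intro conjI ballI; simp)
    fix B f assume B: "B \<in> Ob a" "f \<in> R B"
    show "\<sigma> B f \<in> carrier (FOb F B)" by (rule \<sigma>(1)[OF B])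
    { fix g assume g: "g \<in> R B"
      show "\<sigma> B (f \<oplus>\<^bsub>Hm a B A\<^esub> g) = \<sigma> B f \<oplus>\<^bsub>FOb F B\<^esub> \<sigma> B g"
        by (rule \<sigma>_eq[OF B(1) sieve_add[OF Rs A B(2) g]])
          (use add[OF B g] \<sigma> B g F in auto) }
    fix C g assume C: "C \<in> Ob a" "g \<in> hm C B"
    show "\<sigma> C (Cmp a C B A f g) = FAr F B C g (\<sigma> B f)"
      by (rule \<sigma>_eq[OF C(1) sieve_Cmp[OF Rs B(2) C]]) (use act[OF B(1) C(1) B(2) C(2)] \<sigma>[OF B] B C F in auto)
  qed
  then obtain x where "x \<in> carrier (FOb F A)" "\<forall>B\<in>Ob a. \<forall>f\<in>R B. FAr F A B f x = \<sigma> B f"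
    using F(2) A R unfolding sheaf_elt_def by blast
  then show thesis using that \<sigma> by metis
qed

text \<open>Local surjectivity of \<eta> suffices because the target is a sheaf: the value at y is
  glued from the values of \<phi> at local preimages of y, and \<open>ker\<close> makes these
  independent of the preimages.\<close>

lemma factor:
  assumes F: "psh F" and L: "psh L" and G: "psh G" "sheaf_elt G"
    and \<eta>: "lin_nat F L \<eta>" "locsurj F L \<eta>" and \<phi>: "lin_nat F G \<phi>"
    and ker: "\<And>A x. A \<in> Ob a \<Longrightarrow> x \<in> carrier (FOb F A) \<Longrightarrow> \<eta> A x = \<zero>\<^bsub>FOb L A\<^esub> \<Longrightarrow> \<phi> A x = \<zero>\<^bsub>FOb G A\<^esub>"
  obtains \<psi> where "lin_nat L G \<psi>" "\<And>A x. A \<in> Ob a \<Longrightarrow> x \<in> carrier (FOb F A) \<Longrightarrow> \<psi> A (\<eta> A x) = \<phi> A x"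
proof -
  \<comment> \<open>\<open>W A y z\<close> is the graph of the map to be constructed: on a cover, y
    and z come from a common element of F.\<close>
  define P where "P = (\<lambda>A y z B f. \<exists>x\<in>carrier (FOb F B). \<eta> B x = FAr L A B f y \<and> \<phi> B x = FAr G A B f z)"
  define W where "W = (\<lambda>A y z. locally A (P A y z))"
  have ker': "\<phi> A x = \<phi> A x'"
    if "A \<in> Ob a" "x \<in> carrier (FOb F A)" "x' \<in> carrier (FOb F A)" "\<eta> A x = \<eta> A x'" for A x x'
    using ker[OF that(1), of "x \<ominus>\<^bsub>FOb F A\<^esub> x'"] that F L G(1) \<eta>(1) \<phi>
      lin_nat_zero_neg(3)[OF F L \<eta>(1) that(1-3)] lin_nat_zero_neg(3)[OF F G(1) \<phi> that(1-3)]
      psh_minus_eq_zero[OF L that(1) lin_nat_in[OF \<eta>(1) that(1,2)] lin_nat_in[OF \<eta>(1) that(1,3)]]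
      psh_minus_eq_zero[OF G(1) that(1) lin_nat_in[OF \<phi> that(1,2)] lin_nat_in[OF \<phi> that(1,3)]]
    by simp
  have Wu: "z = z'"
    if A: "A \<in> Ob a" "y \<in> carrier (FOb L A)" and z: "z \<in> carrier (FOb G A)" "z' \<in> carrier (FOb G A)"
      and W: "W A y z" "W A y z'" for A y z z'
  proof (rule sheaf_elt_sep[OF G z])
    show "locally A (\<lambda>B f. FAr G A B f z = FAr G A B f z')"
      by (rule locally_mono[OF locally_conj[OF W[unfolded W_def]]]) (auto simp: P_def, metis ker')
  qed
  have Padd: "P A (y \<oplus>\<^bsub>FOb L A\<^esub> y') (z \<oplus>\<^bsub>FOb G A\<^esub> z') B f" if "P A y z B f" "P A y' z' B f"
    "A \<in> Ob a" "y \<in> carrier (FOb L A)" "y' \<in> carrier (FOb L A)" "z \<in> carrier (FOb G A)" "z' \<in> carrier (FOb G A)"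
    "B \<in> Ob a" "f \<in> hm B A"
    for A y z y' z' B f
  proof -
    obtain x x' where "x\<in>carrier (FOb F B)" "\<eta> B x = FAr L A B f y" "\<phi> B x = FAr G A B f z"
      "x'\<in>carrier (FOb F B)" "\<eta> B x' = FAr L A B f y'" "\<phi> B x' = FAr G A B f z'"
      using \<open>P A y z B f\<close> \<open>P A y' z' B f\<close> unfolding P_def by blast
    then show ?thesis unfolding P_def using F L G that(3-)
      by (intro bexI[of _ "x \<oplus>\<^bsub>FOb F B\<^esub> x'"]) (simp_all add: lin_nat_add[OF \<eta>(1)] lin_nat_add[OF \<phi>] act_add)
  qed
  have Wadd: "W A (y \<oplus>\<^bsub>FOb L A\<^esub> y') (z \<oplus>\<^bsub>FOb G A\<^esub> z')" if "W A y z" "W A y' z'"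
    "A \<in> Ob a" "y \<in> carrier (FOb L A)" "y' \<in> carrier (FOb L A)" "z \<in> carrier (FOb G A)" "z' \<in> carrier (FOb G A)"
    for A y z y' z'
    unfolding W_def
    by (rule locally_mono[OF locally_conj[OF that(1,2)[unfolded W_def]]]) (use that(3-) Padd in blast)
  have Wact: "W B (FAr L A B f y) (FAr G A B f z)" if "W A y z"
    "A \<in> Ob a" "B \<in> Ob a" "f \<in> hm B A" "y \<in> carrier (FOb L A)" "z \<in> carrier (FOb G A)"
    for A B f y z
    unfolding W_def
    by (rule locally_mono[OF locally_pull[OF that(1)[unfolded W_def] that(3,4)]])
      (use that L G in \<open>simp add: P_def act_Cmp\<close>)
  have W\<eta>: "W A (\<eta> A x) (\<phi> A x)" if "A \<in> Ob a" "x \<in> carrier (FOb F A)" for A x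
    unfolding W_def
  proof (rule locally_all[OF that(1)])
    fix B f assume "B \<in> Ob a" "f \<in> hm B A"
    then show "P A (\<eta> A x) (\<phi> A x) B f" unfolding P_def using that F
      by (intro bexI[of _ "FAr F A B f x"]) (simp_all add: lin_nat_act[OF \<eta>(1)] lin_nat_act[OF \<phi>])
  qed
  \<comment> \<open>Over the cover on which y lifts, the related values are glued to some z. The
    definition of W only sees these restrictions, so transitivity of local truth relates y and z
    themselves.\<close>
  have Wex: "\<exists>z\<in>carrier (FOb G A). W A y z" if A: "A \<in> Ob a" and y: "y \<in> carrier (FOb L A)" for A y
  proof -
    obtain R where R: "R \<in> T A"
      "\<And>B f. B \<in> Ob a \<Longrightarrow> f \<in> R B \<Longrightarrow> \<exists>x\<in>carrier (FOb F B). \<eta> B x = FAr L A B f y"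
      using \<eta>(2) A y unfolding locsurj_def locally_def by blast
    have Rh: "\<And>B f. f \<in> R B \<Longrightarrow> f \<in> hm B A" using T_hm[OF R(1)] .
    obtain z where z: "z \<in> carrier (FOb G A)" "\<And>B f. B \<in> Ob a \<Longrightarrow> f \<in> R B \<Longrightarrow> W B (FAr L A B f y) (FAr G A B f z)"
    proof (rule glue[OF G R(1), of "\<lambda>B f z. W B (FAr L A B f y) z"])
      fix B f assume B: "B \<in> Ob a" "f \<in> R B"
      show "\<exists>z\<in>carrier (FOb G B). W B (FAr L A B f y) z"
        using R(2)[OF B] W\<eta>[OF B(1)] lin_nat_in[OF \<phi> B(1)] by metis
    next
      fix B f z z' assume B: "B \<in> Ob a" "f \<in> R B" "z \<in> carrier (FOb G B)" "z' \<in> carrier (FOb G B)"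
        "W B (FAr L A B f y) z" "W B (FAr L A B f y) z'"
      show "z = z'" by (rule Wu[OF B(1) _ B(3-)]) (use A B y L Rh in simp)
    next
      fix B f g z z' assume B: "B \<in> Ob a" "f \<in> R B" "g \<in> R B" "z \<in> carrier (FOb G B)" "z' \<in> carrier (FOb G B)"
        "W B (FAr L A B f y) z" "W B (FAr L A B g y) z'"
      show "W B (FAr L A B (f \<oplus>\<^bsub>Hm a B A\<^esub> g) y) (z \<oplus>\<^bsub>FOb G B\<^esub> z')"
        using Wadd[OF B(6,7,1) _ _ B(4,5)] A B y L Rh by (simp add: act_add_left)
    next
      fix B C f g z assume B: "B \<in> Ob a" "C \<in> Ob a" "f \<in> R B" "g \<in> hm C B" "z \<in> carrier (FOb G B)"
        "W B (FAr L A B f y) z"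
      show "W C (FAr L A C (Cmp a C B A f g) y) (FAr G B C g z)"
        using Wact[OF B(6,1,2,4) _ B(5)] A B y L Rh by (simp add: act_Cmp)
    qed blast
    have sv: "sieve K a A (sieve_of A (P A y z))"
    proof (rule sieve_of_sieveI[OF A])
      fix B assume B: "B \<in> Ob a"
      show "P A y z B \<zero>\<^bsub>Hm a B A\<^esub>" unfolding P_def
        using act_zero_neg_left(1)[OF L A B y] act_zero_neg_left(1)[OF G(1) A B z(1)]
          lin_nat_zero_neg(1)[OF F L \<eta>(1) B] lin_nat_zero_neg(1)[OF F G(1) \<phi> B] F B
        by (intro bexI[of _ "\<zero>\<^bsub>FOb F B\<^esub>"]) auto
    next
      fix B f g assume B: "B \<in> Ob a" "f \<in> hm B A" "g \<in> hm B A" and "P A y z B f" "P A y z B g"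
      then obtain x x' where "x\<in>carrier (FOb F B)" "\<eta> B x = FAr L A B f y" "\<phi> B x = FAr G A B f z"
        "x'\<in>carrier (FOb F B)" "\<eta> B x' = FAr L A B g y" "\<phi> B x' = FAr G A B g z"
        unfolding P_def by blast
      then show "P A y z B (f \<oplus>\<^bsub>Hm a B A\<^esub> g)" unfolding P_def using F L G A B y z
        by (intro bexI[of _ "x \<oplus>\<^bsub>FOb F B\<^esub> x'"]) (simp_all add: lin_nat_add[OF \<eta>(1)] lin_nat_add[OF \<phi>] act_add_left)
    next
      fix B C f g assume B: "B \<in> Ob a" "C \<in> Ob a" "f \<in> hm B A" "P A y z B f" "g \<in> hm C B"
      then obtain x where "x\<in>carrier (FOb F B)" "\<eta> B x = FAr L A B f y" "\<phi> B x = FAr G A B f z"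
        unfolding P_def by blast
      then show "P A y z C (Cmp a C B A f g)" unfolding P_def using F L G A B y z
        by (intro bexI[of _ "FAr F B C g x"]) (simp_all add: lin_nat_act[OF \<eta>(1)] lin_nat_act[OF \<phi>] act_Cmp)
    qed
    have "locally A (P A y z)"
    proof (rule locally_trans[OF sv], rule locallyI[OF R(1)])
      fix B f assume B: "B \<in> Ob a" "f \<in> R B"
      show "locally B (\<lambda>C g. P A y z C (Cmp a C B A f g))"
        by (rule locally_mono[OF z(2)[OF B, unfolded W_def]])
          (use A B y z L G Rh in \<open>simp add: P_def act_Cmp\<close>)
    qed
    then show ?thesis using z(1) unfolding W_def by blast
  qed
  define \<psi> where "\<psi> = (\<lambda>A y. SOME z. z \<in> carrier (FOb G A) \<and> W A y z)"
  have \<psi>: "\<psi> A y \<in> carrier (FOb G A)" "W A y (\<psi> A y)" if "A \<in> Ob a" "y \<in> carrier (FOb L A)" for A y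
    using someI_ex[of "\<lambda>z. z \<in> carrier (FOb G A) \<and> W A y z"] Wex[OF that] unfolding \<psi>_def by blast+
  have \<psi>_eq: "\<psi> A y = z" if "A \<in> Ob a" "y \<in> carrier (FOb L A)" "z \<in> carrier (FOb G A)" "W A y z" for A y z
    using Wu[OF that(1,2) \<psi>(1)[OF that(1,2)] that(3) \<psi>(2)[OF that(1,2)] that(4)] .
  show thesis
  proof (rule that[of \<psi>])
    show "lin_nat L G \<psi>" unfolding lin_nat_def
      using \<psi> G L by (auto intro!: \<psi>_eq Wadd Wact)
    show "\<psi> A (\<eta> A x) = \<phi> A x" if "A \<in> Ob a" "x \<in> carrier (FOb F A)" for A x
      using \<psi>_eq[OF that(1) _ _ W\<eta>[OF that]] lin_nat_in[OF \<eta>(1) that] lin_nat_in[OF \<phi> that] by simp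
  qed
qed

text \<open>The two maps agree on a cover over which y lifts, and the target is separated. This is
  the source of the uniqueness claims for maps out of a sheaf built by hand.\<close>

lemma locsurj_cancel:
  assumes L: "psh L" and G: "psh G" "sheaf_elt G" and \<eta>: "locsurj F L \<eta>"
    and \<psi>: "lin_nat L G \<psi>" "lin_nat L G \<psi>'"
    and eq: "\<And>A x. A \<in> Ob a \<Longrightarrow> x \<in> carrier (FOb F A) \<Longrightarrow> \<psi> A (\<eta> A x) = \<psi>' A (\<eta> A x)"
    and A: "A \<in> Ob a" and y: "y \<in> carrier (FOb L A)"
  shows "\<psi> A y = \<psi>' A y"
proof (rule sheaf_elt_sep[OF G lin_nat_in[OF \<psi>(1) A y] lin_nat_in[OF \<psi>(2) A y]])
  show "locally A (\<lambda>B f. FAr G A B f (\<psi> A y) = FAr G A B f (\<psi>' A y))"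
    by (rule locally_mono[OF \<eta>[unfolded locsurj_def, rule_format, OF A y]])
      (use eq A y in \<open>auto simp: lin_nat_act[OF \<psi>(1), symmetric] lin_nat_act[OF \<psi>(2), symmetric], metis\<close>)
qed

text \<open>The smallest closed subpresheaf: an element that vanishes on a cover lies locally in
  every closed subpresheaf, hence lies in it. Dividing by it gives the sheafification.\<close>

definition torsion :: "('o, 'v, ('k, 'w) module, 'w \<Rightarrow> 'w) linfun \<Rightarrow> 'o \<Rightarrow> 'w set" where
  "torsion F A = {x \<in> carrier (FOb F A). locally A (\<lambda>B f. FAr F A B f x = \<zero>\<^bsub>FOb F B\<^esub>)}"

lemma closed_sub_torsion:
  assumes F: "psh F" shows "closed_sub F (torsion F)"
  unfolding closed_sub_def
proof (intro conjI ballI impI)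
  fix A assume A: "A \<in> Ob a"
  show "torsion F A \<subseteq> carrier (FOb F A)" by (auto simp: torsion_def)
  show "\<zero>\<^bsub>FOb F A\<^esub> \<in> torsion F A"
    using A F by (auto simp: torsion_def act_zero_neg(1) intro: locally_all)
  {
    fix x y assume "x \<in> torsion F A" "y \<in> torsion F A"
    then have *: "x \<in> carrier (FOb F A)" "y \<in> carrier (FOb F A)"
      "locally A (\<lambda>B f. FAr F A B f x = \<zero>\<^bsub>FOb F B\<^esub>)" "locally A (\<lambda>B f. FAr F A B f y = \<zero>\<^bsub>FOb F B\<^esub>)"
      by (auto simp: torsion_def)
    have "locally A (\<lambda>B f. FAr F A B f (x \<oplus>\<^bsub>FOb F A\<^esub> y) = \<zero>\<^bsub>FOb F B\<^esub>)"
      by (rule locally_mono[OF locally_conj[OF *(3,4)]]) (use * A F in \<open>simp add: act_add\<close>)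
    then show "x \<oplus>\<^bsub>FOb F A\<^esub> y \<in> torsion F A" using * A F by (simp add: torsion_def)
  }
  {
    fix B f x assume B: "B \<in> Ob a" "f \<in> hm B A" and "x \<in> torsion F A"
    then have *: "x \<in> carrier (FOb F A)" "locally A (\<lambda>B f. FAr F A B f x = \<zero>\<^bsub>FOb F B\<^esub>)" by (auto simp: torsion_def)
    have "locally B (\<lambda>C g. FAr F B C g (FAr F A B f x) = \<zero>\<^bsub>FOb F C\<^esub>)"
      by (rule locally_mono[OF locally_pull[OF *(2) B]]) (use * A B F in \<open>simp add: act_Cmp\<close>)
    then show "FAr F A B f x \<in> torsion F B" using * A B F by (simp add: torsion_def)
  }
  fix x assume x: "x \<in> carrier (FOb F A)" and loc: "locally A (\<lambda>B f. FAr F A B f x \<in> torsion F B)"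
  have sv: "sieve K a A (sieve_of A (\<lambda>B f. FAr F A B f x = \<zero>\<^bsub>FOb F B\<^esub>))"
    by (rule sieve_of_sieveI[OF A])
      (use F A x in \<open>auto simp: act_zero_neg_left(1) act_add_left act_Cmp act_zero_neg(1)\<close>)
  have "locally A (\<lambda>B f. FAr F A B f x = \<zero>\<^bsub>FOb F B\<^esub>)"
  proof (rule locally_trans[OF sv locally_mono[OF loc]])
    fix B f assume B: "B \<in> Ob a" "f \<in> hm B A" "FAr F A B f x \<in> torsion F B"
    then have "locally B (\<lambda>C g. FAr F B C g (FAr F A B f x) = \<zero>\<^bsub>FOb F C\<^esub>)" by (simp add: torsion_def)
    then show "locally B (\<lambda>C g. FAr F A C (Cmp a C B A f g) x = \<zero>\<^bsub>FOb F C\<^esub>)"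
      by (rule locally_mono) (use A B x F in \<open>simp add: act_Cmp\<close>)
  qed
  then show "x \<in> torsion F A" using x by (simp add: torsion_def)
qed

text \<open>Dividing G by this subpresheaf yields the cokernel of \<phi> among sheaves. Closedness
  is transitivity of local truth for the morphisms along which an element lifts.\<close>

lemma closed_sub_locimg:
  assumes F: "psh F" and G: "psh G" and \<phi>: "lin_nat F G \<phi>"
  shows "closed_sub G (\<lambda>A. {y \<in> carrier (FOb G A). locally A (\<lambda>B f. \<exists>x\<in>carrier (FOb F B). \<phi> B x = FAr G A B f y)})"
    (is "closed_sub G ?N")
  unfolding closed_sub_def
proof (intro conjI ballI impI)
  let ?P = "\<lambda>A y B f. \<exists>x\<in>carrier (FOb F B). \<phi> B x = FAr G A B f y"
  fix A assume A: "A \<in> Ob a"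
  show "?N A \<subseteq> carrier (FOb G A)" by auto
  have "locally A (?P A \<zero>\<^bsub>FOb G A\<^esub>)"
  proof (rule locally_all[OF A])
    fix B f assume B: "B \<in> Ob a" "f \<in> hm B A"
    then show "?P A \<zero>\<^bsub>FOb G A\<^esub> B f"
      using lin_nat_zero_neg(1)[OF F G \<phi> B(1)] act_zero_neg(1)[OF G A B] F by (metis psh_zero_in)
  qed
  then show "\<zero>\<^bsub>FOb G A\<^esub> \<in> ?N A" using A G by simp
  {
    fix y z assume "y \<in> ?N A" "z \<in> ?N A"
    then have *: "y \<in> carrier (FOb G A)" "z \<in> carrier (FOb G A)" "locally A (?P A y)" "locally A (?P A z)" by auto
    have "locally A (?P A (y \<oplus>\<^bsub>FOb G A\<^esub> z))"
    proof (rule locally_mono[OF locally_conj[OF *(3,4)]])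
      fix B f assume B: "B \<in> Ob a" "f \<in> hm B A" and "?P A y B f \<and> ?P A z B f"
      then obtain x x' where "x\<in>carrier (FOb F B)" "\<phi> B x = FAr G A B f y"
        "x'\<in>carrier (FOb F B)" "\<phi> B x' = FAr G A B f z" by blast
      then show "?P A (y \<oplus>\<^bsub>FOb G A\<^esub> z) B f" using A B * F G
        by (intro bexI[of _ "x \<oplus>\<^bsub>FOb F B\<^esub> x'"]) (simp_all add: lin_nat_add[OF \<phi>] act_add)
    qed
    then show "y \<oplus>\<^bsub>FOb G A\<^esub> z \<in> ?N A" using * A G by simp
  }
  {
    fix B f y assume B: "B \<in> Ob a" "f \<in> hm B A" and "y \<in> ?N A"
    then have *: "y \<in> carrier (FOb G A)" "locally A (?P A y)" by auto
    have "locally B (?P B (FAr G A B f y))"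
      by (rule locally_mono[OF locally_pull[OF *(2) B]]) (use * A B G in \<open>simp add: act_Cmp\<close>)
    then show "FAr G A B f y \<in> ?N B" using * A B G by simp
  }
  fix y assume y: "y \<in> carrier (FOb G A)" and loc: "locally A (\<lambda>B f. FAr G A B f y \<in> ?N B)"
  have sv: "sieve K a A (sieve_of A (?P A y))"
  proof (rule sieve_of_sieveI[OF A])
    fix B assume B: "B \<in> Ob a"
    show "?P A y B \<zero>\<^bsub>Hm a B A\<^esub>"
      using act_zero_neg_left(1)[OF G A B y] lin_nat_zero_neg(1)[OF F G \<phi> B] F B
      by (intro bexI[of _ "\<zero>\<^bsub>FOb F B\<^esub>"]) auto
  next
    fix B f g assume B: "B \<in> Ob a" "f \<in> hm B A" "g \<in> hm B A" and "?P A y B f" "?P A y B g"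
    then obtain x x' where "x\<in>carrier (FOb F B)" "\<phi> B x = FAr G A B f y"
      "x'\<in>carrier (FOb F B)" "\<phi> B x' = FAr G A B g y" by blast
    then show "?P A y B (f \<oplus>\<^bsub>Hm a B A\<^esub> g)" using A B y F G
      by (intro bexI[of _ "x \<oplus>\<^bsub>FOb F B\<^esub> x'"]) (simp_all add: lin_nat_add[OF \<phi>] act_add_left)
  next
    fix B C f g assume B: "B \<in> Ob a" "C \<in> Ob a" "f \<in> hm B A" "?P A y B f" "g \<in> hm C B"
    then obtain x where "x\<in>carrier (FOb F B)" "\<phi> B x = FAr G A B f y" by blast
    then show "?P A y C (Cmp a C B A f g)" using A B y F G
      by (intro bexI[of _ "FAr F B C g x"]) (simp_all add: lin_nat_act[OF \<phi>] act_Cmp)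
  qed
  have "locally A (?P A y)"
  proof (rule locally_trans[OF sv locally_mono[OF loc]])
    fix B f assume B: "B \<in> Ob a" "f \<in> hm B A" "FAr G A B f y \<in> ?N B"
    then have "locally B (?P B (FAr G A B f y))" by simp
    then show "locally B (\<lambda>C g. ?P A y C (Cmp a C B A f g))"
      by (rule locally_mono) (use A B y G in \<open>simp add: act_Cmp\<close>)
  qed
  then show "y \<in> ?N A" using y by simp
qed

section \<open>Change of carrier types\<close>

lemma lin_nat_inv:
  assumes F: "psh F" and G: "psh G" and \<phi>: "lin_nat F G \<phi>"
    and bij: "\<And>A. A \<in> Ob a \<Longrightarrow> bij_betw (\<phi> A) (carrier (FOb F A)) (carrier (FOb G A))"
  shows "lin_nat G F (\<lambda>A. inv_into (carrier (FOb F A)) (\<phi> A))"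
proof -
  let ?d = "\<lambda>A. inv_into (carrier (FOb F A)) (\<phi> A)"
  have d: "?d A y \<in> carrier (FOb F A)" "\<phi> A (?d A y) = y" if "A \<in> Ob a" "y \<in> carrier (FOb G A)" for A y
    using bij[OF that(1)] that(2) by (auto simp: bij_betw_def inv_into_into f_inv_into_f)
  have d': "?d A (\<phi> A x) = x" if "A \<in> Ob a" "x \<in> carrier (FOb F A)" for A x
    using bij[OF that(1)] that(2) by (simp add: bij_betw_def)
  have eq: "?d A y = x" if "A \<in> Ob a" "x \<in> carrier (FOb F A)" "\<phi> A x = y" for A x y
    using d'[OF that(1,2)] that(3) by simp
  show ?thesis unfolding lin_nat_def
    using d F G by (auto intro!: eq simp: lin_nat_add[OF \<phi>] lin_nat_act[OF \<phi>])
qed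

lemma sheaf_elt_iso:
  assumes F: "psh F" "sheaf_elt F" and G: "psh G" and \<phi>: "lin_nat F G \<phi>"
    and bij: "\<And>A. A \<in> Ob a \<Longrightarrow> bij_betw (\<phi> A) (carrier (FOb F A)) (carrier (FOb G A))"
  shows "sheaf_elt G"
  unfolding sheaf_elt_def
proof (intro ballI allI impI)
  fix A R \<sigma> assume A: "A \<in> Ob a" and R: "R \<in> T A" and \<sigma>: "lin_nat (sieve_presheaf a A R) G \<sigma>"
  define d where "d = (\<lambda>A. inv_into (carrier (FOb F A)) (\<phi> A))"
  have d: "d A y \<in> carrier (FOb F A)" "\<phi> A (d A y) = y" if "A \<in> Ob a" "y \<in> carrier (FOb G A)" for A y
    using bij[OF that(1)] that(2) by (auto simp: bij_betw_def inv_into_into f_inv_into_f d_def)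
  have "lin_nat (sieve_presheaf a A R) F (\<lambda>B f. d B (\<sigma> B f))"
    using lin_nat_comp[OF \<sigma> lin_nat_inv[OF F(1) G \<phi> bij]] unfolding d_def .
  then have "\<exists>!x. x \<in> carrier (FOb F A) \<and> (\<forall>B\<in>Ob a. \<forall>f\<in>R B. FAr F A B f x = d B (\<sigma> B f))"
    using F(2) A R unfolding sheaf_elt_def by blast
  then obtain x where x: "x \<in> carrier (FOb F A)" "\<forall>B\<in>Ob a. \<forall>f\<in>R B. FAr F A B f x = d B (\<sigma> B f)"
    and u: "\<And>x'. x' \<in> carrier (FOb F A) \<and> (\<forall>B\<in>Ob a. \<forall>f\<in>R B. FAr F A B f x' = d B (\<sigma> B f)) \<Longrightarrow> x' = x" by blast
  have \<sigma>_in: "\<sigma> B f \<in> carrier (FOb G B)" if "B \<in> Ob a" "f \<in> R B" for B f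
    using lin_nat_in[OF \<sigma>, of B f] that by simp
  have d': "d B (\<phi> B z) = z" if "B \<in> Ob a" "z \<in> carrier (FOb F B)" for B z
    using bij[OF that(1)] that(2) by (simp add: bij_betw_def d_def)
  show "\<exists>!x. x \<in> carrier (FOb G A) \<and> (\<forall>B\<in>Ob a. \<forall>f\<in>R B. FAr G A B f x = \<sigma> B f)"
  proof (rule ex1I[of _ "\<phi> A x"])
    show "\<phi> A x \<in> carrier (FOb G A) \<and> (\<forall>B\<in>Ob a. \<forall>f\<in>R B. FAr G A B f (\<phi> A x) = \<sigma> B f)"
      using x A lin_nat_in[OF \<phi> A x(1)] lin_nat_act[OF \<phi> A _ _ x(1)] T_hm[OF R] d(2)[OF _ \<sigma>_in] by metis
    fix y assume y: "y \<in> carrier (FOb G A) \<and> (\<forall>B\<in>Ob a. \<forall>f\<in>R B. FAr G A B f y = \<sigma> B f)"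
    have "d A y = x"
    proof (rule u, intro conjI ballI)
      show "d A y \<in> carrier (FOb F A)" using d(1) A y by blast
      fix B f assume B: "B \<in> Ob a" "f \<in> R B"
      then have f: "f \<in> hm B A" using T_hm[OF R] by blast
      have "\<phi> B (FAr F A B f (d A y)) = \<sigma> B f"
        using lin_nat_act[OF \<phi> A B(1) f d(1)[OF A]] d(2)[OF A] y B by simp
      then show "FAr F A B f (d A y) = d B (\<sigma> B f)"
        using d'[OF B(1), of "FAr F A B f (d A y)"] d(1)[OF A] y F A B f by simp
    qed
    then show "y = \<phi> A x" using d(2)[OF A] y by auto
  qed
qed

text \<open>The structure of F moved along the componentwise injections c. Restriction maps are cut
  down to the new carriers so that the result can be an object of \<open>PSh K a\<close>.\<close>

definition transp :: "('o \<Rightarrow> 'w \<Rightarrow> 'u) \<Rightarrow> ('o, 'v, ('k, 'w) module, 'w \<Rightarrow> 'w) linfun \<Rightarrow>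
    ('o, 'v, ('k, 'u) module, 'u \<Rightarrow> 'u) linfun" where
  "transp c F = (let d = (\<lambda>A. inv_into (carrier (FOb F A)) (c A)) in
     \<lparr>FOb = (\<lambda>A. \<lparr>carrier = c A ` carrier (FOb F A), mult = undefined, one = undefined,
        zero = c A \<zero>\<^bsub>FOb F A\<^esub>, add = (\<lambda>x y. c A (d A x \<oplus>\<^bsub>FOb F A\<^esub> d A y)),
        smult = (\<lambda>r x. c A (r \<odot>\<^bsub>FOb F A\<^esub> d A x))\<rparr>),
      FAr = (\<lambda>A B f. \<lambda>x\<in>c A ` carrier (FOb F A). c B (FAr F A B f (d A x)))\<rparr>)"

lemma transp_simps:
  assumes "inj_on (c A) (carrier (FOb F A))"
  shows "carrier (FOb (transp c F) A) = c A ` carrier (FOb F A)"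
    "\<zero>\<^bsub>FOb (transp c F) A\<^esub> = c A \<zero>\<^bsub>FOb F A\<^esub>"
    "x \<in> carrier (FOb F A) \<Longrightarrow> y \<in> carrier (FOb F A) \<Longrightarrow> c A x \<oplus>\<^bsub>FOb (transp c F) A\<^esub> c A y = c A (x \<oplus>\<^bsub>FOb F A\<^esub> y)"
    "x \<in> carrier (FOb F A) \<Longrightarrow> r \<odot>\<^bsub>FOb (transp c F) A\<^esub> c A x = c A (r \<odot>\<^bsub>FOb F A\<^esub> x)"
    "x \<in> carrier (FOb F A) \<Longrightarrow> FAr (transp c F) A B f (c A x) = c B (FAr F A B f x)"
  using assms by (simp_all add: transp_def Let_def)

lemma psh_transp:
  assumes F: "psh F" and inj: "\<And>A. A \<in> Ob a \<Longrightarrow> inj_on (c A) (carrier (FOb F A))"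
  shows "psh (transp c F)"
proof -
  have grp: "abelian_group (FOb (transp c F) A)" if A: "A \<in> Ob a" for A
  proof -
    interpret M: module K "FOb F A" by (rule psh_mod[OF F A])
    show ?thesis
    proof (rule abelian_groupI)
      fix x assume "x \<in> carrier (FOb (transp c F) A)"
      then obtain x' where x': "x' \<in> carrier (FOb F A)" "x = c A x'" using transp_simps(1)[of c A F, OF inj[OF A]] by blast
      then show "\<exists>y\<in>carrier (FOb (transp c F) A). y \<oplus>\<^bsub>FOb (transp c F) A\<^esub> x = \<zero>\<^bsub>FOb (transp c F) A\<^esub>"
        by (intro bexI[of _ "c A (\<ominus>\<^bsub>FOb F A\<^esub> x')"]) (simp_all add: transp_simps inj A M.l_neg)
    qed (auto simp: transp_simps inj A M.a_ac)
  qed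
  have "module K (FOb (transp c F) A)" if A: "A \<in> Ob a" for A
  proof -
    interpret M: module K "FOb F A" by (rule psh_mod[OF F A])
    show ?thesis
      by (rule moduleI[OF cr grp[OF A]])
        (auto simp: transp_simps inj A M.smult_l_distr M.smult_r_distr M.smult_assoc1)
  qed
  then show ?thesis
    unfolding psh_def using F
    by (auto simp: transp_simps inj act_add act_Cmp act_add_left act_smult_left)
qed

lemma transp_bij:
  assumes F: "psh F" and inj: "\<And>A. A \<in> Ob a \<Longrightarrow> inj_on (c A) (carrier (FOb F A))"
  shows "lin_nat F (transp c F) c"
    and "\<And>A. A \<in> Ob a \<Longrightarrow> bij_betw (c A) (carrier (FOb F A)) (carrier (FOb (transp c F) A))"
  unfolding lin_nat_def using inj by (auto simp: transp_simps bij_betw_def)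

end

section \<open>Dictionary for presheaf and sheaf categories\<close>

context lin_cat
begin

abbreviation psh_hom :: "('o, 'v, 'k) presheaf \<Rightarrow> ('o, 'v, 'k) presheaf \<Rightarrow> ('o \<Rightarrow> 'v \<Rightarrow> 'v) set" where
  "psh_hom F G \<equiv> hom_set (PSh K a) F G"

text \<open>The extensional normal form of an elementwise transformation. By
  \<open>psh_hom_iff\<close> the morphisms of \<open>PSh K a\<close> are the elementwise
  transformations in this form.\<close>

definition res_nat :: "('o, 'v, ('k, 'w) module, 'w \<Rightarrow> 'w) linfun \<Rightarrow> ('o \<Rightarrow> 'w \<Rightarrow> 'u) \<Rightarrow> 'o \<Rightarrow> 'w \<Rightarrow> 'u" where
  "res_nat F \<phi> = (\<lambda>A\<in>Ob a. \<lambda>x\<in>carrier (FOb F A). \<phi> A x)"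

lemma res_nat_apply [simp]: "A \<in> Ob a \<Longrightarrow> x \<in> carrier (FOb F A) \<Longrightarrow> res_nat F \<phi> A x = \<phi> A x"
  by (simp add: res_nat_def)

lemma opcat_simps [simp]:
  "Ob (opcat C) = Ob C" "Hm (opcat C) X Y = Hm C Y X" "Cmp (opcat C) X Y Z g f = Cmp C Z Y X f g"
  "Idt (opcat C) = Idt C"
  by (simp_all add: opcat_def)

text \<open>Besides extensionality, the only demand of \<open>Mod\<close> that is not literally part
  of \<open>psh\<close> is compatibility of restriction with scalars, which is
  \<open>act_smult\<close>.\<close>

lemma PSh_Ob_iff:
  "F \<in> Ob (PSh K a) \<longleftrightarrow> psh F \<and> (\<forall>A\<in>Ob a. \<forall>B\<in>Ob a. \<forall>f\<in>hm B A. FAr F A B f \<in> extensional (carrier (FOb F A)))"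
proof
  assume "F \<in> Ob (PSh K a)"
  then have L: "linear_functor K (opcat a) (Mod K) F" by (simp add: PSh_def fun_cat_def)
  note L' = L[unfolded linear_functor_def Mod_def lin_maps_def, simplified]
  have mod: "A \<in> Ob a \<Longrightarrow> module K (FOb F A)" for A using L'[THEN conjunct1] by blast
  have lin: "FAr F A B f \<in> carrier (FOb F A) \<rightarrow>\<^sub>E carrier (FOb F B)"
    "x \<in> carrier (FOb F A) \<Longrightarrow> y \<in> carrier (FOb F A) \<Longrightarrow>
      FAr F A B f (x \<oplus>\<^bsub>FOb F A\<^esub> y) = FAr F A B f x \<oplus>\<^bsub>FOb F B\<^esub> FAr F A B f y"
    if "A \<in> Ob a" "B \<in> Ob a" "f \<in> hm B A" for A B f x y
    using L'[THEN conjunct2, THEN conjunct1] that by blast+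
  have Id: "FAr F A A (Idt a A) = (\<lambda>x\<in>carrier (FOb F A). x)" if "A \<in> Ob a" for A
    using L'[THEN conjunct2, THEN conjunct2, THEN conjunct1] that by blast
  have comp: "FAr F A C (Cmp a C B A f g) = compose (carrier (FOb F A)) (FAr F B C g) (FAr F A B f)"
    if "A \<in> Ob a" "B \<in> Ob a" "C \<in> Ob a" "f \<in> hm B A" "g \<in> hm C B" for A B C f g
    using L'[THEN conjunct2, THEN conjunct2, THEN conjunct2, THEN conjunct1] that by blast
  have add: "FAr F A B (f \<oplus>\<^bsub>Hm a B A\<^esub> g) = (\<lambda>x\<in>carrier (FOb F A). FAr F A B f x \<oplus>\<^bsub>FOb F B\<^esub> FAr F A B g x)"
    if "A \<in> Ob a" "B \<in> Ob a" "f \<in> hm B A" "g \<in> hm B A" for A B f g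
    using L'[THEN conjunct2, THEN conjunct2, THEN conjunct2, THEN conjunct2, THEN conjunct1] that by blast
  have sm: "FAr F A B (r \<odot>\<^bsub>Hm a B A\<^esub> f) = (\<lambda>x\<in>carrier (FOb F A). r \<odot>\<^bsub>FOb F B\<^esub> FAr F A B f x)"
    if "A \<in> Ob a" "B \<in> Ob a" "f \<in> hm B A" "r \<in> carrier K" for A B f r
    using L'[THEN conjunct2, THEN conjunct2, THEN conjunct2, THEN conjunct2, THEN conjunct2] that by blast
  show "psh F \<and> (\<forall>A\<in>Ob a. \<forall>B\<in>Ob a. \<forall>f\<in>hm B A. FAr F A B f \<in> extensional (carrier (FOb F A)))"
    unfolding psh_def using mod lin Id comp add sm by (auto simp: compose_def PiE_def Pi_def)
next
  assume "psh F \<and> (\<forall>A\<in>Ob a. \<forall>B\<in>Ob a. \<forall>f\<in>hm B A. FAr F A B f \<in> extensional (carrier (FOb F A)))"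
  then have F: "psh F"
    and ext: "\<And>A B f. A \<in> Ob a \<Longrightarrow> B \<in> Ob a \<Longrightarrow> f \<in> hm B A \<Longrightarrow> FAr F A B f \<in> extensional (carrier (FOb F A))"
    by auto
  have "linear_functor K (opcat a) (Mod K) F"
    unfolding linear_functor_def
    by (intro conjI ballI; simp add: Mod_def lin_maps_def)
      (auto simp: psh_mod[OF F] act_in[OF F] act_add[OF F] act_smult[OF F] act_Idt[OF F] act_Cmp[OF F] act_add_left[OF F]
        act_smult_left[OF F] PiE_def ext compose_def intro!: extensionalityI[OF ext])
  then show "F \<in> Ob (PSh K a)" by (simp add: PSh_def fun_cat_def)
qed

lemma PSh_psh: "F \<in> Ob (PSh K a) \<Longrightarrow> psh F"
  using PSh_Ob_iff by blast

lemma psh_hom_iff: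
  assumes F: "psh F" and G: "psh G"
  shows "\<phi> \<in> psh_hom F G \<longleftrightarrow> lin_nat F G \<phi> \<and> res_nat F \<phi> = \<phi>"
proof
  assume "\<phi> \<in> psh_hom F G"
  then have L: "\<phi> \<in> nat_trans (opcat a) (Mod K) F G" by (simp add: PSh_def fun_cat_def)
  then have 1: "\<phi> \<in> (\<Pi>\<^sub>E A\<in>Ob a. lin_maps K (FOb F A) (FOb G A))"
    and 2: "\<And>A B f. A \<in> Ob a \<Longrightarrow> B \<in> Ob a \<Longrightarrow> f \<in> hm B A \<Longrightarrow>
       compose (carrier (FOb F A)) (\<phi> B) (FAr F A B f) = compose (carrier (FOb F A)) (FAr G A B f) (\<phi> A)"
    by (auto simp: nat_trans_def Mod_def)
  have 3: "\<phi> B (FAr F A B f x) = FAr G A B f (\<phi> A x)"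
    if "A \<in> Ob a" "B \<in> Ob a" "f \<in> hm B A" "x \<in> carrier (FOb F A)" for A B f x
    using fun_cong[OF 2[OF that(1-3)], of x] that by (simp add: compose_def)
  have 4: "\<phi> A \<in> lin_maps K (FOb F A) (FOb G A)" if "A \<in> Ob a" for A using 1 that by blast
  show "lin_nat F G \<phi> \<and> res_nat F \<phi> = \<phi>"
  proof
    have "\<phi> A x \<in> carrier (FOb G A)" if "A \<in> Ob a" "x \<in> carrier (FOb F A)" for A x
      using 4[OF that(1)] that(2) unfolding lin_maps_def by blast
    then show "lin_nat F G \<phi>" unfolding lin_nat_def using 3 4 by (auto simp: lin_maps_def)
    show "res_nat F \<phi> = \<phi>"
    proof
      fix A show "res_nat F \<phi> A = \<phi> A"
        using 1 4[of A] by (cases "A \<in> Ob a") (auto simp: res_nat_def lin_maps_def PiE_def extensional_def)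
    qed
  qed
next
  assume "lin_nat F G \<phi> \<and> res_nat F \<phi> = \<phi>"
  then have \<phi>: "lin_nat F G \<phi>" and r: "res_nat F \<phi> = \<phi>" by auto
  have e1: "\<phi> \<in> extensional (Ob a)" by (subst r[symmetric]) (simp add: res_nat_def)
  have e2: "\<phi> A \<in> extensional (carrier (FOb F A))" if "A \<in> Ob a" for A
    by (subst r[symmetric]) (simp add: res_nat_def that)
  show "\<phi> \<in> psh_hom F G"
    using e1 e2 by (auto simp: PSh_def fun_cat_def nat_trans_def Mod_def lin_maps_def PiE_def lin_nat_in[OF \<phi>] lin_nat_add[OF \<phi>]
        lin_nat_smult[OF F G \<phi>] lin_nat_act[OF \<phi>] act_in[OF F] compose_def intro!: restrict_ext)
qed

lemma res_nat_hom:
  assumes "psh F" "psh G" "lin_nat F G \<phi>"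
  shows "res_nat F \<phi> \<in> psh_hom F G"
  unfolding psh_hom_iff[OF assms(1,2)]
proof
  show "lin_nat F G (res_nat F \<phi>)" using assms unfolding lin_nat_def by simp
  show "res_nat F (res_nat F \<phi>) = res_nat F \<phi>" by (auto simp: res_nat_def fun_eq_iff)
qed

lemma hom_lin_nat: "psh F \<Longrightarrow> psh G \<Longrightarrow> \<phi> \<in> psh_hom F G \<Longrightarrow> lin_nat F G \<phi>"
  using psh_hom_iff by blast

lemma psh_hom_eqI:
  assumes "psh F" "psh G" "\<phi> \<in> psh_hom F G" "\<psi> \<in> psh_hom F G"
    and "\<And>A x. A \<in> Ob a \<Longrightarrow> x \<in> carrier (FOb F A) \<Longrightarrow> \<phi> A x = \<psi> A x"
  shows "\<phi> = \<psi>"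
proof -
  have "res_nat F \<phi> = res_nat F \<psi>" using assms(5) by (auto simp: res_nat_def fun_eq_iff)
  then show ?thesis using assms(3,4) psh_hom_iff[OF assms(1,2)] by metis
qed

lemma PSh_Cmp: "Cmp (PSh K a) F G H \<psi> \<phi> = res_nat F (\<lambda>A x. \<psi> A (\<phi> A x))"
  by (auto simp: PSh_def fun_cat_def Mod_def res_nat_def compose_def fun_eq_iff)

lemma PSh_Cmp_apply [simp]:
  "A \<in> Ob a \<Longrightarrow> x \<in> carrier (FOb F A) \<Longrightarrow> Cmp (PSh K a) F G H \<psi> \<phi> A x = \<psi> A (\<phi> A x)"
  by (simp add: PSh_Cmp)

lemma PSh_Cmp_in:
  assumes "psh F" "psh G" "psh H" "\<phi> \<in> psh_hom F G" "\<psi> \<in> psh_hom G H"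
  shows "Cmp (PSh K a) F G H \<psi> \<phi> \<in> psh_hom F H"
  unfolding PSh_Cmp
  using assms by (intro res_nat_hom lin_nat_comp[of F G _ H]) (auto simp: psh_hom_iff)

lemma PSh_ops:
  "\<zero>\<^bsub>Hm (PSh K a) F G\<^esub> = res_nat F (\<lambda>A x. \<zero>\<^bsub>FOb G A\<^esub>)"
  "\<phi> \<oplus>\<^bsub>Hm (PSh K a) F G\<^esub> \<psi> = res_nat F (\<lambda>A x. \<phi> A x \<oplus>\<^bsub>FOb G A\<^esub> \<psi> A x)"
  "r \<odot>\<^bsub>Hm (PSh K a) F G\<^esub> \<phi> = res_nat F (\<lambda>A x. r \<odot>\<^bsub>FOb G A\<^esub> \<phi> A x)"
  "Idt (PSh K a) F = res_nat F (\<lambda>A x. x)"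
  by (auto simp: PSh_def fun_cat_def Mod_def res_nat_def fun_eq_iff)

lemma lin_nat_zero_map: "psh F \<Longrightarrow> psh G \<Longrightarrow> lin_nat F G (\<lambda>A x. \<zero>\<^bsub>FOb G A\<^esub>)"
  unfolding lin_nat_def by (simp add: act_zero_neg(1))

lemma lin_nat_add_map:
  assumes "psh G" "lin_nat F G \<phi>" "lin_nat F G \<psi>"
  shows "lin_nat F G (\<lambda>A x. \<phi> A x \<oplus>\<^bsub>FOb G A\<^esub> \<psi> A x)"
  unfolding lin_nat_def
proof (intro conjI ballI)
  fix A x y assume A: "A \<in> Ob a" and x: "x \<in> carrier (FOb F A)" "y \<in> carrier (FOb F A)"
  interpret M: abelian_group "FOb G A" by (rule psh_grp[OF assms(1) A])
  show "\<phi> A (x \<oplus>\<^bsub>FOb F A\<^esub> y) \<oplus>\<^bsub>FOb G A\<^esub> \<psi> A (x \<oplus>\<^bsub>FOb F A\<^esub> y) =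
      (\<phi> A x \<oplus>\<^bsub>FOb G A\<^esub> \<psi> A x) \<oplus>\<^bsub>FOb G A\<^esub> (\<phi> A y \<oplus>\<^bsub>FOb G A\<^esub> \<psi> A y)"
    using lin_nat_in[OF assms(2) A] lin_nat_in[OF assms(3) A] x
    by (simp add: lin_nat_add[OF assms(2) A x] lin_nat_add[OF assms(3) A x] M.a_ac)
qed (simp_all add: assms(1) lin_nat_in[OF assms(2)] lin_nat_in[OF assms(3)] lin_nat_act[OF assms(2)] lin_nat_act[OF assms(3)] act_add)

lemma lin_nat_neg_map:
  assumes G: "psh G" and \<phi>: "lin_nat F G \<phi>"
  shows "lin_nat F G (\<lambda>A x. \<ominus>\<^bsub>FOb G A\<^esub> \<phi> A x)"
  unfolding lin_nat_def
proof (intro conjI ballI)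
  fix A x y assume A: "A \<in> Ob a" and x: "x \<in> carrier (FOb F A)" "y \<in> carrier (FOb F A)"
  interpret M: abelian_group "FOb G A" by (rule psh_grp[OF G A])
  show "\<ominus>\<^bsub>FOb G A\<^esub> \<phi> A (x \<oplus>\<^bsub>FOb F A\<^esub> y) = \<ominus>\<^bsub>FOb G A\<^esub> \<phi> A x \<oplus>\<^bsub>FOb G A\<^esub> \<ominus>\<^bsub>FOb G A\<^esub> \<phi> A y"
    using lin_nat_in[OF \<phi> A] x by (simp add: lin_nat_add[OF \<phi> A x] M.minus_add)
qed (simp_all add: G lin_nat_in[OF \<phi>] lin_nat_act[OF \<phi>] act_zero_neg(2))

lemma PSh_hom_group:
  assumes F: "psh F" and G: "psh G"
  shows "abelian_group (Hm (PSh K a) F G)"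
proof -
  note mem = hom_lin_nat[OF F G]
  note inG = lin_nat_in[OF mem]
  have z: "\<zero>\<^bsub>Hm (PSh K a) F G\<^esub> \<in> psh_hom F G"
    unfolding PSh_ops by (rule res_nat_hom[OF F G lin_nat_zero_map[OF F G]])
  have ad: "\<phi> \<oplus>\<^bsub>Hm (PSh K a) F G\<^esub> \<psi> \<in> psh_hom F G" if "\<phi> \<in> psh_hom F G" "\<psi> \<in> psh_hom F G" for \<phi> \<psi>
    unfolding PSh_ops by (rule res_nat_hom[OF F G lin_nat_add_map[OF G mem[OF that(1)] mem[OF that(2)]]])
  show ?thesis
  proof (rule abelian_groupI)
    fix \<phi> assume \<phi>: "\<phi> \<in> psh_hom F G"
    show "\<zero>\<^bsub>Hm (PSh K a) F G\<^esub> \<oplus>\<^bsub>Hm (PSh K a) F G\<^esub> \<phi> = \<phi>"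
      by (rule psh_hom_eqI[OF F G ad[OF z \<phi>] \<phi>]) (simp add: PSh_ops G inG[OF \<phi>])
    show "\<exists>\<psi>\<in>psh_hom F G. \<psi> \<oplus>\<^bsub>Hm (PSh K a) F G\<^esub> \<phi> = \<zero>\<^bsub>Hm (PSh K a) F G\<^esub>"
    proof
      let ?n = "res_nat F (\<lambda>A x. \<ominus>\<^bsub>FOb G A\<^esub> \<phi> A x)"
      show n: "?n \<in> psh_hom F G" by (rule res_nat_hom[OF F G lin_nat_neg_map[OF G mem[OF \<phi>]]])
      show "?n \<oplus>\<^bsub>Hm (PSh K a) F G\<^esub> \<phi> = \<zero>\<^bsub>Hm (PSh K a) F G\<^esub>"
        by (rule psh_hom_eqI[OF F G ad[OF n \<phi>] z])
          (simp add: PSh_ops inG[OF \<phi>] abelian_group.l_neg[OF psh_grp[OF G]])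
    qed
    fix \<psi> assume \<psi>: "\<psi> \<in> psh_hom F G"
    show "\<phi> \<oplus>\<^bsub>Hm (PSh K a) F G\<^esub> \<psi> = \<psi> \<oplus>\<^bsub>Hm (PSh K a) F G\<^esub> \<phi>"
      by (rule psh_hom_eqI[OF F G ad[OF \<phi> \<psi>] ad[OF \<psi> \<phi>]])
        (simp add: PSh_ops inG[OF \<phi>] inG[OF \<psi>] abelian_monoid.a_comm[OF psh_mon[OF G]])
    fix \<theta> assume \<theta>: "\<theta> \<in> psh_hom F G"
    show "\<phi> \<oplus>\<^bsub>Hm (PSh K a) F G\<^esub> \<psi> \<oplus>\<^bsub>Hm (PSh K a) F G\<^esub> \<theta> = \<phi> \<oplus>\<^bsub>Hm (PSh K a) F G\<^esub> (\<psi> \<oplus>\<^bsub>Hm (PSh K a) F G\<^esub> \<theta>)"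
      by (rule psh_hom_eqI[OF F G ad[OF ad[OF \<phi> \<psi>] \<theta>] ad[OF \<phi> ad[OF \<psi> \<theta>]]])
        (simp add: PSh_ops inG[OF \<phi>] inG[OF \<psi>] inG[OF \<theta>] abelian_monoid.a_assoc[OF psh_mon[OF G]])
  qed (use z ad in auto)
qed

text \<open>Evaluation at an element is additive in the transformation, so it commutes with finite
  sums.\<close>

lemma PSh_finsum_apply:
  assumes F: "psh F" and G: "psh G" and I: "finite I" and \<phi>: "\<And>i. i \<in> I \<Longrightarrow> \<phi> i \<in> psh_hom F G"
    and A: "A \<in> Ob a" and x: "x \<in> carrier (FOb F A)"
  shows "(\<Oplus>\<^bsub>Hm (PSh K a) F G\<^esub>i\<in>I. \<phi> i) A x = (\<Oplus>\<^bsub>FOb G A\<^esub>i\<in>I. \<phi> i A x)"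
proof -
  note g = abelian_group.axioms(1)[OF PSh_hom_group[OF F G]]
  show ?thesis
    by (rule additive_finsum[OF g psh_mon[OF G A], of "\<lambda>\<phi>. \<phi> A x"])
      (use lin_nat_in[OF hom_lin_nat[OF F G]] A x I \<phi> in \<open>auto simp: PSh_ops\<close>)
qed

lemma yoneda_Ob: "A \<in> Ob a \<Longrightarrow> yo A \<in> Ob (PSh K a)"
  unfolding PSh_Ob_iff by (intro conjI ballI, rule psh_yoneda) (auto simp: yoneda_def)

lemma yoneda_hom:
  assumes "A \<in> Ob a" "B \<in> Ob a" "f \<in> hm A B"
  shows "FAr (yoneda a) A B f \<in> psh_hom (yo A) (yo B)"
    and "\<And>C g. C \<in> Ob a \<Longrightarrow> g \<in> hm C A \<Longrightarrow> FAr (yoneda a) A B f C g = Cmp a C A B f g"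
proof -
  have "FAr (yoneda a) A B f = res_nat (yo A) (\<lambda>C g. Cmp a C A B f g)"
    by (auto simp: yoneda_def res_nat_def)
  moreover have "lin_nat (yo A) (yo B) (\<lambda>C g. Cmp a C A B f g)"
    unfolding lin_nat_def using assms by (simp add: Cmp_add_right Cmp_assoc)
  ultimately show "FAr (yoneda a) A B f \<in> psh_hom (yo A) (yo B)"
    using res_nat_hom assms by simp
  show "\<And>C g. C \<in> Ob a \<Longrightarrow> g \<in> hm C A \<Longrightarrow> FAr (yoneda a) A B f C g = Cmp a C A B f g"
    by (simp add: yoneda_def)
qed

lemma lin_nat_yoneda_eq:
  assumes G: "psh G" and A: "A \<in> Ob a" and \<phi>: "lin_nat (yo A) G \<phi>" and B: "B \<in> Ob a" "f \<in> hm B A"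
  shows "\<phi> B f = FAr G A B f (\<phi> A (Idt a A))"
  using lin_nat_act[OF \<phi> A B, of "Idt a A"] A B by simp

lemma lin_nat_yoneda:
  assumes G: "psh G" and A: "A \<in> Ob a" and x: "x \<in> carrier (FOb G A)"
  shows "lin_nat (yo A) G (\<lambda>B f. FAr G A B f x)"
  unfolding lin_nat_def using assms by (simp add: act_add_left act_Cmp)

end

context site
begin

text \<open>Passing to \<open>res_nat\<close> turns matching families into morphisms out of the
  sieve, so bijectivity of the comparison map becomes unique existence of a glued element.\<close>

lemma is_sheaf_iff: "is_sheaf K a T F \<longleftrightarrow> F \<in> Ob (PSh K a) \<and> sheaf_elt F"
proof (cases "F \<in> Ob (PSh K a)")
  case True
  then have F: "psh F" by (rule PSh_psh)
  have "bij_betw (\<lambda>x. \<lambda>B\<in>Ob a. \<lambda>f\<in>R B. FAr F A B f x) (carrier (FOb F A)) (psh_hom (sieve_presheaf a A R) F) \<longleftrightarrow>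
     (\<forall>\<sigma>. lin_nat (sieve_presheaf a A R) F \<sigma> \<longrightarrow>
       (\<exists>!x. x \<in> carrier (FOb F A) \<and> (\<forall>B\<in>Ob a. \<forall>f\<in>R B. FAr F A B f x = \<sigma> B f)))"
    (is "?L \<longleftrightarrow> ?R") if A: "A \<in> Ob a" and R: "R \<in> T A" for A R
  proof -
    let ?S = "sieve_presheaf a A R"
    note Rs = T_sieve[OF R] and S = psh_sieve[OF T_sieve[OF R] A]
    let ?r = "\<lambda>x. \<lambda>B\<in>Ob a. \<lambda>f\<in>R B. FAr F A B f x"
    have r: "?r x = res_nat ?S (\<lambda>B f. FAr F A B f x)" for x by (simp add: res_nat_def)
    have rin: "?r x \<in> psh_hom ?S F" if "x \<in> carrier (FOb F A)" for x
      unfolding r by (rule res_nat_hom[OF S F lin_nat_restr[OF F Rs A that]])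
    have req: "?r x = \<sigma> \<longleftrightarrow> (\<forall>B\<in>Ob a. \<forall>f\<in>R B. FAr F A B f x = \<sigma> B f)"
      if "\<sigma> \<in> psh_hom ?S F" "x \<in> carrier (FOb F A)" for \<sigma> x
    proof
      assume "?r x = \<sigma>" then show "\<forall>B\<in>Ob a. \<forall>f\<in>R B. FAr F A B f x = \<sigma> B f" by auto
    next
      assume "\<forall>B\<in>Ob a. \<forall>f\<in>R B. FAr F A B f x = \<sigma> B f"
      then show "?r x = \<sigma>" by (intro psh_hom_eqI[OF S F rin[OF that(2)] that(1)]) simp
    qed
    show ?thesis
    proof
      assume L: ?L
      show ?R
      proof (intro allI impI)
        fix \<sigma> assume \<sigma>: "lin_nat ?S F \<sigma>"
        have \<sigma>': "res_nat ?S \<sigma> \<in> psh_hom ?S F" by (rule res_nat_hom[OF S F \<sigma>])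
        have "res_nat ?S \<sigma> \<in> ?r ` carrier (FOb F A)" unfolding bij_betw_imp_surj_on[OF L] by (rule \<sigma>')
        then obtain x where x: "x \<in> carrier (FOb F A)" "?r x = res_nat ?S \<sigma>"
          by (elim imageE) (rule that, assumption, rule sym, assumption)
        have "\<exists>!x. x \<in> carrier (FOb F A) \<and> ?r x = res_nat ?S \<sigma>"
          by (rule ex1I[of _ x]) (rule conjI[OF x], rule inj_onD[OF bij_betw_imp_inj_on[OF L]], use x in simp_all)
        then show "\<exists>!x. x \<in> carrier (FOb F A) \<and> (\<forall>B\<in>Ob a. \<forall>f\<in>R B. FAr F A B f x = \<sigma> B f)"
          using req[OF \<sigma>'] by (simp cong: conj_cong)
      qed
    next
      assume R: ?R
      show ?L
        unfolding bij_betw_def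
      proof (intro conjI inj_onI equalityI subsetI)
        fix x y assume x: "x \<in> carrier (FOb F A)" and y: "y \<in> carrier (FOb F A)" and eq: "?r x = ?r y"
        have "\<forall>B\<in>Ob a. \<forall>f\<in>R B. FAr F A B f x = ?r y B f" using req[OF rin[OF y] x] eq by blast
        then show "x = y" using R[rule_format, OF lin_nat_restr[OF F Rs A y]] x y by auto
      next
        fix \<sigma> assume "\<sigma> \<in> ?r ` carrier (FOb F A)" then show "\<sigma> \<in> psh_hom ?S F" using rin by blast
      next
        fix \<sigma> assume \<sigma>: "\<sigma> \<in> psh_hom ?S F"
        then obtain x where "x \<in> carrier (FOb F A)" "\<forall>B\<in>Ob a. \<forall>f\<in>R B. FAr F A B f x = \<sigma> B f"
          using R hom_lin_nat[OF S F \<sigma>] by blast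
        then show "\<sigma> \<in> ?r ` carrier (FOb F A)" using req[OF \<sigma>] by blast
      qed
    qed
  qed
  then show ?thesis unfolding is_sheaf_def sheaf_elt_def by (intro conj_cong refl ball_cong)
qed (simp add: is_sheaf_def)

lemma Sh_simps [simp]:
  "F \<in> Ob (Sh K a T) \<longleftrightarrow> is_sheaf K a T F" "Hm (Sh K a T) = Hm (PSh K a)" "Cmp (Sh K a T) = Cmp (PSh K a)"
  "Idt (Sh K a T) = Idt (PSh K a)"
  by (auto simp: Sh_def full_subcat_def is_sheaf_def)

lemma sheaf_psh: "is_sheaf K a T F \<Longrightarrow> psh F"
  using is_sheaf_iff PSh_psh by blast

lemma sheaf_sheaf_elt: "is_sheaf K a T F \<Longrightarrow> sheaf_elt F"
  using is_sheaf_iff by blast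

lemma sheaf_PSh: "is_sheaf K a T F \<Longrightarrow> F \<in> Ob (PSh K a)"
  using is_sheaf_iff by blast

lemma subcanonical_iff: "subcanonical K a T \<longleftrightarrow> (\<forall>A\<in>Ob a. sheaf_elt (yo A))"
  unfolding subcanonical_def is_sheaf_iff using yoneda_Ob by blast

end

section \<open>Smallness\<close>

lemma infinite_pairing:
  assumes "infinite (UNIV :: 'i set)"
  obtains p :: "'i \<times> 'i \<Rightarrow> 'i" where "inj p"
proof -
  have "\<exists>f. inj_on f ((UNIV :: 'i set) \<times> (UNIV :: 'i set)) \<and> f ` (UNIV \<times> UNIV) \<subseteq> (UNIV :: 'i set)"
    unfolding card_of_ordLeq using card_of_Times_same_infinite[OF assms] ordIso_iff_ordLeq by blast
  then show thesis using that by auto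
qed

text \<open>The length is coded next to the nested pair because the nesting has no recognisable end:
  its starting value \<open>n 0\<close> may itself be a pair.\<close>

lemma infinite_list_coding:
  assumes "infinite (UNIV :: 'i set)"
  obtains c :: "'i list \<Rightarrow> 'i" where "inj c"
proof -
  obtain p :: "'i \<times> 'i \<Rightarrow> 'i" where p: "inj p" by (rule infinite_pairing[OF assms])
  obtain n :: "nat \<Rightarrow> 'i" where n: "inj n"
    using infinite_countable_subset[OF assms] by blast
  define d where "d xs = foldr (\<lambda>x y. p (x, y)) xs (n 0)" for xs
  have d: "xs = ys" if "length xs = length ys" "d xs = d ys" for xs ys
    using that by (induction xs ys rule: list_induct2) (auto simp: d_def dest: injD[OF p])
  have "inj (\<lambda>xs. p (n (length xs), d xs))"
    by (rule injI) (auto dest!: injD[OF p] injD[OF n] intro: d)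
  then show thesis by (rule that)
qed

locale small_site = site K a T
  for K :: "'k ring" and a :: "('o, 'v, 'k) lincat" and T :: "'o \<Rightarrow> ('o \<Rightarrow> 'v set) set" +
  fixes ity :: "'i itself"
  assumes sc: "size_condition TYPE('i) TYPE('v)" and es: "essentially_small TYPE('i) a"
begin

text \<open>The identity satisfied by v and u writes any f out of X as the composite of f v, whose
  source is in \<open>O0\<close>, with u; so the sources in \<open>O0\<close> see everything. For
  each target A, \<open>j A\<close> codes the morphisms into A together with their sources.\<close>

lemma small_skeleton:
  obtains O0 :: "'o set" and j :: "'o \<Rightarrow> 'o \<times> 'v \<Rightarrow> 'i" where "O0 \<subseteq> Ob a"
    "\<And>X. X \<in> Ob a \<Longrightarrow> \<exists>Y\<in>O0. \<exists>u\<in>hm X Y. \<exists>v\<in>hm Y X. Cmp a X Y X v u = Idt a X"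
    "\<And>A. A \<in> Ob a \<Longrightarrow> inj_on (j A) (SIGMA B:O0. hm B A)"
proof -
  obtain O0 and e0 :: "'o \<Rightarrow> 'i" where O0: "O0 \<subseteq> Ob a" "\<forall>X\<in>Ob a. \<exists>Y\<in>O0. isomorphic a X Y" "inj_on e0 O0"
    and e: "\<forall>X\<in>Ob a. \<forall>Y\<in>Ob a. \<exists>e :: 'v \<Rightarrow> 'i. inj_on e (hm X Y)"
    using es unfolding essentially_small_def by blast
  obtain p :: "'i \<times> 'i \<Rightarrow> 'i" where p: "inj p"
    using infinite_pairing sc unfolding size_condition_def by blast
  define h :: "'o \<Rightarrow> 'o \<Rightarrow> 'v \<Rightarrow> 'i" where "h X Y = (SOME e. inj_on e (hm X Y))" for X Y
  have h: "inj_on (h X Y) (hm X Y)" if "X \<in> Ob a" "Y \<in> Ob a" for X Y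
    unfolding h_def using someI_ex[of "\<lambda>e. inj_on e (hm X Y)"] e that by blast
  show thesis
  proof (rule that[of O0 "\<lambda>A (B, f). p (e0 B, h B A f)"])
    show "\<And>X. X \<in> Ob a \<Longrightarrow> \<exists>Y\<in>O0. \<exists>u\<in>hm X Y. \<exists>v\<in>hm Y X. Cmp a X Y X v u = Idt a X"
      using O0(2) unfolding isomorphic_def by blast
    show "inj_on (\<lambda>(B, f). p (e0 B, h B A f)) (SIGMA B:O0. hm B A)" if A: "A \<in> Ob a" for A
    proof (rule inj_onI, clarify)
      fix B f B' f' assume B: "B \<in> O0" "B' \<in> O0" "f \<in> hm B A" "f' \<in> hm B' A"
        and eq: "p (e0 B, h B A f) = p (e0 B', h B' A f')"
      have "e0 B = e0 B'" "h B A f = h B' A f'" using injD[OF p eq] by auto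
      moreover from this have "B = B'" using O0(3) B by (auto dest: inj_onD)
      ultimately show "B = B' \<and> f = f'" using inj_onD[OF h[of B A]] B A O0(1) by blast
    qed
  qed (rule O0(1))
qed

text \<open>Selecting one representative over each morphism of its domain suffices to recover a graph, because
  two graphs that agree on the covering sieve where both are defined are equal.\<close>

lemma quot_code:
  fixes F :: "('o, 'v, ('k, 'w) module, 'w \<Rightarrow> 'w) linfun" and e :: "'w \<Rightarrow> 'v"
  assumes F: "psh F" and N: "closed_sub F N" and e: "inj e" and A: "A \<in> Ob a"
  shows "\<exists>c :: ('o \<Rightarrow> ('v \<times> 'w) set) \<Rightarrow> 'v. inj_on c {\<Gamma>. quot.sec a T F N A \<Gamma>}"
proof -
  interpret Q: quot K a T F N by unfold_locales (use F N in auto)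
  obtain O0 and j :: "'o \<Rightarrow> 'o \<times> 'v \<Rightarrow> 'i" where O0: "O0 \<subseteq> Ob a"
    "\<And>X. X \<in> Ob a \<Longrightarrow> \<exists>Y\<in>O0. \<exists>u\<in>hm X Y. \<exists>v\<in>hm Y X. Cmp a X Y X v u = Idt a X"
    "\<And>A. A \<in> Ob a \<Longrightarrow> inj_on (j A) (SIGMA B:O0. hm B A)"
    by (rule small_skeleton) (rule that, assumption+)
  obtain E :: "('i \<Rightarrow> 'v) \<Rightarrow> 'v" where E: "inj E"
    using sc unfolding size_condition_def by blast
  let ?S = "SIGMA B:O0. hm B A"
  \<comment> \<open>The code of a graph is the family, indexed by all of \<open>'i\<close>, of its
    chosen values over the morphism decoded from the index. Indices outside the range of
    \<open>j A\<close> decode to something arbitrary, which does no harm to injectivity; the family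
    is then folded into one element by \<open>E\<close>.\<close>
  define g where "g = inv_into ?S (j A)"
  define ch where "ch = (\<lambda>\<Gamma> (B, f). SOME x. (f, x) \<in> (\<Gamma> :: 'o \<Rightarrow> ('v \<times> 'w) set) B)"
  define c where "c = (\<lambda>\<Gamma>. E (\<lambda>i. e (ch \<Gamma> (g i))))"
  have "\<Gamma> = \<Delta>" if \<Gamma>: "Q.sec A \<Gamma>" and \<Delta>: "Q.sec A \<Delta>" and eq: "c \<Gamma> = c \<Delta>" for \<Gamma> \<Delta>
  proof (rule Q.sec_eqI[OF \<Gamma> \<Delta> locally_mono[OF locally_conj[OF Q.sec_dom[OF \<Gamma>] Q.sec_dom[OF \<Delta>]]]])
    have chi: "ch \<Gamma> (g i) = ch \<Delta> (g i)" for i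
      using fun_cong[OF injD[OF E, OF eq[unfolded c_def]], of i] injD[OF e] by blast
    have ch: "ch \<Gamma> (B, f) = ch \<Delta> (B, f)" if "B \<in> O0" "f \<in> hm B A" for B f
    proof -
      have "g (j A (B, f)) = (B, f)"
        unfolding g_def by (rule inv_into_f_f[OF O0(3)[OF A]]) (use that in simp)
      then show ?thesis using chi[of "j A (B, f)"] by simp
    qed
    fix B f assume B: "B \<in> Ob a" "f \<in> hm B A" and ex: "(\<exists>x. (f, x) \<in> \<Gamma> B) \<and> (\<exists>x. (f, x) \<in> \<Delta> B)"
    obtain Y u v where Y: "Y \<in> O0" "u \<in> hm B Y" "v \<in> hm Y B" "Cmp a B Y B v u = Idt a B"
      using O0(2)[OF B(1)] by blast
    have Y': "Y \<in> Ob a" using Y(1) O0(1) by blast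
    \<comment> \<open>The morphism f is replaced by its composite with v, whose source is in
      \<open>O0\<close>. There both graphs have the same chosen value, and restricting along u
      carries this common value back to f.\<close>
    define fv where "fv = Cmp a Y B A f v"
    have fv: "fv \<in> hm Y A" using B A Y Y' by (simp add: fv_def)
    have s: "(fv, ch \<Theta> (Y, fv)) \<in> \<Theta> Y" if "Q.sec A \<Theta>" "\<exists>x. (f, x) \<in> \<Theta> B" for \<Theta>
    proof -
      have "\<exists>x. (fv, x) \<in> \<Theta> Y" using that Q.sec_act[OF that(1) _ Y' Y(3)] unfolding fv_def by blast
      then show ?thesis unfolding ch_def prod.case by (rule someI_ex)
    qed
    have "Cmp a B Y A fv u = f" using B A Y Y' by (simp add: fv_def Cmp_assoc)
    then have "(f, FAr F Y B u (ch \<Gamma> (Y, fv))) \<in> \<Gamma> B" "(f, FAr F Y B u (ch \<Delta> (Y, fv))) \<in> \<Delta> B"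
      using Q.sec_act[OF \<Gamma> s[OF \<Gamma>] B(1) Y(2)] Q.sec_act[OF \<Delta> s[OF \<Delta>] B(1) Y(2)] ex by simp_all
    then show "\<exists>x. (f, x) \<in> \<Gamma> B \<and> (f, x) \<in> \<Delta> B" using ch[OF Y(1) fv] by auto
  qed
  then show ?thesis by (intro exI[of _ c] inj_onI) auto
qed

text \<open>The sheaf of sections moved into \<open>'v\<close>. Later arguments use it only through
  the listed properties; together with \<open>factor\<close> they make \<eta> universal among maps
  into sheaves that vanish on N.\<close>

lemma sheaf_quot:
  fixes F :: "('o, 'v, ('k, 'w) module, 'w \<Rightarrow> 'w) linfun" and e :: "'w \<Rightarrow> 'v"
  assumes F: "psh F" and N: "closed_sub F N" and e: "inj e"
  obtains L \<eta> where "is_sheaf K a T L" "lin_nat F L \<eta>" "locsurj F L \<eta>"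
    "\<And>A x. A \<in> Ob a \<Longrightarrow> x \<in> carrier (FOb F A) \<Longrightarrow> \<eta> A x = \<zero>\<^bsub>FOb L A\<^esub> \<longleftrightarrow> x \<in> N A"
proof -
  interpret Q: quot K a T F N by unfold_locales (use F N in auto)
  define c :: "'o \<Rightarrow> ('o \<Rightarrow> ('v \<times> 'w) set) \<Rightarrow> 'v" where "c A = (SOME c. inj_on c {\<Gamma>. Q.sec A \<Gamma>})" for A
  have c: "inj_on (c A) (carrier (FOb Q.quot_sheaf A))" if "A \<in> Ob a" for A
    unfolding c_def Q.quot_sheaf_simps using someI_ex[OF quot_code[OF F N e that]] .
  let ?L = "transp c Q.quot_sheaf"
  let ?\<eta> = "\<lambda>A x. c A (Q.sec_of A x)"
  have L: "psh ?L" by (rule psh_transp[OF Q.psh_quot_sheaf c])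
  note cn = transp_bij[OF Q.psh_quot_sheaf c]
  show thesis
  proof (rule that[of ?L ?\<eta>])
    have "?L \<in> Ob (PSh K a)" unfolding PSh_Ob_iff using L by (auto simp: transp_def Let_def)
    then show "is_sheaf K a T ?L"
      unfolding is_sheaf_iff using sheaf_elt_iso[OF Q.psh_quot_sheaf Q.sheaf_elt_quot_sheaf L cn] by blast
    show en: "lin_nat F ?L ?\<eta>" by (rule lin_nat_comp[OF Q.lin_nat_sec_of cn(1)])
    show "locsurj F ?L ?\<eta>"
      unfolding locsurj_def
    proof (intro ballI)
      fix A y assume A: "A \<in> Ob a" and "y \<in> carrier (FOb ?L A)"
      then obtain \<Gamma> where \<Gamma>: "\<Gamma> \<in> carrier (FOb Q.quot_sheaf A)" "y = c A \<Gamma>"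
        using transp_simps(1)[of c A Q.quot_sheaf, OF c[OF A]] by blast
      show "locally A (\<lambda>B f. \<exists>x\<in>carrier (FOb F B). c B (Q.sec_of B x) = FAr ?L A B f y)"
        by (rule locally_mono[OF Q.locsurj_sec_of[unfolded locsurj_def, rule_format, OF A \<Gamma>(1)]])
          (use \<Gamma> A in \<open>auto simp: transp_simps(5)[of c A Q.quot_sheaf, OF c[OF A] \<Gamma>(1)]\<close>, metis)
    qed
    fix A x assume A: "A \<in> Ob a" and x: "x \<in> carrier (FOb F A)"
    note z = psh_zero_in[OF F A]
    have "?\<eta> A x = \<zero>\<^bsub>FOb ?L A\<^esub> \<longleftrightarrow> Q.sec_of A x = Q.sec_of A \<zero>\<^bsub>FOb F A\<^esub>"
      unfolding transp_simps(2)[of c A Q.quot_sheaf, OF c[OF A]]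
      using inj_on_eq_iff[OF c[OF A]] Q.sec_of(1)[OF A x] Q.sec_of(1)[OF A z] by simp
    also have "\<dots> \<longleftrightarrow> Q.eqv A x \<zero>\<^bsub>FOb F A\<^esub>" by (rule Q.sec_of_eq_iff[OF A x z])
    also have "\<dots> \<longleftrightarrow> x \<in> N A"
    proof -
      interpret M: abelian_group "FOb F A" by (rule psh_grp[OF F A])
      have "x \<ominus>\<^bsub>FOb F A\<^esub> \<zero>\<^bsub>FOb F A\<^esub> = x"
        using M.add.inv_solve_right[of x x "\<zero>\<^bsub>FOb F A\<^esub>"] x z by (simp add: a_minus_def)
      then show ?thesis using x z by (simp add: Q.eqv_def)
    qed
    finally show "?\<eta> A x = \<zero>\<^bsub>FOb ?L A\<^esub> \<longleftrightarrow> x \<in> N A" .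
  qed
qed

text \<open>The map from G to the cokernel sheaf of \<phi> vanishes on the image of \<phi>, hence by
  \<open>epi\<close> it vanishes altogether. Its kernel consists of the elements that lift
  locally.\<close>

lemma epi_locsurj:
  fixes F :: "('o, 'v, ('k, 'w) module, 'w \<Rightarrow> 'w) linfun" and G :: "('o, 'v, 'k) presheaf"
  assumes F: "psh F" and G: "psh G" and \<phi>: "lin_nat F G \<phi>"
    and epi: "\<And>H \<kappa>. is_sheaf K a T H \<Longrightarrow> lin_nat G H \<kappa> \<Longrightarrow>
      (\<And>A x. A \<in> Ob a \<Longrightarrow> x \<in> carrier (FOb F A) \<Longrightarrow> \<kappa> A (\<phi> A x) = \<zero>\<^bsub>FOb H A\<^esub>) \<Longrightarrow>
      (\<And>A y. A \<in> Ob a \<Longrightarrow> y \<in> carrier (FOb G A) \<Longrightarrow> \<kappa> A y = \<zero>\<^bsub>FOb H A\<^esub>)"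
  shows "locsurj F G \<phi>"
proof -
  define N where "N = (\<lambda>A. {y \<in> carrier (FOb G A). locally A (\<lambda>B f. \<exists>x\<in>carrier (FOb F B). \<phi> B x = FAr G A B f y)})"
  have N: "closed_sub G N" unfolding N_def by (rule closed_sub_locimg[OF F G \<phi>])
  obtain L \<eta> where L: "is_sheaf K a T L" "lin_nat G L \<eta>"
    "\<And>A x. A \<in> Ob a \<Longrightarrow> x \<in> carrier (FOb G A) \<Longrightarrow> \<eta> A x = \<zero>\<^bsub>FOb L A\<^esub> \<longleftrightarrow> x \<in> N A"
    using sheaf_quot[OF G N inj_on_id[of UNIV]] by metis
  have "y \<in> N A" if A: "A \<in> Ob a" "y \<in> carrier (FOb G A)" for A y
  proof -
    have "\<eta> A y = \<zero>\<^bsub>FOb L A\<^esub>"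
    proof (rule epi[OF L(1,2) _ A])
      fix B x assume B: "B \<in> Ob a" "x \<in> carrier (FOb F B)"
      have "locally B (\<lambda>C f. \<exists>z\<in>carrier (FOb F C). \<phi> C z = FAr G B C f (\<phi> B x))"
        by (rule locally_all[OF B(1)]) (use B F lin_nat_act[OF \<phi> B(1) _ _ B(2)] act_in[OF F B(1) _ _ B(2)] in blast)
      then show "\<eta> B (\<phi> B x) = \<zero>\<^bsub>FOb L B\<^esub>"
        using L(3)[OF B(1) lin_nat_in[OF \<phi> B]] lin_nat_in[OF \<phi> B] by (simp add: N_def)
    qed
    then show ?thesis using L(3)[OF A] by simp
  qed
  then show ?thesis unfolding locsurj_def N_def by blast
qed

section \<open>Sheafification\<close>

text \<open>Gives content to the choice in the definition of \<open>sheafification\<close>. The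
  functor is divided out by torsion: a map into a sheaf vanishes on torsion because sheaves are
  separated, so it extends along the unit.\<close>

lemma sheafification_exists:
  "\<exists>L \<eta>. left_adjoint K (PSh K a) (Sh K a T) L id_linfun \<eta>"
proof -
  define good :: "('o, 'v, 'k) presheaf \<Rightarrow> ('o, 'v, 'k) presheaf \<times> ('o \<Rightarrow> 'v \<Rightarrow> 'v) \<Rightarrow> bool" where
    "good F p \<longleftrightarrow> is_sheaf K a T (fst p) \<and> snd p \<in> psh_hom F (fst p) \<and> locsurj F (fst p) (snd p) \<and>
       (\<forall>A\<in>Ob a. \<forall>x\<in>carrier (FOb F A). snd p A x = \<zero>\<^bsub>FOb (fst p) A\<^esub> \<longleftrightarrow> x \<in> torsion F A)" for F p
  have ex: "\<exists>p. good F p" if F: "psh F" for F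
  proof -
    obtain L \<eta> where L: "is_sheaf K a T L" "lin_nat F L \<eta>" "locsurj F L \<eta>"
      "\<And>A x. A \<in> Ob a \<Longrightarrow> x \<in> carrier (FOb F A) \<Longrightarrow> \<eta> A x = \<zero>\<^bsub>FOb L A\<^esub> \<longleftrightarrow> x \<in> torsion F A"
      using sheaf_quot[OF F closed_sub_torsion[OF F] inj_on_id[of UNIV]] by metis
    have "locsurj F L (res_nat F \<eta>)"
      unfolding locsurj_def
      by (intro ballI, rule locally_mono[OF L(3)[unfolded locsurj_def, rule_format]]) auto
    then show ?thesis
      using L res_nat_hom[OF F sheaf_psh[OF L(1)] L(2)] by (intro exI[of _ "(L, res_nat F \<eta>)"]) (simp add: good_def)
  qed
  define p where "p F = (SOME p. good F p)" for F
  define S where "S F = fst (p F)" for F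
  define \<eta> where "\<eta> F = snd (p F)" for F
  have p: "good F (p F)" if "psh F" for F unfolding p_def by (rule someI_ex[OF ex[OF that]])
  have S: "is_sheaf K a T (S F)" "psh (S F)" "sheaf_elt (S F)" if "psh F" for F
    using p[OF that] sheaf_psh sheaf_sheaf_elt unfolding good_def S_def by blast+
  have \<eta>: "\<eta> F \<in> psh_hom F (S F)" "locsurj F (S F) (\<eta> F)" if "psh F" for F
    using p[OF that] unfolding good_def S_def \<eta>_def by blast+
  have \<eta>n: "lin_nat F (S F) (\<eta> F)" if "psh F" for F
    by (rule hom_lin_nat[OF that S(2)[OF that] \<eta>(1)[OF that]])
  have \<eta>0: "\<eta> F A x = \<zero>\<^bsub>FOb (S F) A\<^esub> \<longleftrightarrow> x \<in> torsion F A"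
    if "psh F" "A \<in> Ob a" "x \<in> carrier (FOb F A)" for F A x
    using p[OF that(1)] that(2,3) unfolding good_def S_def \<eta>_def by blast
  have ext: "\<exists>\<psi>\<in>psh_hom (S F) G. \<forall>A\<in>Ob a. \<forall>x\<in>carrier (FOb F A). \<psi> A (\<eta> F A x) = \<phi> A x"
    if F: "psh F" and G: "psh G" "sheaf_elt G" and \<phi>: "lin_nat F G \<phi>" for F G \<phi>
  proof -
    have "\<phi> A x = \<zero>\<^bsub>FOb G A\<^esub>" if A: "A \<in> Ob a" and x: "x \<in> carrier (FOb F A)" "\<eta> F A x = \<zero>\<^bsub>FOb (S F) A\<^esub>" for A x
    proof (rule sheaf_elt_sep[OF G lin_nat_in[OF \<phi> A x(1)] psh_zero_in[OF G(1) A]])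
      have "locally A (\<lambda>B f. FAr F A B f x = \<zero>\<^bsub>FOb F B\<^esub>)" using \<eta>0[OF F A x(1)] x(2) by (simp add: torsion_def)
      then show "locally A (\<lambda>B f. FAr G A B f (\<phi> A x) = FAr G A B f \<zero>\<^bsub>FOb G A\<^esub>)"
        by (rule locally_mono) (simp add: lin_nat_act[OF \<phi> A _ _ x(1), symmetric] lin_nat_zero_neg(1)[OF F G(1) \<phi>] act_zero_neg(1)[OF G(1) A])
    qed
    then obtain \<psi> where "lin_nat (S F) G \<psi>" "\<And>A x. A \<in> Ob a \<Longrightarrow> x \<in> carrier (FOb F A) \<Longrightarrow> \<psi> A (\<eta> F A x) = \<phi> A x"
      using factor[OF F S(2)[OF F] G \<eta>n[OF F] \<eta>(2)[OF F] \<phi>] by metis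
    then show ?thesis
      by (intro bexI[of _ "res_nat (S F) \<psi>"] res_nat_hom[OF S(2)[OF F] G(1)]) (simp_all add: lin_nat_in[OF \<eta>n[OF F]])
  qed
  have uniq: "\<psi> = \<psi>'" if F: "psh F" and G: "psh G" "sheaf_elt G" and \<psi>: "\<psi> \<in> psh_hom (S F) G" "\<psi>' \<in> psh_hom (S F) G"
    and eq: "\<And>A x. A \<in> Ob a \<Longrightarrow> x \<in> carrier (FOb F A) \<Longrightarrow> \<psi> A (\<eta> F A x) = \<psi>' A (\<eta> F A x)" for F G \<psi> \<psi>'
    by (rule psh_hom_eqI[OF S(2)[OF F] G(1) \<psi>], rule locsurj_cancel[OF S(2)[OF F] G \<eta>(2)[OF F] hom_lin_nat[OF S(2)[OF F] G(1) \<psi>(1)]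
        hom_lin_nat[OF S(2)[OF F] G(1) \<psi>(2)] eq]) auto
  \<comment> \<open>The action on morphisms is chosen by its compatibility with the units. Because
    of \<open>uniq\<close>, every functor law has to be checked only after composition with a
    unit.\<close>
  define m where "m F G \<phi> = (SOME \<psi>. \<psi> \<in> psh_hom (S F) (S G) \<and>
     (\<forall>A\<in>Ob a. \<forall>x\<in>carrier (FOb F A). \<psi> A (\<eta> F A x) = \<eta> G A (\<phi> A x)))" for F G \<phi>
  have m: "m F G \<phi> \<in> psh_hom (S F) (S G)"
    "A \<in> Ob a \<Longrightarrow> x \<in> carrier (FOb F A) \<Longrightarrow> m F G \<phi> A (\<eta> F A x) = \<eta> G A (\<phi> A x)"
    if F: "psh F" and G: "psh G" and \<phi>: "\<phi> \<in> psh_hom F G" for F G \<phi> A x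
    using someI_ex[of "\<lambda>\<psi>. \<psi> \<in> psh_hom (S F) (S G) \<and>
     (\<forall>A\<in>Ob a. \<forall>x\<in>carrier (FOb F A). \<psi> A (\<eta> F A x) = \<eta> G A (\<phi> A x))"]
      ext[OF F S(2,3)[OF G] lin_nat_comp[OF hom_lin_nat[OF F G \<phi>] \<eta>n[OF G]]] unfolding m_def by blast+
  define L where "L = \<lparr>FOb = S, FAr = m\<rparr>"
  have L: "FOb L = S" "FAr L = m" by (simp_all add: L_def)
  have ein: "\<phi> A x \<in> carrier (FOb G A)" if "psh F" "psh G" "\<phi> \<in> psh_hom F G" "A \<in> Ob a" "x \<in> carrier (FOb F A)" for F G \<phi> A x
    using lin_nat_in[OF hom_lin_nat[OF that(1-3)] that(4,5)] .
  have "linear_functor K (PSh K a) (Sh K a T) L"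
    unfolding linear_functor_def L Sh_simps
  proof (intro conjI ballI)
    fix F assume "F \<in> Ob (PSh K a)"
    then have F: "psh F" by (rule PSh_psh)
    show "is_sheaf K a T (S F)" by (rule S(1)[OF F])
    have i: "Idt (PSh K a) F \<in> psh_hom F F" unfolding PSh_ops by (rule res_nat_hom[OF F F]) (simp add: lin_nat_def)
    have i': "Idt (PSh K a) (S F) \<in> psh_hom (S F) (S F)"
      unfolding PSh_ops by (rule res_nat_hom[OF S(2)[OF F] S(2)[OF F]]) (simp add: lin_nat_def)
    show "m F F (Idt (PSh K a) F) = Idt (PSh K a) (S F)"
      by (rule uniq[OF F S(2,3)[OF F] m(1)[OF F F i] i']) (simp add: m(2)[OF F F i], simp add: PSh_ops lin_nat_in[OF \<eta>n[OF F]])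
    fix G assume "G \<in> Ob (PSh K a)"
    then have G: "psh G" by (rule PSh_psh)
    fix \<phi> assume \<phi>: "\<phi> \<in> psh_hom F G"
    show "m F G \<phi> \<in> psh_hom (S F) (S G)" by (rule m(1)[OF F G \<phi>])
    {
      fix H \<psi> assume "H \<in> Ob (PSh K a)" and \<psi>: "\<psi> \<in> psh_hom G H"
      then have H: "psh H" by (blast intro: PSh_psh)
      note c = PSh_Cmp_in[OF F G H \<phi> \<psi>]
      show "m F H (Cmp (PSh K a) F G H \<psi> \<phi>) = Cmp (PSh K a) (S F) (S G) (S H) (m G H \<psi>) (m F G \<phi>)"
        by (rule uniq[OF F S(2,3)[OF H] m(1)[OF F H c] PSh_Cmp_in[OF S(2)[OF F] S(2)[OF G] S(2)[OF H] m(1)[OF F G \<phi>] m(1)[OF G H \<psi>]]])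
          (simp add: m(2)[OF F H c] m(2)[OF F G \<phi>] m(2)[OF G H \<psi>] lin_nat_in[OF \<eta>n[OF F]] ein[OF F G \<phi>])
    }
    {
      fix \<psi> assume \<psi>: "\<psi> \<in> psh_hom F G"
      note c = abelian_monoid.a_closed[OF abelian_group.axioms(1)[OF PSh_hom_group[OF F G]] \<phi> \<psi>]
        and c' = abelian_monoid.a_closed[OF abelian_group.axioms(1)[OF PSh_hom_group[OF S(2)[OF F] S(2)[OF G]]] m(1)[OF F G \<phi>] m(1)[OF F G \<psi>]]
      show "m F G (\<phi> \<oplus>\<^bsub>Hm (PSh K a) F G\<^esub> \<psi>) = m F G \<phi> \<oplus>\<^bsub>Hm (PSh K a) (S F) (S G)\<^esub> m F G \<psi>"
        by (rule uniq[OF F S(2,3)[OF G] m(1)[OF F G c] c'])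
          (simp add: m(2)[OF F G c], simp add: PSh_ops m(2)[OF F G \<phi>] m(2)[OF F G \<psi>] lin_nat_in[OF \<eta>n[OF F]] ein[OF F G]
            lin_nat_add[OF \<eta>n[OF G]] \<phi> \<psi>)
    }
    fix r assume r: "r \<in> carrier K"
    have sm: "r \<odot>\<^bsub>Hm (PSh K a) F G\<^esub> \<phi> \<in> psh_hom F G" if F: "psh F" and G: "psh G" and \<phi>: "\<phi> \<in> psh_hom F G" for F G \<phi>
      unfolding PSh_ops
    proof (rule res_nat_hom[OF F G])
      show "lin_nat F G (\<lambda>A x. r \<odot>\<^bsub>FOb G A\<^esub> \<phi> A x)"
        unfolding lin_nat_def
        using r by (auto simp: ein[OF F G \<phi>] G lin_nat_add[OF hom_lin_nat[OF F G \<phi>]] lin_nat_act[OF hom_lin_nat[OF F G \<phi>]]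
            module.smult_r_distr[OF psh_mod[OF G]] act_smult[OF G])
    qed
    show "m F G (r \<odot>\<^bsub>Hm (PSh K a) F G\<^esub> \<phi>) = r \<odot>\<^bsub>Hm (PSh K a) (S F) (S G)\<^esub> m F G \<phi>"
      by (rule uniq[OF F S(2,3)[OF G] m(1)[OF F G sm[OF F G \<phi>]] sm[OF S(2)[OF F] S(2)[OF G] m(1)[OF F G \<phi>]]])
        (simp add: m(2)[OF F G sm[OF F G \<phi>]], simp add: PSh_ops m(2)[OF F G \<phi>] lin_nat_in[OF \<eta>n[OF F]] ein[OF F G]
          lin_nat_smult[OF G S(2)[OF G] \<eta>n[OF G]] \<phi> r)
  qed
  moreover have "linear_functor K (Sh K a T) (PSh K a) id_linfun"
    unfolding linear_functor_def id_linfun_def Sh_simps by (simp add: sheaf_PSh)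
  \<comment> \<open>The unit is restricted to the presheaves because members of
    \<open>nat_trans\<close> are extensional.\<close>
  moreover have "rest' \<in> nat_trans (PSh K a) (PSh K a) id_linfun (comp_linfun id_linfun L)"
    if r: "rest' = restrict \<eta> (Ob (PSh K a))" for rest'
    unfolding nat_trans_def mem_Collect_eq
  proof (intro conjI ballI)
    show "rest' \<in> (\<Pi>\<^sub>E X\<in>Ob (PSh K a). psh_hom (FOb id_linfun X) (FOb (comp_linfun id_linfun L) X))"
      using \<eta>(1) PSh_psh by (auto simp: r id_linfun_def comp_linfun_def L)
    fix F G \<phi> assume FG: "F \<in> Ob (PSh K a)" "G \<in> Ob (PSh K a)" and \<phi>: "\<phi> \<in> psh_hom F G"
    then have F: "psh F" and G: "psh G" by (auto intro: PSh_psh)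
    have "Cmp (PSh K a) F G (S G) (\<eta> G) \<phi> = Cmp (PSh K a) F (S F) (S G) (m F G \<phi>) (\<eta> F)"
      by (rule psh_hom_eqI[OF F S(2)[OF G] PSh_Cmp_in[OF F G S(2)[OF G] \<phi> \<eta>(1)[OF G]]
            PSh_Cmp_in[OF F S(2)[OF F] S(2)[OF G] \<eta>(1)[OF F] m(1)[OF F G \<phi>]]])
        (simp add: m(2)[OF F G \<phi>])
    then show "Cmp (PSh K a) (FOb id_linfun F) (FOb id_linfun G) (FOb (comp_linfun id_linfun L) G) (rest' G) (FAr id_linfun F G \<phi>) =
        Cmp (PSh K a) (FOb id_linfun F) (FOb (comp_linfun id_linfun L) F) (FOb (comp_linfun id_linfun L) G)
          (FAr (comp_linfun id_linfun L) F G \<phi>) (rest' F)"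
      using FG by (simp add: r id_linfun_def comp_linfun_def L)
  qed
  moreover have "bij_betw (\<lambda>g. Cmp (PSh K a) F (S F) G g (\<eta> F)) (psh_hom (S F) G) (psh_hom F G)"
    if "F \<in> Ob (PSh K a)" "is_sheaf K a T G" for F G
  proof -
    have F: "psh F" and G: "psh G" "sheaf_elt G" using that by (auto intro: PSh_psh sheaf_psh sheaf_sheaf_elt)
    show ?thesis
      unfolding bij_betw_def
    proof (intro conjI inj_onI equalityI subsetI)
      fix g h assume g: "g \<in> psh_hom (S F) G" "h \<in> psh_hom (S F) G"
        and eq: "Cmp (PSh K a) F (S F) G g (\<eta> F) = Cmp (PSh K a) F (S F) G h (\<eta> F)"
      show "g = h"
      proof (rule uniq[OF F G g])
        fix A x assume "A \<in> Ob a" "x \<in> carrier (FOb F A)"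
        then show "g A (\<eta> F A x) = h A (\<eta> F A x)" using fun_cong[OF fun_cong[OF eq, of A], of x] by simp
      qed
    next
      fix \<phi> assume "\<phi> \<in> (\<lambda>g. Cmp (PSh K a) F (S F) G g (\<eta> F)) ` psh_hom (S F) G"
      then show "\<phi> \<in> psh_hom F G" using PSh_Cmp_in[OF F S(2)[OF F] G(1) \<eta>(1)[OF F]] by blast
    next
      fix \<phi> assume \<phi>: "\<phi> \<in> psh_hom F G"
      obtain \<psi> where \<psi>: "\<psi> \<in> psh_hom (S F) G" "\<forall>A\<in>Ob a. \<forall>x\<in>carrier (FOb F A). \<psi> A (\<eta> F A x) = \<phi> A x"
        using ext[OF F G hom_lin_nat[OF F G(1) \<phi>]] by blast
      have "Cmp (PSh K a) F (S F) G \<psi> (\<eta> F) = \<phi>"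
        by (rule psh_hom_eqI[OF F G(1) PSh_Cmp_in[OF F S(2)[OF F] G(1) \<eta>(1)[OF F] \<psi>(1)] \<phi>]) (use \<psi>(2) in simp)
      then show "\<phi> \<in> (\<lambda>g. Cmp (PSh K a) F (S F) G g (\<eta> F)) ` psh_hom (S F) G" using \<psi>(1) by blast
    qed
  qed
  ultimately have "left_adjoint K (PSh K a) (Sh K a T) L id_linfun (restrict \<eta> (Ob (PSh K a)))"
    unfolding left_adjoint_def by (simp add: id_linfun_def L)
  then show ?thesis by blast
qed

section \<open>The chosen sheafification and the functor Z\<close>

definition shf :: "(('o, 'v, 'k) presheaf, 'o \<Rightarrow> 'v \<Rightarrow> 'v, ('o, 'v, 'k) presheaf, 'o \<Rightarrow> 'v \<Rightarrow> 'v) linfun" where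
  "shf = sheafification K a T"

text \<open>The functor \<open>sheafification\<close> is chosen without a unit, so a unit is chosen
  afterwards for this fixed functor.\<close>

definition shf_unit :: "('o, 'v, 'k) presheaf \<Rightarrow> 'o \<Rightarrow> 'v \<Rightarrow> 'v" where
  "shf_unit = (SOME \<eta>. left_adjoint K (PSh K a) (Sh K a T) shf id_linfun \<eta>)"

lemma adj: "left_adjoint K (PSh K a) (Sh K a T) shf id_linfun shf_unit"
proof -
  have "\<exists>\<eta>. left_adjoint K (PSh K a) (Sh K a T) shf id_linfun \<eta>"
    unfolding shf_def sheafification_def by (rule someI_ex[OF sheafification_exists])
  then show ?thesis unfolding shf_unit_def by (rule someI_ex)
qed

lemma shf_functor: "linear_functor K (PSh K a) (Sh K a T) shf"
  using adj unfolding left_adjoint_def by blast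

lemma shf_sheaf: "F \<in> Ob (PSh K a) \<Longrightarrow> is_sheaf K a T (FOb shf F)"
  using shf_functor unfolding linear_functor_def Sh_simps by blast

lemma shf_hom: "F \<in> Ob (PSh K a) \<Longrightarrow> G \<in> Ob (PSh K a) \<Longrightarrow> \<phi> \<in> psh_hom F G \<Longrightarrow> FAr shf F G \<phi> \<in> psh_hom (FOb shf F) (FOb shf G)"
  using shf_functor unfolding linear_functor_def Sh_simps by blast

lemma shf_unit_nat: "shf_unit \<in> nat_trans (PSh K a) (PSh K a) id_linfun (comp_linfun id_linfun shf)"
  using adj unfolding left_adjoint_def by blast

lemma shf_unit_hom: "F \<in> Ob (PSh K a) \<Longrightarrow> shf_unit F \<in> psh_hom F (FOb shf F)"
  using shf_unit_nat unfolding nat_trans_def id_linfun_def comp_linfun_def by auto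

lemma shf_unit_lin_nat: "F \<in> Ob (PSh K a) \<Longrightarrow> lin_nat F (FOb shf F) (shf_unit F)"
  using hom_lin_nat[OF PSh_psh sheaf_psh[OF shf_sheaf] shf_unit_hom] .

lemma shf_shf_unit:
  assumes "F \<in> Ob (PSh K a)" "G \<in> Ob (PSh K a)" "\<phi> \<in> psh_hom F G" "A \<in> Ob a" "x \<in> carrier (FOb F A)"
  shows "FAr shf F G \<phi> A (shf_unit F A x) = shf_unit G A (\<phi> A x)"
proof -
  have "Cmp (PSh K a) F G (FOb shf G) (shf_unit G) \<phi> = Cmp (PSh K a) F (FOb shf F) (FOb shf G) (FAr shf F G \<phi>) (shf_unit F)"
    using shf_unit_nat assms(1-3) unfolding nat_trans_def id_linfun_def comp_linfun_def by auto
  from fun_cong[OF fun_cong[OF this, of A], of x] show ?thesis using assms by simp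
qed

lemma adj_bij:
  "F \<in> Ob (PSh K a) \<Longrightarrow> is_sheaf K a T G \<Longrightarrow>
   bij_betw (\<lambda>g. Cmp (PSh K a) F (FOb shf F) G g (shf_unit F)) (psh_hom (FOb shf F) G) (psh_hom F G)"
  using adj unfolding left_adjoint_def Sh_simps by (auto simp: id_linfun_def)

lemma adj_ext:
  assumes F: "F \<in> Ob (PSh K a)" and G: "is_sheaf K a T G" and \<phi>: "lin_nat F G \<phi>"
  obtains \<psi> where "\<psi> \<in> psh_hom (FOb shf F) G" "\<And>A x. A \<in> Ob a \<Longrightarrow> x \<in> carrier (FOb F A) \<Longrightarrow> \<psi> A (shf_unit F A x) = \<phi> A x"
proof -
  have "res_nat F \<phi> \<in> psh_hom F G" by (rule res_nat_hom[OF PSh_psh[OF F] sheaf_psh[OF G] \<phi>])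
  then have "res_nat F \<phi> \<in> (\<lambda>g. Cmp (PSh K a) F (FOb shf F) G g (shf_unit F)) ` psh_hom (FOb shf F) G"
    unfolding bij_betw_imp_surj_on[OF adj_bij[OF F G]] .
  then obtain \<psi> where \<psi>: "\<psi> \<in> psh_hom (FOb shf F) G" "res_nat F \<phi> = Cmp (PSh K a) F (FOb shf F) G \<psi> (shf_unit F)"
    by (elim imageE) (rule that)
  show thesis
  proof (rule that[OF \<psi>(1)])
    fix A x assume "A \<in> Ob a" "x \<in> carrier (FOb F A)"
    then show "\<psi> A (shf_unit F A x) = \<phi> A x" using fun_cong[OF fun_cong[OF \<psi>(2), of A], of x] by simp
  qed
qed

lemma adj_uniq_hom:
  assumes F: "F \<in> Ob (PSh K a)" and G: "is_sheaf K a T G"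
    and \<psi>: "\<psi> \<in> psh_hom (FOb shf F) G" "\<psi>' \<in> psh_hom (FOb shf F) G"
    and eq: "\<And>A x. A \<in> Ob a \<Longrightarrow> x \<in> carrier (FOb F A) \<Longrightarrow> \<psi> A (shf_unit F A x) = \<psi>' A (shf_unit F A x)"
  shows "\<psi> = \<psi>'"
proof (rule inj_onD[OF bij_betw_imp_inj_on[OF adj_bij[OF F G]] _ \<psi>])
  show "Cmp (PSh K a) F (FOb shf F) G \<psi> (shf_unit F) = Cmp (PSh K a) F (FOb shf F) G \<psi>' (shf_unit F)"
    unfolding PSh_Cmp using eq by (auto simp: res_nat_def fun_eq_iff)
qed

text \<open>The adjunction is all that is known about the chosen unit. The map from F to the sheaf
  built by hand factors through it, so whatever the unit kills is killed there as well, and the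
  kernel there is the torsion.\<close>

lemma shf_unit_torsion:
  assumes F: "F \<in> Ob (PSh K a)" and A: "A \<in> Ob a" "x \<in> carrier (FOb F A)" and 0: "shf_unit F A x = \<zero>\<^bsub>FOb (FOb shf F) A\<^esub>"
  shows "x \<in> torsion F A"
proof -
  note F' = PSh_psh[OF F]
  obtain L \<eta> where L: "is_sheaf K a T L" "lin_nat F L \<eta>"
    "\<And>A x. A \<in> Ob a \<Longrightarrow> x \<in> carrier (FOb F A) \<Longrightarrow> \<eta> A x = \<zero>\<^bsub>FOb L A\<^esub> \<longleftrightarrow> x \<in> torsion F A"
    using sheaf_quot[OF F' closed_sub_torsion[OF F'] inj_on_id[of UNIV]] by metis
  obtain \<psi> where \<psi>: "\<psi> \<in> psh_hom (FOb shf F) L"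
    "\<And>A x. A \<in> Ob a \<Longrightarrow> x \<in> carrier (FOb F A) \<Longrightarrow> \<psi> A (shf_unit F A x) = \<eta> A x"
    by (rule adj_ext[OF F L(1,2)]) (rule that)
  note S = sheaf_psh[OF shf_sheaf[OF F]] and L' = sheaf_psh[OF L(1)]
  have "\<eta> A x = \<zero>\<^bsub>FOb L A\<^esub>"
    using \<psi>(2)[OF A] 0 lin_nat_zero_neg(1)[OF S L' hom_lin_nat[OF S L' \<psi>(1)] A(1)] by simp
  then show ?thesis using L(3)[OF A] by simp
qed

text \<open>A map from the sheafification to a sheaf that vanishes after composition with the unit
  is zero by uniqueness in the adjunction; \<open>epi_locsurj\<close> turns this into local
  surjectivity.\<close>

lemma shf_unit_locsurj:
  assumes F: "F \<in> Ob (PSh K a)"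
  shows "locsurj F (FOb shf F) (shf_unit F)"
proof (rule epi_locsurj[OF PSh_psh[OF F] sheaf_psh[OF shf_sheaf[OF F]] shf_unit_lin_nat[OF F]])
  note S = sheaf_psh[OF shf_sheaf[OF F]]
  fix H \<kappa> A y assume H: "is_sheaf K a T H" and \<kappa>: "lin_nat (FOb shf F) H \<kappa>"
    and 0: "\<And>A x. A \<in> Ob a \<Longrightarrow> x \<in> carrier (FOb F A) \<Longrightarrow> \<kappa> A (shf_unit F A x) = \<zero>\<^bsub>FOb H A\<^esub>"
    and A: "A \<in> Ob a" "y \<in> carrier (FOb (FOb shf F) A)"
  note H' = sheaf_psh[OF H]
  have "res_nat (FOb shf F) \<kappa> = res_nat (FOb shf F) (\<lambda>A x. \<zero>\<^bsub>FOb H A\<^esub>)"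
    by (rule adj_uniq_hom[OF F H res_nat_hom[OF S H' \<kappa>] res_nat_hom[OF S H' lin_nat_zero_map[OF S H']]])
      (simp add: 0 lin_nat_in[OF shf_unit_lin_nat[OF F]])
  from fun_cong[OF fun_cong[OF this, of A], of y] show "\<kappa> A y = \<zero>\<^bsub>FOb H A\<^esub>" using A by simp
qed

abbreviation "Zo X \<equiv> FOb (Zfun K a T) X"
abbreviation "Za X Y f \<equiv> FAr (Zfun K a T) X Y f"
definition "Z_unit X = shf_unit (yo X)"

lemma Zfun_eq: "Zo X = FOb shf (yo X)" "Za X Y f = FAr shf (yo X) (yo Y) (FAr (yoneda a) X Y f)"
  by (simp_all add: Zfun_def comp_linfun_def shf_def)

lemma Zo_sheaf [simp]: "X \<in> Ob a \<Longrightarrow> is_sheaf K a T (Zo X)"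
  unfolding Zfun_eq by (rule shf_sheaf[OF yoneda_Ob])

lemma Zo_psh [simp]: "X \<in> Ob a \<Longrightarrow> psh (Zo X)"
  by (rule sheaf_psh[OF Zo_sheaf])

lemma Zo_sheaf_elt [simp]: "X \<in> Ob a \<Longrightarrow> sheaf_elt (Zo X)"
  by (rule sheaf_sheaf_elt[OF Zo_sheaf])

lemma Za_hom: "X \<in> Ob a \<Longrightarrow> Y \<in> Ob a \<Longrightarrow> f \<in> hm X Y \<Longrightarrow> Za X Y f \<in> psh_hom (Zo X) (Zo Y)"
  unfolding Zfun_eq by (rule shf_hom[OF yoneda_Ob yoneda_Ob yoneda_hom(1)])

lemma Z_unit_lin_nat: "X \<in> Ob a \<Longrightarrow> lin_nat (yo X) (Zo X) (Z_unit X)"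
  unfolding Zfun_eq Z_unit_def by (rule shf_unit_lin_nat[OF yoneda_Ob])

lemma Z_unit_in: "X \<in> Ob a \<Longrightarrow> A \<in> Ob a \<Longrightarrow> g \<in> hm A X \<Longrightarrow> Z_unit X A g \<in> carrier (FOb (Zo X) A)"
  using lin_nat_in[OF Z_unit_lin_nat, of X A g] by simp

lemma Za_Z_unit:
  assumes "X \<in> Ob a" "Y \<in> Ob a" "f \<in> hm X Y" "A \<in> Ob a" "g \<in> hm A X"
  shows "Za X Y f A (Z_unit X A g) = Z_unit Y A (Cmp a A X Y f g)"
  using shf_shf_unit[OF yoneda_Ob yoneda_Ob yoneda_hom(1), of X Y f A g] assms yoneda_hom(2)[of X Y f A g]
  unfolding Zfun_eq Z_unit_def by simp

text \<open>The adjunction and the Yoneda lemma together: morphisms from \<open>Zo X\<close> to a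
  sheaf G correspond to elements of G over X, by evaluation at the image of the identity.
  \<open>Z_uniq\<close> is the injectivity of this evaluation, so equality of such morphisms is
  tested at a single element.\<close>

lemma Z_ext:
  assumes X: "X \<in> Ob a" and G: "is_sheaf K a T G" and x: "x \<in> carrier (FOb G X)"
  obtains \<psi> where "\<psi> \<in> psh_hom (Zo X) G" "\<And>A g. A \<in> Ob a \<Longrightarrow> g \<in> hm A X \<Longrightarrow> \<psi> A (Z_unit X A g) = FAr G X A g x"
proof -
  obtain \<psi> where "\<psi> \<in> psh_hom (FOb shf (yo X)) G"
    "\<And>A g. A \<in> Ob a \<Longrightarrow> g \<in> carrier (FOb (yo X) A) \<Longrightarrow> \<psi> A (shf_unit (yo X) A g) = FAr G X A g x"
    by (rule adj_ext[OF yoneda_Ob[OF X] G lin_nat_yoneda[OF sheaf_psh[OF G] X x]]) (rule that)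
  then show thesis using that[of \<psi>] unfolding Zfun_eq Z_unit_def by simp
qed

lemma Z_unit_eq:
  assumes "X \<in> Ob a" "A \<in> Ob a" "g \<in> hm A X"
  shows "Z_unit X A g = FAr (Zo X) X A g (Z_unit X X (Idt a X))"
  using lin_nat_yoneda_eq[OF Zo_psh[OF assms(1)] assms(1) Z_unit_lin_nat[OF assms(1)] assms(2,3)] .

lemma Z_uniq:
  assumes X: "X \<in> Ob a" and G: "is_sheaf K a T G" and \<psi>: "\<psi> \<in> psh_hom (Zo X) G" "\<psi>' \<in> psh_hom (Zo X) G"
    and eq: "\<psi> X (Z_unit X X (Idt a X)) = \<psi>' X (Z_unit X X (Idt a X))"
  shows "\<psi> = \<psi>'"
proof (rule adj_uniq_hom[OF yoneda_Ob[OF X] G \<psi>[unfolded Zfun_eq]])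
  fix A g assume A: "A \<in> Ob a" "g \<in> carrier (FOb (yo X) A)"
  note e = hom_lin_nat[OF Zo_psh[OF X] sheaf_psh[OF G]]
  have z: "Z_unit X X (Idt a X) \<in> carrier (FOb (Zo X) X)" using X by (simp add: Z_unit_in)
  have "\<psi> A (Z_unit X A g) = \<psi>' A (Z_unit X A g)"
    using Z_unit_eq[OF X A(1), of g] A lin_nat_act[OF e[OF \<psi>(1)] X A(1) _ z, of g] lin_nat_act[OF e[OF \<psi>(2)] X A(1) _ z, of g] eq
    by simp
  then show "\<psi> A (shf_unit (yo X) A g) = \<psi>' A (shf_unit (yo X) A g)" by (simp add: Z_unit_def)
qed

lemma Z_unit_locsurj: "X \<in> Ob a \<Longrightarrow> locsurj (yo X) (Zo X) (Z_unit X)"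
  unfolding Zfun_eq Z_unit_def by (rule shf_unit_locsurj[OF yoneda_Ob])

section \<open>Full faithfulness\<close>

lemma fully_faithful_iff:
  "fully_faithful a (Sh K a T) (Zfun K a T) \<longleftrightarrow>
    (\<forall>X\<in>Ob a. \<forall>Y\<in>Ob a. bij_betw (Z_unit Y X) (hm X Y) (carrier (FOb (Zo Y) X)))"
  unfolding fully_faithful_def Sh_simps
proof (intro ball_cong refl)
  fix X Y assume X: "X \<in> Ob a" and Y: "Y \<in> Ob a"
  let ?ev = "\<lambda>\<psi>. \<psi> X (Z_unit X X (Idt a X))"
  have z: "Z_unit X X (Idt a X) \<in> carrier (FOb (Zo X) X)" using X by (simp add: Z_unit_in)
  have ev: "bij_betw ?ev (psh_hom (Zo X) (Zo Y)) (carrier (FOb (Zo Y) X))"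
    unfolding bij_betw_def
  proof (intro conjI inj_onI equalityI subsetI)
    fix \<psi> \<psi>' assume "\<psi> \<in> psh_hom (Zo X) (Zo Y)" "\<psi>' \<in> psh_hom (Zo X) (Zo Y)" "?ev \<psi> = ?ev \<psi>'"
    then show "\<psi> = \<psi>'" using Z_uniq[OF X Zo_sheaf[OF Y]] by blast
  next
    fix y assume "y \<in> ?ev ` psh_hom (Zo X) (Zo Y)"
    then show "y \<in> carrier (FOb (Zo Y) X)"
      using lin_nat_in[OF hom_lin_nat[OF Zo_psh[OF X] Zo_psh[OF Y]] X z] by blast
  next
    fix y assume y: "y \<in> carrier (FOb (Zo Y) X)"
    obtain \<psi> where \<psi>: "\<psi> \<in> psh_hom (Zo X) (Zo Y)"
      "\<And>A g. A \<in> Ob a \<Longrightarrow> g \<in> hm A X \<Longrightarrow> \<psi> A (Z_unit X A g) = FAr (Zo Y) X A g y"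
      by (rule Z_ext[OF X Zo_sheaf[OF Y] y]) (rule that)
    have "?ev \<psi> = y" using \<psi>(2)[OF X Idt_in[OF X]] X Y y by simp
    then show "y \<in> ?ev ` psh_hom (Zo X) (Zo Y)" using \<psi>(1) by blast
  qed
  have "bij_betw (Za X Y) (hm X Y) (psh_hom (Zo X) (Zo Y)) \<longleftrightarrow>
      bij_betw (?ev \<circ> Za X Y) (hm X Y) (carrier (FOb (Zo Y) X))"
    by (rule bij_betw_comp_iff2[OF ev]) (use Za_hom[OF X Y] in blast)
  also have "\<dots> \<longleftrightarrow> bij_betw (Z_unit Y X) (hm X Y) (carrier (FOb (Zo Y) X))"
    by (rule bij_betw_cong) (use X Y in \<open>simp add: Za_Z_unit\<close>)
  finally show "bij_betw (Za X Y) (hm X Y) (psh_hom (Zo X) (Zo Y)) \<longleftrightarrow>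
      bij_betw (Z_unit Y X) (hm X Y) (carrier (FOb (Zo Y) X))" .
qed

lemma subcanonical_iff_fully_faithful:
  "subcanonical K a T \<longleftrightarrow> fully_faithful a (Sh K a T) (Zfun K a T)"
  unfolding fully_faithful_iff subcanonical_iff
proof (intro iffI ballI)
  fix X Y assume "\<forall>Y\<in>Ob a. sheaf_elt (yo Y)" and X: "X \<in> Ob a" and Y: "Y \<in> Ob a"
  then have s: "is_sheaf K a T (yo Y)" using is_sheaf_iff yoneda_Ob by blast
  note y = psh_yoneda[OF Y]
  \<comment> \<open>The identity of the sheaf \<open>yo Y\<close> extends along the unit to a
    one-sided inverse of the unit. The other composite agrees with the identity of
    \<open>Zo Y\<close> on the image of the identity morphism, so \<open>Z_uniq\<close> makes the
    inverse two-sided.\<close>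
  obtain \<psi> where \<psi>: "\<psi> \<in> psh_hom (Zo Y) (yo Y)"
    "\<And>A g. A \<in> Ob a \<Longrightarrow> g \<in> hm A Y \<Longrightarrow> \<psi> A (Z_unit Y A g) = FAr (yo Y) Y A g (Idt a Y)"
    by (rule Z_ext[OF Y s, of "Idt a Y"]) (simp add: Y, rule that)
  note e = hom_lin_nat[OF Zo_psh[OF Y] y \<psi>(1)]
  have 1: "\<psi> A (Z_unit Y A g) = g" if "A \<in> Ob a" "g \<in> hm A Y" for A g using \<psi>(2)[OF that] that Y by simp
  have i: "Idt (PSh K a) (Zo Y) \<in> psh_hom (Zo Y) (Zo Y)"
    unfolding PSh_ops by (rule res_nat_hom) (use Y in \<open>simp_all add: lin_nat_def\<close>)
  have c: "res_nat (Zo Y) (\<lambda>A x. Z_unit Y A (\<psi> A x)) \<in> psh_hom (Zo Y) (Zo Y)"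
    by (rule res_nat_hom[OF _ _ lin_nat_comp[OF e Z_unit_lin_nat[OF Y]]]) (use Y in simp_all)
  have 2: "Idt (PSh K a) (Zo Y) = res_nat (Zo Y) (\<lambda>A x. Z_unit Y A (\<psi> A x))"
    by (rule Z_uniq[OF Y Zo_sheaf[OF Y] i c]) (use Y 1 in \<open>simp add: PSh_ops Z_unit_in\<close>)
  have 3: "Z_unit Y X (\<psi> X z) = z" if "z \<in> carrier (FOb (Zo Y) X)" for z
    using fun_cong[OF fun_cong[OF 2, of X], of z] that X by (simp add: PSh_ops)
  show "bij_betw (Z_unit Y X) (hm X Y) (carrier (FOb (Zo Y) X))"
    by (rule bij_betw_byWitness[of _ "\<psi> X"])
      (use 1[OF X] 3 Z_unit_in[OF Y X] lin_nat_in[OF e X] in auto)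
next
  fix Y assume b: "\<forall>X\<in>Ob a. \<forall>Y\<in>Ob a. bij_betw (Z_unit Y X) (hm X Y) (carrier (FOb (Zo Y) X))" and Y: "Y \<in> Ob a"
  \<comment> \<open>The unit at Y is bijective over every object, so its inverse carries the sheaf
    condition from \<open>Zo Y\<close> to \<open>yo Y\<close>.\<close>
  let ?d = "\<lambda>A. inv_into (carrier (FOb (yo Y) A)) (Z_unit Y A)"
  show "sheaf_elt (yo Y)"
  proof (rule sheaf_elt_iso[OF Zo_psh[OF Y] Zo_sheaf_elt[OF Y] psh_yoneda[OF Y]])
    show "lin_nat (Zo Y) (yo Y) ?d"
      by (rule lin_nat_inv[OF psh_yoneda[OF Y] Zo_psh[OF Y] Z_unit_lin_nat[OF Y]]) (use b Y in simp)
    show "bij_betw (?d A) (carrier (FOb (Zo Y) A)) (carrier (FOb (yo Y) A))" if "A \<in> Ob a" for A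
      by (rule bij_betw_inv_into) (use b Y that in simp)
  qed
qed

end

section \<open>Formal morphisms\<close>

context lin_cat
begin

lemma Cmp_zero:
  assumes "X \<in> Ob a" "Y \<in> Ob a" "Z \<in> Ob a"
  shows "f \<in> hm X Y \<Longrightarrow> Cmp a X Y Z \<zero>\<^bsub>Hm a Y Z\<^esub> f = \<zero>\<^bsub>Hm a X Z\<^esub>"
    and "g \<in> hm Y Z \<Longrightarrow> Cmp a X Y Z g \<zero>\<^bsub>Hm a X Y\<^esub> = \<zero>\<^bsub>Hm a X Z\<^esub>"
  using act_zero_neg(1)[OF psh_yoneda[OF assms(3)] assms(2,1), of f]
    act_zero_neg_left(1)[OF psh_yoneda[OF assms(3)] assms(2,1), of g] assms by simp_all

lemma Hmon: "X \<in> Ob a \<Longrightarrow> Y \<in> Ob a \<Longrightarrow> abelian_monoid (Hm a X Y)"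
  using abelian_group.axioms(1)[OF Hgrp] .

lemma Hzero_add [simp]:
  assumes "X \<in> Ob a" "Y \<in> Ob a" "f \<in> hm X Y"
  shows "f \<oplus>\<^bsub>Hm a X Y\<^esub> \<zero>\<^bsub>Hm a X Y\<^esub> = f" "\<zero>\<^bsub>Hm a X Y\<^esub> \<oplus>\<^bsub>Hm a X Y\<^esub> f = f"
  using abelian_monoid.r_zero[OF Hmon] abelian_monoid.l_zero[OF Hmon] assms by auto

definition supp :: "'o \<Rightarrow> ('i, 'o) fam \<Rightarrow> ('i \<Rightarrow> 'v) \<Rightarrow> 'i set" where
  "supp A Y g = {\<beta>\<in>fst Y. g \<beta> \<noteq> \<zero>\<^bsub>Hm a A (snd Y \<beta>)\<^esub>}"

text \<open>Formal morphisms from a single object to a family are the sections of a direct sum of representable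
  presheaves; this turns the calculus of matrices into naturality.\<close>

definition dirsum :: "('i, 'o) fam \<Rightarrow> ('o, 'v, ('k, 'i \<Rightarrow> 'v) module, ('i \<Rightarrow> 'v) \<Rightarrow> ('i \<Rightarrow> 'v)) linfun" where
  "dirsum Y = \<lparr>FOb = (\<lambda>A. \<lparr>carrier = {g \<in> \<Pi>\<^sub>E \<beta>\<in>fst Y. hm A (snd Y \<beta>). finite (supp A Y g)},
       mult = undefined, one = undefined,
       zero = (\<lambda>\<beta>\<in>fst Y. \<zero>\<^bsub>Hm a A (snd Y \<beta>)\<^esub>),
       add = (\<lambda>g h. \<lambda>\<beta>\<in>fst Y. g \<beta> \<oplus>\<^bsub>Hm a A (snd Y \<beta>)\<^esub> h \<beta>),
       smult = (\<lambda>r g. \<lambda>\<beta>\<in>fst Y. r \<odot>\<^bsub>Hm a A (snd Y \<beta>)\<^esub> g \<beta>)\<rparr>),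
     FAr = (\<lambda>A B f g. \<lambda>\<beta>\<in>fst Y. Cmp a B A (snd Y \<beta>) (g \<beta>) f)\<rparr>"

lemma dirsum_simps:
  "carrier (FOb (dirsum Y) A) = {g \<in> \<Pi>\<^sub>E \<beta>\<in>fst Y. hm A (snd Y \<beta>). finite (supp A Y g)}"
  "\<zero>\<^bsub>FOb (dirsum Y) A\<^esub> = (\<lambda>\<beta>\<in>fst Y. \<zero>\<^bsub>Hm a A (snd Y \<beta>)\<^esub>)"
  "g \<oplus>\<^bsub>FOb (dirsum Y) A\<^esub> h = (\<lambda>\<beta>\<in>fst Y. g \<beta> \<oplus>\<^bsub>Hm a A (snd Y \<beta>)\<^esub> h \<beta>)"
  "r \<odot>\<^bsub>FOb (dirsum Y) A\<^esub> g = (\<lambda>\<beta>\<in>fst Y. r \<odot>\<^bsub>Hm a A (snd Y \<beta>)\<^esub> g \<beta>)"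
  "FAr (dirsum Y) A B f g = (\<lambda>\<beta>\<in>fst Y. Cmp a B A (snd Y \<beta>) (g \<beta>) f)"
  by (simp_all add: dirsum_def)

lemma dirsum_apply [simp]:
  assumes "\<beta> \<in> fst Y"
  shows "\<zero>\<^bsub>FOb (dirsum Y) A\<^esub> \<beta> = \<zero>\<^bsub>Hm a A (snd Y \<beta>)\<^esub>"
    "(g \<oplus>\<^bsub>FOb (dirsum Y) A\<^esub> h) \<beta> = g \<beta> \<oplus>\<^bsub>Hm a A (snd Y \<beta>)\<^esub> h \<beta>"
    "FAr (dirsum Y) A B f g \<beta> = Cmp a B A (snd Y \<beta>) (g \<beta>) f"
  using assms by (simp_all add: dirsum_simps)

lemma dirsum_I: "g \<in> extensional (fst Y) \<Longrightarrow> (\<And>\<beta>. \<beta> \<in> fst Y \<Longrightarrow> g \<beta> \<in> hm A (snd Y \<beta>)) \<Longrightarrow> finite S \<Longrightarrow>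
    (\<And>\<beta>. \<beta> \<in> fst Y \<Longrightarrow> \<beta> \<notin> S \<Longrightarrow> g \<beta> = \<zero>\<^bsub>Hm a A (snd Y \<beta>)\<^esub>) \<Longrightarrow> g \<in> carrier (FOb (dirsum Y) A)"
  by (auto simp: dirsum_simps supp_def PiE_def intro: finite_subset[of _ S])

lemma dirsum_D:
  assumes "g \<in> carrier (FOb (dirsum Y) A)"
  shows "g \<in> extensional (fst Y)" "finite (supp A Y g)" "\<beta> \<in> fst Y \<Longrightarrow> g \<beta> \<in> hm A (snd Y \<beta>)"
    "\<beta> \<in> fst Y \<Longrightarrow> \<beta> \<notin> supp A Y g \<Longrightarrow> g \<beta> = \<zero>\<^bsub>Hm a A (snd Y \<beta>)\<^esub>"
  using assms by (auto simp: dirsum_simps supp_def PiE_def Pi_def)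

lemma dirsum_eqI:
  assumes "g \<in> carrier (FOb (dirsum Y) A)" "h \<in> carrier (FOb (dirsum Y) A)" "\<And>\<beta>. \<beta> \<in> fst Y \<Longrightarrow> g \<beta> = h \<beta>"
  shows "g = h"
  using dirsum_D(1)[OF assms(1)] dirsum_D(1)[OF assms(2)] assms(3) by (rule extensionalityI)

lemma fam_Ob [simp]: "is_fam a Y \<Longrightarrow> \<beta> \<in> fst Y \<Longrightarrow> snd Y \<beta> \<in> Ob a"
  unfolding is_fam_def by blast

lemma dirsum_closed:
  assumes Y: "is_fam a Y" and A: "A \<in> Ob a"
  shows "\<zero>\<^bsub>FOb (dirsum Y) A\<^esub> \<in> carrier (FOb (dirsum Y) A)"
    "g \<in> carrier (FOb (dirsum Y) A) \<Longrightarrow> h \<in> carrier (FOb (dirsum Y) A) \<Longrightarrow> g \<oplus>\<^bsub>FOb (dirsum Y) A\<^esub> h \<in> carrier (FOb (dirsum Y) A)"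
    "g \<in> carrier (FOb (dirsum Y) A) \<Longrightarrow> r \<in> carrier K \<Longrightarrow> r \<odot>\<^bsub>FOb (dirsum Y) A\<^esub> g \<in> carrier (FOb (dirsum Y) A)"
    "g \<in> carrier (FOb (dirsum Y) A) \<Longrightarrow> B \<in> Ob a \<Longrightarrow> f \<in> hm B A \<Longrightarrow> FAr (dirsum Y) A B f g \<in> carrier (FOb (dirsum Y) B)"
proof -
  show "\<zero>\<^bsub>FOb (dirsum Y) A\<^esub> \<in> carrier (FOb (dirsum Y) A)"
    by (rule dirsum_I[of _ _ _ "{}"]) (use Y A in \<open>auto simp: dirsum_simps\<close>)
  show "g \<oplus>\<^bsub>FOb (dirsum Y) A\<^esub> h \<in> carrier (FOb (dirsum Y) A)" if "g \<in> carrier (FOb (dirsum Y) A)" "h \<in> carrier (FOb (dirsum Y) A)"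
    by (rule dirsum_I[of _ _ _ "supp A Y g \<union> supp A Y h"])
      (use Y A dirsum_D[OF that(1)] dirsum_D[OF that(2)] in \<open>auto simp: dirsum_simps(3)\<close>)
  show "r \<odot>\<^bsub>FOb (dirsum Y) A\<^esub> g \<in> carrier (FOb (dirsum Y) A)" if "g \<in> carrier (FOb (dirsum Y) A)" "r \<in> carrier K"
    by (rule dirsum_I[of _ _ _ "supp A Y g"])
      (use Y A dirsum_D[OF that(1)] that(2) module.smult_r_null[OF Hmod] in \<open>auto simp: dirsum_simps(4)\<close>)
  show "FAr (dirsum Y) A B f g \<in> carrier (FOb (dirsum Y) B)" if "g \<in> carrier (FOb (dirsum Y) A)" "B \<in> Ob a" "f \<in> hm B A"
    by (rule dirsum_I[of _ _ _ "supp A Y g"])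
      (use Y A dirsum_D[OF that(1)] that(2,3) Cmp_zero(1) in \<open>auto simp: dirsum_simps(5)\<close>)
qed

lemma psh_dirsum [simp]:
  assumes Y: "is_fam a Y" shows "psh (dirsum Y)"
proof -
  note cl = dirsum_closed[OF Y]
  have grp: "abelian_group (FOb (dirsum Y) A)" if A: "A \<in> Ob a" for A
  proof (rule abelian_groupI)
    fix x assume x: "x \<in> carrier (FOb (dirsum Y) A)"
    show "\<zero>\<^bsub>FOb (dirsum Y) A\<^esub> \<oplus>\<^bsub>FOb (dirsum Y) A\<^esub> x = x"
      by (rule dirsum_eqI[OF cl(2)[OF A cl(1)[OF A] x] x]) (use dirsum_D(3)[OF x] A Y in simp)
    let ?n = "(\<ominus>\<^bsub>K\<^esub> \<one>\<^bsub>K\<^esub>) \<odot>\<^bsub>FOb (dirsum Y) A\<^esub> x"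
    have n: "?n \<in> carrier (FOb (dirsum Y) A)" using cl(3)[OF A x] by simp
    show "\<exists>y\<in>carrier (FOb (dirsum Y) A). y \<oplus>\<^bsub>FOb (dirsum Y) A\<^esub> x = \<zero>\<^bsub>FOb (dirsum Y) A\<^esub>"
    proof (rule bexI[OF _ n], rule dirsum_eqI[OF cl(2)[OF A n x] cl(1)[OF A]])
      fix \<beta> assume b: "\<beta> \<in> fst Y"
      interpret H: module K "Hm a A (snd Y \<beta>)" by (rule Hmod) (use A Y b in auto)
      show "(?n \<oplus>\<^bsub>FOb (dirsum Y) A\<^esub> x) \<beta> = \<zero>\<^bsub>FOb (dirsum Y) A\<^esub> \<beta>"
        using b dirsum_D(3)[OF x b] by (simp add: dirsum_simps(4) H.smult_l_minus H.l_neg)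
    qed
    fix y assume y: "y \<in> carrier (FOb (dirsum Y) A)"
    show "x \<oplus>\<^bsub>FOb (dirsum Y) A\<^esub> y = y \<oplus>\<^bsub>FOb (dirsum Y) A\<^esub> x"
      by (rule dirsum_eqI[OF cl(2)[OF A x y] cl(2)[OF A y x]])
        (use dirsum_D(3)[OF x] dirsum_D(3)[OF y] A Y in \<open>simp add: abelian_monoid.a_comm[OF Hmon]\<close>)
    fix z assume z: "z \<in> carrier (FOb (dirsum Y) A)"
    show "x \<oplus>\<^bsub>FOb (dirsum Y) A\<^esub> y \<oplus>\<^bsub>FOb (dirsum Y) A\<^esub> z = x \<oplus>\<^bsub>FOb (dirsum Y) A\<^esub> (y \<oplus>\<^bsub>FOb (dirsum Y) A\<^esub> z)"
      by (rule dirsum_eqI[OF cl(2)[OF A cl(2)[OF A x y] z] cl(2)[OF A x cl(2)[OF A y z]]])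
        (use dirsum_D(3)[OF x] dirsum_D(3)[OF y] dirsum_D(3)[OF z] A Y in \<open>simp add: abelian_monoid.a_assoc[OF Hmon]\<close>)
  qed (use cl that in auto)
  have "module K (FOb (dirsum Y) A)" if A: "A \<in> Ob a" for A
  proof (rule moduleI[OF cr grp[OF A]])
    fix x assume x: "x \<in> carrier (FOb (dirsum Y) A)"
    show "\<one>\<^bsub>K\<^esub> \<odot>\<^bsub>FOb (dirsum Y) A\<^esub> x = x"
      by (rule dirsum_eqI[OF cl(3)[OF A x] x]) (use A Y dirsum_D(3)[OF x] in \<open>simp_all add: dirsum_simps(4) module.smult_one[OF Hmod]\<close>)
  qed (use cl(3)[OF A] A Y in \<open>auto simp: dirsum_simps(3,4) module.smult_l_distr[OF Hmod] module.smult_r_distr[OF Hmod]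
        module.smult_assoc1[OF Hmod] dirsum_D(3) intro!: restrict_ext\<close>)
  moreover have "FAr (dirsum Y) A A (Idt a A) x = x" if A: "A \<in> Ob a" and x: "x \<in> carrier (FOb (dirsum Y) A)" for A x
    by (rule dirsum_eqI[OF cl(4)[OF A x A] x]) (use A Y dirsum_D(3)[OF x] in simp_all)
  ultimately show ?thesis
    unfolding psh_def using cl
    by (auto simp: dirsum_D(3) dirsum_simps(3-5) Y Cmp_add_left Cmp_add_right Cmp_assoc Cmp_smult intro!: restrict_ext)
qed

text \<open>The map from the direct sum of representables to G whose component at \<beta>
  corresponds to \<open>y \<beta>\<close> under the Yoneda lemma. Matrix products and the relations
  imposed by p are all instances of it.\<close>

definition row_comb :: "('o, 'v, ('k, 'w) module, 'w \<Rightarrow> 'w) linfun \<Rightarrow> ('i, 'o) fam \<Rightarrow> ('i \<Rightarrow> 'w) \<Rightarrow> 'o \<Rightarrow> ('i \<Rightarrow> 'v) \<Rightarrow> 'w" where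
  "row_comb G Y y A g = (\<Oplus>\<^bsub>FOb G A\<^esub>\<beta>\<in>supp A Y g. FAr G (snd Y \<beta>) A (g \<beta>) (y \<beta>))"

text \<open>Supports change under addition and restriction, so sums are compared over a common
  finite index set; the additional entries are zero and act as zero.\<close>

lemma row_comb_over:
  assumes G: "psh G" and Y: "is_fam a Y" and y: "\<And>\<beta>. \<beta> \<in> fst Y \<Longrightarrow> y \<beta> \<in> carrier (FOb G (snd Y \<beta>))"
    and A: "A \<in> Ob a" and g: "\<And>\<beta>. \<beta> \<in> S \<Longrightarrow> g \<beta> \<in> hm A (snd Y \<beta>)" and S: "finite S" "supp A Y g \<subseteq> S" "S \<subseteq> fst Y"
  shows "row_comb G Y y A g = (\<Oplus>\<^bsub>FOb G A\<^esub>\<beta>\<in>S. FAr G (snd Y \<beta>) A (g \<beta>) (y \<beta>))"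
proof -
  interpret M: abelian_monoid "FOb G A" by (rule psh_mon[OF G A])
  show ?thesis unfolding row_comb_def
  proof (rule M.add.finprod_mono_neutral_cong_left[OF S(1,2)])
    fix \<beta> assume b: "\<beta> \<in> S - supp A Y g"
    then have "g \<beta> = \<zero>\<^bsub>Hm a A (snd Y \<beta>)\<^esub>" "\<beta> \<in> fst Y" using S(3) by (auto simp: supp_def)
    then show "FAr G (snd Y \<beta>) A (g \<beta>) (y \<beta>) = \<zero>\<^bsub>FOb G A\<^esub>"
      using act_zero_neg_left(1)[OF G _ A y] Y by simp
  qed (use G Y y A g S(3) in auto)
qed

lemma row_comb_lin_nat:
  assumes G: "psh G" and Y: "is_fam a Y" and y: "\<And>\<beta>. \<beta> \<in> fst Y \<Longrightarrow> y \<beta> \<in> carrier (FOb G (snd Y \<beta>))"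
  shows "lin_nat (dirsum Y) G (row_comb G Y y)"
  unfolding lin_nat_def
proof (intro conjI ballI)
  fix A g assume A: "A \<in> Ob a" and g: "g \<in> carrier (FOb (dirsum Y) A)"
  interpret M: abelian_monoid "FOb G A" by (rule psh_mon[OF G A])
  have t: "FAr G (snd Y \<beta>) A (h \<beta>) (y \<beta>) \<in> carrier (FOb G A)"
    if "h \<in> carrier (FOb (dirsum Y) A)" "\<beta> \<in> fst Y" for \<beta> h
    using dirsum_D(3)[OF that] y[OF that(2)] G Y A that(2) by simp
  show "row_comb G Y y A g \<in> carrier (FOb G A)"
    unfolding row_comb_def by (rule M.finsum_closed) (use t[OF g] in \<open>auto simp: supp_def\<close>)
  {
    fix h assume h: "h \<in> carrier (FOb (dirsum Y) A)"
    let ?S = "supp A Y g \<union> supp A Y h"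
    have S: "finite ?S" "?S \<subseteq> fst Y" using dirsum_D(2)[OF g] dirsum_D(2)[OF h] by (auto simp: supp_def)
    have gh: "supp A Y (g \<oplus>\<^bsub>FOb (dirsum Y) A\<^esub> h) \<subseteq> ?S"
      using Y A by (auto simp: supp_def)
    have "row_comb G Y y A (g \<oplus>\<^bsub>FOb (dirsum Y) A\<^esub> h) =
        (\<Oplus>\<^bsub>FOb G A\<^esub>\<beta>\<in>?S. FAr G (snd Y \<beta>) A ((g \<oplus>\<^bsub>FOb (dirsum Y) A\<^esub> h) \<beta>) (y \<beta>))"
      by (rule row_comb_over[OF G Y y A _ S(1) gh S(2)]) (use S(2) Y A dirsum_D(3)[OF g] dirsum_D(3)[OF h] in auto)
    also have "\<dots> = (\<Oplus>\<^bsub>FOb G A\<^esub>\<beta>\<in>?S. FAr G (snd Y \<beta>) A (g \<beta>) (y \<beta>) \<oplus>\<^bsub>FOb G A\<^esub> FAr G (snd Y \<beta>) A (h \<beta>) (y \<beta>))"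
      by (rule M.finsum_cong') (use S(2) Y A dirsum_D(3)[OF g] dirsum_D(3)[OF h] t[OF g] t[OF h] G y in \<open>auto simp: act_add_left\<close>)
    also have "\<dots> = (\<Oplus>\<^bsub>FOb G A\<^esub>\<beta>\<in>?S. FAr G (snd Y \<beta>) A (g \<beta>) (y \<beta>)) \<oplus>\<^bsub>FOb G A\<^esub> (\<Oplus>\<^bsub>FOb G A\<^esub>\<beta>\<in>?S. FAr G (snd Y \<beta>) A (h \<beta>) (y \<beta>))"
      by (rule M.finsum_addf) (use S(2) t[OF g] t[OF h] in auto)
    also have "\<dots> = row_comb G Y y A g \<oplus>\<^bsub>FOb G A\<^esub> row_comb G Y y A h"
    proof -
      have "row_comb G Y y A g = (\<Oplus>\<^bsub>FOb G A\<^esub>\<beta>\<in>?S. FAr G (snd Y \<beta>) A (g \<beta>) (y \<beta>))"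
        by (rule row_comb_over[OF G Y y A _ S(1) _ S(2)]) (use dirsum_D(3)[OF g] S(2) in auto)
      moreover have "row_comb G Y y A h = (\<Oplus>\<^bsub>FOb G A\<^esub>\<beta>\<in>?S. FAr G (snd Y \<beta>) A (h \<beta>) (y \<beta>))"
        by (rule row_comb_over[OF G Y y A _ S(1) _ S(2)]) (use dirsum_D(3)[OF h] S(2) in auto)
      ultimately show ?thesis by simp
    qed
    finally show "row_comb G Y y A (g \<oplus>\<^bsub>FOb (dirsum Y) A\<^esub> h) = row_comb G Y y A g \<oplus>\<^bsub>FOb G A\<^esub> row_comb G Y y A h" .
  }
  fix B f assume B: "B \<in> Ob a" "f \<in> hm B A"
  have S: "finite (supp A Y g)" "supp A Y g \<subseteq> fst Y" using dirsum_D(2)[OF g] by (auto simp: supp_def)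
  interpret MB: abelian_monoid "FOb G B" by (rule psh_mon[OF G B(1)])
  have "supp B Y (FAr (dirsum Y) A B f g) \<subseteq> supp A Y g"
    using Y A B Cmp_zero(1) by (auto simp: supp_def)
  then have "row_comb G Y y B (FAr (dirsum Y) A B f g) =
      (\<Oplus>\<^bsub>FOb G B\<^esub>\<beta>\<in>supp A Y g. FAr G (snd Y \<beta>) B (FAr (dirsum Y) A B f g \<beta>) (y \<beta>))"
    by (intro row_comb_over[OF G Y y B(1) _ S(1) _ S(2)]) (use S(2) Y A B dirsum_D(3)[OF g] in auto)
  also have "\<dots> = (\<Oplus>\<^bsub>FOb G B\<^esub>\<beta>\<in>supp A Y g. FAr G A B f (FAr G (snd Y \<beta>) A (g \<beta>) (y \<beta>)))"
    by (rule MB.finsum_cong') (use S(2) Y A B dirsum_D(3)[OF g] t[OF g] G y in \<open>auto simp: act_Cmp\<close>)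
  also have "\<dots> = FAr G A B f (row_comb G Y y A g)"
    unfolding row_comb_def
    by (rule additive_finsum[OF psh_mon[OF G A] psh_mon[OF G B(1)], symmetric])
      (use G A B S t[OF g] in \<open>auto simp: act_add act_zero_neg(1)\<close>)
  finally show "row_comb G Y y B (FAr (dirsum Y) A B f g) = FAr G A B f (row_comb G Y y A g)" .
qed

lemma lin_nat_row_comb:
  assumes G: "psh G" and H: "psh H" and \<phi>: "lin_nat G H \<phi>" and Y: "is_fam a Y"
    and y: "\<And>\<beta>. \<beta> \<in> fst Y \<Longrightarrow> y \<beta> \<in> carrier (FOb G (snd Y \<beta>))" and A: "A \<in> Ob a" and g: "g \<in> carrier (FOb (dirsum Y) A)"
  shows "\<phi> A (row_comb G Y y A g) = row_comb H Y (\<lambda>\<beta>. \<phi> (snd Y \<beta>) (y \<beta>)) A g"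
proof -
  have t: "FAr G (snd Y \<beta>) A (g \<beta>) (y \<beta>) \<in> carrier (FOb G A)" if "\<beta> \<in> fst Y" for \<beta>
    using dirsum_D(3)[OF g that] y[OF that] G Y A that by simp
  have "\<phi> A (row_comb G Y y A g) = (\<Oplus>\<^bsub>FOb H A\<^esub>\<beta>\<in>supp A Y g. \<phi> A (FAr G (snd Y \<beta>) A (g \<beta>) (y \<beta>)))"
    unfolding row_comb_def
    by (rule additive_finsum[OF psh_mon[OF G A] psh_mon[OF H A]])
      (use t lin_nat_in[OF \<phi> A] lin_nat_add[OF \<phi> A] lin_nat_zero_neg(1)[OF G H \<phi> A] dirsum_D(2)[OF g] in \<open>auto simp: supp_def\<close>)
  also have "\<dots> = row_comb H Y (\<lambda>\<beta>. \<phi> (snd Y \<beta>) (y \<beta>)) A g"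
    unfolding row_comb_def
    by (rule abelian_monoid.finsum_cong'[OF psh_mon[OF H A]])
      (use Y A dirsum_D(3)[OF g] y lin_nat_act[OF \<phi> _ A] lin_nat_in[OF \<phi>] H in \<open>auto simp: supp_def\<close>)
  finally show ?thesis .
qed

lemma row_comb_cong:
  assumes G: "psh G" and Y: "is_fam a Y" and y: "\<And>\<beta>. \<beta> \<in> fst Y \<Longrightarrow> y \<beta> \<in> carrier (FOb G (snd Y \<beta>))"
    and A: "A \<in> Ob a" and g: "g \<in> carrier (FOb (dirsum Y) A)" and eq: "\<And>\<beta>. \<beta> \<in> fst Y \<Longrightarrow> y' \<beta> = y \<beta>"
  shows "row_comb G Y y' A g = row_comb G Y y A g"
  unfolding row_comb_def
  by (rule abelian_monoid.finsum_cong'[OF psh_mon[OF G A]])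
    (use Y A dirsum_D(3)[OF g] y eq G in \<open>auto simp: supp_def\<close>)

text \<open>The inclusion of the summand at \<beta>, evaluated at f. With f an identity these are
  the generators of the direct sum.\<close>

definition unit_row :: "('i, 'o) fam \<Rightarrow> 'i \<Rightarrow> 'o \<Rightarrow> 'v \<Rightarrow> 'i \<Rightarrow> 'v" where
  "unit_row Y \<beta> A f = (\<lambda>\<beta>'\<in>fst Y. if \<beta>' = \<beta> then f else \<zero>\<^bsub>Hm a A (snd Y \<beta>')\<^esub>)"

lemma unit_row_in:
  assumes "is_fam a Y" "\<beta> \<in> fst Y" "A \<in> Ob a" "f \<in> hm A (snd Y \<beta>)"
  shows "unit_row Y \<beta> A f \<in> carrier (FOb (dirsum Y) A)"
  by (rule dirsum_I[of _ _ _ "{\<beta>}"]) (use assms in \<open>auto simp: unit_row_def\<close>)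

lemma row_comb_unit_row:
  assumes G: "psh G" and Y: "is_fam a Y" and y: "\<And>\<beta>. \<beta> \<in> fst Y \<Longrightarrow> y \<beta> \<in> carrier (FOb G (snd Y \<beta>))"
    and b: "\<beta> \<in> fst Y" and A: "A \<in> Ob a" and f: "f \<in> hm A (snd Y \<beta>)"
  shows "row_comb G Y y A (unit_row Y \<beta> A f) = FAr G (snd Y \<beta>) A f (y \<beta>)"
proof -
  interpret M: abelian_monoid "FOb G A" by (rule psh_mon[OF G A])
  have "row_comb G Y y A (unit_row Y \<beta> A f) = (\<Oplus>\<^bsub>FOb G A\<^esub>\<beta>'\<in>{\<beta>}. FAr G (snd Y \<beta>') A (unit_row Y \<beta> A f \<beta>') (y \<beta>'))"
    by (rule row_comb_over[OF G Y y A]) (use b f in \<open>auto simp: unit_row_def supp_def\<close>)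
  also have "\<dots> = FAr G (snd Y \<beta>) A f (y \<beta>)"
    using G Y y b A f by (simp add: unit_row_def M.finsum_insert)
  finally show ?thesis .
qed

lemma proj_lin_nat:
  assumes "is_fam a Y" "\<beta> \<in> fst Y" shows "lin_nat (dirsum Y) (yo (snd Y \<beta>)) (\<lambda>A g. g \<beta>)"
  unfolding lin_nat_def using assms by (auto simp: dirsum_D(3))

lemma row_comb_dirsum_apply:
  assumes Y: "is_fam a Y" and Z: "is_fam a Z" and p: "\<And>\<gamma>. \<gamma> \<in> fst Z \<Longrightarrow> p \<gamma> \<in> carrier (FOb (dirsum Y) (snd Z \<gamma>))"
    and A: "A \<in> Ob a" and g: "g \<in> carrier (FOb (dirsum Z) A)" and b: "\<beta> \<in> fst Y"
  shows "row_comb (dirsum Y) Z p A g \<beta> = row_comb (yo (snd Y \<beta>)) Z (\<lambda>\<gamma>. p \<gamma> \<beta>) A g"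
  using lin_nat_row_comb[OF psh_dirsum[OF Y] psh_yoneda proj_lin_nat[OF Y b] Z p A g] Y b by simp

text \<open>A row is the combination of the generators with its own entries as coefficients.
  Therefore a map out of the direct sum is determined by its values on the generators, which is
  \<open>lin_nat_dirsum_eq\<close>.\<close>

lemma dirsum_decomp:
  assumes Y: "is_fam a Y" and A: "A \<in> Ob a" and g: "g \<in> carrier (FOb (dirsum Y) A)"
  shows "row_comb (dirsum Y) Y (\<lambda>\<beta>. unit_row Y \<beta> (snd Y \<beta>) (Idt a (snd Y \<beta>))) A g = g"
proof (rule dirsum_eqI[OF _ g])
  let ?i = "\<lambda>\<beta>. unit_row Y \<beta> (snd Y \<beta>) (Idt a (snd Y \<beta>))"
  have i: "?i \<beta> \<in> carrier (FOb (dirsum Y) (snd Y \<beta>))" if "\<beta> \<in> fst Y" for \<beta>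
    using unit_row_in[OF Y that] Y that by simp
  show "row_comb (dirsum Y) Y ?i A g \<in> carrier (FOb (dirsum Y) A)"
    by (rule lin_nat_in[OF row_comb_lin_nat[OF psh_dirsum[OF Y] Y i] A g])
  fix \<beta> assume b: "\<beta> \<in> fst Y"
  let ?G = "yo (snd Y \<beta>)"
  interpret M: abelian_monoid "Hm a A (snd Y \<beta>)" by (rule Hmon) (use A Y b in auto)
  have "row_comb (dirsum Y) Y ?i A g \<beta> = row_comb ?G Y (\<lambda>\<gamma>. ?i \<gamma> \<beta>) A g"
    by (rule row_comb_dirsum_apply[OF Y Y i A g b])
  \<comment> \<open>The index \<beta> is inserted since the entry \<open>g \<beta>\<close> may
    vanish; the sum can then be collapsed to \<beta> without a case distinction.\<close>
  also have "\<dots> = (\<Oplus>\<^bsub>FOb ?G A\<^esub>\<gamma>\<in>insert \<beta> (supp A Y g). FAr ?G (snd Y \<gamma>) A (g \<gamma>) (?i \<gamma> \<beta>))"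
    by (rule row_comb_over[OF psh_yoneda Y]) (use Y A b dirsum_D[OF g] i[THEN dirsum_D(3)[of _ Y]] in \<open>auto simp: supp_def\<close>)
  also have "\<dots> = (\<Oplus>\<^bsub>Hm a A (snd Y \<beta>)\<^esub>\<gamma>\<in>insert \<beta> (supp A Y g). if \<beta> = \<gamma> then g \<gamma> else \<zero>\<^bsub>Hm a A (snd Y \<beta>)\<^esub>)"
    unfolding yoneda_simps
    by (rule M.finsum_cong') (use Y A b dirsum_D(3)[OF g] in \<open>auto simp: unit_row_def supp_def Cmp_zero(1)\<close>)
  also have "\<dots> = g \<beta>"
  proof -
    have "(\<Oplus>\<^bsub>Hm a A (snd Y \<beta>)\<^esub>\<gamma>\<in>insert \<beta> (supp A Y g). if \<beta> = \<gamma> then g \<gamma> else \<zero>\<^bsub>Hm a A (snd Y \<beta>)\<^esub>) =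
      (\<Oplus>\<^bsub>Hm a A (snd Y \<beta>)\<^esub>\<gamma>\<in>{\<beta>}. g \<beta>)"
      by (rule M.add.finprod_mono_neutral_cong_right) (use Y A b dirsum_D[OF g] in auto)
    then show ?thesis using dirsum_D(3)[OF g b] by (simp add: M.finsum_insert)
  qed
  finally show "row_comb (dirsum Y) Y ?i A g \<beta> = g \<beta>" .
qed

lemma lin_nat_dirsum_eq:
  assumes Y: "is_fam a Y" and G: "psh G" and \<phi>: "lin_nat (dirsum Y) G \<phi>" and A: "A \<in> Ob a" and g: "g \<in> carrier (FOb (dirsum Y) A)"
  shows "\<phi> A g = row_comb G Y (\<lambda>\<beta>. \<phi> (snd Y \<beta>) (unit_row Y \<beta> (snd Y \<beta>) (Idt a (snd Y \<beta>)))) A g"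
proof -
  have i: "unit_row Y \<beta> (snd Y \<beta>) (Idt a (snd Y \<beta>)) \<in> carrier (FOb (dirsum Y) (snd Y \<beta>))" if "\<beta> \<in> fst Y" for \<beta>
    using unit_row_in[OF Y that] Y that by simp
  show ?thesis using lin_nat_row_comb[OF psh_dirsum[OF Y] G \<phi> Y i A g] dirsum_decomp[OF Y A g] by simp
qed

subsection \<open>Matrices\<close>

lemma sng_simps [simp]: "fst (sng X) = UNIV" "snd (sng X) u = X"
  by (simp_all add: sng_def)

lemma is_fam_sng [simp]: "is_fam a (sng X) \<longleftrightarrow> X \<in> Ob a"
  by (auto simp: is_fam_def sng_def PiE_def extensional_def)

lemma dirsum_sng: "g \<in> carrier (FOb (dirsum (sng X)) A) \<longleftrightarrow> g () \<in> hm A X"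
  by (auto simp: dirsum_simps(1) supp_def PiE_def extensional_def Pi_def sng_def)

lemma row_comb_sng:
  assumes "psh G" "X \<in> Ob a" "A \<in> Ob a" "g () \<in> hm A X" "y () \<in> carrier (FOb G X)"
  shows "row_comb G (sng X) y A g = FAr G X A (g ()) (y ())"
proof -
  interpret M: abelian_monoid "FOb G A" by (rule psh_mon[OF assms(1,3)])
  have "row_comb G (sng X) y A g = (\<Oplus>\<^bsub>FOb G A\<^esub>\<beta>\<in>UNIV. FAr G (snd (sng X) \<beta>) A (g \<beta>) (y \<beta>))"
    by (rule row_comb_over) (use assms in \<open>auto simp: UNIV_unit\<close>)
  then show ?thesis using assms by (simp add: UNIV_unit M.finsum_insert)
qed

lemma FHom_iff: "f \<in> FHom a V W \<longleftrightarrow> f \<in> extensional (fst V) \<and> (\<forall>\<alpha>\<in>fst V. f \<alpha> \<in> carrier (FOb (dirsum W) (snd V \<alpha>)))"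
  by (auto simp: FHom_def dirsum_simps(1) supp_def PiE_def Pi_def)

lemma FHom_row: "f \<in> FHom a V W \<Longrightarrow> \<alpha> \<in> fst V \<Longrightarrow> f \<alpha> \<in> carrier (FOb (dirsum W) (snd V \<alpha>))"
  by (simp add: FHom_iff)

lemma FHom_sng: "v \<in> FHom a V (sng X) \<longleftrightarrow> v \<in> extensional (fst V) \<and> (\<forall>\<alpha>\<in>fst V. v \<alpha> () \<in> hm (snd V \<alpha>) X)"
  by (simp add: FHom_iff dirsum_sng)

lemma FHom_sng_in: "v \<in> FHom a V (sng X) \<Longrightarrow> \<alpha> \<in> fst V \<Longrightarrow> v \<alpha> () \<in> hm (snd V \<alpha>) X"
  by (simp add: FHom_sng)

lemma fcomp_entry:
  assumes U: "is_fam a U" and V: "is_fam a V" and W: "is_fam a W" and f: "f \<in> FHom a U V" and g: "g \<in> FHom a V W"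
    and \<alpha>: "\<alpha> \<in> fst U" and \<gamma>: "\<gamma> \<in> fst W"
  shows "fcomp a U V W g f \<alpha> \<gamma> = row_comb (yo (snd W \<gamma>)) V (\<lambda>\<beta>. g \<beta> \<gamma>) (snd U \<alpha>) (f \<alpha>)"
proof -
  interpret M: abelian_monoid "Hm a (snd U \<alpha>) (snd W \<gamma>)" by (rule Hmon) (use U W \<alpha> \<gamma> in auto)
  show ?thesis
    using \<alpha> \<gamma> unfolding fcomp_def row_comb_def supp_def
    by (simp, intro M.finsum_cong')
      (use U V W dirsum_D(3)[OF FHom_row[OF f \<alpha>]] dirsum_D(3)[OF FHom_row[OF g] \<gamma>] in auto)
qed

lemma fcomp_row:
  assumes U: "is_fam a U" and V: "is_fam a V" and W: "is_fam a W" and f: "f \<in> FHom a U V" and g: "g \<in> FHom a V W"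
    and \<alpha>: "\<alpha> \<in> fst U"
  shows "fcomp a U V W g f \<alpha> = row_comb (dirsum W) V g (snd U \<alpha>) (f \<alpha>)"
proof -
  have "row_comb (dirsum W) V g (snd U \<alpha>) (f \<alpha>) \<in> carrier (FOb (dirsum W) (snd U \<alpha>))"
    by (rule lin_nat_in[OF row_comb_lin_nat[OF psh_dirsum[OF W] V FHom_row[OF g]] _ FHom_row[OF f \<alpha>]]) (use U \<alpha> in auto)
  note ext = dirsum_D(1)[OF this]
  show ?thesis
  proof
    fix \<gamma> show "fcomp a U V W g f \<alpha> \<gamma> = row_comb (dirsum W) V g (snd U \<alpha>) (f \<alpha>) \<gamma>"
    proof (cases "\<gamma> \<in> fst W")
      case True
      have "row_comb (dirsum W) V g (snd U \<alpha>) (f \<alpha>) \<gamma> = row_comb (yo (snd W \<gamma>)) V (\<lambda>\<beta>. g \<beta> \<gamma>) (snd U \<alpha>) (f \<alpha>)"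
        by (rule row_comb_dirsum_apply[OF W V FHom_row[OF g] _ FHom_row[OF f \<alpha>] True]) (use U \<alpha> in auto)
      then show ?thesis using fcomp_entry[OF U V W f g \<alpha> True] by simp
    next
      case False
      then show ?thesis using ext \<alpha> by (simp add: fcomp_def extensional_def)
    qed
  qed
qed

lemma fcomp_ext: "fcomp a U V W g f \<in> extensional (fst U)"
  by (simp add: fcomp_def)

lemma fcomp_eq_iff:
  "fcomp a U V W g f = h \<longleftrightarrow> h \<in> extensional (fst U) \<and> (\<forall>\<alpha>\<in>fst U. fcomp a U V W g f \<alpha> = h \<alpha>)"
  using extensionalityI[OF fcomp_ext, of h U V W g f] fcomp_ext by metis

lemma fcomp_eq_fcomp_iff:
  "fcomp a U V W g f = fcomp a U V' W' g' f' \<longleftrightarrow> (\<forall>\<alpha>\<in>fst U. fcomp a U V W g f \<alpha> = fcomp a U V' W' g' f' \<alpha>)"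
  unfolding fcomp_eq_iff[of U V W g f] by (simp add: fcomp_ext)

lemma fcomp_sng_row:
  assumes "is_fam a U" "is_fam a V" "X \<in> Ob a" "f \<in> FHom a U V" "q \<in> FHom a V (sng X)" "\<alpha> \<in> fst U"
  shows "fcomp a U V (sng X) q f \<alpha> = (\<lambda>_. row_comb (yo X) V (\<lambda>\<beta>. q \<beta> ()) (snd U \<alpha>) (f \<alpha>))"
  using fcomp_entry[OF assms(1,2) _ assms(4,5,6), of "()"] assms(3) by auto

lemma fzero_sng_row: "\<alpha> \<in> fst U \<Longrightarrow> fzero a U (sng X) \<alpha> = (\<lambda>_. \<zero>\<^bsub>Hm a (snd U \<alpha>) X\<^esub>)"
  by (auto simp: fzero_def)

lemma fcomp_zero_iff:
  assumes "is_fam a U" "is_fam a V" "X \<in> Ob a" "f \<in> FHom a U V" "q \<in> FHom a V (sng X)"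
  shows "fcomp a U V (sng X) q f = fzero a U (sng X) \<longleftrightarrow>
    (\<forall>\<alpha>\<in>fst U. row_comb (yo X) V (\<lambda>\<beta>. q \<beta> ()) (snd U \<alpha>) (f \<alpha>) = \<zero>\<^bsub>Hm a (snd U \<alpha>) X\<^esub>)"
  unfolding fcomp_eq_iff using assms
  by (auto simp: fcomp_sng_row fzero_sng_row fun_eq_iff fzero_def)

lemma fcomp_sng_mid:
  assumes U: "is_fam a U" and A: "A \<in> Ob a" and X: "X \<in> Ob a" and f: "f \<in> FHom a (sng A) (sng X)"
    and q: "q \<in> FHom a U (sng A)" and \<alpha>: "\<alpha> \<in> fst U"
  shows "fcomp a U (sng A) (sng X) f q \<alpha> = (\<lambda>_. Cmp a (snd U \<alpha>) A X (f () ()) (q \<alpha> ()))"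
proof -
  have "f () () \<in> hm A X" using FHom_sng_in[OF f, of "()"] by simp
  then show ?thesis
    using fcomp_sng_row[OF U _ X q f \<alpha>] A X \<alpha> U FHom_sng_in[OF q \<alpha>] by (simp add: row_comb_sng)
qed

lemma fcomp_sng_act:
  assumes U: "is_fam a U" and A: "A \<in> Ob a" and Y: "is_fam a Y" and f: "f \<in> FHom a (sng A) Y"
    and q: "q \<in> FHom a U (sng A)" and \<alpha>: "\<alpha> \<in> fst U"
  shows "fcomp a U (sng A) Y f q \<alpha> = FAr (dirsum Y) A (snd U \<alpha>) (q \<alpha> ()) (f ())"
  using fcomp_row[OF U _ Y q f \<alpha>] A \<alpha> U Y FHom_sng_in[OF q \<alpha>] FHom_row[OF f, of "()"] by (simp add: row_comb_sng)

lemma sng_FHom_iff: "f \<in> FHom a (sng A) Y \<longleftrightarrow> f () \<in> carrier (FOb (dirsum Y) A)"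
  by (auto simp: FHom_iff extensional_def sng_def)

text \<open>\<open>qmap\<close> and \<open>pmap\<close> are the morphisms of presheaves for which
  the matrices q and p stand, so that conditions on formal sequences become conditions on
  elements.\<close>

definition qmap :: "('i, 'o) fam \<Rightarrow> 'o \<Rightarrow> ('i \<Rightarrow> unit \<Rightarrow> 'v) \<Rightarrow> 'o \<Rightarrow> ('i \<Rightarrow> 'v) \<Rightarrow> 'v" where
  "qmap Y X q = row_comb (yo X) Y (\<lambda>\<beta>. q \<beta> ())"

definition pmap :: "('i, 'o) fam \<Rightarrow> ('i, 'o) fam \<Rightarrow> ('i \<Rightarrow> 'i \<Rightarrow> 'v) \<Rightarrow> 'o \<Rightarrow> ('i \<Rightarrow> 'v) \<Rightarrow> 'i \<Rightarrow> 'v" where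
  "pmap Z Y p = row_comb (dirsum Y) Z p"

lemma qmap_lin_nat:
  assumes "is_fam a Y" "X \<in> Ob a" "q \<in> FHom a Y (sng X)"
  shows "lin_nat (dirsum Y) (yo X) (qmap Y X q)"
  unfolding qmap_def by (rule row_comb_lin_nat[OF psh_yoneda]) (use assms FHom_sng_in[OF assms(3)] in auto)

lemma qmap_in:
  assumes "is_fam a Y" "X \<in> Ob a" "q \<in> FHom a Y (sng X)" "A \<in> Ob a" "g \<in> carrier (FOb (dirsum Y) A)"
  shows "qmap Y X q A g \<in> hm A X"
  using lin_nat_in[OF qmap_lin_nat[OF assms(1-3)] assms(4,5)] by simp

lemma pmap_lin_nat:
  assumes "is_fam a Z" "is_fam a Y" "p \<in> FHom a Z Y"
  shows "lin_nat (dirsum Z) (dirsum Y) (pmap Z Y p)"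
  unfolding pmap_def by (rule row_comb_lin_nat[OF psh_dirsum]) (use assms FHom_row[OF assms(3)] in auto)

lemma formal_sequence_iff:
  "formal_sequence a (Z, Y, X, p, q) \<longleftrightarrow> is_fam a Z \<and> is_fam a Y \<and> X \<in> Ob a \<and> p \<in> FHom a Z Y \<and> q \<in> FHom a Y (sng X) \<and>
    (\<forall>\<gamma>\<in>fst Z. qmap Y X q (snd Z \<gamma>) (p \<gamma>) = \<zero>\<^bsub>Hm a (snd Z \<gamma>) X\<^esub>)"
  unfolding formal_sequence_def qmap_def prod.case using fcomp_zero_iff[of Z Y X p q] by blast

text \<open>Associativity of matrix composition, obtained from naturality of
  \<open>row_comb G Y y\<close> instead of an exchange of finite sums.\<close>

lemma row_comb_comp:
  assumes Z: "is_fam a Z" and Y: "is_fam a Y" and p: "p \<in> FHom a Z Y" and G: "psh G"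
    and y: "\<And>\<beta>. \<beta> \<in> fst Y \<Longrightarrow> y \<beta> \<in> carrier (FOb G (snd Y \<beta>))" and A: "A \<in> Ob a" and g: "g \<in> carrier (FOb (dirsum Z) A)"
  shows "row_comb G Y y A (pmap Z Y p A g) = row_comb G Z (\<lambda>\<gamma>. row_comb G Y y (snd Z \<gamma>) (p \<gamma>)) A g"
  unfolding pmap_def
  by (rule lin_nat_row_comb[OF psh_dirsum[OF Y] G row_comb_lin_nat[OF G Y y] Z FHom_row[OF p] A g])

lemma row_comb_zero:
  assumes Z: "is_fam a Z" and G: "psh G" and A: "A \<in> Ob a" and g: "g \<in> carrier (FOb (dirsum Z) A)"
    and 0: "\<And>\<gamma>. \<gamma> \<in> fst Z \<Longrightarrow> y \<gamma> = \<zero>\<^bsub>FOb G (snd Z \<gamma>)\<^esub>"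
  shows "row_comb G Z y A g = \<zero>\<^bsub>FOb G A\<^esub>"
proof -
  interpret M: abelian_monoid "FOb G A" by (rule psh_mon[OF G A])
  show ?thesis unfolding row_comb_def
    by (rule M.add.finprod_one_eqI) (use Z A dirsum_D(3)[OF g] 0 G in \<open>auto simp: supp_def act_zero_neg(1)\<close>)
qed

text \<open>The right-hand side separates uniqueness from existence. That composites with q are
  killed by p comes from the relation q p = 0, which is \<open>cz\<close> in the proof.\<close>

lemma right_exact_iff:
  assumes s: "formal_sequence a (Z, Y, X, p, q)"
  shows "right_exact a (Z, Y, X, p, q) \<longleftrightarrow> (\<forall>A\<in>Ob a.
    (\<forall>h\<in>hm X A. \<forall>h'\<in>hm X A. (\<forall>\<beta>\<in>fst Y. Cmp a (snd Y \<beta>) X A h (q \<beta> ()) = Cmp a (snd Y \<beta>) X A h' (q \<beta> ())) \<longrightarrow> h = h') \<and>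
    (\<forall>y. (\<forall>\<beta>\<in>fst Y. y \<beta> \<in> hm (snd Y \<beta>) A) \<longrightarrow>
       (\<forall>\<gamma>\<in>fst Z. row_comb (yo A) Y y (snd Z \<gamma>) (p \<gamma>) = \<zero>\<^bsub>Hm a (snd Z \<gamma>) A\<^esub>) \<longrightarrow>
       (\<exists>h\<in>hm X A. \<forall>\<beta>\<in>fst Y. Cmp a (snd Y \<beta>) X A h (q \<beta> ()) = y \<beta>)))"
  unfolding right_exact_def prod.case
proof (intro ball_cong refl)
  have Z: "is_fam a Z" and Y: "is_fam a Y" and X: "X \<in> Ob a" and p: "p \<in> FHom a Z Y" and q: "q \<in> FHom a Y (sng X)"
    and pq: "\<And>\<gamma>. \<gamma> \<in> fst Z \<Longrightarrow> qmap Y X q (snd Z \<gamma>) (p \<gamma>) = \<zero>\<^bsub>Hm a (snd Z \<gamma>) X\<^esub>"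
    using s unfolding formal_sequence_iff by auto
  fix A assume A: "A \<in> Ob a"
  let ?c = "\<lambda>h. fcomp a Y (sng X) (sng A) h q"
  have c: "?c h \<beta> = (\<lambda>_. Cmp a (snd Y \<beta>) X A (h () ()) (q \<beta> ()))" if "h \<in> FHom a (sng X) (sng A)" "\<beta> \<in> fst Y" for h \<beta>
    by (rule fcomp_sng_mid[OF Y X A that(1) q that(2)])
  have F1: "h \<in> FHom a (sng X) (sng A) \<longleftrightarrow> h () () \<in> hm X A" for h :: "unit \<Rightarrow> unit \<Rightarrow> 'v"
    by (simp add: sng_FHom_iff dirsum_sng)
  have ci: "?c h \<in> FHom a Y (sng A)" if h: "h \<in> FHom a (sng X) (sng A)" for h
    unfolding FHom_sng using c[OF h] F1 h Y X A FHom_sng_in[OF q] by (auto simp: fcomp_ext)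
  have z: "fcomp a Z Y (sng A) h p = fzero a Z (sng A) \<longleftrightarrow>
     (\<forall>\<gamma>\<in>fst Z. row_comb (yo A) Y (\<lambda>\<beta>. h \<beta> ()) (snd Z \<gamma>) (p \<gamma>) = \<zero>\<^bsub>Hm a (snd Z \<gamma>) A\<^esub>)"
    if "h \<in> FHom a Y (sng A)" for h by (rule fcomp_zero_iff[OF Z Y A p that])
  have cz: "fcomp a Z Y (sng A) (?c h) p = fzero a Z (sng A)" if h: "h \<in> FHom a (sng X) (sng A)" for h
    unfolding z[OF ci[OF h]]
  proof
    fix \<gamma> assume g: "\<gamma> \<in> fst Z"
    note pg = FHom_row[OF p g] and Zg = fam_Ob[OF Z g]
    have hh: "h () () \<in> hm X A" using h F1 by blast
    have e: "lin_nat (yo X) (yo A) (\<lambda>B f. Cmp a B X A (h () ()) f)"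
      unfolding lin_nat_def using A X hh by (simp add: Cmp_add_right Cmp_assoc)
    have "row_comb (yo A) Y (\<lambda>\<beta>. ?c h \<beta> ()) (snd Z \<gamma>) (p \<gamma>) =
        row_comb (yo A) Y (\<lambda>\<beta>. Cmp a (snd Y \<beta>) X A (h () ()) (q \<beta> ())) (snd Z \<gamma>) (p \<gamma>)"
      by (rule row_comb_cong[OF psh_yoneda[OF A] Y _ Zg pg]) (use c[OF h] Y X A hh FHom_sng_in[OF q] in auto)
    also have "\<dots> = Cmp a (snd Z \<gamma>) X A (h () ()) (qmap Y X q (snd Z \<gamma>) (p \<gamma>))"
      unfolding qmap_def
      by (rule lin_nat_row_comb[OF psh_yoneda[OF X] psh_yoneda[OF A] e Y _ Zg pg, symmetric]) (use FHom_sng_in[OF q] in auto)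
    also have "\<dots> = \<zero>\<^bsub>Hm a (snd Z \<gamma>) A\<^esub>" using pq[OF g] Zg X A hh by (simp add: Cmp_zero(2))
    finally show "row_comb (yo A) Y (\<lambda>\<beta>. ?c h \<beta> ()) (snd Z \<gamma>) (p \<gamma>) = \<zero>\<^bsub>Hm a (snd Z \<gamma>) A\<^esub>" .
  qed
  let ?k = "\<lambda>h :: 'v. \<lambda>_ :: unit. \<lambda>_ :: unit. h"
  have k: "?k h \<in> FHom a (sng X) (sng A) \<longleftrightarrow> h \<in> hm X A" for h by (simp add: F1)
  show "(inj_on ?c (FHom a (sng X) (sng A)) \<and>
      ?c ` FHom a (sng X) (sng A) = {h \<in> FHom a Y (sng A). fcomp a Z Y (sng A) h p = fzero a Z (sng A)}) \<longleftrightarrow>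
    ((\<forall>h\<in>hm X A. \<forall>h'\<in>hm X A. (\<forall>\<beta>\<in>fst Y. Cmp a (snd Y \<beta>) X A h (q \<beta> ()) = Cmp a (snd Y \<beta>) X A h' (q \<beta> ())) \<longrightarrow> h = h') \<and>
    (\<forall>y. (\<forall>\<beta>\<in>fst Y. y \<beta> \<in> hm (snd Y \<beta>) A) \<longrightarrow>
       (\<forall>\<gamma>\<in>fst Z. row_comb (yo A) Y y (snd Z \<gamma>) (p \<gamma>) = \<zero>\<^bsub>Hm a (snd Z \<gamma>) A\<^esub>) \<longrightarrow>
       (\<exists>h\<in>hm X A. \<forall>\<beta>\<in>fst Y. Cmp a (snd Y \<beta>) X A h (q \<beta> ()) = y \<beta>)))"
    (is "?I \<and> ?E \<longleftrightarrow> ?I' \<and> ?E'")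
  proof (intro conj_cong)
    show "?I \<longleftrightarrow> ?I'"
    proof
      assume I: ?I
      show ?I'
      proof (intro ballI impI)
        fix h h' assume h: "h \<in> hm X A" "h' \<in> hm X A"
          and eq: "\<forall>\<beta>\<in>fst Y. Cmp a (snd Y \<beta>) X A h (q \<beta> ()) = Cmp a (snd Y \<beta>) X A h' (q \<beta> ())"
        have "?c (?k h) = ?c (?k h')" unfolding fcomp_eq_fcomp_iff using c h eq k by simp
        then have "?k h = ?k h'" using inj_onD[OF I] h k by blast
        then show "h = h'" by meson
      qed
    next
      assume I: ?I'
      show ?I
      proof (rule inj_onI)
        fix h h' assume h: "h \<in> FHom a (sng X) (sng A)" "h' \<in> FHom a (sng X) (sng A)" and eq: "?c h = ?c h'"
        have "Cmp a (snd Y \<beta>) X A (h () ()) (q \<beta> ()) = Cmp a (snd Y \<beta>) X A (h' () ()) (q \<beta> ())" if "\<beta> \<in> fst Y" for \<beta>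
          using c[OF h(1) that] c[OF h(2) that] eq by metis
        then have "h () () = h' () ()" using I h F1 by blast
        then show "h = h'" by (auto simp: fun_eq_iff)
      qed
    qed
  next
    show "?E \<longleftrightarrow> ?E'"
    proof
      assume E: ?E
      show ?E'
      proof (intro allI impI)
        fix y assume y: "\<forall>\<beta>\<in>fst Y. y \<beta> \<in> hm (snd Y \<beta>) A"
          and y0: "\<forall>\<gamma>\<in>fst Z. row_comb (yo A) Y y (snd Z \<gamma>) (p \<gamma>) = \<zero>\<^bsub>Hm a (snd Z \<gamma>) A\<^esub>"
        define Y' where "Y' = (\<lambda>\<beta>\<in>fst Y. \<lambda>_::unit. y \<beta>)"
        have Y': "Y' \<in> FHom a Y (sng A)" unfolding FHom_sng using y by (simp add: Y'_def)
        have "fcomp a Z Y (sng A) Y' p = fzero a Z (sng A)"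
          unfolding z[OF Y']
        proof
          fix \<gamma> assume g: "\<gamma> \<in> fst Z"
          have "row_comb (yo A) Y (\<lambda>\<beta>. Y' \<beta> ()) (snd Z \<gamma>) (p \<gamma>) = row_comb (yo A) Y y (snd Z \<gamma>) (p \<gamma>)"
            by (rule row_comb_cong[OF psh_yoneda[OF A] Y _ fam_Ob[OF Z g] FHom_row[OF p g]]) (use y in \<open>auto simp: Y'_def\<close>)
          then show "row_comb (yo A) Y (\<lambda>\<beta>. Y' \<beta> ()) (snd Z \<gamma>) (p \<gamma>) = \<zero>\<^bsub>Hm a (snd Z \<gamma>) A\<^esub>" using y0 g by simp
        qed
        then have "Y' \<in> ?c ` FHom a (sng X) (sng A)" using E Y' by blast
        then obtain h where h: "h \<in> FHom a (sng X) (sng A)" "Y' = ?c h" by blast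
        have "Cmp a (snd Y \<beta>) X A (h () ()) (q \<beta> ()) = y \<beta>" if b: "\<beta> \<in> fst Y" for \<beta>
        proof -
          have "Y' \<beta> () = y \<beta>" using b by (simp add: Y'_def)
          then show ?thesis unfolding h(2) c[OF h(1) b] .
        qed
        then show "\<exists>h\<in>hm X A. \<forall>\<beta>\<in>fst Y. Cmp a (snd Y \<beta>) X A h (q \<beta> ()) = y \<beta>" using h(1) F1 by blast
      qed
    next
      assume E: ?E'
      show ?E
      proof (intro equalityI subsetI)
        fix y assume "y \<in> ?c ` FHom a (sng X) (sng A)"
        then show "y \<in> {h \<in> FHom a Y (sng A). fcomp a Z Y (sng A) h p = fzero a Z (sng A)}"
          using ci cz by blast
      next
        fix y assume "y \<in> {h \<in> FHom a Y (sng A). fcomp a Z Y (sng A) h p = fzero a Z (sng A)}"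
        then have y: "y \<in> FHom a Y (sng A)" and y0: "fcomp a Z Y (sng A) y p = fzero a Z (sng A)" by auto
        obtain h where h: "h \<in> hm X A" "\<forall>\<beta>\<in>fst Y. Cmp a (snd Y \<beta>) X A h (q \<beta> ()) = y \<beta> ()"
          using E[rule_format, of "\<lambda>\<beta>. y \<beta> ()"] y0[unfolded z[OF y]] FHom_sng_in[OF y] by blast
        have kh: "?k h \<in> FHom a (sng X) (sng A)" using k h(1) by simp
        have "?c (?k h) = y"
          unfolding fcomp_eq_iff
        proof
          show "y \<in> extensional (fst Y)" using y unfolding FHom_sng by blast
          show "\<forall>\<beta>\<in>fst Y. ?c (?k h) \<beta> = y \<beta>" using c[OF kh] h(2) by auto
        qed
        then show "y \<in> ?c ` FHom a (sng X) (sng A)" using kh by blast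
      qed
    qed
  qed
qed

end

section \<open>Pretopologies\<close>

context lin_cat
begin

lemma qmap_unit_row:
  assumes "is_fam a V" "X \<in> Ob a" "v \<in> FHom a V (sng X)" "\<alpha> \<in> fst V"
  shows "qmap V X v (snd V \<alpha>) (unit_row V \<alpha> (snd V \<alpha>) (Idt a (snd V \<alpha>))) = v \<alpha> ()"
  unfolding qmap_def
  by (subst row_comb_unit_row[OF psh_yoneda[OF assms(2)] assms(1)]) (use assms FHom_sng_in[OF assms(3)] in auto)

lemma lin_nat_incl:
  assumes "sieve K a X R" "X \<in> Ob a"
  shows "lin_nat (sieve_presheaf a X R) (yo X) (\<lambda>B f. f)"
  unfolding lin_nat_def using assms sieve_hm[OF assms] by simp

lemma row_comb_sieve:
  assumes R: "sieve K a X R" and X: "X \<in> Ob a" and V: "is_fam a V" and y: "\<And>\<alpha>. \<alpha> \<in> fst V \<Longrightarrow> y \<alpha> \<in> R (snd V \<alpha>)"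
    and A: "A \<in> Ob a" and g: "g \<in> carrier (FOb (dirsum V) A)"
  shows "row_comb (sieve_presheaf a X R) V y A g = row_comb (yo X) V y A g"
    and "row_comb (yo X) V y A g \<in> R A"
proof -
  note S = psh_sieve[OF R X]
  show 1: "row_comb (sieve_presheaf a X R) V y A g = row_comb (yo X) V y A g"
    by (rule lin_nat_row_comb[OF S psh_yoneda[OF X] lin_nat_incl[OF R X] V _ A g]) (use y in simp)
  show "row_comb (yo X) V y A g \<in> R A"
    using lin_nat_in[OF row_comb_lin_nat[OF S V] A g, of y] y 1 by simp
qed

text \<open>The image of \<open>qmap\<close> is a sieve by naturality, contains each
  \<open>v \<alpha>\<close> as the value at a generator, and lies in every sieve that contains all
  of these.\<close>

lemma gen_sieve_eq:
  assumes V: "is_fam a V" and X: "X \<in> Ob a" and v: "v \<in> FHom a V (sng X)"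
  shows "gen_sieve K a (V, X, v) = sieve_of X (\<lambda>B f. \<exists>g\<in>carrier (FOb (dirsum V) B). qmap V X v B g = f)" (is "_ = ?G")
    and "sieve K a X (gen_sieve K a (V, X, v))"
proof -
  note e = qmap_lin_nat[OF V X v] and D = psh_dirsum[OF V]
  have G: "sieve K a X ?G"
  proof (rule sieve_of_sieveI[OF X])
    fix B assume B: "B \<in> Ob a"
    show "\<exists>g\<in>carrier (FOb (dirsum V) B). qmap V X v B g = \<zero>\<^bsub>Hm a B X\<^esub>"
      using lin_nat_zero_neg(1)[OF D psh_yoneda[OF X] e B] psh_zero_in[OF D B] by auto
  next
    fix B f g assume B: "B \<in> Ob a" "f \<in> hm B X" "g \<in> hm B X"
      and "\<exists>f'\<in>carrier (FOb (dirsum V) B). qmap V X v B f' = f" "\<exists>g'\<in>carrier (FOb (dirsum V) B). qmap V X v B g' = g"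
    then obtain f' g' where "f' \<in> carrier (FOb (dirsum V) B)" "g' \<in> carrier (FOb (dirsum V) B)"
      "qmap V X v B f' = f" "qmap V X v B g' = g" by blast
    then show "\<exists>h\<in>carrier (FOb (dirsum V) B). qmap V X v B h = f \<oplus>\<^bsub>Hm a B X\<^esub> g"
      using lin_nat_add[OF e B(1), of f' g'] psh_add_in[OF D B(1)] by auto
  next
    fix B C f g assume B: "B \<in> Ob a" "C \<in> Ob a" "f \<in> hm B X" "\<exists>f'\<in>carrier (FOb (dirsum V) B). qmap V X v B f' = f" "g \<in> hm C B"
    then obtain f' where "f' \<in> carrier (FOb (dirsum V) B)" "qmap V X v B f' = f" by blast
    then show "\<exists>h\<in>carrier (FOb (dirsum V) C). qmap V X v C h = Cmp a C B X f g"
      using lin_nat_act[OF e B(1,2,5), of f'] act_in[OF D B(1,2,5)] B by auto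
  qed
  have sub: "?G B \<subseteq> R B" if R: "sieve K a X R" "\<forall>\<alpha>\<in>fst V. v \<alpha> () \<in> R (snd V \<alpha>)" for R B
    using row_comb_sieve(2)[OF R(1) X V, of "\<lambda>\<alpha>. v \<alpha> ()"] R(2) unfolding qmap_def by auto
  have mem: "v \<alpha> () \<in> ?G (snd V \<alpha>)" if "\<alpha> \<in> fst V" for \<alpha>
    using qmap_unit_row[OF V X v that] unit_row_in[OF V that] FHom_sng_in[OF v that] V that by auto
  show eq: "gen_sieve K a (V, X, v) = ?G"
  proof
    fix B
    show "gen_sieve K a (V, X, v) B = ?G B"
      unfolding gen_sieve_def prod.case using sub[of _ B] G mem by blast
  qed
  show "sieve K a X (gen_sieve K a (V, X, v))" unfolding eq by (rule G)
qed

text \<open>Serves as induction on a generated sieve: a property whose morphisms form a sieve holds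
  throughout once it holds for the generators.\<close>

lemma gen_sieve_min:
  assumes "sieve K a X R" "\<And>\<alpha>. \<alpha> \<in> fst V \<Longrightarrow> v \<alpha> () \<in> R (snd V \<alpha>)" "f \<in> gen_sieve K a (V, X, v) B"
  shows "f \<in> R B"
  using assms unfolding gen_sieve_def prod.case by blast

lemma gen_sieve_mem: "\<alpha> \<in> fst V \<Longrightarrow> v \<alpha> () \<in> gen_sieve K a (V, X, v) (snd V \<alpha>)"
  unfolding gen_sieve_def prod.case by blast

section \<open>Iterated covers\<close>

lemma Co_wf:
  assumes S: "\<forall>s\<in>S. formal_sequence a s" and "(V, X, v) \<in> Co a S n"
  shows "is_fam a V" "X \<in> Ob a" "v \<in> FHom a V (sng X)"
proof -
  have "is_fam a V \<and> X \<in> Ob a \<and> v \<in> FHom a V (sng X)"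
    using assms(2)
  proof (induction n arbitrary: V X v rule: less_induct)
    case (less n)
    consider "n = 0" | "n = Suc 0" | m where "n = Suc (Suc m)" by (metis old.nat.exhaust)
    then show ?case
    proof cases
      case 1
      then show ?thesis using less.prems by (auto simp: is_fam_def FHom_sng)
    next
      case 2
      then obtain Z p where "(Z, V, X, p, v) \<in> S" using less.prems by auto
      then show ?thesis using S formal_sequence_iff by blast
    next
      case (3 m)
      then obtain V' v' where "(V', X, v') \<in> Co a S (Suc m)" "is_fam a V" "v \<in> FHom a V (sng X)"
        using less.prems by auto
      then show ?thesis using less.IH[of "Suc m" V' X v'] 3 by blast
    qed
  qed
  then show "is_fam a V" "X \<in> Ob a" "v \<in> FHom a V (sng X)" by auto
qed

lemma Co_SucE:
  assumes "(U, X, r) \<in> Co a S (Suc (Suc n))"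
  obtains V v W w e where "(V, X, v) \<in> Co a S (Suc n)" "\<And>\<alpha>. \<alpha> \<in> fst V \<Longrightarrow> (W \<alpha>, snd V \<alpha>, w \<alpha>) \<in> Co a S (Suc 0)"
    "bij_betw e (fst U) (SIGMA \<alpha>:fst V. fst (W \<alpha>))"
    "\<And>\<epsilon> \<alpha> \<delta>. \<epsilon> \<in> fst U \<Longrightarrow> e \<epsilon> = (\<alpha>, \<delta>) \<Longrightarrow> snd U \<epsilon> = snd (W \<alpha>) \<delta>"
    "\<And>\<epsilon> \<alpha> \<delta>. \<epsilon> \<in> fst U \<Longrightarrow> e \<epsilon> = (\<alpha>, \<delta>) \<Longrightarrow> r \<epsilon> () = Cmp a (snd (W \<alpha>) \<delta>) (snd V \<alpha>) X (v \<alpha> ()) (w \<alpha> \<delta> ())"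
  using assms unfolding Co.simps mem_Collect_eq prod.case by blast

lemma Co_Suc_index:
  assumes "bij_betw e (fst U) (SIGMA \<alpha>:fst V. fst (W \<alpha>))" "\<alpha> \<in> fst V" "\<delta> \<in> fst (W \<alpha>)"
  obtains \<epsilon> where "\<epsilon> \<in> fst U" "e \<epsilon> = (\<alpha>, \<delta>)"
proof -
  have "(\<alpha>, \<delta>) \<in> e ` fst U" unfolding bij_betw_imp_surj_on[OF assms(1)] using assms(2,3) by simp
  then show thesis using that by (metis imageE)
qed

lemma pretopology_formal: "pretopology a S \<Longrightarrow> \<forall>s\<in>S. formal_sequence a s"
  unfolding pretopology_def by blast

lemma Co1_iff: "(Y, X, q) \<in> Co a S (Suc 0) \<longleftrightarrow> (\<exists>Z p. (Z, Y, X, p, q) \<in> S)"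
  by auto

lemma sieve_eq_on:
  assumes X: "X \<in> Ob a" and A: "A \<in> Ob a" and h: "h \<in> hm X A" "h' \<in> hm X A"
  shows "sieve K a X (sieve_of X (\<lambda>B f. Cmp a B X A h f = Cmp a B X A h' f))"
  by (rule sieve_of_sieveI[OF X]) (use assms in \<open>simp_all add: Cmp_zero Cmp_add_right Cmp_assoc[symmetric]\<close>)

text \<open>Allows local liftability along p to be tested on the generators of a cover only.\<close>

lemma pmap_sieve:
  assumes Z: "is_fam a Z" and Y: "is_fam a Y" and p: "p \<in> FHom a Z Y" and A: "A \<in> Ob a" and f: "f \<in> carrier (FOb (dirsum Y) A)"
  shows "sieve K a A (sieve_of A (\<lambda>B g. \<exists>f'\<in>carrier (FOb (dirsum Z) B). pmap Z Y p B f' = FAr (dirsum Y) A B g f))"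
proof (rule sieve_of_sieveI[OF A])
  note e = pmap_lin_nat[OF Z Y p] and DZ = psh_dirsum[OF Z] and DY = psh_dirsum[OF Y]
  fix B assume B: "B \<in> Ob a"
  show "\<exists>f'\<in>carrier (FOb (dirsum Z) B). pmap Z Y p B f' = FAr (dirsum Y) A B \<zero>\<^bsub>Hm a B A\<^esub> f"
    using lin_nat_zero_neg(1)[OF DZ DY e B] psh_zero_in[OF DZ B] act_zero_neg_left(1)[OF DY A B f] by auto
  fix g assume g: "g \<in> hm B A" "\<exists>f'\<in>carrier (FOb (dirsum Z) B). pmap Z Y p B f' = FAr (dirsum Y) A B g f"
  then obtain f' where f': "f' \<in> carrier (FOb (dirsum Z) B)" "pmap Z Y p B f' = FAr (dirsum Y) A B g f" by blast
  {
    fix h assume h: "h \<in> hm B A" "\<exists>f'\<in>carrier (FOb (dirsum Z) B). pmap Z Y p B f' = FAr (dirsum Y) A B h f"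
    then obtain h' where "h' \<in> carrier (FOb (dirsum Z) B)" "pmap Z Y p B h' = FAr (dirsum Y) A B h f" by blast
    then show "\<exists>f'\<in>carrier (FOb (dirsum Z) B). pmap Z Y p B f' = FAr (dirsum Y) A B (g \<oplus>\<^bsub>Hm a B A\<^esub> h) f"
      using f' lin_nat_add[OF e B f'(1), of h'] act_add_left[OF DY A B g(1) h(1) f] psh_add_in[OF DZ B f'(1), of h'] by metis
  }
  fix C h assume C: "C \<in> Ob a" "h \<in> hm C B"
  show "\<exists>f'\<in>carrier (FOb (dirsum Z) C). pmap Z Y p C f' = FAr (dirsum Y) A C (Cmp a C B A g h) f"
    using f' lin_nat_act[OF e B C f'(1)] act_Cmp[OF DY A B C(1) g(1) C(2) f] act_in[OF DZ B C f'(1)] by metis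
qed

end

context site
begin

lemma pull_in_T_iff:
  assumes "sieve K a A S" "A \<in> Ob a" "B \<in> Ob a" "f \<in> hm B A"
  shows "pull_sieve a B A f S \<in> T B \<longleftrightarrow> locally B (\<lambda>C g. Cmp a C B A f g \<in> S C)"
  using sieve_pull[OF assms] unfolding pull_sieve_sieve_of by (rule locally_sieve_of[symmetric])

text \<open>This is the closure of S under the topology. Since it is a sieve, membership of a whole
  generated sieve in it can be tested on generators.\<close>

lemma T_closure_sieve:
  assumes S: "sieve K a A S" and A: "A \<in> Ob a"
  shows "sieve K a A (sieve_of A (\<lambda>B f. pull_sieve a B A f S \<in> T B))"
proof (rule sieve_of_sieveI[OF A])
  fix B assume B: "B \<in> Ob a"
  show "pull_sieve a B A \<zero>\<^bsub>Hm a B A\<^esub> S \<in> T B"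
    unfolding pull_in_T_iff[OF S A B Hzero_in[OF B A]]
    by (rule locally_all[OF B]) (use A B sieve_zero[OF S A] in \<open>simp add: Cmp_zero(1)\<close>)
next
  fix B f g assume B: "B \<in> Ob a" "f \<in> hm B A" "g \<in> hm B A" and "pull_sieve a B A f S \<in> T B" "pull_sieve a B A g S \<in> T B"
  then have l: "locally B (\<lambda>C h. Cmp a C B A f h \<in> S C)" "locally B (\<lambda>C h. Cmp a C B A g h \<in> S C)"
    using pull_in_T_iff[OF S A B(1)] by blast+
  show "pull_sieve a B A (f \<oplus>\<^bsub>Hm a B A\<^esub> g) S \<in> T B"
    unfolding pull_in_T_iff[OF S A B(1) Hadd_in[OF B(1) A B(2,3)]]
    by (rule locally_mono[OF locally_conj[OF l]]) (use A B sieve_add[OF S A] in \<open>simp add: Cmp_add_left\<close>)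
next
  fix B C f g assume B: "B \<in> Ob a" "C \<in> Ob a" "f \<in> hm B A" "pull_sieve a B A f S \<in> T B" "g \<in> hm C B"
  then have l: "locally B (\<lambda>C h. Cmp a C B A f h \<in> S C)" using pull_in_T_iff[OF S A B(1,3)] by blast
  show "pull_sieve a C A (Cmp a C B A f g) S \<in> T C"
    unfolding pull_in_T_iff[OF S A B(2) Cmp_in[OF B(2,1) A B(5,3)]]
    by (rule locally_mono[OF locally_pull[OF l B(2,5)]]) (use A B in \<open>simp add: Cmp_assoc\<close>)
qed

text \<open>By (T3): pulled back along an outer generator \<open>v' \<alpha>\<close>, the sieve of
  the composite family contains the sieve of the inner cover \<open>w \<alpha>\<close>, so it is
  covering. (T3) asks for this along every member of the outer sieve, and
  \<open>T_closure_sieve\<close> passes from the generators to all of them.\<close>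

lemma Co_cover:
  assumes S: "\<forall>s\<in>S. formal_sequence a s"
    and cov: "\<And>Y X q. (Y, X, q) \<in> Co a S (Suc 0) \<Longrightarrow> gen_sieve K a (Y, X, q) \<in> T X"
    and v: "(V, X, v) \<in> Co a S n"
  shows "gen_sieve K a (V, X, v) \<in> T X"
  using v
proof (induction n arbitrary: V X v rule: less_induct)
  case (less n)
  note wf = Co_wf[OF S less.prems]
  consider "n = 0" | "n = Suc 0" | m where "n = Suc (Suc m)" by (metis old.nat.exhaust)
  then show ?case
  proof cases
    case 1
    show ?thesis
    proof (rule T_mono[OF gen_sieve_eq(2)[OF wf] T_max[OF wf(2)]])
      fix B f assume B: "B \<in> Ob a" "f \<in> max_sieve a X B"
      obtain i where "i \<in> fst V" "snd V i = X" "v i () = Idt a X" using less.prems 1 by auto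
      then have "Idt a X \<in> gen_sieve K a (V, X, v) X" using gen_sieve_mem[of i V v X] by simp
      then show "f \<in> gen_sieve K a (V, X, v) B"
        using sieve_Cmp[OF gen_sieve_eq(2)[OF wf] _ B(1), of "Idt a X" X f] B wf(2) by (simp add: max_sieve_def)
    qed
  next
    case 2
    then show ?thesis using cov less.prems by simp
  next
    case (3 m)
    obtain V' v' W w e where V': "(V', X, v') \<in> Co a S (Suc m)"
      and W: "\<And>\<alpha>. \<alpha> \<in> fst V' \<Longrightarrow> (W \<alpha>, snd V' \<alpha>, w \<alpha>) \<in> Co a S (Suc 0)"
      and e: "bij_betw e (fst V) (SIGMA \<alpha>:fst V'. fst (W \<alpha>))"
      and e1: "\<And>\<epsilon> \<alpha> \<delta>. \<epsilon> \<in> fst V \<Longrightarrow> e \<epsilon> = (\<alpha>, \<delta>) \<Longrightarrow> snd V \<epsilon> = snd (W \<alpha>) \<delta>"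
      and e2: "\<And>\<epsilon> \<alpha> \<delta>. \<epsilon> \<in> fst V \<Longrightarrow> e \<epsilon> = (\<alpha>, \<delta>) \<Longrightarrow> v \<epsilon> () = Cmp a (snd (W \<alpha>) \<delta>) (snd V' \<alpha>) X (v' \<alpha> ()) (w \<alpha> \<delta> ())"
      using less.prems unfolding 3 by (rule Co_SucE) (rule that)
    note wf' = Co_wf[OF S V'] and G = gen_sieve_eq(2)[OF wf]
    let ?G = "gen_sieve K a (V, X, v)"
    show ?thesis
    proof (rule T_local[OF G less.IH[OF _ V']])
      show "Suc m < n" using 3 by simp
      fix B f assume B: "B \<in> Ob a" "f \<in> gen_sieve K a (V', X, v') B"
      have "f \<in> sieve_of X (\<lambda>B f. pull_sieve a B X f ?G \<in> T B) B"
      proof (rule gen_sieve_min[OF T_closure_sieve[OF G wf(2)] _ B(2)])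
        fix \<alpha> assume \<alpha>: "\<alpha> \<in> fst V'"
        have V\<alpha>: "snd V' \<alpha> \<in> Ob a" "v' \<alpha> () \<in> hm (snd V' \<alpha>) X" using fam_Ob[OF wf'(1) \<alpha>] FHom_sng_in[OF wf'(3) \<alpha>] by auto
        note wW = Co_wf[OF S W[OF \<alpha>]] and pl = sieve_pull[OF G wf(2) V\<alpha>]
        have "pull_sieve a (snd V' \<alpha>) X (v' \<alpha> ()) ?G \<in> T (snd V' \<alpha>)"
        proof (rule T_mono[OF pl cov[OF W[OF \<alpha>]]], rule gen_sieve_min[OF pl])
          fix \<delta> assume \<delta>: "\<delta> \<in> fst (W \<alpha>)"
          obtain \<epsilon> where \<epsilon>: "\<epsilon> \<in> fst V" "e \<epsilon> = (\<alpha>, \<delta>)" by (rule Co_Suc_index[OF e \<alpha> \<delta>])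
          show "w \<alpha> \<delta> () \<in> pull_sieve a (snd V' \<alpha>) X (v' \<alpha> ()) ?G (snd (W \<alpha>) \<delta>)"
            using gen_sieve_mem[OF \<epsilon>(1), of v X] e1[OF \<epsilon>] e2[OF \<epsilon>] wW \<delta> FHom_sng_in[OF wW(3) \<delta>]
            by (simp add: pull_sieve_def)
        qed
        then show "v' \<alpha> () \<in> sieve_of X (\<lambda>B f. pull_sieve a B X f ?G \<in> T B) (snd V' \<alpha>)" using V\<alpha> by simp
      qed
      then show "pull_sieve a B X f ?G \<in> T B" by simp
    qed
  qed
qed

text \<open>Exactness of the associated sequence of sheaves, expressed without sheafification.\<close>

definition exact_seqs :: "('i, 'o, 'v) fseq set" where
  "exact_seqs = {(Z, Y, X, p, q). formal_sequence a (Z, Y, X, p, q) \<and> gen_sieve K a (Y, X, q) \<in> T X \<and>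
     (\<forall>A\<in>Ob a. \<forall>f\<in>carrier (FOb (dirsum Y) A). qmap Y X q A f = \<zero>\<^bsub>Hm a A X\<^esub> \<longrightarrow>
        locally A (\<lambda>B g. \<exists>f'\<in>carrier (FOb (dirsum Z) B). pmap Z Y p B f' = FAr (dirsum Y) A B g f))}"

lemma exact_seqs_iff: "(Z, Y, X, p, q) \<in> exact_seqs \<longleftrightarrow> formal_sequence a (Z, Y, X, p, q) \<and> gen_sieve K a (Y, X, q) \<in> T X \<and>
     (\<forall>A\<in>Ob a. \<forall>f\<in>carrier (FOb (dirsum Y) A). qmap Y X q A f = \<zero>\<^bsub>Hm a A X\<^esub> \<longrightarrow>
        locally A (\<lambda>B g. \<exists>f'\<in>carrier (FOb (dirsum Z) B). pmap Z Y p B f' = FAr (dirsum Y) A B g f))"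
  by (simp add: exact_seqs_def)

section \<open>Exactness and right exactness of sequences\<close>

lemma top_of_cover:
  assumes S: "\<forall>s\<in>S. formal_sequence a s" and T: "T = top_of K a S" and V: "(V, X, v) \<in> Co_iter a S"
  shows "gen_sieve K a (V, X, v) \<in> T X"
proof -
  obtain n where "(V, X, v) \<in> Co a S n" using V unfolding Co_iter_def by blast
  note wf = Co_wf[OF S this]
  show ?thesis unfolding T top_of_def using gen_sieve_eq(2)[OF wf] wf(2) V by blast
qed

lemma Co1_Co_iter: "s \<in> Co a S (Suc 0) \<Longrightarrow> s \<in> Co_iter a S"
  unfolding Co_iter_def by blast

text \<open>Applied to a row that q kills, (PTb) provides lifts along the generators of an iterated
  cover. That cover belongs to T by the definition of the induced topology, and the lifts spread to
  its sieve because liftability defines a sieve.\<close>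

lemma pretopology_sub_exact_seqs:
  assumes S: "pretopology a S" and T: "T = top_of K a S"
  shows "S \<subseteq> exact_seqs"
proof
  fix s assume s: "s \<in> S"
  obtain Z Y X p q where eq: "s = (Z, Y, X, p, q)" by (cases s) auto
  note fo = pretopology_formal[OF S]
  have fs: "formal_sequence a (Z, Y, X, p, q)" using fo s eq by blast
  then have Z: "is_fam a Z" and Y: "is_fam a Y" and X: "X \<in> Ob a" and p: "p \<in> FHom a Z Y" and q: "q \<in> FHom a Y (sng X)"
    unfolding formal_sequence_iff by auto
  have PTb: "\<forall>A\<in>Ob a. \<forall>f\<in>FHom a (sng A) Y.
        fcomp a (sng A) Y (sng X) q f = fzero a (sng A) (sng X) \<longrightarrow>
        (\<exists>B q'. (B, A, q') \<in> Co_iter a S \<and> (\<exists>f'\<in>FHom a B Z. fcomp a B Z Y p f' = fcomp a B (sng A) Y f q'))"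
    using S s eq unfolding pretopology_def by fast
  have "locally A (\<lambda>B g. \<exists>f'\<in>carrier (FOb (dirsum Z) B). pmap Z Y p B f' = FAr (dirsum Y) A B g f)"
    if A: "A \<in> Ob a" and f: "f \<in> carrier (FOb (dirsum Y) A)" and q0: "qmap Y X q A f = \<zero>\<^bsub>Hm a A X\<^esub>" for A f
  proof -
    let ?f = "\<lambda>_::unit. f"
    have sA: "is_fam a (sng A)" using A by simp
    have f1: "?f \<in> FHom a (sng A) Y" unfolding sng_FHom_iff by (rule f)
    have "fcomp a (sng A) Y (sng X) q ?f = fzero a (sng A) (sng X)"
      using q0 unfolding fcomp_zero_iff[OF sA Y X f1 q] qmap_def by simp
    then obtain B q' f' where B: "(B, A, q') \<in> Co_iter a S" "f' \<in> FHom a B Z" "fcomp a B Z Y p f' = fcomp a B (sng A) Y ?f q'"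
      using PTb A f1 by blast
    obtain n where "(B, A, q') \<in> Co a S n" using B(1) unfolding Co_iter_def by blast
    note wf = Co_wf[OF fo this]
    show ?thesis
    proof (rule locallyI[OF top_of_cover[OF fo T B(1)]])
      fix C g assume C: "C \<in> Ob a" "g \<in> gen_sieve K a (B, A, q') C"
      have "g \<in> sieve_of A (\<lambda>B g. \<exists>f'\<in>carrier (FOb (dirsum Z) B). pmap Z Y p B f' = FAr (dirsum Y) A B g f) C"
      proof (rule gen_sieve_min[OF pmap_sieve[OF Z Y p A f] _ C(2)])
        fix \<alpha> assume \<alpha>: "\<alpha> \<in> fst B"
        have "pmap Z Y p (snd B \<alpha>) (f' \<alpha>) = FAr (dirsum Y) A (snd B \<alpha>) (q' \<alpha> ()) f"
          using fcomp_row[OF wf(1) Z Y B(2) p \<alpha>] fcomp_sng_act[OF wf(1) A Y f1 wf(3) \<alpha>] B(3) unfolding pmap_def by metis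
        then show "q' \<alpha> () \<in> sieve_of A (\<lambda>B g. \<exists>f'\<in>carrier (FOb (dirsum Z) B). pmap Z Y p B f' = FAr (dirsum Y) A B g f) (snd B \<alpha>)"
          using FHom_sng_in[OF wf(3) \<alpha>] FHom_row[OF B(2) \<alpha>] wf(1) \<alpha> by auto
      qed
      then show "\<exists>f'\<in>carrier (FOb (dirsum Z) C). pmap Z Y p C f' = FAr (dirsum Y) A C g f" by simp
    qed
  qed
  moreover have "gen_sieve K a (Y, X, q) \<in> T X"
    by (rule top_of_cover[OF fo T Co1_Co_iter]) (use s eq Co1_iff in blast)
  ultimately show "s \<in> exact_seqs" unfolding eq exact_seqs_iff using fs by blast
qed

lemma exact_seqs_right_exact:
  assumes sub: "subcanonical K a T" and s: "s \<in> exact_seqs"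
  shows "right_exact a s"
proof -
  obtain Z Y X p q where eq: "s = (Z, Y, X, p, q)" by (cases s) auto
  have fs: "formal_sequence a (Z, Y, X, p, q)" and cov: "gen_sieve K a (Y, X, q) \<in> T X"
    and ex: "\<And>A f. A \<in> Ob a \<Longrightarrow> f \<in> carrier (FOb (dirsum Y) A) \<Longrightarrow> qmap Y X q A f = \<zero>\<^bsub>Hm a A X\<^esub> \<Longrightarrow>
        locally A (\<lambda>B g. \<exists>f'\<in>carrier (FOb (dirsum Z) B). pmap Z Y p B f' = FAr (dirsum Y) A B g f)"
    using s unfolding eq exact_seqs_iff by auto
  have Z: "is_fam a Z" and Y: "is_fam a Y" and X: "X \<in> Ob a" and p: "p \<in> FHom a Z Y" and q: "q \<in> FHom a Y (sng X)"
    using fs unfolding formal_sequence_iff by auto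
  let ?R = "gen_sieve K a (Y, X, q)"
  note Re = gen_sieve_eq(1)[OF Y X q] and Rs = gen_sieve_eq(2)[OF Y X q]
  show ?thesis unfolding eq right_exact_iff[OF fs]
  proof (intro ballI conjI allI impI)
    fix A h h' assume A: "A \<in> Ob a" and h: "h \<in> hm X A" "h' \<in> hm X A"
      and hq: "\<forall>\<beta>\<in>fst Y. Cmp a (snd Y \<beta>) X A h (q \<beta> ()) = Cmp a (snd Y \<beta>) X A h' (q \<beta> ())"
    note sh = psh_yoneda[OF A] sub[unfolded subcanonical_iff, rule_format, OF A]
    show "h = h'"
    proof (rule sheaf_elt_sep[OF sh, of _ X])
      show "locally X (\<lambda>B f. FAr (yo A) X B f h = FAr (yo A) X B f h')"
      proof (rule locallyI[OF cov])
        fix B f assume B: "B \<in> Ob a" "f \<in> ?R B"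
        have "f \<in> sieve_of X (\<lambda>B f. Cmp a B X A h f = Cmp a B X A h' f) B"
          by (rule gen_sieve_min[OF sieve_eq_on[OF X A h] _ B(2)]) (use hq Y FHom_sng_in[OF q] in auto)
        then show "FAr (yo A) X B f h = FAr (yo A) X B f h'" using h by simp
      qed
    qed (use h in simp_all)
  next
    fix A y assume A: "A \<in> Ob a" and y: "\<forall>\<beta>\<in>fst Y. y \<beta> \<in> hm (snd Y \<beta>) A"
      and yp: "\<forall>\<gamma>\<in>fst Z. row_comb (yo A) Y y (snd Z \<gamma>) (p \<gamma>) = \<zero>\<^bsub>Hm a (snd Z \<gamma>) A\<^esub>"
    note yA = psh_yoneda[OF A] and sh = sub[unfolded subcanonical_iff, rule_format, OF A]
    let ?\<phi> = "row_comb (yo A) Y y"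
    have y': "\<And>\<beta>. \<beta> \<in> fst Y \<Longrightarrow> y \<beta> \<in> carrier (FOb (yo A) (snd Y \<beta>))" using y by simp
    note \<phi> = row_comb_lin_nat[OF yA Y y'] and DY = psh_dirsum[OF Y] and S = psh_sieve[OF Rs X]
    \<comment> \<open>The covering sieve generated by q, viewed as a presheaf, is the image of the
      direct sum of the generators. The family y is a map out of this direct sum, and
      \<open>factor\<close> pushes it down to the sieve, where the sheaf condition applies.\<close>
    have e: "lin_nat (dirsum Y) (sieve_presheaf a X ?R) (qmap Y X q)"
    proof -
      have m: "qmap Y X q B g \<in> ?R B" if "B \<in> Ob a" "g \<in> carrier (FOb (dirsum Y) B)" for B g
        unfolding Re using qmap_in[OF Y X q that] that by auto
      show ?thesis using qmap_lin_nat[OF Y X q] unfolding lin_nat_def by (simp add: m qmap_in[OF Y X q])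
    qed
    have ls: "locsurj (dirsum Y) (sieve_presheaf a X ?R) (qmap Y X q)"
      unfolding locsurj_def
    proof (intro ballI)
      fix B f assume B: "B \<in> Ob a" "f \<in> carrier (FOb (sieve_presheaf a X ?R) B)"
      show "locally B (\<lambda>C g. \<exists>x\<in>carrier (FOb (dirsum Y) C). qmap Y X q C x = FAr (sieve_presheaf a X ?R) B C g f)"
      proof (rule locally_all[OF B(1)])
        fix C g assume C: "C \<in> Ob a" "g \<in> hm C B"
        have "FAr (sieve_presheaf a X ?R) B C g f \<in> ?R C" using act_in[OF S B(1) C B(2)] by simp
        then show "\<exists>x\<in>carrier (FOb (dirsum Y) C). qmap Y X q C x = FAr (sieve_presheaf a X ?R) B C g f"
          by (subst (asm) (1) Re) (use B in \<open>simp add: Re\<close>)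
      qed
    qed
    \<comment> \<open>A row killed by q lifts locally along p, and y vanishes on the rows of p;
      separatedness makes the local vanishing global.\<close>
    have ker: "?\<phi> B g = \<zero>\<^bsub>FOb (yo A) B\<^esub>"
      if B: "B \<in> Ob a" and g: "g \<in> carrier (FOb (dirsum Y) B)" and "qmap Y X q B g = \<zero>\<^bsub>FOb (sieve_presheaf a X ?R) B\<^esub>" for B g
    proof (rule sheaf_elt_sep[OF yA sh lin_nat_in[OF \<phi> B g] psh_zero_in[OF yA B]])
      have "locally B (\<lambda>C c. \<exists>f'\<in>carrier (FOb (dirsum Z) C). pmap Z Y p C f' = FAr (dirsum Y) B C c g)"
        by (rule ex[OF B g]) (use that(3) in simp)
      then show "locally B (\<lambda>C c. FAr (yo A) B C c (?\<phi> B g) = FAr (yo A) B C c \<zero>\<^bsub>FOb (yo A) B\<^esub>)"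
      proof (rule locally_mono)
        fix C c assume C: "C \<in> Ob a" "c \<in> hm C B" and "\<exists>f'\<in>carrier (FOb (dirsum Z) C). pmap Z Y p C f' = FAr (dirsum Y) B C c g"
        then obtain f' where f': "f' \<in> carrier (FOb (dirsum Z) C)" "pmap Z Y p C f' = FAr (dirsum Y) B C c g" by blast
        have "FAr (yo A) B C c (?\<phi> B g) = ?\<phi> C (pmap Z Y p C f')"
          unfolding f'(2) by (rule lin_nat_act[OF \<phi> B C g, symmetric])
        also have "\<dots> = row_comb (yo A) Z (\<lambda>\<gamma>. ?\<phi> (snd Z \<gamma>) (p \<gamma>)) C f'"
          by (rule row_comb_comp[OF Z Y p yA y' C(1) f'(1)])
        also have "\<dots> = \<zero>\<^bsub>FOb (yo A) C\<^esub>"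
          by (rule row_comb_zero[OF Z yA C(1) f'(1)]) (use yp in simp)
        finally show "FAr (yo A) B C c (?\<phi> B g) = FAr (yo A) B C c \<zero>\<^bsub>FOb (yo A) B\<^esub>"
          using act_zero_neg(1)[OF yA B C] by simp
      qed
    qed
    obtain \<psi> where \<psi>: "lin_nat (sieve_presheaf a X ?R) (yo A) \<psi>"
      "\<And>B g. B \<in> Ob a \<Longrightarrow> g \<in> carrier (FOb (dirsum Y) B) \<Longrightarrow> \<psi> B (qmap Y X q B g) = ?\<phi> B g"
      by (rule factor[OF DY S yA sh e ls \<phi> ker]) (assumption+, rule that)
    obtain h where h: "h \<in> hm X A" "\<forall>B\<in>Ob a. \<forall>f\<in>?R B. FAr (yo A) X B f h = \<psi> B f"
      using sh[unfolded sheaf_elt_def, rule_format, OF X cov \<psi>(1), THEN ex1_implies_ex] unfolding yoneda_simps(1) by blast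
    have "Cmp a (snd Y \<beta>) X A h (q \<beta> ()) = y \<beta>" if b: "\<beta> \<in> fst Y" for \<beta>
    proof -
      note Yb = fam_Ob[OF Y b]
      let ?i = "unit_row Y \<beta> (snd Y \<beta>) (Idt a (snd Y \<beta>))"
      have i: "?i \<in> carrier (FOb (dirsum Y) (snd Y \<beta>))" using unit_row_in[OF Y b] Yb by simp
      have "Cmp a (snd Y \<beta>) X A h (q \<beta> ()) = \<psi> (snd Y \<beta>) (q \<beta> ())"
        using h Yb gen_sieve_mem[OF b, of q X] by simp
      also have "\<dots> = ?\<phi> (snd Y \<beta>) ?i" using \<psi>(2)[OF Yb i] qmap_unit_row[OF Y X q b] by simp
      also have "\<dots> = FAr (yo A) (snd Y \<beta>) (snd Y \<beta>) (Idt a (snd Y \<beta>)) (y \<beta>)"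
        by (rule row_comb_unit_row[OF yA Y y' b Yb Idt_in[OF Yb]])
      also have "\<dots> = y \<beta>" using y b Yb A by simp
      finally show ?thesis .
    qed
    then show "\<exists>h\<in>hm X A. \<forall>\<beta>\<in>fst Y. Cmp a (snd Y \<beta>) X A h (q \<beta> ()) = y \<beta>" using h(1) by blast
  qed
qed

section \<open>From right exact sequences back to sheaves\<close>

lemma right_exact_sep:
  assumes S: "\<forall>s\<in>S. formal_sequence a s" and rex: "\<forall>s\<in>S. right_exact a s" and v: "(V, X, v) \<in> Co a S n"
    and C: "C \<in> Ob a" and h: "h \<in> hm X C" "h' \<in> hm X C"
    and eq: "\<And>\<alpha>. \<alpha> \<in> fst V \<Longrightarrow> Cmp a (snd V \<alpha>) X C h (v \<alpha> ()) = Cmp a (snd V \<alpha>) X C h' (v \<alpha> ())"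
  shows "h = h'"
  using v h eq
\<comment> \<open>For a composite cover, level one applied to each inner cover gives equality over
  \<open>snd V' \<alpha>\<close>, and the level below applied to the outer cover gives equality over
  X. Both levels are called, hence strong induction.\<close>
proof (induction n arbitrary: V X v h h' rule: less_induct)
  case (less n)
  note wf = Co_wf[OF S less.prems(1)]
  consider "n = 0" | "n = Suc 0" | m where "n = Suc (Suc m)" by (metis old.nat.exhaust)
  then show ?case
  proof cases
    case 1
    obtain i where "i \<in> fst V" "snd V i = X" "v i () = Idt a X" using less.prems(1) 1 by auto
    then show ?thesis using less.prems(4)[of i] less.prems(2,3) wf(2) C by simp
  next
    case 2
    then obtain Z p where s: "(Z, V, X, p, v) \<in> S" using less.prems(1) by auto
    have fs: "formal_sequence a (Z, V, X, p, v)" using S s by blast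
    have "right_exact a (Z, V, X, p, v)" using rex s by blast
    then show ?thesis using less.prems(2-) C unfolding right_exact_iff[OF fs] by blast
  next
    case (3 m)
    obtain V' v' W w e where V': "(V', X, v') \<in> Co a S (Suc m)"
      and W: "\<And>\<alpha>. \<alpha> \<in> fst V' \<Longrightarrow> (W \<alpha>, snd V' \<alpha>, w \<alpha>) \<in> Co a S (Suc 0)"
      and e: "bij_betw e (fst V) (SIGMA \<alpha>:fst V'. fst (W \<alpha>))"
      and e1: "\<And>\<epsilon> \<alpha> \<delta>. \<epsilon> \<in> fst V \<Longrightarrow> e \<epsilon> = (\<alpha>, \<delta>) \<Longrightarrow> snd V \<epsilon> = snd (W \<alpha>) \<delta>"
      and e2: "\<And>\<epsilon> \<alpha> \<delta>. \<epsilon> \<in> fst V \<Longrightarrow> e \<epsilon> = (\<alpha>, \<delta>) \<Longrightarrow> v \<epsilon> () = Cmp a (snd (W \<alpha>) \<delta>) (snd V' \<alpha>) X (v' \<alpha> ()) (w \<alpha> \<delta> ())"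
      using less.prems(1) unfolding 3 by (rule Co_SucE) (rule that)
    note wf' = Co_wf[OF S V']
    show ?thesis
    proof (rule less.IH[OF _ V' less.prems(2,3)])
      show "Suc m < n" using 3 by simp
      fix \<alpha> assume \<alpha>: "\<alpha> \<in> fst V'"
      have V\<alpha>: "snd V' \<alpha> \<in> Ob a" "v' \<alpha> () \<in> hm (snd V' \<alpha>) X"
        using fam_Ob[OF wf'(1) \<alpha>] FHom_sng_in[OF wf'(3) \<alpha>] by auto
      note wW = Co_wf[OF S W[OF \<alpha>]]
      show "Cmp a (snd V' \<alpha>) X C h (v' \<alpha> ()) = Cmp a (snd V' \<alpha>) X C h' (v' \<alpha> ())"
      proof (rule less.IH[OF _ W[OF \<alpha>]])
        show "Suc 0 < n" using 3 by simp
        fix \<delta> assume \<delta>: "\<delta> \<in> fst (W \<alpha>)"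
        obtain \<epsilon> where \<epsilon>: "\<epsilon> \<in> fst V" "e \<epsilon> = (\<alpha>, \<delta>)" by (rule Co_Suc_index[OF e \<alpha> \<delta>])
        show "Cmp a (snd (W \<alpha>) \<delta>) (snd V' \<alpha>) C (Cmp a (snd V' \<alpha>) X C h (v' \<alpha> ())) (w \<alpha> \<delta> ()) =
            Cmp a (snd (W \<alpha>) \<delta>) (snd V' \<alpha>) C (Cmp a (snd V' \<alpha>) X C h' (v' \<alpha> ())) (w \<alpha> \<delta> ())"
          using less.prems(4)[OF \<epsilon>(1)] e1[OF \<epsilon>] e2[OF \<epsilon>] less.prems(2,3) V\<alpha> C wf(2) fam_Ob[OF wW(1) \<delta>] FHom_sng_in[OF wW(3) \<delta>]
          by (simp add: Cmp_assoc)
      qed (use less.prems(2,3) V\<alpha> C wf(2) in simp_all)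
    qed
  qed
qed

text \<open>The statement concerns any covering sieve that contains the cover, not the generated
  sieve. This freedom carries the induction: the outer members of a composite cover may lie outside
  R, but they lie in the larger sieve of all morphisms along which \<sigma> is represented locally
  by an element. By separatedness that element is unique, so \<sigma> extends to the larger sieve
  and the hypothesis for the outer cover applies there.\<close>

lemma right_exact_extend:
  assumes S: "\<forall>s\<in>S. formal_sequence a s" and rex: "\<forall>s\<in>S. right_exact a s"
    and cov: "\<And>Y X q. (Y, X, q) \<in> Co a S (Suc 0) \<Longrightarrow> gen_sieve K a (Y, X, q) \<in> T X"
    and C: "C \<in> Ob a"
    and sep: "\<And>X h h'. h \<in> hm X C \<Longrightarrow> h' \<in> hm X C \<Longrightarrow> locally X (\<lambda>B f. Cmp a B X C h f = Cmp a B X C h' f) \<Longrightarrow> h = h'"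
    and v: "(V, X, v) \<in> Co a S n" and R: "R \<in> T X" and vR: "\<And>\<alpha>. \<alpha> \<in> fst V \<Longrightarrow> v \<alpha> () \<in> R (snd V \<alpha>)"
    and \<sigma>: "lin_nat (sieve_presheaf a X R) (yo C) \<sigma>"
  shows "\<exists>h\<in>hm X C. \<forall>\<alpha>\<in>fst V. Cmp a (snd V \<alpha>) X C h (v \<alpha> ()) = \<sigma> (snd V \<alpha>) (v \<alpha> ())"
  using v R vR \<sigma>
proof (induction n arbitrary: V X v R \<sigma> rule: less_induct)
  case (less n)
  note wf = Co_wf[OF S less.prems(1)] and Rs = T_sieve[OF less.prems(2)] and \<sigma> = less.prems(4)
  note X = wf(2) and SR = psh_sieve[OF Rs wf(2)] and vR = less.prems(3)
  have \<sigma>_in: "\<sigma> B f \<in> hm B C" if "B \<in> Ob a" "f \<in> R B" for B f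
    using lin_nat_in[OF \<sigma>, of B f] that by simp
  have \<sigma>_add: "\<sigma> B (f \<oplus>\<^bsub>Hm a B X\<^esub> g) = \<sigma> B f \<oplus>\<^bsub>Hm a B C\<^esub> \<sigma> B g" if "B \<in> Ob a" "f \<in> R B" "g \<in> R B" for B f g
    using lin_nat_add[OF \<sigma>, of B f g] that by simp
  have \<sigma>_act: "\<sigma> D (Cmp a D B X f g) = Cmp a D B C (\<sigma> B f) g" if "B \<in> Ob a" "D \<in> Ob a" "f \<in> R B" "g \<in> hm D B" for B D f g
    using lin_nat_act[OF \<sigma> that(1,2,4), of f] that \<sigma>_in by simp
  consider "n = 0" | "n = Suc 0" | m where "n = Suc (Suc m)" by (metis old.nat.exhaust)
  then show ?case
  proof cases
    case 1
    obtain i where i: "fst V = {i}" "snd V i = X" "v i () = Idt a X" using less.prems(1) 1 by auto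
    then show ?thesis using vR[of i] \<sigma>_in[of X "Idt a X"] X C by auto
  next
    case 2
    then obtain Z p where s: "(Z, V, X, p, v) \<in> S" using less.prems(1) by auto
    have fs: "formal_sequence a (Z, V, X, p, v)" using S s by blast
    have rx: "right_exact a (Z, V, X, p, v)" using rex s by blast
    have Z: "is_fam a Z" "p \<in> FHom a Z V" and pq: "\<And>\<gamma>. \<gamma> \<in> fst Z \<Longrightarrow> qmap V X v (snd Z \<gamma>) (p \<gamma>) = \<zero>\<^bsub>Hm a (snd Z \<gamma>) X\<^esub>"
      using fs unfolding formal_sequence_iff by auto
    let ?y = "\<lambda>\<beta>. \<sigma> (snd V \<beta>) (v \<beta> ())"
    \<comment> \<open>On the sieve, \<sigma> is a map of presheaves, so it commutes with the
      combination given by a row of p; that combination of the generators is zero because q p =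
      0.\<close>
    have "row_comb (yo C) V ?y (snd Z \<gamma>) (p \<gamma>) = \<zero>\<^bsub>Hm a (snd Z \<gamma>) C\<^esub>" if g: "\<gamma> \<in> fst Z" for \<gamma>
    proof -
      note Zg = fam_Ob[OF Z(1) g] and pg = FHom_row[OF Z(2) g]
      have "row_comb (yo C) V ?y (snd Z \<gamma>) (p \<gamma>) = \<sigma> (snd Z \<gamma>) (row_comb (sieve_presheaf a X R) V (\<lambda>\<beta>. v \<beta> ()) (snd Z \<gamma>) (p \<gamma>))"
        by (rule lin_nat_row_comb[OF SR psh_yoneda[OF C] \<sigma> wf(1) _ Zg pg, symmetric]) (use vR in simp)
      also have "\<dots> = \<sigma> (snd Z \<gamma>) \<zero>\<^bsub>FOb (sieve_presheaf a X R) (snd Z \<gamma>)\<^esub>"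
        using row_comb_sieve(1)[OF Rs X wf(1) vR Zg pg] pq[OF g] by (simp add: qmap_def)
      also have "\<dots> = \<zero>\<^bsub>Hm a (snd Z \<gamma>) C\<^esub>"
        using lin_nat_zero_neg(1)[OF SR psh_yoneda[OF C] \<sigma> Zg] by simp
      finally show ?thesis .
    qed
    moreover have "\<forall>\<beta>\<in>fst V. ?y \<beta> \<in> hm (snd V \<beta>) C" using \<sigma>_in vR wf(1) by simp
    ultimately show ?thesis
      using rx[unfolded right_exact_iff[OF fs], rule_format, OF C, THEN conjunct2, rule_format, of ?y] by blast
  next
    case (3 m)
    obtain V' v' W w e where V': "(V', X, v') \<in> Co a S (Suc m)"
      and W: "\<And>\<alpha>. \<alpha> \<in> fst V' \<Longrightarrow> (W \<alpha>, snd V' \<alpha>, w \<alpha>) \<in> Co a S (Suc 0)"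
      and e: "bij_betw e (fst V) (SIGMA \<alpha>:fst V'. fst (W \<alpha>))"
      and e1: "\<And>\<epsilon> \<alpha> \<delta>. \<epsilon> \<in> fst V \<Longrightarrow> e \<epsilon> = (\<alpha>, \<delta>) \<Longrightarrow> snd V \<epsilon> = snd (W \<alpha>) \<delta>"
      and e2: "\<And>\<epsilon> \<alpha> \<delta>. \<epsilon> \<in> fst V \<Longrightarrow> e \<epsilon> = (\<alpha>, \<delta>) \<Longrightarrow> v \<epsilon> () = Cmp a (snd (W \<alpha>) \<delta>) (snd V' \<alpha>) X (v' \<alpha> ()) (w \<alpha> \<delta> ())"
      using less.prems(1) unfolding 3 by (rule Co_SucE) (rule that)
    note wf' = Co_wf[OF S V']
    \<comment> \<open>\<open>W' B f h\<close> says that h represents \<sigma> along f: on some cover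
      of B the composites with f lie in R and \<sigma> takes there the restrictions of h as
      values.\<close>
    define P where "P = (\<lambda>B f h D g. Cmp a D B X f g \<in> R D \<and> Cmp a D B C h g = \<sigma> D (Cmp a D B X f g))"
    define W' where "W' = (\<lambda>B f h. h \<in> hm B C \<and> locally B (P B f h))"
    have uniq: "h = h'" if "W' B f h" "W' B f h'" for B f h h'
    proof (rule sep)
      show "h \<in> hm B C" "h' \<in> hm B C" using that by (auto simp: W'_def)
      have l: "locally B (P B f h)" "locally B (P B f h')" using that by (auto simp: W'_def)
      show "locally B (\<lambda>D g. Cmp a D B C h g = Cmp a D B C h' g)"
        by (rule locally_mono[OF locally_conj[OF l]]) (auto simp: P_def)
    qed
    have Wadd: "W' B (f \<oplus>\<^bsub>Hm a B X\<^esub> g) (h \<oplus>\<^bsub>Hm a B C\<^esub> k)"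
      if "W' B f h" "W' B g k" "B \<in> Ob a" "f \<in> hm B X" "g \<in> hm B X" for B f g h k
    proof -
      have l: "locally B (P B f h)" "locally B (P B g k)" and hk: "h \<in> hm B C" "k \<in> hm B C" using that(1,2) by (auto simp: W'_def)
      have "locally B (P B (f \<oplus>\<^bsub>Hm a B X\<^esub> g) (h \<oplus>\<^bsub>Hm a B C\<^esub> k))"
        by (rule locally_mono[OF locally_conj[OF l]])
          (use that(3-) hk X C \<sigma>_add sieve_add[OF Rs X] in \<open>simp add: P_def Cmp_add_left\<close>)
      then show ?thesis using hk that(3) C by (simp add: W'_def)
    qed
    have Wact: "W' D (Cmp a D B X f g) (Cmp a D B C h g)" if "W' B f h" "B \<in> Ob a" "f \<in> hm B X" "D \<in> Ob a" "g \<in> hm D B" for B D f g h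
    proof -
      have l: "locally B (P B f h)" and h: "h \<in> hm B C" using that(1) by (auto simp: W'_def)
      have "locally D (P D (Cmp a D B X f g) (Cmp a D B C h g))"
        by (rule locally_mono[OF locally_pull[OF l that(4,5)]]) (use that(2-) h X C in \<open>simp add: P_def Cmp_assoc\<close>)
      then show ?thesis using h that C by (simp add: W'_def)
    qed
    have W\<sigma>: "W' B f (\<sigma> B f)" if B: "B \<in> Ob a" "f \<in> R B" for B f
      unfolding W'_def P_def
      by (intro conjI \<sigma>_in[OF B] locally_all[OF B(1)]) (use \<sigma>_act B sieve_Cmp[OF Rs B(2)] in simp_all)
    \<comment> \<open>The sieve of all morphisms along which \<sigma> is represented. It contains R,
      since \<open>\<sigma> B f\<close> itself represents \<sigma> along a member f of R, so it is
      covering.\<close>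
    let ?R' = "sieve_of X (\<lambda>B f. \<exists>h. W' B f h)"
    have R's: "sieve K a X ?R'"
      by (rule sieve_of_sieveI[OF X]) (use Wadd Wact W\<sigma>[OF _ sieve_zero[OF Rs X]] in blast)+
    have R': "?R' \<in> T X"
      by (rule T_mono[OF R's less.prems(2)]) (use W\<sigma> sieve_hm[OF Rs X] in auto)
    define \<sigma>' where "\<sigma>' = (\<lambda>B f. SOME h. W' B f h)"
    have \<sigma>': "W' B f (\<sigma>' B f)" if "f \<in> ?R' B" for B f
      unfolding \<sigma>'_def by (rule someI_ex) (use that in simp)
    have \<sigma>'_eq: "\<sigma>' B f = h" if "f \<in> ?R' B" "W' B f h" for B f h
      by (rule uniq[OF \<sigma>'[OF that(1)] that(2)])
    have \<sigma>'n: "lin_nat (sieve_presheaf a X ?R') (yo C) \<sigma>'"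
      unfolding lin_nat_def
    proof (intro conjI ballI)
      fix B f assume B: "B \<in> Ob a" and "f \<in> carrier (FOb (sieve_presheaf a X ?R') B)"
      then have f: "f \<in> ?R' B" by simp
      have f': "f \<in> hm B X" and h: "\<sigma>' B f \<in> hm B C" using f \<sigma>'[OF f] by (auto simp: W'_def)
      show "\<sigma>' B f \<in> carrier (FOb (yo C) B)" using h by simp
      {
        fix g assume "g \<in> carrier (FOb (sieve_presheaf a X ?R') B)"
        then have g: "g \<in> ?R' B" and g': "g \<in> hm B X" by auto
        have "\<sigma>' B (f \<oplus>\<^bsub>Hm a B X\<^esub> g) = \<sigma>' B f \<oplus>\<^bsub>Hm a B C\<^esub> \<sigma>' B g"
          by (rule \<sigma>'_eq[OF sieve_add[OF R's X f g] Wadd[OF \<sigma>'[OF f] \<sigma>'[OF g] B f' g']])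
        then show "\<sigma>' B (f \<oplus>\<^bsub>FOb (sieve_presheaf a X ?R') B\<^esub> g) = \<sigma>' B f \<oplus>\<^bsub>FOb (yo C) B\<^esub> \<sigma>' B g" by simp
      }
      fix D g assume D: "D \<in> Ob a" "g \<in> hm D B"
      have "\<sigma>' D (Cmp a D B X f g) = Cmp a D B C (\<sigma>' B f) g"
        by (rule \<sigma>'_eq[OF sieve_Cmp[OF R's f D] Wact[OF \<sigma>'[OF f] B f' D]])
      then show "\<sigma>' D (FAr (sieve_presheaf a X ?R') B D g f) = FAr (yo C) B D g (\<sigma>' B f)"
        using f h by simp
    qed
    \<comment> \<open>Level one, applied to R and \<sigma> pulled back along
      \<open>v' \<alpha>\<close>, gives an element with the right restrictions along the inner
      cover. The morphisms where it represents \<sigma> form a sieve, so it does so on the sieve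
      generated by the inner cover.\<close>
    have vW: "\<exists>h. W' (snd V' \<alpha>) (v' \<alpha> ()) h \<and>
        (\<forall>\<delta>\<in>fst (W \<alpha>). Cmp a (snd (W \<alpha>) \<delta>) (snd V' \<alpha>) C h (w \<alpha> \<delta> ()) =
          \<sigma> (snd (W \<alpha>) \<delta>) (Cmp a (snd (W \<alpha>) \<delta>) (snd V' \<alpha>) X (v' \<alpha> ()) (w \<alpha> \<delta> ())))" if \<alpha>: "\<alpha> \<in> fst V'" for \<alpha>
    proof -
      let ?A = "snd V' \<alpha>" and ?f = "v' \<alpha> ()"
      have A: "?A \<in> Ob a" "?f \<in> hm ?A X" using fam_Ob[OF wf'(1) \<alpha>] FHom_sng_in[OF wf'(3) \<alpha>] by auto
      note wW = Co_wf[OF S W[OF \<alpha>]] and pT = T_pull[OF less.prems(2) A]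
      let ?Rp = "pull_sieve a ?A X ?f R" and ?\<tau> = "\<lambda>B g. \<sigma> B (Cmp a B ?A X ?f g)"
      have Rp: "g \<in> ?Rp B \<longleftrightarrow> B \<in> Ob a \<and> g \<in> hm B ?A \<and> Cmp a B ?A X ?f g \<in> R B" for B g by (simp add: pull_sieve_def)
      have \<tau>: "lin_nat (sieve_presheaf a ?A ?Rp) (yo C) ?\<tau>"
        unfolding lin_nat_def
        using A X \<sigma>_in \<sigma>_add \<sigma>_act by (auto simp: Rp Cmp_add_right Cmp_assoc[symmetric])
      have wR: "w \<alpha> \<delta> () \<in> ?Rp (snd (W \<alpha>) \<delta>)" if \<delta>: "\<delta> \<in> fst (W \<alpha>)" for \<delta>
      proof -
        obtain \<epsilon> where \<epsilon>: "\<epsilon> \<in> fst V" "e \<epsilon> = (\<alpha>, \<delta>)" by (rule Co_Suc_index[OF e \<alpha> \<delta>])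
        show ?thesis using vR[OF \<epsilon>(1)] e1[OF \<epsilon>] e2[OF \<epsilon>] FHom_sng_in[OF wW(3) \<delta>] fam_Ob[OF wW(1) \<delta>] by (simp add: Rp)
      qed
      have "Suc 0 < n" using 3 by simp
      from less.IH[OF this W[OF \<alpha>] pT wR \<tau>] obtain h where h: "h \<in> hm ?A C"
        "\<forall>\<delta>\<in>fst (W \<alpha>). Cmp a (snd (W \<alpha>) \<delta>) ?A C h (w \<alpha> \<delta> ()) = ?\<tau> (snd (W \<alpha>) \<delta>) (w \<alpha> \<delta> ())" by auto
      have sv: "sieve K a ?A (sieve_of ?A (P ?A ?f h))"
      proof (rule sieve_of_sieveI[OF A(1)])
        fix B assume B: "B \<in> Ob a"
        have 0: "\<sigma> B \<zero>\<^bsub>Hm a B X\<^esub> = \<zero>\<^bsub>Hm a B C\<^esub>"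
          using lin_nat_zero_neg(1)[OF SR psh_yoneda[OF C] \<sigma> B] by simp
        show "P ?A ?f h B \<zero>\<^bsub>Hm a B ?A\<^esub>"
          using A B C X h(1) 0 sieve_zero[OF Rs X B] by (simp add: P_def Cmp_zero(2))
      next
        fix B g k assume "B \<in> Ob a" "g \<in> hm B ?A" "k \<in> hm B ?A" "P ?A ?f h B g" "P ?A ?f h B k"
        then show "P ?A ?f h B (g \<oplus>\<^bsub>Hm a B ?A\<^esub> k)"
          using A C X h(1) sieve_add[OF Rs X] \<sigma>_add by (simp add: P_def Cmp_add_right)
      next
        fix B D g k assume B: "B \<in> Ob a" "D \<in> Ob a" "g \<in> hm B ?A" and Pg: "P ?A ?f h B g" and k: "k \<in> hm D B"
        have gR: "Cmp a B ?A X ?f g \<in> R B" using Pg by (simp add: P_def)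
        show "P ?A ?f h D (Cmp a D B ?A g k)"
          using Pg A B C X k h(1) sieve_Cmp[OF Rs gR B(2) k] \<sigma>_act[OF B(1,2) gR k]
          by (simp add: P_def Cmp_assoc[symmetric])
      qed
      have "locally ?A (P ?A ?f h)"
      proof (rule locallyI[OF cov[OF W[OF \<alpha>]]])
        fix B g assume B: "B \<in> Ob a" "g \<in> gen_sieve K a (W \<alpha>, ?A, w \<alpha>) B"
        have "g \<in> sieve_of ?A (P ?A ?f h) B"
          by (rule gen_sieve_min[OF sv _ B(2)]) (use wR h(2) in \<open>simp add: P_def Rp\<close>)
        then show "P ?A ?f h B g" by simp
      qed
      then show ?thesis using h by (auto simp: W'_def)
    qed
    have v'R: "v' \<alpha> () \<in> ?R' (snd V' \<alpha>)" if "\<alpha> \<in> fst V'" for \<alpha>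
      using vW[OF that] fam_Ob[OF wf'(1) that] FHom_sng_in[OF wf'(3) that] by auto
    have "Suc m < n" using 3 by simp
    from less.IH[OF this V' R' v'R \<sigma>'n] obtain h where h: "h \<in> hm X C"
      "\<And>\<alpha>. \<alpha> \<in> fst V' \<Longrightarrow> Cmp a (snd V' \<alpha>) X C h (v' \<alpha> ()) = \<sigma>' (snd V' \<alpha>) (v' \<alpha> ())" by auto
    show ?thesis
    proof (intro bexI[OF _ h(1)] ballI)
      fix \<epsilon> assume \<epsilon>: "\<epsilon> \<in> fst V"
      obtain \<alpha> \<delta> where ad: "e \<epsilon> = (\<alpha>, \<delta>)" by (cases "e \<epsilon>") auto
      then have \<alpha>: "\<alpha> \<in> fst V'" and \<delta>: "\<delta> \<in> fst (W \<alpha>)" using bij_betw_apply[OF e \<epsilon>] by auto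
      have A: "snd V' \<alpha> \<in> Ob a" "v' \<alpha> () \<in> hm (snd V' \<alpha>) X" using fam_Ob[OF wf'(1) \<alpha>] FHom_sng_in[OF wf'(3) \<alpha>] by auto
      note wW = Co_wf[OF S W[OF \<alpha>]]
      obtain k where k: "W' (snd V' \<alpha>) (v' \<alpha> ()) k"
        "Cmp a (snd (W \<alpha>) \<delta>) (snd V' \<alpha>) C k (w \<alpha> \<delta> ()) =
          \<sigma> (snd (W \<alpha>) \<delta>) (Cmp a (snd (W \<alpha>) \<delta>) (snd V' \<alpha>) X (v' \<alpha> ()) (w \<alpha> \<delta> ()))" using vW[OF \<alpha>] \<delta> by blast
      have "Cmp a (snd V' \<alpha>) X C h (v' \<alpha> ()) = k" using h(2)[OF \<alpha>] \<sigma>'_eq[OF v'R[OF \<alpha>] k(1)] by simp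
      then show "Cmp a (snd V \<epsilon>) X C h (v \<epsilon> ()) = \<sigma> (snd V \<epsilon>) (v \<epsilon> ())"
        using k(2) e1[OF \<epsilon> ad] e2[OF \<epsilon> ad] A h(1) C X fam_Ob[OF wW(1) \<delta>] FHom_sng_in[OF wW(3) \<delta>]
        by (simp add: Cmp_assoc[symmetric])
    qed
  qed
qed

lemma right_exact_subcanonical:
  assumes S: "pretopology a S" and T: "T = top_of K a S" and rex: "\<forall>s\<in>S. right_exact a s"
  shows "subcanonical K a T"
  unfolding subcanonical_iff sheaf_elt_def
proof (intro ballI allI impI)
  note fo = pretopology_formal[OF S]
  have cov: "\<And>Y X q. (Y, X, q) \<in> Co a S (Suc 0) \<Longrightarrow> gen_sieve K a (Y, X, q) \<in> T X"
    by (rule top_of_cover[OF fo T Co1_Co_iter])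
  fix C X R \<sigma> assume C: "C \<in> Ob a" and X: "X \<in> Ob a" and R: "R \<in> T X" and \<sigma>: "lin_nat (sieve_presheaf a X R) (yo C) \<sigma>"
  have sub: "\<exists>V v n. (V, X, v) \<in> Co a S n \<and> (\<forall>B\<in>Ob a. gen_sieve K a (V, X, v) B \<subseteq> R B)" if "R \<in> T X" for X R
    using that unfolding T top_of_def Co_iter_def by blast
  have sep: "h = h'" if h: "h \<in> hm X C" "h' \<in> hm X C" and loc: "locally X (\<lambda>B f. Cmp a B X C h f = Cmp a B X C h' f)" for X h h'
  proof -
    obtain R where R: "R \<in> T X" "\<forall>B\<in>Ob a. \<forall>f\<in>R B. Cmp a B X C h f = Cmp a B X C h' f" using loc unfolding locally_def by blast
    obtain V v n where v: "(V, X, v) \<in> Co a S n" "\<forall>B\<in>Ob a. gen_sieve K a (V, X, v) B \<subseteq> R B" using sub[OF R(1)] by blast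
    show ?thesis
    proof (rule right_exact_sep[OF fo rex v(1) C h])
      fix \<alpha> assume "\<alpha> \<in> fst V"
      then have "snd V \<alpha> \<in> Ob a" "v \<alpha> () \<in> R (snd V \<alpha>)"
        using v(2) gen_sieve_mem[of \<alpha> V v X] fam_Ob[OF Co_wf(1)[OF fo v(1)]] by blast+
      then show "Cmp a (snd V \<alpha>) X C h (v \<alpha> ()) = Cmp a (snd V \<alpha>) X C h' (v \<alpha> ())" using R(2) by blast
    qed
  qed
  obtain V v n where v: "(V, X, v) \<in> Co a S n" "\<forall>B\<in>Ob a. gen_sieve K a (V, X, v) B \<subseteq> R B" using sub[OF R] by blast
  note wf = Co_wf[OF fo v(1)] and Rs = T_sieve[OF R]
  have vR: "v \<alpha> () \<in> R (snd V \<alpha>)" if "\<alpha> \<in> fst V" for \<alpha>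
    using v(2) gen_sieve_mem[OF that, of v X] fam_Ob[OF wf(1) that] by blast
  have "\<exists>h\<in>hm X C. \<forall>\<alpha>\<in>fst V. Cmp a (snd V \<alpha>) X C h (v \<alpha> ()) = \<sigma> (snd V \<alpha>) (v \<alpha> ())"
    by (rule right_exact_extend[OF fo rex _ C _ v(1) R _ \<sigma>]) (rule cov sep vR, assumption+)+
  then obtain h where h: "h \<in> hm X C" "\<forall>\<alpha>\<in>fst V. Cmp a (snd V \<alpha>) X C h (v \<alpha> ()) = \<sigma> (snd V \<alpha>) (v \<alpha> ())"
    by blast
  have SR: "psh (sieve_presheaf a X R)" by (rule psh_sieve[OF Rs X])
  have \<sigma>_in: "\<sigma> B f \<in> hm B C" if "B \<in> Ob a" "f \<in> R B" for B f
    using lin_nat_in[OF \<sigma>, of B f] that by simp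
  have \<sigma>_act: "\<sigma> D (Cmp a D B X f g) = Cmp a D B C (\<sigma> B f) g" if "B \<in> Ob a" "D \<in> Ob a" "f \<in> R B" "g \<in> hm D B" for B D f g
    using lin_nat_act[OF \<sigma> that(1,2,4), of f] that \<sigma>_in by simp
  \<comment> \<open>So far h is known to represent \<sigma> only on the generators. The equality
    spreads to the generated sieve because its morphisms form a sieve, and from there to all of R by
    separatedness, since the generated sieve is covering.\<close>
  let ?P = "\<lambda>B f. f \<in> R B \<and> Cmp a B X C h f = \<sigma> B f"
  have sv: "sieve K a X (sieve_of X ?P)"
  proof (rule sieve_of_sieveI[OF X])
    fix B assume B: "B \<in> Ob a"
    show "?P B \<zero>\<^bsub>Hm a B X\<^esub>"
      using lin_nat_zero_neg(1)[OF SR psh_yoneda[OF C] \<sigma> B] sieve_zero[OF Rs X B] h(1) B X C by (simp add: Cmp_zero(2))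
  next
    fix B f g assume "B \<in> Ob a" "f \<in> hm B X" "g \<in> hm B X" "?P B f" "?P B g"
    then show "?P B (f \<oplus>\<^bsub>Hm a B X\<^esub> g)"
      using lin_nat_add[OF \<sigma>, of B f g] sieve_add[OF Rs X] h(1) X C by (simp add: Cmp_add_right)
  next
    fix B D f g assume "B \<in> Ob a" "D \<in> Ob a" "f \<in> hm B X" "?P B f" "g \<in> hm D B"
    then show "?P D (Cmp a D B X f g)"
      using sieve_Cmp[OF Rs] \<sigma>_act h(1) X C by (simp add: Cmp_assoc[symmetric])
  qed
  have gT: "gen_sieve K a (V, X, v) \<in> T X" by (rule Co_cover[OF fo cov v(1)])
  have on_gen: "Cmp a B X C h f = \<sigma> B f" if B: "B \<in> Ob a" "f \<in> gen_sieve K a (V, X, v) B" for B f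
  proof -
    have "f \<in> sieve_of X ?P B"
      by (rule gen_sieve_min[OF sv _ B(2)]) (use vR h(2) fam_Ob[OF wf(1)] FHom_sng_in[OF wf(3)] in auto)
    then show ?thesis by simp
  qed
  have on_R: "Cmp a B X C h f = \<sigma> B f" if B: "B \<in> Ob a" "f \<in> R B" for B f
  proof (rule sep)
    have f: "f \<in> hm B X" by (rule sieve_hm[OF Rs X B(2)])
    show "Cmp a B X C h f \<in> hm B C" "\<sigma> B f \<in> hm B C" using f B h(1) X C \<sigma>_in by auto
    show "locally B (\<lambda>D g. Cmp a D B C (Cmp a B X C h f) g = Cmp a D B C (\<sigma> B f) g)"
    proof (rule locallyI[OF T_pull[OF gT B(1) f]])
      fix D g assume D: "D \<in> Ob a" "g \<in> pull_sieve a B X f (gen_sieve K a (V, X, v)) D"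
      then have "g \<in> hm D B" "Cmp a D B X f g \<in> gen_sieve K a (V, X, v) D" by (auto simp: pull_sieve_def)
      then show "Cmp a D B C (Cmp a B X C h f) g = Cmp a D B C (\<sigma> B f) g"
        using on_gen[OF D(1), of "Cmp a D B X f g"] \<sigma>_act[OF B(1) D(1) B(2)] f B D h(1) X C by (simp add: Cmp_assoc)
    qed
  qed
  show "\<exists>!x. x \<in> carrier (FOb (yo C) X) \<and> (\<forall>B\<in>Ob a. \<forall>f\<in>R B. FAr (yo C) X B f x = \<sigma> B f)"
  proof (rule ex1I[of _ h])
    show "h \<in> carrier (FOb (yo C) X) \<and> (\<forall>B\<in>Ob a. \<forall>f\<in>R B. FAr (yo C) X B f h = \<sigma> B f)"
      using h(1) on_R by simp
    fix x assume x: "x \<in> carrier (FOb (yo C) X) \<and> (\<forall>B\<in>Ob a. \<forall>f\<in>R B. FAr (yo C) X B f x = \<sigma> B f)"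
    show "x = h"
      by (rule sep[OF _ h(1) locallyI[OF R]]) (use x on_R in auto)
  qed
qed

end

section \<open>Small presentations of covering sieves\<close>

context small_site
begin

text \<open>A row amounts to its source, a finite set of indices and the entries at these indices.
  All of this can be coded in \<open>'i\<close> and collected in a list, and lists over an infinite
  type can be coded in the type.\<close>

lemma small_rows:
  fixes j :: "'o \<Rightarrow> 'o \<times> 'v \<Rightarrow> 'i" and Y :: "('i, 'o) fam"
  assumes O0: "O0 \<subseteq> Ob a" and j: "\<And>A. A \<in> Ob a \<Longrightarrow> inj_on (j A) (SIGMA B:O0. hm B A)" and Y: "is_fam a Y"
  obtains c :: "'o \<times> ('i \<Rightarrow> 'v) \<Rightarrow> 'i" where "inj_on c (SIGMA B:O0. carrier (FOb (dirsum Y) B))"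
proof -
  have inf: "infinite (UNIV :: 'i set)" using sc unfolding size_condition_def by blast
  obtain p :: "'i \<times> 'i \<Rightarrow> 'i" where p: "inj p" by (rule infinite_pairing[OF inf])
  obtain l :: "'i list \<Rightarrow> 'i" where l: "inj l" by (rule infinite_list_coding[OF inf])
  show thesis
  proof (cases "O0 = {}")
    case False
    \<comment> \<open>An arbitrary fixed object serves as a common target: the source B is coded by
      the zero morphism from B to it.\<close>
    then obtain A where A: "A \<in> Ob a" using O0 by blast
    define ls :: "'i set \<Rightarrow> 'i list" where "ls S = (SOME xs. set xs = S)" for S
    have ls: "set (ls S) = S" if "finite S" for S
      unfolding ls_def by (rule someI_ex) (rule finite_list[OF that])
    define c where "c = (\<lambda>(B, g). l (j A (B, \<zero>\<^bsub>Hm a B A\<^esub>) # map (\<lambda>\<beta>. p (\<beta>, j (snd Y \<beta>) (B, g \<beta>))) (ls (supp B Y g))))"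
    have "inj_on c (SIGMA B:O0. carrier (FOb (dirsum Y) B))"
    proof (rule inj_onI, clarify)
      fix B g B' g' assume B: "B \<in> O0" "B' \<in> O0" and g: "g \<in> carrier (FOb (dirsum Y) B)" and g': "g' \<in> carrier (FOb (dirsum Y) B')"
        and eq: "c (B, g) = c (B', g')"
      have e1: "j A (B, \<zero>\<^bsub>Hm a B A\<^esub>) = j A (B', \<zero>\<^bsub>Hm a B' A\<^esub>)"
        and e2: "map (\<lambda>\<beta>. p (\<beta>, j (snd Y \<beta>) (B, g \<beta>))) (ls (supp B Y g)) = map (\<lambda>\<beta>. p (\<beta>, j (snd Y \<beta>) (B', g' \<beta>))) (ls (supp B' Y g'))"
        using injD[OF l eq[unfolded c_def prod.case]] by auto
      have BB: "B' = B" using inj_onD[OF j[OF A] e1] B subsetD[OF O0] A by simp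
      \<comment> \<open>The lists enumerate the two supports in chosen orders that are as yet
        unrelated, so only their sets are compared. Each entry carries its index, which suffices to
        recover the row.\<close>
      have e3: "(\<lambda>\<beta>. p (\<beta>, j (snd Y \<beta>) (B, g \<beta>))) ` supp B Y g = (\<lambda>\<beta>. p (\<beta>, j (snd Y \<beta>) (B, g' \<beta>))) ` supp B Y g'"
        using arg_cong[OF e2, of set] ls[OF dirsum_D(2)[OF g]] ls[OF dirsum_D(2)[OF g']] BB by simp
      have gg: "\<beta> \<in> supp B Y g' \<and> g \<beta> = g' \<beta>" if g: "g \<in> carrier (FOb (dirsum Y) B)" and g': "g' \<in> carrier (FOb (dirsum Y) B)"
        and e3: "(\<lambda>\<beta>. p (\<beta>, j (snd Y \<beta>) (B, g \<beta>))) ` supp B Y g = (\<lambda>\<beta>. p (\<beta>, j (snd Y \<beta>) (B, g' \<beta>))) ` supp B Y g'"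
        and b: "\<beta> \<in> supp B Y g" for \<beta> g g'
      proof -
        obtain \<beta>' where b': "\<beta>' \<in> supp B Y g'" "p (\<beta>, j (snd Y \<beta>) (B, g \<beta>)) = p (\<beta>', j (snd Y \<beta>') (B, g' \<beta>'))"
          using e3 b by blast
        have "\<beta> = \<beta>'" "j (snd Y \<beta>) (B, g \<beta>) = j (snd Y \<beta>') (B, g' \<beta>')" using injD[OF p b'(2)] by auto
        moreover have "\<beta> \<in> fst Y" using b by (simp add: supp_def)
        ultimately show ?thesis
          using inj_onD[OF j[OF fam_Ob[OF Y]], of \<beta> "(B, g \<beta>)" "(B, g' \<beta>)"] dirsum_D(3)[OF g] dirsum_D(3)[OF g'] b' B by auto
      qed
      have g'': "g' \<in> carrier (FOb (dirsum Y) B)" using g' BB by simp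
      have "g = g'"
      proof (rule dirsum_eqI[OF g g''])
        fix \<beta> assume b: "\<beta> \<in> fst Y"
        show "g \<beta> = g' \<beta>"
          using gg[OF g g'' e3] gg[OF g'' g e3[symmetric]] dirsum_D(4)[OF g b] dirsum_D(4)[OF g'' b] by metis
      qed
      then show "B = B' \<and> g = g'" using BB by simp
    qed
    then show ?thesis by (rule that)
  qed (use that[of "\<lambda>_. undefined"] in simp)
qed

text \<open>The canonical presentation of a covering sieve: the generators are all members of R with
  source in \<open>O0\<close>, the relations all rows with source in \<open>O0\<close> that q kills.
  Both collections are indexed by their codes in \<open>'i\<close>.\<close>

lemma exact_seqs_covers:
  assumes R: "R \<in> T A"
  obtains Z Y p q where "((Z, Y, A, p, q) :: ('i, 'o, 'v) fseq) \<in> exact_seqs" "\<And>B f. f \<in> gen_sieve K a (Y, A, q) B \<Longrightarrow> f \<in> R B"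
proof -
  note A = T_Ob[OF R] and Rs = T_sieve[OF R]
  obtain O0 and j :: "'o \<Rightarrow> 'o \<times> 'v \<Rightarrow> 'i" where O0: "O0 \<subseteq> Ob a"
    "\<And>X. X \<in> Ob a \<Longrightarrow> \<exists>Y\<in>O0. \<exists>u\<in>hm X Y. \<exists>v\<in>hm Y X. Cmp a X Y X v u = Idt a X"
    "\<And>A. A \<in> Ob a \<Longrightarrow> inj_on (j A) (SIGMA B:O0. hm B A)"
    by (rule small_skeleton) (rule that, assumption+)
  define YS where "YS = (SIGMA B:O0. R B)"
  have jY: "inj_on (j A) YS"
    by (rule inj_on_subset[OF O0(3)[OF A]]) (use sieve_hm[OF Rs A] in \<open>auto simp: YS_def\<close>)
  define dY where "dY = inv_into YS (j A)"
  have dY: "dY (j A y) = y" if "y \<in> YS" for y unfolding dY_def by (rule inv_into_f_f[OF jY that])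
  define Y :: "('i, 'o) fam" where "Y = (j A ` YS, \<lambda>i\<in>j A ` YS. fst (dY i))"
  define q where "q = (\<lambda>i\<in>j A ` YS. \<lambda>_::unit. snd (dY i))"
  have Yi: "j A (B, f) \<in> fst Y" "snd Y (j A (B, f)) = B" "q (j A (B, f)) () = f" if "B \<in> O0" "f \<in> R B" for B f
    using dY[of "(B, f)"] that by (auto simp: Y_def q_def YS_def)
  have Ye: "\<exists>B f. B \<in> O0 \<and> f \<in> R B \<and> i = j A (B, f)" if "i \<in> fst Y" for i
    using that by (auto simp: Y_def YS_def)
  have Y: "is_fam a Y"
    unfolding is_fam_def using O0(1) dY by (auto simp: Y_def YS_def)
  have q: "q \<in> FHom a Y (sng A)"
    unfolding FHom_sng
  proof (intro conjI ballI)
    show "q \<in> extensional (fst Y)" by (simp add: q_def Y_def)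
    show "q i () \<in> hm (snd Y i) A" if i: "i \<in> fst Y" for i
      using Ye[OF i] Yi sieve_hm[OF Rs A] by metis
  qed
  obtain c :: "'o \<times> ('i \<Rightarrow> 'v) \<Rightarrow> 'i" where c: "inj_on c (SIGMA B:O0. carrier (FOb (dirsum Y) B))"
    by (rule small_rows[OF O0(1,3) Y]) (assumption, rule that)
  define ZS where "ZS = (SIGMA B:O0. {g \<in> carrier (FOb (dirsum Y) B). qmap Y A q B g = \<zero>\<^bsub>Hm a B A\<^esub>})"
  have cZ: "inj_on c ZS" by (rule inj_on_subset[OF c]) (auto simp: ZS_def)
  define dZ where "dZ = inv_into ZS c"
  have dZ: "dZ (c y) = y" if "y \<in> ZS" for y unfolding dZ_def by (rule inv_into_f_f[OF cZ that])
  define Z :: "('i, 'o) fam" where "Z = (c ` ZS, \<lambda>i\<in>c ` ZS. fst (dZ i))"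
  define p where "p = (\<lambda>i\<in>c ` ZS. snd (dZ i))"
  have Zi: "c (B, g) \<in> fst Z" "snd Z (c (B, g)) = B" "p (c (B, g)) = g"
    if "B \<in> O0" "g \<in> carrier (FOb (dirsum Y) B)" "qmap Y A q B g = \<zero>\<^bsub>Hm a B A\<^esub>" for B g
    using dZ[of "(B, g)"] that by (auto simp: Z_def p_def ZS_def)
  have Ze: "\<exists>B g. B \<in> O0 \<and> g \<in> carrier (FOb (dirsum Y) B) \<and> qmap Y A q B g = \<zero>\<^bsub>Hm a B A\<^esub> \<and> i = c (B, g)" if "i \<in> fst Z" for i
    using that by (auto simp: Z_def ZS_def)
  have Z: "is_fam a Z"
    unfolding is_fam_def using O0(1) dZ by (auto simp: Z_def ZS_def)
  have p: "p \<in> FHom a Z Y"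
    unfolding FHom_iff
  proof (intro conjI ballI)
    show "p \<in> extensional (fst Z)" by (simp add: p_def Z_def)
    show "p i \<in> carrier (FOb (dirsum Y) (snd Z i))" if i: "i \<in> fst Z" for i
      using Ze[OF i] Zi by metis
  qed
  have "formal_sequence a (Z, Y, A, p, q)"
    unfolding formal_sequence_iff using Z Y A p q
  proof (intro conjI ballI)
    show "qmap Y A q (snd Z i) (p i) = \<zero>\<^bsub>Hm a (snd Z i) A\<^esub>" if i: "i \<in> fst Z" for i
      using Ze[OF i] Zi by metis
  qed
  moreover have "gen_sieve K a (Y, A, q) \<in> T A"
  proof (rule T_mono[OF gen_sieve_eq(2)[OF Y A q] R])
    fix B f assume B: "B \<in> Ob a" "f \<in> R B"
    obtain D u v where D: "D \<in> O0" "u \<in> hm B D" "v \<in> hm D B" "Cmp a B D B v u = Idt a B" using O0(2)[OF B(1)] by blast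
    have D': "D \<in> Ob a" using D(1) O0(1) by blast
    have f: "f \<in> hm B A" by (rule sieve_hm[OF Rs A B(2)])
    have fv: "Cmp a D B A f v \<in> R D" by (rule sieve_Cmp[OF Rs B(2) D' D(3)])
    have "Cmp a D B A f v \<in> gen_sieve K a (Y, A, q) D"
      using gen_sieve_mem[OF Yi(1)[OF D(1) fv], of q A] Yi(2,3)[OF D(1) fv] by simp
    from sieve_Cmp[OF gen_sieve_eq(2)[OF Y A q] this B(1) D(2)]
    show "f \<in> gen_sieve K a (Y, A, q) B" using D D' B f A by (simp add: Cmp_assoc)
  qed
  \<comment> \<open>Here lifting is even global. Moved along v to a source in \<open>O0\<close>, the
    row becomes one of the relations, and the corresponding generator, restricted along u, maps back
    to it.\<close>
  moreover have "locally B (\<lambda>C g. \<exists>f'\<in>carrier (FOb (dirsum Z) C). pmap Z Y p C f' = FAr (dirsum Y) B C g f)"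
    if B: "B \<in> Ob a" and f: "f \<in> carrier (FOb (dirsum Y) B)" and f0: "qmap Y A q B f = \<zero>\<^bsub>Hm a B A\<^esub>" for B f
  proof (rule locally_all[OF B])
    note DY = psh_dirsum[OF Y] and DZ = psh_dirsum[OF Z] and qe = qmap_lin_nat[OF Y A q] and pe = pmap_lin_nat[OF Z Y p]
    obtain D u v where D: "D \<in> O0" "u \<in> hm B D" "v \<in> hm D B" "Cmp a B D B v u = Idt a B" using O0(2)[OF B] by blast
    have D': "D \<in> Ob a" using D(1) O0(1) by blast
    let ?\<rho> = "FAr (dirsum Y) B D v f"
    have \<rho>: "?\<rho> \<in> carrier (FOb (dirsum Y) D)" by (rule act_in[OF DY B D' D(3) f])
    have \<rho>0: "qmap Y A q D ?\<rho> = \<zero>\<^bsub>Hm a D A\<^esub>"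
      using lin_nat_act[OF qe B D' D(3) f] f0 B A D D' by (simp add: Cmp_zero(1))
    note i = Zi[OF D(1) \<rho> \<rho>0]
    let ?f' = "unit_row Z (c (D, ?\<rho>)) B u"
    have f': "?f' \<in> carrier (FOb (dirsum Z) B)" by (rule unit_row_in[OF Z i(1) B]) (use i D in simp)
    have "pmap Z Y p B ?f' = FAr (dirsum Y) D B u ?\<rho>"
      unfolding pmap_def
      by (subst row_comb_unit_row[OF DY Z FHom_row[OF p] i(1) B]) (use i D in simp_all)
    also have "\<dots> = f" using act_Cmp[OF DY B D' B D(3,2) f] D(4) B f DY by simp
    finally have pf: "pmap Z Y p B ?f' = f" .
    fix C g assume C: "C \<in> Ob a" "g \<in> hm C B"
    show "\<exists>f'\<in>carrier (FOb (dirsum Z) C). pmap Z Y p C f' = FAr (dirsum Y) B C g f"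
      using lin_nat_act[OF pe B C f'] pf act_in[OF DZ B C f'] by metis
  qed
  ultimately have "(Z, Y, A, p, q) \<in> exact_seqs" unfolding exact_seqs_iff by blast
  moreover have "f \<in> R B" if "f \<in> gen_sieve K a (Y, A, q) B" for B f
    by (rule gen_sieve_min[OF Rs _ that]) (use Ye Yi in metis)
  ultimately show thesis by (rule that)
qed

text \<open>Both axioms ask for a cover inside a suitable covering sieve, and
  \<open>exact_seqs_covers\<close> provides one of level one. For (PTa) the sieve is the pullback
  along f of the one generated by q; for (PTb) it is a sieve on which the given row lifts. Lifts
  chosen for the individual members are the rows of the required formal morphism.\<close>

lemma exact_seqs_pretopology: "pretopology a (exact_seqs :: ('i, 'o, 'v) fseq set)"
  unfolding pretopology_def
proof (intro conjI)
  show "\<forall>s\<in>exact_seqs. formal_sequence a s" by (auto simp: exact_seqs_def)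
  show "\<forall>(Y, X, q)\<in>Co a (exact_seqs :: ('i, 'o, 'v) fseq set) 1. \<forall>A\<in>Ob a. \<forall>f\<in>FHom a (sng A) (sng X).
        \<exists>C q'. (C, A, q') \<in> Co_iter a (exact_seqs :: ('i, 'o, 'v) fseq set) \<and>
          (\<exists>f'\<in>FHom a C Y. fcomp a C Y (sng X) q f' = fcomp a C (sng A) (sng X) f q')"
  proof (clarify, goal_cases)
    case (1 Yi Yf X q A f)
    let ?Y = "(Yi, Yf)"
    obtain Z p where s: "(Z, ?Y, X, p, q) \<in> exact_seqs" using 1(1) by auto
    have Y: "is_fam a ?Y" and X: "X \<in> Ob a" and q: "q \<in> FHom a ?Y (sng X)" and cov: "gen_sieve K a (?Y, X, q) \<in> T X"
      using s unfolding exact_seqs_iff formal_sequence_iff by auto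
    note A = 1(2) and f = 1(3)
    have f0: "f () () \<in> hm A X" using FHom_sng_in[OF f, of "()"] by simp
    obtain Z' C p' q' where s': "((Z', C, A, p', q') :: ('i, 'o, 'v) fseq) \<in> exact_seqs"
      and sub: "\<And>B g. g \<in> gen_sieve K a (C, A, q') B \<Longrightarrow> g \<in> pull_sieve a A X (f () ()) (gen_sieve K a (?Y, X, q)) B"
      by (rule exact_seqs_covers[OF T_pull[OF cov A f0]]) (rule that)
    have C: "is_fam a C" and q': "q' \<in> FHom a C (sng A)" using s' unfolding exact_seqs_iff formal_sequence_iff by auto
    have "\<exists>g\<in>carrier (FOb (dirsum ?Y) (snd C \<alpha>)). qmap ?Y X q (snd C \<alpha>) g = Cmp a (snd C \<alpha>) A X (f () ()) (q' \<alpha> ())"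
      if \<alpha>: "\<alpha> \<in> fst C" for \<alpha>
    proof -
      have "Cmp a (snd C \<alpha>) A X (f () ()) (q' \<alpha> ()) \<in> gen_sieve K a (?Y, X, q) (snd C \<alpha>)"
        using sub[OF gen_sieve_mem[OF \<alpha>]] fam_Ob[OF C \<alpha>] by (simp add: pull_sieve_def)
      then show ?thesis unfolding gen_sieve_eq(1)[OF Y X q] by auto
    qed
    then obtain g where g: "\<And>\<alpha>. \<alpha> \<in> fst C \<Longrightarrow> g \<alpha> \<in> carrier (FOb (dirsum ?Y) (snd C \<alpha>))"
      "\<And>\<alpha>. \<alpha> \<in> fst C \<Longrightarrow> qmap ?Y X q (snd C \<alpha>) (g \<alpha>) = Cmp a (snd C \<alpha>) A X (f () ()) (q' \<alpha> ())" by metis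
    let ?g = "restrict g (fst C)"
    have gF: "?g \<in> FHom a C ?Y" unfolding FHom_iff using g(1) by simp
    have "fcomp a C ?Y (sng X) q ?g = fcomp a C (sng A) (sng X) f q'"
      unfolding fcomp_eq_fcomp_iff
    proof
      fix \<alpha> assume \<alpha>: "\<alpha> \<in> fst C"
      show "fcomp a C ?Y (sng X) q ?g \<alpha> = fcomp a C (sng A) (sng X) f q' \<alpha>"
        unfolding fcomp_sng_row[OF C Y X gF q \<alpha>] fcomp_sng_mid[OF C A X f q' \<alpha>]
        using g(2)[OF \<alpha>] \<alpha> by (simp add: qmap_def)
    qed
    moreover have "(C, A, q') \<in> Co_iter a exact_seqs" by (rule Co1_Co_iter) (unfold Co1_iff, use s' in blast)
    ultimately show ?case using gF by blast
  qed
  show "\<forall>(Z, Y, X, p, q)\<in>exact_seqs. \<forall>A\<in>Ob a. \<forall>f\<in>FHom a (sng A) Y.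
        fcomp a (sng A) Y (sng X) q f = fzero a (sng A) (sng X) \<longrightarrow>
        (\<exists>B q'. (B, A, q') \<in> Co_iter a (exact_seqs :: ('i, 'o, 'v) fseq set) \<and>
          (\<exists>f'\<in>FHom a B Z. fcomp a B Z Y p f' = fcomp a B (sng A) Y f q'))"
  proof (clarify, goal_cases)
    case (1 Zi Zf Yi Yf X p q A f)
    let ?Y = "(Yi, Yf)" and ?Z = "(Zi, Zf)"
    note s = 1(1) and A = 1(2) and f = 1(3)
    have Z: "is_fam a ?Z" and Y: "is_fam a ?Y" and X: "X \<in> Ob a" and p: "p \<in> FHom a ?Z ?Y" and q: "q \<in> FHom a ?Y (sng X)"
      using s unfolding exact_seqs_iff formal_sequence_iff by auto
    have f1: "f () \<in> carrier (FOb (dirsum ?Y) A)" using f unfolding sng_FHom_iff .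
    have sA: "is_fam a (sng A)" using A by simp
    have "qmap ?Y X q A (f ()) = \<zero>\<^bsub>Hm a A X\<^esub>"
      using 1(4) unfolding fcomp_zero_iff[OF sA Y X f q] qmap_def by simp
    then have "locally A (\<lambda>B g. \<exists>f'\<in>carrier (FOb (dirsum ?Z) B). pmap ?Z ?Y p B f' = FAr (dirsum ?Y) A B g (f ()))"
      using s A f1 unfolding exact_seqs_iff by blast
    then obtain R where R: "R \<in> T A"
      "\<And>B g. B \<in> Ob a \<Longrightarrow> g \<in> R B \<Longrightarrow> \<exists>f'\<in>carrier (FOb (dirsum ?Z) B). pmap ?Z ?Y p B f' = FAr (dirsum ?Y) A B g (f ())"
      unfolding locally_def by blast
    obtain Z' C p' q' where s': "((Z', C, A, p', q') :: ('i, 'o, 'v) fseq) \<in> exact_seqs"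
      and sub: "\<And>B g. g \<in> gen_sieve K a (C, A, q') B \<Longrightarrow> g \<in> R B"
      by (rule exact_seqs_covers[OF R(1)]) (rule that)
    have C: "is_fam a C" and q': "q' \<in> FHom a C (sng A)" using s' unfolding exact_seqs_iff formal_sequence_iff by auto
    have "\<exists>g\<in>carrier (FOb (dirsum ?Z) (snd C \<alpha>)). pmap ?Z ?Y p (snd C \<alpha>) g = FAr (dirsum ?Y) A (snd C \<alpha>) (q' \<alpha> ()) (f ())"
      if \<alpha>: "\<alpha> \<in> fst C" for \<alpha>
      by (rule R(2)[OF fam_Ob[OF C \<alpha>] sub[OF gen_sieve_mem[OF \<alpha>]]])
    then obtain g where g: "\<And>\<alpha>. \<alpha> \<in> fst C \<Longrightarrow> g \<alpha> \<in> carrier (FOb (dirsum ?Z) (snd C \<alpha>))"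
      "\<And>\<alpha>. \<alpha> \<in> fst C \<Longrightarrow> pmap ?Z ?Y p (snd C \<alpha>) (g \<alpha>) = FAr (dirsum ?Y) A (snd C \<alpha>) (q' \<alpha> ()) (f ())" by metis
    let ?g = "restrict g (fst C)"
    have gF: "?g \<in> FHom a C ?Z" unfolding FHom_iff using g(1) by simp
    have "fcomp a C ?Z ?Y p ?g = fcomp a C (sng A) ?Y f q'"
      unfolding fcomp_eq_fcomp_iff
    proof
      fix \<alpha> assume \<alpha>: "\<alpha> \<in> fst C"
      show "fcomp a C ?Z ?Y p ?g \<alpha> = fcomp a C (sng A) ?Y f q' \<alpha>"
        unfolding fcomp_row[OF C Z Y gF p \<alpha>] fcomp_sng_act[OF C A Y f q' \<alpha>]
        using g(2)[OF \<alpha>] \<alpha> by (simp add: pmap_def)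
    qed
    moreover have "(C, A, q') \<in> Co_iter a exact_seqs" by (rule Co1_Co_iter) (unfold Co1_iff, use s' in blast)
    ultimately show ?case using gF by blast
  qed
qed

text \<open>A covering sieve contains the sieve of a single presentation, without iteration; in the
  other direction, iterated covers from this class stay covering by \<open>Co_cover\<close>.\<close>

lemma top_of_exact_seqs: "T = top_of K a (exact_seqs :: ('i, 'o, 'v) fseq set)"
proof
  fix X
  have fo: "\<forall>s\<in>(exact_seqs :: ('i, 'o, 'v) fseq set). formal_sequence a s" by (auto simp: exact_seqs_def)
  show "T X = top_of K a (exact_seqs :: ('i, 'o, 'v) fseq set) X"
  proof (intro equalityI subsetI)
    fix R assume R: "R \<in> T X"
    obtain Z Y p q where s: "((Z, Y, X, p, q) :: ('i, 'o, 'v) fseq) \<in> exact_seqs"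
      and sub: "\<And>B f. f \<in> gen_sieve K a (Y, X, q) B \<Longrightarrow> f \<in> R B" by (rule exact_seqs_covers[OF R]) (rule that)
    have "(Y, X, q) \<in> Co_iter a exact_seqs" by (rule Co1_Co_iter) (unfold Co1_iff, use s in blast)
    then show "R \<in> top_of K a (exact_seqs :: ('i, 'o, 'v) fseq set) X"
      unfolding top_of_def using T_Ob[OF R] T_sieve[OF R] sub by blast
  next
    fix R assume "R \<in> top_of K a (exact_seqs :: ('i, 'o, 'v) fseq set) X"
    then obtain V r n where X: "X \<in> Ob a" and R: "sieve K a X R" and V: "(V, X, r) \<in> Co a (exact_seqs :: ('i, 'o, 'v) fseq set) n"
      and sub: "\<forall>B\<in>Ob a. gen_sieve K a (V, X, r) B \<subseteq> R B"
      unfolding top_of_def Co_iter_def by blast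
    have "gen_sieve K a (V, X, r) \<in> T X"
      by (rule Co_cover[OF fo _ V]) (unfold Co1_iff exact_seqs_iff, blast)
    then show "R \<in> T X" by (rule T_mono[OF R]) (use sub in blast)
  qed
qed

end

section \<open>Exact sequences of sheaves\<close>

context lin_cat
begin

lemma PSh_Cmp_eq_iff:
  assumes "psh F" "psh G" "psh H" "\<phi> \<in> psh_hom F G" "\<psi> \<in> psh_hom G H" "\<theta> \<in> psh_hom F H"
  shows "Cmp (PSh K a) F G H \<psi> \<phi> = \<theta> \<longleftrightarrow> (\<forall>A\<in>Ob a. \<forall>x\<in>carrier (FOb F A). \<psi> A (\<phi> A x) = \<theta> A x)"
proof
  assume "Cmp (PSh K a) F G H \<psi> \<phi> = \<theta>"
  then show "\<forall>A\<in>Ob a. \<forall>x\<in>carrier (FOb F A). \<psi> A (\<phi> A x) = \<theta> A x" by (auto simp: PSh_Cmp)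
next
  assume "\<forall>A\<in>Ob a. \<forall>x\<in>carrier (FOb F A). \<psi> A (\<phi> A x) = \<theta> A x"
  then show "Cmp (PSh K a) F G H \<psi> \<phi> = \<theta>"
    by (intro psh_hom_eqI[OF assms(1,3) PSh_Cmp_in[OF assms(1-5)] assms(6)]) simp
qed

lemma PSh_zero_in: "psh F \<Longrightarrow> psh G \<Longrightarrow> \<zero>\<^bsub>Hm (PSh K a) F G\<^esub> \<in> psh_hom F G"
  unfolding PSh_ops by (rule res_nat_hom[OF _ _ lin_nat_zero_map])

lemma PSh_zero_apply [simp]:
  "A \<in> Ob a \<Longrightarrow> x \<in> carrier (FOb F A) \<Longrightarrow> \<zero>\<^bsub>Hm (PSh K a) F G\<^esub> A x = \<zero>\<^bsub>FOb G A\<^esub>"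
  by (simp add: PSh_ops)

lemma PSh_Idt_in: "psh F \<Longrightarrow> Idt (PSh K a) F \<in> psh_hom F F"
  unfolding PSh_ops by (rule res_nat_hom) (simp_all add: lin_nat_def)

lemma PSh_Idt_apply [simp]: "A \<in> Ob a \<Longrightarrow> x \<in> carrier (FOb F A) \<Longrightarrow> Idt (PSh K a) F A x = x"
  by (simp add: PSh_ops)

section \<open>Kernels of sheaf morphisms\<close>

definition ker_psh :: "('o, 'v, 'k) presheaf \<Rightarrow> ('o, 'v, 'k) presheaf \<Rightarrow> ('o \<Rightarrow> 'v \<Rightarrow> 'v) \<Rightarrow> ('o, 'v, 'k) presheaf" where
  "ker_psh F G \<phi> = \<lparr>FOb = (\<lambda>A. (FOb F A)\<lparr>carrier := {x \<in> carrier (FOb F A). \<phi> A x = \<zero>\<^bsub>FOb G A\<^esub>}\<rparr>),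
     FAr = (\<lambda>A B f. restrict (FAr F A B f) {x \<in> carrier (FOb F A). \<phi> A x = \<zero>\<^bsub>FOb G A\<^esub>})\<rparr>"

lemma ker_psh_simps [simp]:
  "carrier (FOb (ker_psh F G \<phi>) A) = {x \<in> carrier (FOb F A). \<phi> A x = \<zero>\<^bsub>FOb G A\<^esub>}"
  "x \<oplus>\<^bsub>FOb (ker_psh F G \<phi>) A\<^esub> y = x \<oplus>\<^bsub>FOb F A\<^esub> y" "\<zero>\<^bsub>FOb (ker_psh F G \<phi>) A\<^esub> = \<zero>\<^bsub>FOb F A\<^esub>"
  "r \<odot>\<^bsub>FOb (ker_psh F G \<phi>) A\<^esub> x = r \<odot>\<^bsub>FOb F A\<^esub> x"
  "x \<in> carrier (FOb F A) \<Longrightarrow> \<phi> A x = \<zero>\<^bsub>FOb G A\<^esub> \<Longrightarrow> FAr (ker_psh F G \<phi>) A B f x = FAr F A B f x"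
  by (simp_all add: ker_psh_def)

lemma ker_psh_psh:
  assumes F: "psh F" and G: "psh G" and \<phi>: "lin_nat F G \<phi>"
  shows "psh (ker_psh F G \<phi>)" "ker_psh F G \<phi> \<in> Ob (PSh K a)" "lin_nat (ker_psh F G \<phi>) F (\<lambda>A x. x)"
proof -
  have mod: "module K (FOb (ker_psh F G \<phi>) A)" if A: "A \<in> Ob a" for A
  proof -
    interpret M: module K "FOb F A" by (rule psh_mod[OF F A])
    interpret N: module K "FOb G A" by (rule psh_mod[OF G A])
    have "submodule {x \<in> carrier (FOb F A). \<phi> A x = \<zero>\<^bsub>FOb G A\<^esub>} K (FOb F A)"
      using lin_nat_zero_neg[OF F G \<phi> A] lin_nat_add[OF \<phi> A] lin_nat_smult[OF F G \<phi> A]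
      by (intro M.submoduleI) (auto simp: N.add.inv_one[simplified])
    then show ?thesis using submodule.submodule_is_module M.module_axioms unfolding ker_psh_def by fastforce
  qed
  show p: "psh (ker_psh F G \<phi>)"
    unfolding psh_def
    by (intro conjI ballI mod) (use F G \<phi> in \<open>auto simp: lin_nat_act[OF \<phi>] lin_nat_add[OF \<phi>] act_zero_neg(1)[OF G] act_add act_Cmp act_add_left act_smult_left\<close>)
  show "ker_psh F G \<phi> \<in> Ob (PSh K a)"
    unfolding PSh_Ob_iff using p by (simp add: ker_psh_def)
  show "lin_nat (ker_psh F G \<phi>) F (\<lambda>A x. x)" unfolding lin_nat_def by simp
qed

end

context site
begin

text \<open>A family in the kernel glues in F, and \<phi> of the glued element vanishes on a cover,
  hence vanishes because G is separated.\<close>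

lemma ker_psh_sheaf:
  assumes F: "is_sheaf K a T F" and G: "is_sheaf K a T G" and \<phi>: "lin_nat F G \<phi>"
  shows "is_sheaf K a T (ker_psh F G \<phi>)"
proof -
  note F' = sheaf_psh[OF F] and G' = sheaf_psh[OF G] sheaf_sheaf_elt[OF G]
  note k = ker_psh_psh[OF F' G'(1) \<phi>]
  have "sheaf_elt (ker_psh F G \<phi>)"
    unfolding sheaf_elt_def
  proof (intro ballI allI impI)
    fix A R \<sigma> assume A: "A \<in> Ob a" and R: "R \<in> T A" and \<sigma>: "lin_nat (sieve_presheaf a A R) (ker_psh F G \<phi>) \<sigma>"
    have "\<exists>!x. x \<in> carrier (FOb F A) \<and> (\<forall>B\<in>Ob a. \<forall>f\<in>R B. FAr F A B f x = \<sigma> B f)"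
      using sheaf_sheaf_elt[OF F, unfolded sheaf_elt_def, rule_format, OF A R lin_nat_comp[OF \<sigma> k(3)]] by simp
    then obtain x where x: "x \<in> carrier (FOb F A)" "\<forall>B\<in>Ob a. \<forall>f\<in>R B. FAr F A B f x = \<sigma> B f"
      and u: "\<And>y. y \<in> carrier (FOb F A) \<Longrightarrow> (\<forall>B\<in>Ob a. \<forall>f\<in>R B. FAr F A B f y = \<sigma> B f) \<Longrightarrow> y = x" by blast
    have \<phi>x: "\<phi> A x = \<zero>\<^bsub>FOb G A\<^esub>"
    proof (rule sheaf_elt_sep[OF G' lin_nat_in[OF \<phi> A x(1)] psh_zero_in[OF G'(1) A]], rule locallyI[OF R])
      fix B f assume B: "B \<in> Ob a" "f \<in> R B"
      have f: "f \<in> hm B A" by (rule T_hm[OF R B(2)])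
      have "\<phi> B (\<sigma> B f) = \<zero>\<^bsub>FOb G B\<^esub>" using lin_nat_in[OF \<sigma>, of B f] B by simp
      then show "FAr G A B f (\<phi> A x) = FAr G A B f \<zero>\<^bsub>FOb G A\<^esub>"
        using lin_nat_act[OF \<phi> A B(1) f x(1)] x(2) B act_zero_neg(1)[OF G'(1) A B(1) f] by simp
    qed
    show "\<exists>!x. x \<in> carrier (FOb (ker_psh F G \<phi>) A) \<and> (\<forall>B\<in>Ob a. \<forall>f\<in>R B. FAr (ker_psh F G \<phi>) A B f x = \<sigma> B f)"
    proof (rule ex1I[of _ x])
      show "x \<in> carrier (FOb (ker_psh F G \<phi>) A) \<and> (\<forall>B\<in>Ob a. \<forall>f\<in>R B. FAr (ker_psh F G \<phi>) A B f x = \<sigma> B f)"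
        using x \<phi>x by simp
      fix y assume y: "y \<in> carrier (FOb (ker_psh F G \<phi>) A) \<and> (\<forall>B\<in>Ob a. \<forall>f\<in>R B. FAr (ker_psh F G \<phi>) A B f y = \<sigma> B f)"
      then have y': "y \<in> carrier (FOb F A)" "\<phi> A y = \<zero>\<^bsub>FOb G A\<^esub>" by auto
      show "y = x" by (rule u[OF y'(1)]) (use y ker_psh_simps(5)[of y F A \<phi> G, OF y'] in simp)
    qed
  qed
  then show ?thesis using k(2) is_sheaf_iff by blast
qed

lemma ker_psh_kernel:
  assumes F: "is_sheaf K a T F" and G: "is_sheaf K a T G" and \<phi>: "\<phi> \<in> psh_hom F G"
  shows "is_kernel (Sh K a T) F G \<phi> (ker_psh F G \<phi>) (res_nat (ker_psh F G \<phi>) (\<lambda>A x. x))"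
proof -
  note F' = sheaf_psh[OF F] and G' = sheaf_psh[OF G]
  note \<phi>' = hom_lin_nat[OF F' G' \<phi>]
  note k = ker_psh_psh[OF F' G' \<phi>'] and m = res_nat_hom[OF ker_psh_psh(1)[OF F' G' \<phi>'] F' ker_psh_psh(3)[OF F' G' \<phi>']]
  let ?K = "ker_psh F G \<phi>" and ?m = "res_nat (ker_psh F G \<phi>) (\<lambda>A x. x)"
  show ?thesis unfolding is_kernel_def Sh_simps
  proof (intro conjI ballI impI)
    show "is_sheaf K a T ?K" by (rule ker_psh_sheaf[OF F G \<phi>'])
    show "?m \<in> psh_hom ?K F" by (rule m)
    show "Cmp (PSh K a) ?K F G \<phi> ?m = \<zero>\<^bsub>Hm (PSh K a) ?K G\<^esub>"
      unfolding PSh_Cmp_eq_iff[OF k(1) F' G' m \<phi> PSh_zero_in[OF k(1) G']] by simp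
    fix W h assume "W \<in> Ob (Sh K a T)" and h: "h \<in> psh_hom W F" and 0: "Cmp (PSh K a) W F G \<phi> h = \<zero>\<^bsub>Hm (PSh K a) W G\<^esub>"
    then have W: "psh W" by (simp add: sheaf_psh)
    note h' = hom_lin_nat[OF W F' h]
    have h0: "\<phi> A (h A x) = \<zero>\<^bsub>FOb G A\<^esub>" if "A \<in> Ob a" "x \<in> carrier (FOb W A)" for A x
      using 0 that unfolding PSh_Cmp_eq_iff[OF W F' G' h \<phi> PSh_zero_in[OF W G']] by simp
    have "lin_nat W ?K h" using h' h0 unfolding lin_nat_def by simp
    then have hK: "h \<in> psh_hom W ?K" using h psh_hom_iff[OF W F'] psh_hom_iff[OF W k(1)] by blast
    have mu: "?m A (u A x) = u A x" if "u \<in> psh_hom W ?K" "A \<in> Ob a" "x \<in> carrier (FOb W A)" for u A x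
      using lin_nat_in[OF hom_lin_nat[OF W k(1) that(1)] that(2,3)] that(2) by (intro res_nat_apply) auto
    show "\<exists>!u. u \<in> psh_hom W ?K \<and> Cmp (PSh K a) W ?K F ?m u = h"
    proof (rule ex1I[of _ h])
      show "h \<in> psh_hom W ?K \<and> Cmp (PSh K a) W ?K F ?m h = h"
        using PSh_Cmp_eq_iff[OF W k(1) F' hK m h] mu[OF hK] hK by blast
      fix u assume u: "u \<in> psh_hom W ?K \<and> Cmp (PSh K a) W ?K F ?m u = h"
      then have uK: "u \<in> psh_hom W ?K" by blast
      have "\<forall>A\<in>Ob a. \<forall>x\<in>carrier (FOb W A). ?m A (u A x) = h A x"
        using u PSh_Cmp_eq_iff[OF W k(1) F' uK m h] by blast
      then show "u = h" by (intro psh_hom_eqI[OF W k(1) uK hK]) (use mu[OF uK] in metis)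
    qed
  qed
qed

lemma is_cokernel_iff:
  "is_cokernel (Sh K a T) P Q u C c \<longleftrightarrow> is_sheaf K a T C \<and> c \<in> psh_hom Q C \<and>
     Cmp (PSh K a) P Q C c u = \<zero>\<^bsub>Hm (PSh K a) P C\<^esub> \<and>
     (\<forall>W. is_sheaf K a T W \<longrightarrow> (\<forall>h\<in>psh_hom Q W. Cmp (PSh K a) P Q W h u = \<zero>\<^bsub>Hm (PSh K a) P W\<^esub> \<longrightarrow>
        (\<exists>!v. v \<in> psh_hom C W \<and> Cmp (PSh K a) Q C W v c = h)))"
  unfolding is_cokernel_def is_kernel_def opcat_simps Ball_def Sh_simps by simp

end

section \<open>Coproducts and exactness among sheaves\<close>

context small_site
begin

lemma Z_unit_Idt [simp]: "X \<in> Ob a \<Longrightarrow> Z_unit X X (Idt a X) \<in> carrier (FOb (Zo X) X)"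
  by (simp add: Z_unit_in)

text \<open>The finite sum by which \<open>pre_of\<close> prescribes the map induced by p, evaluated
  at the generator of \<open>Zo Z\<close>: it is the combination of the generators of the summands
  with coefficients g. Since a map out of \<open>Zo Z\<close> is determined by this value, sums of
  morphisms can be exchanged for sums of elements.\<close>

lemma row_sum:
  assumes Z: "Z \<in> Ob a" and Y: "is_fam a Y" and g: "g \<in> carrier (FOb (dirsum Y) Z)" and Q: "is_sheaf K a T Q"
    and j: "\<And>\<beta>. \<beta> \<in> fst Y \<Longrightarrow> j \<beta> \<in> psh_hom (Zo (snd Y \<beta>)) Q"
  shows "(\<Oplus>\<^bsub>Hm (PSh K a) (Zo Z) Q\<^esub>\<beta>\<in>supp Z Y g. Cmp (PSh K a) (Zo Z) (Zo (snd Y \<beta>)) Q (j \<beta>) (Za Z (snd Y \<beta>) (g \<beta>)))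
      \<in> psh_hom (Zo Z) Q" (is "?s \<in> _")
    and "(\<Oplus>\<^bsub>Hm (PSh K a) (Zo Z) Q\<^esub>\<beta>\<in>supp Z Y g. Cmp (PSh K a) (Zo Z) (Zo (snd Y \<beta>)) Q (j \<beta>) (Za Z (snd Y \<beta>) (g \<beta>)))
      Z (Z_unit Z Z (Idt a Z)) = row_comb Q Y (\<lambda>\<beta>. j \<beta> (snd Y \<beta>) (Z_unit (snd Y \<beta>) (snd Y \<beta>) (Idt a (snd Y \<beta>)))) Z g"
proof -
  note Q' = sheaf_psh[OF Q]
  interpret H: abelian_group "Hm (PSh K a) (Zo Z) Q" by (rule PSh_hom_group[OF Zo_psh[OF Z] Q'])
  have t: "Cmp (PSh K a) (Zo Z) (Zo (snd Y \<beta>)) Q (j \<beta>) (Za Z (snd Y \<beta>) (g \<beta>)) \<in> psh_hom (Zo Z) Q" if "\<beta> \<in> supp Z Y g" for \<beta>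
  proof -
    have b: "\<beta> \<in> fst Y" using that by (simp add: supp_def)
    note Yb = fam_Ob[OF Y b]
    show ?thesis
      by (rule PSh_Cmp_in[OF Zo_psh[OF Z] Zo_psh[OF Yb] Q' Za_hom[OF Z Yb dirsum_D(3)[OF g b]] j[OF b]])
  qed
  show "?s \<in> psh_hom (Zo Z) Q" by (rule H.finsum_closed) (use t in auto)
  have "?s Z (Z_unit Z Z (Idt a Z)) = (\<Oplus>\<^bsub>FOb Q Z\<^esub>\<beta>\<in>supp Z Y g.
      Cmp (PSh K a) (Zo Z) (Zo (snd Y \<beta>)) Q (j \<beta>) (Za Z (snd Y \<beta>) (g \<beta>)) Z (Z_unit Z Z (Idt a Z)))"
    by (rule PSh_finsum_apply[OF Zo_psh[OF Z] Q' dirsum_D(2)[OF g] t Z Z_unit_Idt[OF Z]])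
  also have "\<dots> = row_comb Q Y (\<lambda>\<beta>. j \<beta> (snd Y \<beta>) (Z_unit (snd Y \<beta>) (snd Y \<beta>) (Idt a (snd Y \<beta>)))) Z g"
    unfolding row_comb_def
  proof (rule abelian_monoid.finsum_cong'[OF psh_mon[OF Q' Z]])
    fix \<beta> assume "\<beta> \<in> supp Z Y g"
    then have b: "\<beta> \<in> fst Y" by (simp add: supp_def)
    note Yb = fam_Ob[OF Y b] and gb = dirsum_D(3)[OF g b]
    note jb = hom_lin_nat[OF Zo_psh[OF Yb] Q' j[OF b]]
    have "Cmp (PSh K a) (Zo Z) (Zo (snd Y \<beta>)) Q (j \<beta>) (Za Z (snd Y \<beta>) (g \<beta>)) Z (Z_unit Z Z (Idt a Z)) = j \<beta> Z (Z_unit (snd Y \<beta>) Z (g \<beta>))"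
      using Z Yb gb by (simp add: Za_Z_unit)
    also have "\<dots> = FAr Q (snd Y \<beta>) Z (g \<beta>) (j \<beta> (snd Y \<beta>) (Z_unit (snd Y \<beta>) (snd Y \<beta>) (Idt a (snd Y \<beta>))))"
      unfolding Z_unit_eq[OF Yb Z gb] by (rule lin_nat_act[OF jb Yb Z gb Z_unit_Idt[OF Yb]])
    finally show "Cmp (PSh K a) (Zo Z) (Zo (snd Y \<beta>)) Q (j \<beta>) (Za Z (snd Y \<beta>) (g \<beta>)) Z (Z_unit Z Z (Idt a Z)) =
      FAr Q (snd Y \<beta>) Z (g \<beta>) (j \<beta> (snd Y \<beta>) (Z_unit (snd Y \<beta>) (snd Y \<beta>) (Idt a (snd Y \<beta>))))" .
  next
    show "(\<lambda>\<beta>. FAr Q (snd Y \<beta>) Z (g \<beta>) (j \<beta> (snd Y \<beta>) (Z_unit (snd Y \<beta>) (snd Y \<beta>) (Idt a (snd Y \<beta>)))))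
        \<in> supp Z Y g \<rightarrow> carrier (FOb Q Z)"
    proof
      fix \<beta> assume "\<beta> \<in> supp Z Y g"
      then have b: "\<beta> \<in> fst Y" by (simp add: supp_def)
      note Yb = fam_Ob[OF Y b]
      show "FAr Q (snd Y \<beta>) Z (g \<beta>) (j \<beta> (snd Y \<beta>) (Z_unit (snd Y \<beta>) (snd Y \<beta>) (Idt a (snd Y \<beta>)))) \<in> carrier (FOb Q Z)"
        by (rule act_in[OF Q' Yb Z dirsum_D(3)[OF g b] lin_nat_in[OF hom_lin_nat[OF Zo_psh[OF Yb] Q' j[OF b]] Yb Z_unit_Idt[OF Yb]]])
    qed
  qed simp
  finally show "?s Z (Z_unit Z Z (Idt a Z)) = row_comb Q Y (\<lambda>\<beta>. j \<beta> (snd Y \<beta>) (Z_unit (snd Y \<beta>) (snd Y \<beta>) (Idt a (snd Y \<beta>)))) Z g" .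
qed

text \<open>Extracts from exactness the two facts about elements that \<open>factor\<close> requires
  in order to treat w as a cokernel of u. They come from the universal properties of the kernels and
  cokernels that occur in \<open>exact_at\<close>.\<close>

lemma exact_cokernel:
  assumes P: "is_sheaf K a T P" and Q: "is_sheaf K a T Q" and X: "is_sheaf K a T L"
    and ex: "exact_to_zero (Sh K a T) P Q L u w"
  shows "locsurj Q L w"
    and "\<And>A x G h. is_sheaf K a T G \<Longrightarrow> h \<in> psh_hom Q G \<Longrightarrow> Cmp (PSh K a) P Q G h u = \<zero>\<^bsub>Hm (PSh K a) P G\<^esub> \<Longrightarrow>
      A \<in> Ob a \<Longrightarrow> x \<in> carrier (FOb Q A) \<Longrightarrow> w A x = \<zero>\<^bsub>FOb L A\<^esub> \<Longrightarrow> h A x = \<zero>\<^bsub>FOb G A\<^esub>"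
proof -
  note P' = sheaf_psh[OF P] and Q' = sheaf_psh[OF Q] and L' = sheaf_psh[OF X]
  have e1: "exact_at (Sh K a T) P Q L u w" using ex unfolding exact_to_zero_def by blast
  obtain N where N: "is_zero_object (Sh K a T) N" and e2: "exact_at (Sh K a T) Q L N w \<zero>\<^bsub>Hm (PSh K a) L N\<^esub>"
    using ex unfolding exact_to_zero_def Sh_simps by blast
  have u: "u \<in> psh_hom P Q" and w: "w \<in> psh_hom Q L" using e1 unfolding exact_at_def Sh_simps by auto
  note wn = hom_lin_nat[OF Q' L' w]
  show "locsurj Q L w"
  proof (rule epi_locsurj[OF Q' L' wn])
    fix H \<kappa> A y
    assume H: "is_sheaf K a T H" and \<kappa>: "lin_nat L H \<kappa>"
      and \<kappa>w: "\<And>A x. A \<in> Ob a \<Longrightarrow> x \<in> carrier (FOb Q A) \<Longrightarrow> \<kappa> A (w A x) = \<zero>\<^bsub>FOb H A\<^esub>"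
      and A: "A \<in> Ob a" and y: "y \<in> carrier (FOb L A)"
    note H' = sheaf_psh[OF H]
    obtain I m C c where co: "is_cokernel (Sh K a T) Q L w C c" and k1: "is_kernel (Sh K a T) L C c I m"
      and k2: "is_kernel (Sh K a T) L N \<zero>\<^bsub>Hm (PSh K a) L N\<^esub> I m"
      using e2 unfolding exact_at_def is_image_def by blast
    have C: "is_sheaf K a T C" and c: "c \<in> psh_hom L C" using co unfolding is_cokernel_iff by auto
    have I: "is_sheaf K a T I" and m: "m \<in> psh_hom I L" and cm: "Cmp (PSh K a) I L C c m = \<zero>\<^bsub>Hm (PSh K a) I C\<^esub>"
      using k1 unfolding is_kernel_def Sh_simps by auto
    note C' = sheaf_psh[OF C] and I' = sheaf_psh[OF I]
    have N': "psh N" using N unfolding is_zero_object_def Sh_simps by (blast intro: sheaf_psh)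
    \<comment> \<open>The identity of L is killed by the zero map, so it factors through the kernel
      I of that map. This kernel is also the image of w, on which the cokernel map c vanishes;
      therefore c vanishes everywhere, and with it every \<kappa> that kills w.\<close>
    have "Cmp (PSh K a) L L N \<zero>\<^bsub>Hm (PSh K a) L N\<^esub> (Idt (PSh K a) L) = \<zero>\<^bsub>Hm (PSh K a) L N\<^esub>"
      unfolding PSh_Cmp_eq_iff[OF L' L' N' PSh_Idt_in[OF L'] PSh_zero_in[OF L' N'] PSh_zero_in[OF L' N']] by simp
    then obtain t where t: "t \<in> psh_hom L I" "Cmp (PSh K a) L I L m t = Idt (PSh K a) L"
      using k2 X PSh_Idt_in[OF L'] unfolding is_kernel_def Ball_def Sh_simps by blast
    have "m A (t A y) = y"
      using t(2) A y unfolding PSh_Cmp_eq_iff[OF L' I' L' t(1) m PSh_Idt_in[OF L']] by simp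
    moreover have "c A (m A (t A y)) = \<zero>\<^bsub>FOb C A\<^esub>"
      using cm A lin_nat_in[OF hom_lin_nat[OF L' I' t(1)] A y] unfolding PSh_Cmp_eq_iff[OF I' L' C' m c PSh_zero_in[OF I' C']] by simp
    ultimately have cy: "c A y = \<zero>\<^bsub>FOb C A\<^esub>" by simp
    have r: "res_nat L \<kappa> \<in> psh_hom L H" by (rule res_nat_hom[OF L' H' \<kappa>])
    have "Cmp (PSh K a) Q L H (res_nat L \<kappa>) w = \<zero>\<^bsub>Hm (PSh K a) Q H\<^esub>"
      unfolding PSh_Cmp_eq_iff[OF Q' L' H' w r PSh_zero_in[OF Q' H']] using \<kappa>w lin_nat_in[OF wn] by simp
    then obtain v where v: "v \<in> psh_hom C H" "Cmp (PSh K a) L C H v c = res_nat L \<kappa>"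
      using co H r unfolding is_cokernel_iff by blast
    have "\<kappa> A y = v A (c A y)"
      using v(2) A y unfolding PSh_Cmp_eq_iff[OF L' C' H' c v(1) r] by simp
    then show "\<kappa> A y = \<zero>\<^bsub>FOb H A\<^esub>"
      using cy lin_nat_zero_neg(1)[OF C' H' hom_lin_nat[OF C' H' v(1)] A] by simp
  qed
  fix A x G h assume G: "is_sheaf K a T G" and h: "h \<in> psh_hom Q G" and hu: "Cmp (PSh K a) P Q G h u = \<zero>\<^bsub>Hm (PSh K a) P G\<^esub>"
    and A: "A \<in> Ob a" and x: "x \<in> carrier (FOb Q A)" and wx: "w A x = \<zero>\<^bsub>FOb L A\<^esub>"
  note G' = sheaf_psh[OF G]
  obtain I m C c where co: "is_cokernel (Sh K a T) P Q u C c" and k1: "is_kernel (Sh K a T) Q C c I m"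
    and k2: "is_kernel (Sh K a T) Q L w I m"
    using e1 unfolding exact_at_def is_image_def by blast
  have C: "is_sheaf K a T C" and c: "c \<in> psh_hom Q C" using co unfolding is_cokernel_iff by auto
  have I: "is_sheaf K a T I" and m: "m \<in> psh_hom I Q" and cm: "Cmp (PSh K a) I Q C c m = \<zero>\<^bsub>Hm (PSh K a) I C\<^esub>"
    using k1 unfolding is_kernel_def Sh_simps by auto
  note C' = sheaf_psh[OF C] and I' = sheaf_psh[OF I] and ZA = Zo_psh[OF A]
  \<comment> \<open>The element x is turned into a morphism out of \<open>Zo A\<close> so that the
    universal property of the kernel of w can be applied to it; it factors through the image of u,
    where c vanishes.\<close>
  obtain \<psi> where \<psi>: "\<psi> \<in> psh_hom (Zo A) Q" "\<And>B g. B \<in> Ob a \<Longrightarrow> g \<in> hm B A \<Longrightarrow> \<psi> B (Z_unit A B g) = FAr Q A B g x"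
    by (rule Z_ext[OF A Q x]) (rule that)
  have \<psi>x: "\<psi> A (Z_unit A A (Idt a A)) = x" using \<psi>(2)[OF A Idt_in[OF A]] Q' A x by simp
  have "Cmp (PSh K a) (Zo A) Q L w \<psi> = \<zero>\<^bsub>Hm (PSh K a) (Zo A) L\<^esub>"
    by (rule Z_uniq[OF A X PSh_Cmp_in[OF ZA Q' L' \<psi>(1) w] PSh_zero_in[OF ZA L']]) (simp add: A \<psi>x wx)
  then obtain t where t: "t \<in> psh_hom (Zo A) I" "Cmp (PSh K a) (Zo A) I Q m t = \<psi>"
    using k2 \<psi>(1) Zo_sheaf[OF A] unfolding is_kernel_def Ball_def Sh_simps by blast
  let ?z = "Z_unit A A (Idt a A)"
  have "m A (t A ?z) = x"
    using t(2) A \<psi>x unfolding PSh_Cmp_eq_iff[OF ZA I' Q' t(1) m \<psi>(1)] by simp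
  moreover have "c A (m A (t A ?z)) = \<zero>\<^bsub>FOb C A\<^esub>"
    using cm A lin_nat_in[OF hom_lin_nat[OF ZA I' t(1)] A Z_unit_Idt[OF A]] unfolding PSh_Cmp_eq_iff[OF I' Q' C' m c PSh_zero_in[OF I' C']] by simp
  ultimately have cx: "c A x = \<zero>\<^bsub>FOb C A\<^esub>" by simp
  obtain v where v: "v \<in> psh_hom C G" "Cmp (PSh K a) Q C G v c = h"
    using co G h hu unfolding is_cokernel_iff by blast
  have "h A x = v A (c A x)"
    using v(2) A x unfolding PSh_Cmp_eq_iff[OF Q' C' G' c v(1) h] by simp
  then show "h A x = \<zero>\<^bsub>FOb G A\<^esub>"
    using cx lin_nat_zero_neg(1)[OF C' G' hom_lin_nat[OF C' G' v(1)] A] by simp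
qed

lemma pre_of_iff:
  "(Z, Y, X, p, q) \<in> pre_of K a T \<longleftrightarrow> formal_sequence a (Z, Y, X, p, q) \<and>
    (\<exists>P j Q j' u w. is_coproduct (Sh K a T) (fst Z) (\<lambda>\<gamma>. Zo (snd Z \<gamma>)) P j \<and>
      is_coproduct (Sh K a T) (fst Y) (\<lambda>\<beta>. Zo (snd Y \<beta>)) Q j' \<and> u \<in> psh_hom P Q \<and>
      (\<forall>\<gamma>\<in>fst Z. Cmp (PSh K a) (Zo (snd Z \<gamma>)) P Q u (j \<gamma>) =
         (\<Oplus>\<^bsub>Hm (PSh K a) (Zo (snd Z \<gamma>)) Q\<^esub>\<beta>\<in>supp (snd Z \<gamma>) Y (p \<gamma>).
            Cmp (PSh K a) (Zo (snd Z \<gamma>)) (Zo (snd Y \<beta>)) Q (j' \<beta>) (Za (snd Z \<gamma>) (snd Y \<beta>) (p \<gamma> \<beta>)))) \<and>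
      w \<in> psh_hom Q (Zo X) \<and>
      (\<forall>\<beta>\<in>fst Y. Cmp (PSh K a) (Zo (snd Y \<beta>)) Q (Zo X) w (j' \<beta>) = Za (snd Y \<beta>) X (q \<beta> ())) \<and>
      exact_to_zero (Sh K a T) P Q (Zo X) u w)"
  unfolding pre_of_def Let_def supp_def by simp

lemma coproductD:
  assumes "is_coproduct (Sh K a T) J Xs P j"
  shows "is_sheaf K a T P" "i \<in> J \<Longrightarrow> is_sheaf K a T (Xs i)" "i \<in> J \<Longrightarrow> j i \<in> psh_hom (Xs i) P"
    and "is_sheaf K a T W \<Longrightarrow> (\<And>i. i \<in> J \<Longrightarrow> h i \<in> psh_hom (Xs i) W) \<Longrightarrow>
      \<exists>!u. u \<in> psh_hom P W \<and> (\<forall>i\<in>J. Cmp (PSh K a) (Xs i) P W u (j i) = h i)"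
  using assms unfolding is_coproduct_def Sh_simps Ball_def by blast+

lemma coproduct_cancel:
  assumes c: "is_coproduct (Sh K a T) J Xs P j" and W: "is_sheaf K a T W" and u: "u \<in> psh_hom P W" "u' \<in> psh_hom P W"
    and eq: "\<And>i. i \<in> J \<Longrightarrow> Cmp (PSh K a) (Xs i) P W u (j i) = Cmp (PSh K a) (Xs i) P W u' (j i)"
  shows "u = u'"
proof -
  have h: "Cmp (PSh K a) (Xs i) P W u (j i) \<in> psh_hom (Xs i) W" if "i \<in> J" for i
    by (rule PSh_Cmp_in[OF sheaf_psh[OF coproductD(2)[OF c that]] sheaf_psh[OF coproductD(1)[OF c]] sheaf_psh[OF W]
          coproductD(3)[OF c that] u(1)])
  show ?thesis using coproductD(4)[OF c W, of "\<lambda>i. Cmp (PSh K a) (Xs i) P W u (j i)"] h u eq by metis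
qed

text \<open>As representables are sheaves, a family y is the same as a morphism from the coproduct Q
  to \<open>yo A\<close>. The relations say that it kills u, as can be checked on the generator of
  each summand of P, so it factors through w; its value at the generator of \<open>Zo X\<close> is
  the required morphism. Uniqueness comes from the local surjectivity of w.\<close>

lemma pre_of_right_exact:
  assumes sub: "subcanonical K a T" and s: "s \<in> pre_of K a T"
  shows "right_exact a s"
proof -
  obtain Z Y X p q where eq: "s = (Z, Y, X, p, q)" by (cases s) auto
  have fs: "formal_sequence a (Z, Y, X, p, q)" using s unfolding eq pre_of_iff by blast
  have Z: "is_fam a Z" and Y: "is_fam a Y" and X: "X \<in> Ob a" and p: "p \<in> FHom a Z Y" and q: "q \<in> FHom a Y (sng X)"
    using fs unfolding formal_sequence_iff by auto
  obtain P j Q j' u w where cP: "is_coproduct (Sh K a T) (fst Z) (\<lambda>\<gamma>. Zo (snd Z \<gamma>)) P j"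
    and cQ: "is_coproduct (Sh K a T) (fst Y) (\<lambda>\<beta>. Zo (snd Y \<beta>)) Q j'" and u: "u \<in> psh_hom P Q"
    and uj: "\<And>\<gamma>. \<gamma> \<in> fst Z \<Longrightarrow> Cmp (PSh K a) (Zo (snd Z \<gamma>)) P Q u (j \<gamma>) =
         (\<Oplus>\<^bsub>Hm (PSh K a) (Zo (snd Z \<gamma>)) Q\<^esub>\<beta>\<in>supp (snd Z \<gamma>) Y (p \<gamma>).
            Cmp (PSh K a) (Zo (snd Z \<gamma>)) (Zo (snd Y \<beta>)) Q (j' \<beta>) (Za (snd Z \<gamma>) (snd Y \<beta>) (p \<gamma> \<beta>)))"
    and w: "w \<in> psh_hom Q (Zo X)"
    and wj: "\<And>\<beta>. \<beta> \<in> fst Y \<Longrightarrow> Cmp (PSh K a) (Zo (snd Y \<beta>)) Q (Zo X) w (j' \<beta>) = Za (snd Y \<beta>) X (q \<beta> ())"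
    and ex: "exact_to_zero (Sh K a T) P Q (Zo X) u w"
    using s unfolding eq pre_of_iff by blast
  note P = coproductD(1)[OF cP] and Q = coproductD(1)[OF cQ] and j = coproductD(3)[OF cP] and j' = coproductD(3)[OF cQ]
  note P' = sheaf_psh[OF P] and Q' = sheaf_psh[OF Q] and ZX = Zo_sheaf[OF X] and ZX' = Zo_psh[OF X]
  note wn = hom_lin_nat[OF Q' ZX' w] and un = hom_lin_nat[OF P' Q' u]
  note ls = exact_cokernel(1)[OF P Q ZX ex] and ker = exact_cokernel(2)[OF P Q ZX ex]
  have wjz: "w (snd Y \<beta>) (j' \<beta> (snd Y \<beta>) (Z_unit (snd Y \<beta>) (snd Y \<beta>) (Idt a (snd Y \<beta>)))) = Z_unit X (snd Y \<beta>) (q \<beta> ())"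
    if b: "\<beta> \<in> fst Y" for \<beta>
  proof -
    note Yb = fam_Ob[OF Y b] and qb = FHom_sng_in[OF q b]
    have "w (snd Y \<beta>) (j' \<beta> (snd Y \<beta>) (Z_unit (snd Y \<beta>) (snd Y \<beta>) (Idt a (snd Y \<beta>)))) =
        Cmp (PSh K a) (Zo (snd Y \<beta>)) Q (Zo X) w (j' \<beta>) (snd Y \<beta>) (Z_unit (snd Y \<beta>) (snd Y \<beta>) (Idt a (snd Y \<beta>)))"
      using Yb by simp
    also have "\<dots> = Z_unit X (snd Y \<beta>) (q \<beta> ())" unfolding wj[OF b] using Za_Z_unit[OF Yb X qb Yb Idt_in[OF Yb]] Yb X qb by simp
    finally show ?thesis .
  qed
  have jz: "j' \<beta> (snd Y \<beta>) (Z_unit (snd Y \<beta>) (snd Y \<beta>) (Idt a (snd Y \<beta>))) \<in> carrier (FOb Q (snd Y \<beta>))" if b: "\<beta> \<in> fst Y" for \<beta>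
    by (rule lin_nat_in[OF hom_lin_nat[OF Zo_psh[OF fam_Ob[OF Y b]] Q' j'[OF b]] fam_Ob[OF Y b] Z_unit_Idt[OF fam_Ob[OF Y b]]])
  show ?thesis unfolding eq right_exact_iff[OF fs]
  proof (intro ballI conjI allI impI)
    fix A h h' assume A: "A \<in> Ob a" and h: "h \<in> hm X A" "h' \<in> hm X A"
      and hq: "\<forall>\<beta>\<in>fst Y. Cmp a (snd Y \<beta>) X A h (q \<beta> ()) = Cmp a (snd Y \<beta>) X A h' (q \<beta> ())"
    have yA: "is_sheaf K a T (yo A)" using sub A unfolding subcanonical_def by blast
    note yA' = psh_yoneda[OF A]
    have ext: "\<exists>\<psi>. \<psi> \<in> psh_hom (Zo X) (yo A) \<and> (\<forall>B\<in>Ob a. \<forall>g\<in>hm B X. \<psi> B (Z_unit X B g) = Cmp a B X A h g)" if h: "h \<in> hm X A" for h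
    proof -
      obtain \<psi> where \<psi>: "\<psi> \<in> psh_hom (Zo X) (yo A)" "\<And>B g. B \<in> Ob a \<Longrightarrow> g \<in> hm B X \<Longrightarrow> \<psi> B (Z_unit X B g) = FAr (yo A) X B g h"
        by (rule Z_ext[OF X yA, of h]) (use h in simp, rule that)
      then show ?thesis using h by (intro exI[of _ \<psi>]) simp
    qed
    obtain \<psi> \<psi>' where \<psi>: "\<psi> \<in> psh_hom (Zo X) (yo A)" "\<And>B g. B \<in> Ob a \<Longrightarrow> g \<in> hm B X \<Longrightarrow> \<psi> B (Z_unit X B g) = Cmp a B X A h g"
      and \<psi>': "\<psi>' \<in> psh_hom (Zo X) (yo A)" "\<And>B g. B \<in> Ob a \<Longrightarrow> g \<in> hm B X \<Longrightarrow> \<psi>' B (Z_unit X B g) = Cmp a B X A h' g"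
      using ext[OF h(1)] ext[OF h(2)] by blast
    note c = PSh_Cmp_in[OF Q' ZX' yA' w \<psi>(1)] and c' = PSh_Cmp_in[OF Q' ZX' yA' w \<psi>'(1)]
    have "Cmp (PSh K a) Q (Zo X) (yo A) \<psi> w = Cmp (PSh K a) Q (Zo X) (yo A) \<psi>' w"
    proof (rule coproduct_cancel[OF cQ yA c c'])
      fix \<beta> assume b: "\<beta> \<in> fst Y"
      note Yb = fam_Ob[OF Y b] and ZY = Zo_psh[OF fam_Ob[OF Y b]] and qb = FHom_sng_in[OF q b]
      show "Cmp (PSh K a) (Zo (snd Y \<beta>)) Q (yo A) (Cmp (PSh K a) Q (Zo X) (yo A) \<psi> w) (j' \<beta>) =
            Cmp (PSh K a) (Zo (snd Y \<beta>)) Q (yo A) (Cmp (PSh K a) Q (Zo X) (yo A) \<psi>' w) (j' \<beta>)"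
        by (rule Z_uniq[OF Yb yA PSh_Cmp_in[OF ZY Q' yA' j'[OF b] c] PSh_Cmp_in[OF ZY Q' yA' j'[OF b] c']])
          (use Yb jz[OF b] wjz[OF b] \<psi>(2)[OF Yb qb] \<psi>'(2)[OF Yb qb] hq b in simp)
    qed
    then have e: "\<psi> B (w B x) = \<psi>' B (w B x)" if "B \<in> Ob a" "x \<in> carrier (FOb Q B)" for B x
      using that by (metis PSh_Cmp_apply)
    have "\<psi> X (Z_unit X X (Idt a X)) = \<psi>' X (Z_unit X X (Idt a X))"
      by (rule locsurj_cancel[OF ZX' yA' sheaf_sheaf_elt[OF yA] ls hom_lin_nat[OF ZX' yA' \<psi>(1)] hom_lin_nat[OF ZX' yA' \<psi>'(1)] e X Z_unit_Idt[OF X]])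
    then show "h = h'" using \<psi>(2)[OF X Idt_in[OF X]] \<psi>'(2)[OF X Idt_in[OF X]] h X A by simp
  next
    fix A y assume A: "A \<in> Ob a" and y: "\<forall>\<beta>\<in>fst Y. y \<beta> \<in> hm (snd Y \<beta>) A"
      and yp: "\<forall>\<gamma>\<in>fst Z. row_comb (yo A) Y y (snd Z \<gamma>) (p \<gamma>) = \<zero>\<^bsub>Hm a (snd Z \<gamma>) A\<^esub>"
    have yA: "is_sheaf K a T (yo A)" using sub A unfolding subcanonical_def by blast
    note yA' = psh_yoneda[OF A]
    have "\<exists>\<psi>. \<psi> \<in> psh_hom (Zo (snd Y \<beta>)) (yo A) \<and> \<psi> (snd Y \<beta>) (Z_unit (snd Y \<beta>) (snd Y \<beta>) (Idt a (snd Y \<beta>))) = y \<beta>"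
      if b: "\<beta> \<in> fst Y" for \<beta>
    proof -
      note Yb = fam_Ob[OF Y b]
      have yb: "y \<beta> \<in> hm (snd Y \<beta>) A" using y b by blast
      obtain \<psi> where \<psi>: "\<psi> \<in> psh_hom (Zo (snd Y \<beta>)) (yo A)"
        "\<And>B g. B \<in> Ob a \<Longrightarrow> g \<in> hm B (snd Y \<beta>) \<Longrightarrow> \<psi> B (Z_unit (snd Y \<beta>) B g) = FAr (yo A) (snd Y \<beta>) B g (y \<beta>)"
        by (rule Z_ext[OF Yb yA, of "y \<beta>"]) (use yb in simp, rule that)
      then show ?thesis using \<psi>(2)[OF Yb Idt_in[OF Yb]] yb Yb A by (intro exI[of _ \<psi>]) simp
    qed
    then obtain k where k: "\<And>\<beta>. \<beta> \<in> fst Y \<Longrightarrow> k \<beta> \<in> psh_hom (Zo (snd Y \<beta>)) (yo A)"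
      "\<And>\<beta>. \<beta> \<in> fst Y \<Longrightarrow> k \<beta> (snd Y \<beta>) (Z_unit (snd Y \<beta>) (snd Y \<beta>) (Idt a (snd Y \<beta>))) = y \<beta>" by metis
    obtain g where g: "g \<in> psh_hom Q (yo A)" "\<And>\<beta>. \<beta> \<in> fst Y \<Longrightarrow> Cmp (PSh K a) (Zo (snd Y \<beta>)) Q (yo A) g (j' \<beta>) = k \<beta>"
      using coproductD(4)[OF cQ yA, of k] k(1) by blast
    note gn = hom_lin_nat[OF Q' yA' g(1)]
    have gj: "g (snd Y \<beta>) (j' \<beta> (snd Y \<beta>) (Z_unit (snd Y \<beta>) (snd Y \<beta>) (Idt a (snd Y \<beta>)))) = y \<beta>" if b: "\<beta> \<in> fst Y" for \<beta>
      using fun_cong[OF fun_cong[OF g(2)[OF b], of "snd Y \<beta>"], of "Z_unit (snd Y \<beta>) (snd Y \<beta>) (Idt a (snd Y \<beta>))"]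
        k(2)[OF b] fam_Ob[OF Y b] by simp
    note gu = PSh_Cmp_in[OF P' Q' yA' u g(1)] and z = PSh_zero_in[OF P' yA']
    have "Cmp (PSh K a) P Q (yo A) g u = \<zero>\<^bsub>Hm (PSh K a) P (yo A)\<^esub>"
    proof (rule coproduct_cancel[OF cP yA gu z])
      fix \<gamma> assume c: "\<gamma> \<in> fst Z"
      note Zc = fam_Ob[OF Z c] and ZZ = Zo_psh[OF fam_Ob[OF Z c]] and pc = FHom_row[OF p c]
      let ?z = "Z_unit (snd Z \<gamma>) (snd Z \<gamma>) (Idt a (snd Z \<gamma>))"
      have jc: "j \<gamma> (snd Z \<gamma>) ?z \<in> carrier (FOb P (snd Z \<gamma>))"
        by (rule lin_nat_in[OF hom_lin_nat[OF ZZ P' j[OF c]] Zc Z_unit_Idt[OF Zc]])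
      have "u (snd Z \<gamma>) (j \<gamma> (snd Z \<gamma>) ?z) = Cmp (PSh K a) (Zo (snd Z \<gamma>)) P Q u (j \<gamma>) (snd Z \<gamma>) ?z" using Zc by simp
      also have "\<dots> = row_comb Q Y (\<lambda>\<beta>. j' \<beta> (snd Y \<beta>) (Z_unit (snd Y \<beta>) (snd Y \<beta>) (Idt a (snd Y \<beta>)))) (snd Z \<gamma>) (p \<gamma>)"
        unfolding uj[OF c] by (rule row_sum(2)[OF Zc Y pc Q j'])
      finally have "g (snd Z \<gamma>) (u (snd Z \<gamma>) (j \<gamma> (snd Z \<gamma>) ?z)) =
          row_comb (yo A) Y (\<lambda>\<beta>. g (snd Y \<beta>) (j' \<beta> (snd Y \<beta>) (Z_unit (snd Y \<beta>) (snd Y \<beta>) (Idt a (snd Y \<beta>))))) (snd Z \<gamma>) (p \<gamma>)"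
        using lin_nat_row_comb[OF Q' yA' gn Y jz Zc pc] by simp
      also have "\<dots> = row_comb (yo A) Y y (snd Z \<gamma>) (p \<gamma>)"
        by (rule row_comb_cong[OF yA' Y _ Zc pc gj]) (use y in auto)
      also have "\<dots> = \<zero>\<^bsub>Hm a (snd Z \<gamma>) A\<^esub>" using yp c by blast
      finally have 0: "g (snd Z \<gamma>) (u (snd Z \<gamma>) (j \<gamma> (snd Z \<gamma>) ?z)) = \<zero>\<^bsub>Hm a (snd Z \<gamma>) A\<^esub>" .
      show "Cmp (PSh K a) (Zo (snd Z \<gamma>)) P (yo A) (Cmp (PSh K a) P Q (yo A) g u) (j \<gamma>) =
          Cmp (PSh K a) (Zo (snd Z \<gamma>)) P (yo A) \<zero>\<^bsub>Hm (PSh K a) P (yo A)\<^esub> (j \<gamma>)"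
        by (rule Z_uniq[OF Zc yA PSh_Cmp_in[OF ZZ P' yA' j[OF c] gu] PSh_Cmp_in[OF ZZ P' yA' j[OF c] z]])
          (use Zc jc 0 in simp)
    qed
    note k0 = ker[OF yA g(1) this]
    obtain \<psi> where \<psi>: "lin_nat (Zo X) (yo A) \<psi>" "\<And>B x. B \<in> Ob a \<Longrightarrow> x \<in> carrier (FOb Q B) \<Longrightarrow> \<psi> B (w B x) = g B x"
      by (rule factor[OF Q' ZX' yA' sheaf_sheaf_elt[OF yA] wn ls gn k0]) (assumption+, rule that)
    let ?h = "\<psi> X (Z_unit X X (Idt a X))"
    have h: "?h \<in> hm X A" using lin_nat_in[OF \<psi>(1) X Z_unit_Idt[OF X]] by simp
    have "Cmp a (snd Y \<beta>) X A ?h (q \<beta> ()) = y \<beta>" if b: "\<beta> \<in> fst Y" for \<beta>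
    proof -
      note Yb = fam_Ob[OF Y b] and qb = FHom_sng_in[OF q b]
      have "Cmp a (snd Y \<beta>) X A ?h (q \<beta> ()) = \<psi> (snd Y \<beta>) (Z_unit X (snd Y \<beta>) (q \<beta> ()))"
        using lin_nat_act[OF \<psi>(1) X Yb qb Z_unit_Idt[OF X]] Z_unit_eq[OF X Yb qb] h by simp
      also have "\<dots> = y \<beta>" using wjz[OF b] \<psi>(2)[OF Yb jz[OF b]] gj[OF b] by simp
      finally show ?thesis .
    qed
    then show "\<exists>h\<in>hm X A. \<forall>\<beta>\<in>fst Y. Cmp a (snd Y \<beta>) X A h (q \<beta> ()) = y \<beta>" using h by blast
  qed
qed

text \<open>The coproduct of the sheaves Z of the members of Y is the sheaf associated with their
  presheaf direct sum. Rows have type \<open>'i \<Rightarrow> 'v\<close> and are brought into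
  \<open>'v\<close> by the closure of \<open>'v\<close> under families in the size condition. The
  map \<eta> is recorded with the coproduct so that elements of Q can be treated locally as
  rows.\<close>

lemma sum_sheaf:
  fixes Y :: "('i, 'o) fam"
  assumes Y: "is_fam a Y"
  obtains Q \<eta> j where "is_sheaf K a T Q" "lin_nat (dirsum Y) Q \<eta>" "locsurj (dirsum Y) Q \<eta>"
    "\<And>G \<phi>. is_sheaf K a T G \<Longrightarrow> lin_nat (dirsum Y) G \<phi> \<Longrightarrow>
      \<exists>\<psi>\<in>psh_hom Q G. \<forall>A\<in>Ob a. \<forall>g\<in>carrier (FOb (dirsum Y) A). \<psi> A (\<eta> A g) = \<phi> A g"
    "is_coproduct (Sh K a T) (fst Y) (\<lambda>\<beta>. Zo (snd Y \<beta>)) Q j"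
    "\<And>\<beta>. \<beta> \<in> fst Y \<Longrightarrow> j \<beta> (snd Y \<beta>) (Z_unit (snd Y \<beta>) (snd Y \<beta>) (Idt a (snd Y \<beta>))) =
      \<eta> (snd Y \<beta>) (unit_row Y \<beta> (snd Y \<beta>) (Idt a (snd Y \<beta>)))"
proof -
  obtain e :: "('i \<Rightarrow> 'v) \<Rightarrow> 'v" where e: "inj e" using sc unfolding size_condition_def by blast
  note DY = psh_dirsum[OF Y]
  obtain Q \<eta> where Q: "is_sheaf K a T Q" "lin_nat (dirsum Y) Q \<eta>" "locsurj (dirsum Y) Q \<eta>"
    "\<And>A g. A \<in> Ob a \<Longrightarrow> g \<in> carrier (FOb (dirsum Y) A) \<Longrightarrow> \<eta> A g = \<zero>\<^bsub>FOb Q A\<^esub> \<longleftrightarrow> g \<in> torsion (dirsum Y) A"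
    by (rule sheaf_quot[OF DY closed_sub_torsion[OF DY] e]) (rule that)
  note Q' = sheaf_psh[OF Q(1)]
  have ext: "\<exists>\<psi>\<in>psh_hom Q G. \<forall>A\<in>Ob a. \<forall>g\<in>carrier (FOb (dirsum Y) A). \<psi> A (\<eta> A g) = \<phi> A g"
    if G: "is_sheaf K a T G" and \<phi>: "lin_nat (dirsum Y) G \<phi>" for G \<phi>
  proof -
    note G' = sheaf_psh[OF G]
    have ker: "\<phi> A x = \<zero>\<^bsub>FOb G A\<^esub>" if A: "A \<in> Ob a" and x: "x \<in> carrier (FOb (dirsum Y) A)" "\<eta> A x = \<zero>\<^bsub>FOb Q A\<^esub>" for A x
    proof (rule sheaf_elt_sep[OF G' sheaf_sheaf_elt[OF G] lin_nat_in[OF \<phi> A x(1)] psh_zero_in[OF G' A]])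
      have "locally A (\<lambda>B f. FAr (dirsum Y) A B f x = \<zero>\<^bsub>FOb (dirsum Y) B\<^esub>)" using Q(4)[OF A x(1)] x(2) by (simp add: torsion_def)
      then show "locally A (\<lambda>B f. FAr G A B f (\<phi> A x) = FAr G A B f \<zero>\<^bsub>FOb G A\<^esub>)"
        by (rule locally_mono) (simp add: lin_nat_act[OF \<phi> A _ _ x(1), symmetric] lin_nat_zero_neg(1)[OF DY G' \<phi>] act_zero_neg(1)[OF G' A])
    qed
    obtain \<psi> where \<psi>: "lin_nat Q G \<psi>" "\<And>A x. A \<in> Ob a \<Longrightarrow> x \<in> carrier (FOb (dirsum Y) A) \<Longrightarrow> \<psi> A (\<eta> A x) = \<phi> A x"
      by (rule factor[OF DY Q' G' sheaf_sheaf_elt[OF G] Q(2,3) \<phi> ker]) (assumption+, rule that)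
    then show ?thesis
      by (intro bexI[of _ "res_nat Q \<psi>"] res_nat_hom[OF Q' G']) (simp_all add: lin_nat_in[OF Q(2)])
  qed
  let ?i = "\<lambda>\<beta>. unit_row Y \<beta> (snd Y \<beta>) (Idt a (snd Y \<beta>))"
  let ?z = "\<lambda>\<beta>. Z_unit (snd Y \<beta>) (snd Y \<beta>) (Idt a (snd Y \<beta>))"
  have i: "?i \<beta> \<in> carrier (FOb (dirsum Y) (snd Y \<beta>))" if b: "\<beta> \<in> fst Y" for \<beta>
    by (rule unit_row_in[OF Y b fam_Ob[OF Y b] Idt_in[OF fam_Ob[OF Y b]]])
  have "\<exists>j. j \<in> psh_hom (Zo (snd Y \<beta>)) Q \<and> j (snd Y \<beta>) (?z \<beta>) = \<eta> (snd Y \<beta>) (?i \<beta>)" if b: "\<beta> \<in> fst Y" for \<beta>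
  proof -
    note Yb = fam_Ob[OF Y b] and ib = lin_nat_in[OF Q(2) fam_Ob[OF Y b] i[OF b]]
    obtain \<psi> where \<psi>: "\<psi> \<in> psh_hom (Zo (snd Y \<beta>)) Q"
      "\<And>B g. B \<in> Ob a \<Longrightarrow> g \<in> hm B (snd Y \<beta>) \<Longrightarrow> \<psi> B (Z_unit (snd Y \<beta>) B g) = FAr Q (snd Y \<beta>) B g (\<eta> (snd Y \<beta>) (?i \<beta>))"
      by (rule Z_ext[OF Yb Q(1) ib]) (rule that)
    then show ?thesis using \<psi>(2)[OF Yb Idt_in[OF Yb]] act_Idt[OF Q' Yb ib] by auto
  qed
  then obtain j where j: "\<And>\<beta>. \<beta> \<in> fst Y \<Longrightarrow> j \<beta> \<in> psh_hom (Zo (snd Y \<beta>)) Q"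
    "\<And>\<beta>. \<beta> \<in> fst Y \<Longrightarrow> j \<beta> (snd Y \<beta>) (?z \<beta>) = \<eta> (snd Y \<beta>) (?i \<beta>)" by metis
  have cp: "is_coproduct (Sh K a T) (fst Y) (\<lambda>\<beta>. Zo (snd Y \<beta>)) Q j"
    unfolding is_coproduct_def Sh_simps
  proof (intro conjI ballI allI impI)
    show "is_sheaf K a T Q" by (rule Q(1))
    show "is_sheaf K a T (Zo (snd Y \<beta>))" if "\<beta> \<in> fst Y" for \<beta> by (rule Zo_sheaf[OF fam_Ob[OF Y that]])
    show "j \<beta> \<in> psh_hom (Zo (snd Y \<beta>)) Q" if "\<beta> \<in> fst Y" for \<beta> by (rule j(1)[OF that])
    fix W h assume "W \<in> Ob (Sh K a T)" and h: "\<forall>\<beta>\<in>fst Y. h \<beta> \<in> psh_hom (Zo (snd Y \<beta>)) W"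
    then have W: "is_sheaf K a T W" by simp
    note W' = sheaf_psh[OF W]
    have hz: "h \<beta> (snd Y \<beta>) (?z \<beta>) \<in> carrier (FOb W (snd Y \<beta>))" if b: "\<beta> \<in> fst Y" for \<beta>
      by (rule lin_nat_in[OF hom_lin_nat[OF Zo_psh[OF fam_Ob[OF Y b]] W' bspec[OF h b]] fam_Ob[OF Y b] Z_unit_Idt[OF fam_Ob[OF Y b]]])
    let ?\<phi> = "row_comb W Y (\<lambda>\<beta>. h \<beta> (snd Y \<beta>) (?z \<beta>))"
    obtain u where u: "u \<in> psh_hom Q W" "\<And>A g. A \<in> Ob a \<Longrightarrow> g \<in> carrier (FOb (dirsum Y) A) \<Longrightarrow> u A (\<eta> A g) = ?\<phi> A g"
      using ext[OF W row_comb_lin_nat[OF W' Y hz]] by blast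
    have c: "Cmp (PSh K a) (Zo (snd Y \<beta>)) Q W v (j \<beta>) \<in> psh_hom (Zo (snd Y \<beta>)) W" if "v \<in> psh_hom Q W" "\<beta> \<in> fst Y" for v \<beta>
      by (rule PSh_Cmp_in[OF Zo_psh[OF fam_Ob[OF Y that(2)]] Q' W' j(1)[OF that(2)] that(1)])
    have cz: "Cmp (PSh K a) (Zo (snd Y \<beta>)) Q W v (j \<beta>) (snd Y \<beta>) (?z \<beta>) = v (snd Y \<beta>) (\<eta> (snd Y \<beta>) (?i \<beta>))" if b: "\<beta> \<in> fst Y" for v \<beta>
      using j(2)[OF b] fam_Ob[OF Y b] by simp
    show "\<exists>!u. u \<in> psh_hom Q W \<and> (\<forall>\<beta>\<in>fst Y. Cmp (PSh K a) (Zo (snd Y \<beta>)) Q W u (j \<beta>) = h \<beta>)"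
    proof (rule ex1I[of _ u], intro conjI ballI u(1))
      fix \<beta> assume b: "\<beta> \<in> fst Y"
      note Yb = fam_Ob[OF Y b]
      have "u (snd Y \<beta>) (\<eta> (snd Y \<beta>) (?i \<beta>)) = h \<beta> (snd Y \<beta>) (?z \<beta>)"
        using u(2)[OF Yb i[OF b]] row_comb_unit_row[OF W' Y hz b Yb Idt_in[OF Yb]] act_Idt[OF W' Yb hz[OF b]] by simp
      then show "Cmp (PSh K a) (Zo (snd Y \<beta>)) Q W u (j \<beta>) = h \<beta>"
        using h b cz[OF b] by (intro Z_uniq[OF Yb W c[OF u(1) b]]) auto
    next
      fix v assume v: "v \<in> psh_hom Q W \<and> (\<forall>\<beta>\<in>fst Y. Cmp (PSh K a) (Zo (snd Y \<beta>)) Q W v (j \<beta>) = h \<beta>)"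
      note un = hom_lin_nat[OF Q' W' u(1)] and vn = hom_lin_nat[OF Q' W' conjunct1[OF v]]
      have vz: "v (snd Y \<beta>) (\<eta> (snd Y \<beta>) (?i \<beta>)) = h \<beta> (snd Y \<beta>) (?z \<beta>)" if b: "\<beta> \<in> fst Y" for \<beta>
        using cz[OF b, of v] v b by simp
      have e: "v A (\<eta> A g) = u A (\<eta> A g)" if A: "A \<in> Ob a" and g: "g \<in> carrier (FOb (dirsum Y) A)" for A g
      proof -
        have "v A (\<eta> A g) = row_comb W Y (\<lambda>\<beta>. v (snd Y \<beta>) (\<eta> (snd Y \<beta>) (?i \<beta>))) A g"
          by (rule lin_nat_dirsum_eq[OF Y W' lin_nat_comp[OF Q(2) vn] A g])
        also have "\<dots> = ?\<phi> A g" by (rule row_comb_cong[OF W' Y hz A g vz])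
        finally show ?thesis using u(2)[OF A g] by simp
      qed
      show "v = u"
        by (rule psh_hom_eqI[OF Q' W' conjunct1[OF v] u(1)])
          (rule locsurj_cancel[OF Q' W' sheaf_sheaf_elt[OF W] Q(3) vn un e])
    qed
  qed
  show thesis by (rule that[OF Q(1-3) _ cp]) (rule ext j(2), assumption+)+
qed

text \<open>The coproducts are taken as associated sheaves of direct sums of representables, so u
  and w are induced by \<open>pmap\<close> and \<open>qmap\<close>. Covering by q makes w locally
  surjective, and local lifting of killed rows makes w a cokernel of u; both exactness conditions
  follow from these.\<close>

lemma exact_seqs_sub_pre_of: "(exact_seqs :: ('i, 'o, 'v) fseq set) \<subseteq> pre_of K a T"
proof
  fix s :: "('i, 'o, 'v) fseq" assume s: "s \<in> exact_seqs"
  obtain Z Y X p q where eq: "s = (Z, Y, X, p, q)" by (cases s) auto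
  have fs: "formal_sequence a (Z, Y, X, p, q)" and cov: "gen_sieve K a (Y, X, q) \<in> T X"
    and lex: "\<And>A f. A \<in> Ob a \<Longrightarrow> f \<in> carrier (FOb (dirsum Y) A) \<Longrightarrow> qmap Y X q A f = \<zero>\<^bsub>Hm a A X\<^esub> \<Longrightarrow>
        locally A (\<lambda>B g. \<exists>f'\<in>carrier (FOb (dirsum Z) B). pmap Z Y p B f' = FAr (dirsum Y) A B g f)"
    using s unfolding eq exact_seqs_iff by auto
  have Z: "is_fam a Z" and Y: "is_fam a Y" and X: "X \<in> Ob a" and p: "p \<in> FHom a Z Y" and q: "q \<in> FHom a Y (sng X)"
    and pq: "\<And>\<gamma>. \<gamma> \<in> fst Z \<Longrightarrow> qmap Y X q (snd Z \<gamma>) (p \<gamma>) = \<zero>\<^bsub>Hm a (snd Z \<gamma>) X\<^esub>"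
    using fs unfolding formal_sequence_iff by auto
  note DZ = psh_dirsum[OF Z] and DY = psh_dirsum[OF Y] and qe = qmap_lin_nat[OF Y X q] and pe = pmap_lin_nat[OF Z Y p]
  note ZX = Zo_sheaf[OF X] and ZX' = Zo_psh[OF X] and zx = Z_unit_lin_nat[OF X] and yX = psh_yoneda[OF X]
  obtain P \<zeta> j where P: "is_sheaf K a T P" and \<zeta>: "lin_nat (dirsum Z) P \<zeta>" "locsurj (dirsum Z) P \<zeta>"
    and Pext: "\<And>G \<phi>. is_sheaf K a T G \<Longrightarrow> lin_nat (dirsum Z) G \<phi> \<Longrightarrow>
      \<exists>\<psi>\<in>psh_hom P G. \<forall>A\<in>Ob a. \<forall>g\<in>carrier (FOb (dirsum Z) A). \<psi> A (\<zeta> A g) = \<phi> A g"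
    and cP: "is_coproduct (Sh K a T) (fst Z) (\<lambda>\<beta>. Zo (snd Z \<beta>)) P j"
    and jz: "\<And>\<beta>. \<beta> \<in> fst Z \<Longrightarrow> j \<beta> (snd Z \<beta>) (Z_unit (snd Z \<beta>) (snd Z \<beta>) (Idt a (snd Z \<beta>))) =
      \<zeta> (snd Z \<beta>) (unit_row Z \<beta> (snd Z \<beta>) (Idt a (snd Z \<beta>)))"
    by (rule sum_sheaf[OF Z]) (rule that)
  obtain Q \<eta> j' where Q: "is_sheaf K a T Q" and \<eta>: "lin_nat (dirsum Y) Q \<eta>" "locsurj (dirsum Y) Q \<eta>"
    and Qext: "\<And>G \<phi>. is_sheaf K a T G \<Longrightarrow> lin_nat (dirsum Y) G \<phi> \<Longrightarrow>
      \<exists>\<psi>\<in>psh_hom Q G. \<forall>A\<in>Ob a. \<forall>g\<in>carrier (FOb (dirsum Y) A). \<psi> A (\<eta> A g) = \<phi> A g"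
    and cQ: "is_coproduct (Sh K a T) (fst Y) (\<lambda>\<beta>. Zo (snd Y \<beta>)) Q j'"
    and jz': "\<And>\<beta>. \<beta> \<in> fst Y \<Longrightarrow> j' \<beta> (snd Y \<beta>) (Z_unit (snd Y \<beta>) (snd Y \<beta>) (Idt a (snd Y \<beta>))) =
      \<eta> (snd Y \<beta>) (unit_row Y \<beta> (snd Y \<beta>) (Idt a (snd Y \<beta>)))"
    by (rule sum_sheaf[OF Y]) (rule that)
  note P' = sheaf_psh[OF P] and Q' = sheaf_psh[OF Q] and j = coproductD(3)[OF cP] and j' = coproductD(3)[OF cQ]
  obtain u where u: "u \<in> psh_hom P Q" "\<And>A g. A \<in> Ob a \<Longrightarrow> g \<in> carrier (FOb (dirsum Z) A) \<Longrightarrow> u A (\<zeta> A g) = \<eta> A (pmap Z Y p A g)"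
    using Pext[OF Q lin_nat_comp[OF pe \<eta>(1)]] by blast
  obtain w where w: "w \<in> psh_hom Q (Zo X)" "\<And>A g. A \<in> Ob a \<Longrightarrow> g \<in> carrier (FOb (dirsum Y) A) \<Longrightarrow> w A (\<eta> A g) = Z_unit X A (qmap Y X q A g)"
    using Qext[OF ZX lin_nat_comp[OF qe zx]] by blast
  note un = hom_lin_nat[OF P' Q' u(1)] and wn = hom_lin_nat[OF Q' ZX' w(1)]
  have uj: "Cmp (PSh K a) (Zo (snd Z \<gamma>)) P Q u (j \<gamma>) =
         (\<Oplus>\<^bsub>Hm (PSh K a) (Zo (snd Z \<gamma>)) Q\<^esub>\<beta>\<in>supp (snd Z \<gamma>) Y (p \<gamma>).
            Cmp (PSh K a) (Zo (snd Z \<gamma>)) (Zo (snd Y \<beta>)) Q (j' \<beta>) (Za (snd Z \<gamma>) (snd Y \<beta>) (p \<gamma> \<beta>)))"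
    if c: "\<gamma> \<in> fst Z" for \<gamma>
  proof -
    note Zc = fam_Ob[OF Z c] and pc = FHom_row[OF p c]
    note ii = unit_row_in[OF Z c Zc Idt_in[OF Zc]]
    show ?thesis
    proof (rule Z_uniq[OF Zc Q PSh_Cmp_in[OF Zo_psh[OF Zc] P' Q' j[OF c] u(1)] row_sum(1)[OF Zc Y pc Q j']])
      fix \<beta> assume "\<beta> \<in> fst Y" then show "\<beta> \<in> fst Y" .
    next
      have i: "unit_row Y \<beta> (snd Y \<beta>) (Idt a (snd Y \<beta>)) \<in> carrier (FOb (dirsum Y) (snd Y \<beta>))" if b: "\<beta> \<in> fst Y" for \<beta>
        by (rule unit_row_in[OF Y b fam_Ob[OF Y b] Idt_in[OF fam_Ob[OF Y b]]])
      have "Cmp (PSh K a) (Zo (snd Z \<gamma>)) P Q u (j \<gamma>) (snd Z \<gamma>) (Z_unit (snd Z \<gamma>) (snd Z \<gamma>) (Idt a (snd Z \<gamma>))) =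
          \<eta> (snd Z \<gamma>) (pmap Z Y p (snd Z \<gamma>) (unit_row Z \<gamma> (snd Z \<gamma>) (Idt a (snd Z \<gamma>))))"
        using Zc jz[OF c] u(2)[OF Zc ii] by simp
      also have "pmap Z Y p (snd Z \<gamma>) (unit_row Z \<gamma> (snd Z \<gamma>) (Idt a (snd Z \<gamma>))) = p \<gamma>"
        unfolding pmap_def
        using row_comb_unit_row[OF DY Z FHom_row[OF p] c Zc Idt_in[OF Zc]] act_Idt[OF DY Zc pc] by simp
      also have "\<eta> (snd Z \<gamma>) (p \<gamma>) = row_comb Q Y (\<lambda>\<beta>. \<eta> (snd Y \<beta>) (unit_row Y \<beta> (snd Y \<beta>) (Idt a (snd Y \<beta>)))) (snd Z \<gamma>) (p \<gamma>)"
        by (rule lin_nat_dirsum_eq[OF Y Q' \<eta>(1) Zc pc])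
      also have "\<dots> = row_comb Q Y (\<lambda>\<beta>. j' \<beta> (snd Y \<beta>) (Z_unit (snd Y \<beta>) (snd Y \<beta>) (Idt a (snd Y \<beta>)))) (snd Z \<gamma>) (p \<gamma>)"
        by (rule row_comb_cong[OF Q' Y _ Zc pc, symmetric]) (use jz' lin_nat_in[OF \<eta>(1) fam_Ob[OF Y] i] in auto)
      also have "\<dots> = (\<Oplus>\<^bsub>Hm (PSh K a) (Zo (snd Z \<gamma>)) Q\<^esub>\<beta>\<in>supp (snd Z \<gamma>) Y (p \<gamma>).
            Cmp (PSh K a) (Zo (snd Z \<gamma>)) (Zo (snd Y \<beta>)) Q (j' \<beta>) (Za (snd Z \<gamma>) (snd Y \<beta>) (p \<gamma> \<beta>))) (snd Z \<gamma>) (Z_unit (snd Z \<gamma>) (snd Z \<gamma>) (Idt a (snd Z \<gamma>)))"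
        by (rule row_sum(2)[OF Zc Y pc Q j', symmetric])
      finally show "Cmp (PSh K a) (Zo (snd Z \<gamma>)) P Q u (j \<gamma>) (snd Z \<gamma>) (Z_unit (snd Z \<gamma>) (snd Z \<gamma>) (Idt a (snd Z \<gamma>))) =
        (\<Oplus>\<^bsub>Hm (PSh K a) (Zo (snd Z \<gamma>)) Q\<^esub>\<beta>\<in>supp (snd Z \<gamma>) Y (p \<gamma>).
            Cmp (PSh K a) (Zo (snd Z \<gamma>)) (Zo (snd Y \<beta>)) Q (j' \<beta>) (Za (snd Z \<gamma>) (snd Y \<beta>) (p \<gamma> \<beta>))) (snd Z \<gamma>) (Z_unit (snd Z \<gamma>) (snd Z \<gamma>) (Idt a (snd Z \<gamma>)))" .
    qed
  qed
  have wj: "Cmp (PSh K a) (Zo (snd Y \<beta>)) Q (Zo X) w (j' \<beta>) = Za (snd Y \<beta>) X (q \<beta> ())" if b: "\<beta> \<in> fst Y" for \<beta>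
  proof -
    note Yb = fam_Ob[OF Y b] and qb = FHom_sng_in[OF q b]
    note ii = unit_row_in[OF Y b Yb Idt_in[OF Yb]]
    show ?thesis
      by (rule Z_uniq[OF Yb ZX PSh_Cmp_in[OF Zo_psh[OF Yb] Q' ZX' j'[OF b] w(1)] Za_hom[OF Yb X qb]])
        (use Yb X qb jz'[OF b] w(2)[OF Yb ii] qmap_unit_row[OF Y X q b] Za_Z_unit[OF Yb X qb Yb Idt_in[OF Yb]] in simp)
  qed
  \<comment> \<open>The sections of \<open>Zo X\<close> that lift locally along w form a closed
    subpresheaf. It contains the image of the unit because q generates a covering sieve, and every
    section lies locally in that image, so it is everything.\<close>
  have ls: "locsurj Q (Zo X) w"
  proof -
    let ?N = "\<lambda>A. {y \<in> carrier (FOb (Zo X) A). locally A (\<lambda>B f. \<exists>x\<in>carrier (FOb Q B). w B x = FAr (Zo X) A B f y)}"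
    have N: "closed_sub (Zo X) ?N" by (rule closed_sub_locimg[OF Q' ZX' wn])
    have zN: "Z_unit X B g \<in> ?N B" if B: "B \<in> Ob a" and g: "g \<in> hm B X" for B g
    proof -
      have "locally B (\<lambda>C c. \<exists>x\<in>carrier (FOb Q C). w C x = FAr (Zo X) B C c (Z_unit X B g))"
      proof (rule locallyI[OF T_pull[OF cov B g]])
        fix C c assume C: "C \<in> Ob a" "c \<in> pull_sieve a B X g (gen_sieve K a (Y, X, q)) C"
        then have c: "c \<in> hm C B" "Cmp a C B X g c \<in> gen_sieve K a (Y, X, q) C" by (auto simp: pull_sieve_def)
        obtain x where x: "x \<in> carrier (FOb (dirsum Y) C)" "qmap Y X q C x = Cmp a C B X g c"
          using c(2) unfolding gen_sieve_eq(1)[OF Y X q] by auto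
        have "w C (\<eta> C x) = FAr (Zo X) B C c (Z_unit X B g)"
          using w(2)[OF C(1) x(1)] x(2) lin_nat_act[OF zx B C(1) c(1), of g] g by simp
        then show "\<exists>x\<in>carrier (FOb Q C). w C x = FAr (Zo X) B C c (Z_unit X B g)"
          using lin_nat_in[OF \<eta>(1) C(1) x(1)] by blast
      qed
      then show ?thesis using Z_unit_in[OF X B g] by blast
    qed
    have "y \<in> ?N A" if A: "A \<in> Ob a" and y: "y \<in> carrier (FOb (Zo X) A)" for A y
    proof -
      have "locally A (\<lambda>B f. FAr (Zo X) A B f y \<in> ?N B)"
      proof (rule locally_mono[OF Z_unit_locsurj[OF X, unfolded locsurj_def, rule_format, OF A y]])
        fix B f assume B: "B \<in> Ob a" "f \<in> hm B A" and "\<exists>x\<in>carrier (FOb (yo X) B). Z_unit X B x = FAr (Zo X) A B f y"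
        then show "FAr (Zo X) A B f y \<in> ?N B" using zN[OF B(1)] by fastforce
      qed
      then show ?thesis using N[unfolded closed_sub_def, THEN conjunct2, THEN conjunct2, THEN conjunct2, THEN conjunct1] A y by blast
    qed
    then show ?thesis unfolding locsurj_def by blast
  qed
  \<comment> \<open>Three stages. In \<open>1\<close> the row is killed by q and lifts locally along
    p. In \<open>2\<close> its image under q dies only in \<open>Zo X\<close>; that image is
    torsion, so q kills the row locally and \<open>1\<close> applies. Finally an element of Q is
    locally the image of a row.\<close>
  have ker: "h A x = \<zero>\<^bsub>FOb G A\<^esub>"
    if G: "is_sheaf K a T G" and h: "h \<in> psh_hom Q G" and hu: "Cmp (PSh K a) P Q G h u = \<zero>\<^bsub>Hm (PSh K a) P G\<^esub>"
      and A: "A \<in> Ob a" and x: "x \<in> carrier (FOb Q A)" and wx: "w A x = \<zero>\<^bsub>FOb (Zo X) A\<^esub>" for G h A x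
  proof -
    note G' = sheaf_psh[OF G] sheaf_sheaf_elt[OF G]
    note hn = hom_lin_nat[OF Q' G'(1) h] and h\<eta> = lin_nat_comp[OF \<eta>(1) hom_lin_nat[OF Q' G'(1) h]]
    have hu0: "h B (u B y) = \<zero>\<^bsub>FOb G B\<^esub>" if "B \<in> Ob a" "y \<in> carrier (FOb P B)" for B y
      using hu that unfolding PSh_Cmp_eq_iff[OF P' Q' G'(1) u(1) h PSh_zero_in[OF P' G'(1)]] by simp
    have 1: "h B (\<eta> B y) = \<zero>\<^bsub>FOb G B\<^esub>" if B: "B \<in> Ob a" and y: "y \<in> carrier (FOb (dirsum Y) B)" and q0: "qmap Y X q B y = \<zero>\<^bsub>Hm a B X\<^esub>" for B y
    proof (rule sheaf_elt_sep[OF G' lin_nat_in[OF h\<eta> B y] psh_zero_in[OF G'(1) B]], rule locally_mono[OF lex[OF B y q0]])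
      fix C c assume C: "C \<in> Ob a" "c \<in> hm C B" and "\<exists>f'\<in>carrier (FOb (dirsum Z) C). pmap Z Y p C f' = FAr (dirsum Y) B C c y"
      then obtain f' where f': "f' \<in> carrier (FOb (dirsum Z) C)" "pmap Z Y p C f' = FAr (dirsum Y) B C c y" by blast
      have "FAr G B C c (h B (\<eta> B y)) = h C (\<eta> C (FAr (dirsum Y) B C c y))" by (rule lin_nat_act[OF h\<eta> B C y, symmetric])
      also have "\<dots> = \<zero>\<^bsub>FOb G C\<^esub>"
        using u(2)[OF C(1) f'(1)] hu0[OF C(1) lin_nat_in[OF \<zeta>(1) C(1) f'(1)]] f'(2) by simp
      finally show "FAr G B C c (h B (\<eta> B y)) = FAr G B C c \<zero>\<^bsub>FOb G B\<^esub>" using act_zero_neg(1)[OF G'(1) B C] by simp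
    qed
    have 2: "h B (\<eta> B y) = \<zero>\<^bsub>FOb G B\<^esub>" if B: "B \<in> Ob a" and y: "y \<in> carrier (FOb (dirsum Y) B)" and z0: "Z_unit X B (qmap Y X q B y) = \<zero>\<^bsub>FOb (Zo X) B\<^esub>" for B y
    proof (rule sheaf_elt_sep[OF G' lin_nat_in[OF h\<eta> B y] psh_zero_in[OF G'(1) B]])
      have "qmap Y X q B y \<in> torsion (yo X) B"
        by (rule shf_unit_torsion[OF yoneda_Ob[OF X] B]) (use qmap_in[OF Y X q B y] z0 in \<open>simp_all add: Z_unit_def Zfun_eq\<close>)
      then have "locally B (\<lambda>C c. FAr (yo X) B C c (qmap Y X q B y) = \<zero>\<^bsub>FOb (yo X) C\<^esub>)"
        unfolding torsion_def mem_Collect_eq by (rule conjunct2)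
      then show "locally B (\<lambda>C c. FAr G B C c (h B (\<eta> B y)) = FAr G B C c \<zero>\<^bsub>FOb G B\<^esub>)"
      proof (rule locally_mono)
        fix C c assume C: "C \<in> Ob a" "c \<in> hm C B" and 0: "FAr (yo X) B C c (qmap Y X q B y) = \<zero>\<^bsub>FOb (yo X) C\<^esub>"
        have "qmap Y X q C (FAr (dirsum Y) B C c y) = \<zero>\<^bsub>Hm a C X\<^esub>" using lin_nat_act[OF qe B C y] 0 by simp
        then have "h C (\<eta> C (FAr (dirsum Y) B C c y)) = \<zero>\<^bsub>FOb G C\<^esub>" by (rule 1[OF C(1) act_in[OF DY B C y]])
        then show "FAr G B C c (h B (\<eta> B y)) = FAr G B C c \<zero>\<^bsub>FOb G B\<^esub>"
          using lin_nat_act[OF h\<eta> B C y] act_zero_neg(1)[OF G'(1) B C] by simp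
      qed
    qed
    show ?thesis
    proof (rule sheaf_elt_sep[OF G' lin_nat_in[OF hn A x] psh_zero_in[OF G'(1) A]],
        rule locally_mono[OF \<eta>(2)[unfolded locsurj_def, rule_format, OF A x]])
      fix B f assume B: "B \<in> Ob a" "f \<in> hm B A" and "\<exists>y\<in>carrier (FOb (dirsum Y) B). \<eta> B y = FAr Q A B f x"
      then obtain y where y: "y \<in> carrier (FOb (dirsum Y) B)" "\<eta> B y = FAr Q A B f x" by blast
      have "Z_unit X B (qmap Y X q B y) = \<zero>\<^bsub>FOb (Zo X) B\<^esub>"
        using w(2)[OF B(1) y(1)] y(2) lin_nat_act[OF wn A B x] wx act_zero_neg(1)[OF ZX' A B] by simp
      then have "h B (\<eta> B y) = \<zero>\<^bsub>FOb G B\<^esub>" by (rule 2[OF B(1) y(1)])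
      then show "FAr G A B f (h A x) = FAr G A B f \<zero>\<^bsub>FOb G A\<^esub>"
        using y(2) lin_nat_act[OF hn A B x] act_zero_neg(1)[OF G'(1) A B] by simp
    qed
  qed
  have wu: "Cmp (PSh K a) P Q (Zo X) w u = \<zero>\<^bsub>Hm (PSh K a) P (Zo X)\<^esub>"
  proof -
    note c = PSh_Cmp_in[OF P' Q' ZX' u(1) w(1)] and z = PSh_zero_in[OF P' ZX']
    have "w A (u A (\<zeta> A g)) = \<zero>\<^bsub>FOb (Zo X) A\<^esub>" if A: "A \<in> Ob a" and g: "g \<in> carrier (FOb (dirsum Z) A)" for A g
    proof -
      have "qmap Y X q A (pmap Z Y p A g) = row_comb (yo X) Z (\<lambda>\<gamma>. qmap Y X q (snd Z \<gamma>) (p \<gamma>)) A g"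
        unfolding qmap_def by (rule row_comb_comp[OF Z Y p yX _ A g]) (use FHom_sng_in[OF q] in simp)
      also have "\<dots> = \<zero>\<^bsub>FOb (yo X) A\<^esub>" by (rule row_comb_zero[OF Z yX A g]) (use pq in simp)
      finally have "Z_unit X A (qmap Y X q A (pmap Z Y p A g)) = \<zero>\<^bsub>FOb (Zo X) A\<^esub>"
        using lin_nat_zero_neg(1)[OF yX ZX' zx A] by simp
      then show ?thesis using u(2)[OF A g] w(2)[OF A lin_nat_in[OF pe A g]] by simp
    qed
    then have e: "Cmp (PSh K a) P Q (Zo X) w u A (\<zeta> A g) = \<zero>\<^bsub>Hm (PSh K a) P (Zo X)\<^esub> A (\<zeta> A g)"
      if "A \<in> Ob a" "g \<in> carrier (FOb (dirsum Z) A)" for A g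
      using that lin_nat_in[OF \<zeta>(1)] by simp
    show ?thesis
      by (rule psh_hom_eqI[OF P' ZX' c z])
        (rule locsurj_cancel[OF P' ZX' sheaf_sheaf_elt[OF ZX] \<zeta>(2) hom_lin_nat[OF P' ZX' c] hom_lin_nat[OF P' ZX' z] e])
  qed
  have cok: "is_cokernel (Sh K a T) P Q u (Zo X) w"
    unfolding is_cokernel_iff
  proof (intro conjI allI impI ballI ZX w(1) wu)
    fix W h assume W: "is_sheaf K a T W" and h: "h \<in> psh_hom Q W" and hu: "Cmp (PSh K a) P Q W h u = \<zero>\<^bsub>Hm (PSh K a) P W\<^esub>"
    note W' = sheaf_psh[OF W]
    note hn = hom_lin_nat[OF Q' W' h] and k0 = ker[OF W h hu]
    obtain \<psi> where \<psi>: "lin_nat (Zo X) W \<psi>" "\<And>A x. A \<in> Ob a \<Longrightarrow> x \<in> carrier (FOb Q A) \<Longrightarrow> \<psi> A (w A x) = h A x"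
      by (rule factor[OF Q' ZX' W' sheaf_sheaf_elt[OF W] wn ls hn k0]) (assumption+, rule that)
    let ?v = "res_nat (Zo X) \<psi>"
    have v: "?v \<in> psh_hom (Zo X) W" by (rule res_nat_hom[OF ZX' W' \<psi>(1)])
    have vw: "Cmp (PSh K a) Q (Zo X) W ?v w = h"
      unfolding PSh_Cmp_eq_iff[OF Q' ZX' W' w(1) v h] using \<psi>(2) lin_nat_in[OF wn] by simp
    show "\<exists>!v. v \<in> psh_hom (Zo X) W \<and> Cmp (PSh K a) Q (Zo X) W v w = h"
    proof (rule ex1I[of _ ?v], intro conjI v vw)
      fix v' assume v': "v' \<in> psh_hom (Zo X) W \<and> Cmp (PSh K a) Q (Zo X) W v' w = h"
      have e: "v' A (w A x) = ?v A (w A x)" if "A \<in> Ob a" "x \<in> carrier (FOb Q A)" for A x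
        using v' vw that by (metis PSh_Cmp_apply)
      show "v' = ?v"
        by (rule psh_hom_eqI[OF ZX' W' conjunct1[OF v'] v])
          (rule locsurj_cancel[OF ZX' W' sheaf_sheaf_elt[OF W] ls hom_lin_nat[OF ZX' W' conjunct1[OF v']] hom_lin_nat[OF ZX' W' v] e])
    qed
  qed
  \<comment> \<open>The image of u is by definition the kernel of its cokernel, and this cokernel is
    w; so the kernel of w serves on both sides.\<close>
  have ex1: "exact_at (Sh K a T) P Q (Zo X) u w"
    unfolding exact_at_def is_image_def Sh_simps
    using P Q ZX u(1) w(1) cok ker_psh_kernel[OF Q ZX w(1)] by blast
  text \<open>The kernel of an identity serves as the zero sheaf.\<close>
  let ?N = "ker_psh (Zo X) (Zo X) (\<lambda>A x. x)"
  have idn: "lin_nat (Zo X) (Zo X) (\<lambda>A x. x)" by (simp add: lin_nat_def)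
  have N: "is_sheaf K a T ?N" by (rule ker_psh_sheaf[OF ZX ZX idn])
  note N' = sheaf_psh[OF N]
  have N0: "x = \<zero>\<^bsub>FOb ?N A\<^esub>" if "x \<in> carrier (FOb ?N A)" for x A using that by simp
  have NZ: "is_zero_object (Sh K a T) ?N"
    unfolding is_zero_object_def Sh_simps
  proof
    show "Idt (PSh K a) ?N = \<zero>\<^bsub>Hm (PSh K a) ?N ?N\<^esub>"
      by (rule psh_hom_eqI[OF N' N' PSh_Idt_in[OF N'] PSh_zero_in[OF N' N']])
        (use N0 in \<open>simp del: ker_psh_simps\<close>)
  qed (rule N)
  let ?o = "\<zero>\<^bsub>Hm (PSh K a) (Zo X) ?N\<^esub>"
  have z: "?o \<in> psh_hom (Zo X) ?N" by (rule PSh_zero_in[OF ZX' N'])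
  \<comment> \<open>Local surjectivity of w says that a map into a sheaf that kills w is zero, so
    the cokernel of w is the map to the zero sheaf. The image of w is then the kernel of this map,
    which is the identity of \<open>Zo X\<close>.\<close>
  have cok0: "is_cokernel (Sh K a T) Q (Zo X) w ?N ?o"
    unfolding is_cokernel_iff
  proof (intro conjI allI impI ballI N z)
    show "Cmp (PSh K a) Q (Zo X) ?N ?o w = \<zero>\<^bsub>Hm (PSh K a) Q ?N\<^esub>"
      unfolding PSh_Cmp_eq_iff[OF Q' ZX' N' w(1) z PSh_zero_in[OF Q' N']]
      using lin_nat_in[OF wn] by (simp del: ker_psh_simps)
    fix W h assume W: "is_sheaf K a T W" and h: "h \<in> psh_hom (Zo X) W"
      and hw: "Cmp (PSh K a) Q (Zo X) W h w = \<zero>\<^bsub>Hm (PSh K a) Q W\<^esub>"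
    note W' = sheaf_psh[OF W]
    have "h A (w A x) = \<zero>\<^bsub>Hm (PSh K a) (Zo X) W\<^esub> A (w A x)" if "A \<in> Ob a" "x \<in> carrier (FOb Q A)" for A x
      using hw that lin_nat_in[OF wn that] unfolding PSh_Cmp_eq_iff[OF Q' ZX' W' w(1) h PSh_zero_in[OF Q' W']] by simp
    note h0 = locsurj_cancel[OF ZX' W' sheaf_sheaf_elt[OF W] ls hom_lin_nat[OF ZX' W' h] hom_lin_nat[OF ZX' W' PSh_zero_in[OF ZX' W']] this]
    let ?v = "\<zero>\<^bsub>Hm (PSh K a) ?N W\<^esub>"
    have v: "?v \<in> psh_hom ?N W" by (rule PSh_zero_in[OF N' W'])
    show "\<exists>!v. v \<in> psh_hom ?N W \<and> Cmp (PSh K a) (Zo X) ?N W v ?o = h"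
    proof (rule ex1I[of _ ?v], intro conjI v)
      show "Cmp (PSh K a) (Zo X) ?N W ?v ?o = h"
        unfolding PSh_Cmp_eq_iff[OF ZX' N' W' z v h]
        using h0 psh_zero_in[OF N'] by (simp del: ker_psh_simps)
      fix v' assume v': "v' \<in> psh_hom ?N W \<and> Cmp (PSh K a) (Zo X) ?N W v' ?o = h"
      show "v' = ?v"
      proof (rule psh_hom_eqI[OF N' W' conjunct1[OF v'] v])
        fix A x assume A: "A \<in> Ob a" and x: "x \<in> carrier (FOb ?N A)"
        show "v' A x = ?v A x"
          using lin_nat_zero_neg(1)[OF N' W' hom_lin_nat[OF N' W' conjunct1[OF v']] A] N0[OF x] A x by (simp del: ker_psh_simps)
      qed
    qed
  qed
  have ker0: "is_kernel (Sh K a T) (Zo X) ?N ?o (Zo X) (Idt (PSh K a) (Zo X))"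
    unfolding is_kernel_def Sh_simps
  proof (intro conjI ballI impI ZX PSh_Idt_in[OF ZX'])
    show "Cmp (PSh K a) (Zo X) (Zo X) ?N ?o (Idt (PSh K a) (Zo X)) = ?o"
      unfolding PSh_Cmp_eq_iff[OF ZX' ZX' N' PSh_Idt_in[OF ZX'] z z] by (simp del: ker_psh_simps)
    fix W h assume "W \<in> Ob (Sh K a T)" and h: "h \<in> psh_hom W (Zo X)"
    then have W': "psh W" by (simp add: sheaf_psh)
    note hi = lin_nat_in[OF hom_lin_nat[OF W' ZX' h]]
    show "\<exists>!u. u \<in> psh_hom W (Zo X) \<and> Cmp (PSh K a) W (Zo X) (Zo X) (Idt (PSh K a) (Zo X)) u = h"
    proof (rule ex1I[of _ h], intro conjI h)
      show "Cmp (PSh K a) W (Zo X) (Zo X) (Idt (PSh K a) (Zo X)) h = h"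
        unfolding PSh_Cmp_eq_iff[OF W' ZX' ZX' h PSh_Idt_in[OF ZX'] h] using hi by simp
      fix v assume v: "v \<in> psh_hom W (Zo X) \<and> Cmp (PSh K a) W (Zo X) (Zo X) (Idt (PSh K a) (Zo X)) v = h"
      have vh: "v \<in> psh_hom W (Zo X)" using v by blast
      have "\<forall>A\<in>Ob a. \<forall>x\<in>carrier (FOb W A). Idt (PSh K a) (Zo X) A (v A x) = h A x"
        using v PSh_Cmp_eq_iff[OF W' ZX' ZX' vh PSh_Idt_in[OF ZX'] h] by blast
      then show "v = h"
        by (intro psh_hom_eqI[OF W' ZX' vh h]) (use lin_nat_in[OF hom_lin_nat[OF W' ZX' vh]] in simp)
    qed
  qed
  have ex2: "exact_at (Sh K a T) Q (Zo X) ?N w ?o"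
    unfolding exact_at_def is_image_def Sh_simps
    using Q ZX N w(1) z cok0 ker0 by blast
  have "exact_to_zero (Sh K a T) P Q (Zo X) u w"
    unfolding exact_to_zero_def Sh_simps using ex1 NZ ex2 by blast
  then show "s \<in> pre_of K a T"
    unfolding eq pre_of_iff using fs cP cQ u(1) uj w(1) wj by blast
qed

text \<open>The class \<open>exact_seqs\<close> closes the circle: it is one of the pretopologies
  over which (b) and (c) quantify and it is contained in the class of (d). Under (a) its members are
  right exact, which gives (b); under (c) or (d) they are right exact too, which leads back to
  (a).\<close>

lemma subcanonical_equivalences:
  "(subcanonical K a T \<longleftrightarrow>
     (\<exists>S :: ('i, 'o, 'v) fseq set. pretopology a S \<and> T = top_of K a S \<and> (\<forall>s\<in>S. right_exact a s))) \<and>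
   (subcanonical K a T \<longleftrightarrow>
     (\<forall>S :: ('i, 'o, 'v) fseq set. pretopology a S \<longrightarrow> T = top_of K a S \<longrightarrow> (\<forall>s\<in>S. right_exact a s))) \<and>
   (subcanonical K a T \<longleftrightarrow> (\<forall>s \<in> (pre_of K a T :: ('i, 'o, 'v) fseq set). right_exact a s)) \<and>
   (subcanonical K a T \<longleftrightarrow> fully_faithful a (Sh K a T) (Zfun K a T))"
proof -
  have exact_seqs: "subcanonical K a T" if "\<forall>s\<in>(exact_seqs :: ('i, 'o, 'v) fseq set). right_exact a s"
    using right_exact_subcanonical[OF exact_seqs_pretopology top_of_exact_seqs that] .
  have ac: "right_exact a s" if "subcanonical K a T" "pretopology a S" "T = top_of K a S" "s \<in> S"
    for S :: "('i, 'o, 'v) fseq set" and s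
    using exact_seqs_right_exact[OF that(1)] pretopology_sub_exact_seqs[OF that(2,3)] that(4) by blast
  have b: "subcanonical K a T \<longleftrightarrow>
     (\<exists>S :: ('i, 'o, 'v) fseq set. pretopology a S \<and> T = top_of K a S \<and> (\<forall>s\<in>S. right_exact a s))"
    using exact_seqs_pretopology top_of_exact_seqs exact_seqs_right_exact right_exact_subcanonical by blast
  have c: "subcanonical K a T \<longleftrightarrow>
     (\<forall>S :: ('i, 'o, 'v) fseq set. pretopology a S \<longrightarrow> T = top_of K a S \<longrightarrow> (\<forall>s\<in>S. right_exact a s))"
    using ac exact_seqs exact_seqs_pretopology top_of_exact_seqs by blast
  have d: "subcanonical K a T \<longleftrightarrow> (\<forall>s \<in> (pre_of K a T :: ('i, 'o, 'v) fseq set). right_exact a s)"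
    using pre_of_right_exact exact_seqs exact_seqs_sub_pre_of by blast
  show ?thesis using b c d subcanonical_iff_fully_faithful by blast
qed

end

theorem theorem3p2p2:
  fixes K :: "'k ring"
    and a :: "('o, 'v, 'k) lincat"
    and T :: "'o \<Rightarrow> ('o \<Rightarrow> 'v set) set"
  assumes "size_condition TYPE('i) TYPE('v)"
    and "cring K"
    and "linear_category K a"
    and "essentially_small TYPE('i) a"
    and "topology K a T"
  shows "(subcanonical K a T \<longleftrightarrow>
           (\<exists>S :: ('i, 'o, 'v) fseq set.
              pretopology a S \<and> T = top_of K a S \<and> (\<forall>s\<in>S. right_exact a s))) \<and>
         (subcanonical K a T \<longleftrightarrow>
           (\<forall>S :: ('i, 'o, 'v) fseq set.
              pretopology a S \<longrightarrow> T = top_of K a S \<longrightarrow> (\<forall>s\<in>S. right_exact a s))) \<and>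
         (subcanonical K a T \<longleftrightarrow>
           (\<forall>s \<in> (pre_of K a T :: ('i, 'o, 'v) fseq set). right_exact a s)) \<and>
         (subcanonical K a T \<longleftrightarrow> fully_faithful a (Sh K a T) (Zfun K a T))"
proof -
  interpret small_site K a T "TYPE('i)"
    by unfold_locales (use assms in auto)
  show ?thesis by (rule subcanonical_equivalences)
qed

end
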